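(* If $c$ is a regular function and $0<K\le\infty$, then the sampling procedure described in the context stops with probability $1$, and its output is a sample value of $(\tau,\ Z(\tau-),\ \Delta_Z(\tau))$, where $\tau=\tau^Z_c\wedge K$ (that is, the output has the same distribution as this random triple). The claim is still true if $c\equiv\infty$ and $K<\infty$.
   Context: A function $c$ is called regular if it is absolutely continuous and non-increasing on $(0,\infty)$ with $c(0+)>0$, and is differentiable on $(0,\infty)\setminus F$, where $F$ is a closed set of Lebesgue measure $0$. $Z$ is a subordinator without drift, with Lévy measure $\Pi$ such that $\Pi(0,\infty)=\infty$ and $$\Pi(\mathrm dx)=e^{-qx}\mathbf 1\{x\le r\}\,\Lambda(\mathrm dx)+\chi(\mathrm dx),\qquad q\ge0,\quad 0<r\le\infty,$$ with $\chi$ a measure on $(0,\infty)$ with $\chi(0,\infty)<\infty$, and $\Lambda$ the Lévy measure of a driftless subordinator $S$ (whose first passage event across any regular function is assumed to be samplable, i.e. the sampling steps below involving $S$ can be carried out). Let $X_1,X_2,X_3,Q$ be independent driftless subordinators with Lévy measures $e^{-qx}\mathbf 1\{x\le r\}\Lambda(\mathrm dx)$, $(1-e^{-qx})\mathbf 1\{x\le r\}\Lambda(\mathrm dx)$, $\mathbf 1\{x>r\}\Lambda(\mathrm dx)$, and $\chi$, respectively, and represent $Z=X_1+Q$, $S=X_1+X_2+X_3$. For a process $Y$, $\Delta_Y(t)=Y(t)-Y(t-)$ is its jump process. For a boundary $b$, $\tau^Z_b=\inf\{t>0:Z(t)>b(t)\}$, $\tau^S_b=\inf\{t>0:S(t)>b(t)\}$;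 $\inf\emptyset=\infty$. Procedure. Input: $c$ and $K$. In each iteration the random quantities are sampled afresh, independently of the past given the current values of the variables. Initialization: set $T=H=D=0$, $A=K$, $b(\cdot)\equiv c(\cdot)$. Step 1. If $D=0$, sample $(D,J)\sim(\tau_Q\wedge A,\ \Delta_Q(\tau_Q\wedge A))$, where $\tau_Q=\inf\{t:\Delta_Q(t)>0\}$. Step 2. Sample $t_1\sim\tau^S_{b\wedge r}$ and set $t=t_1\wedge D$. Step 3. If $t=t_1<D$, sample $(s,v)\sim(S(t-),\Delta_S(t))$ conditional on $\tau^S_{b\wedge r}=t$. Step 4. If $t=D<t_1$, sample $s\sim S(t)$ conditional on $S(t)<b(t)\wedge r$ and set $v=0$. Step 5. Sample $x\sim X_1(t)$ conditional on $X_1(t)+X_2(t)=s$. Step 6. If $v>0$, sample $U$ uniform on $(0,1)$ and reset $v\leftarrow v\,\mathbf 1\{v\le r,\ U\le e^{-qv}\}$. Step 7. Update $T\leftarrow T+t$. Set $\Delta=v+\mathbf 1\{t=D\}J$, $z=x+\Delta$, and update $H\leftarrow H+z$. Step 8. If $z<b(t)$ and $t<A$, then update $A\leftarrow A-t$, $D\leftarrow D-t$, $b(\cdot)\leftarrow b(\cdot+t)-z$, and go back to Step 1 to start a new iteration; else output $(T,H-\Delta,\Delta)$ and stop. Conditional distributions given the value of a random variable are regular conditional distributions; where such a distribution is evaluated at a point that is not determined up to null sets (Step 5 when $S$ crosses the boundary without a jump, so that $s=b(t)\wedge r$), an appropriate version is understood. *)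

theory Defs
  imports "HOL-Probability.Probability"
begin

section \<open>Boundaries\<close>

definition absolutely_continuous_fun_on :: "(real \<Rightarrow> real) \<Rightarrow> real set \<Rightarrow> bool" where
  "absolutely_continuous_fun_on f S \<longleftrightarrow>
     (\<forall>\<epsilon>>0. \<exists>\<delta>>0. \<forall>I :: (real \<times> real) set.
        finite I \<and> (\<forall>(x, y)\<in>I. x \<le> y \<and> {x..y} \<subseteq> S) \<and>
        pairwise (\<lambda>(x, y) (x', y'). {x<..<y} \<inter> {x'<..<y'} = {}) I \<and>
        (\<Sum>(x, y)\<in>I. y - x) < \<delta>
        \<longrightarrow> (\<Sum>(x, y)\<in>I. \<bar>f y - f x\<bar>) < \<epsilon>)"

text \<open>
  Only the values on \<open>(0, \<infinity>)\<close> matter. Absolute continuity is required on compact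
  subintervals, so that \<open>c(0+) = \<infinity>\<close> and functions such as \<open>t \<mapsto> 1 - t\<^sup>2\<close> are allowed;
  a function satisfying the epsilon-delta condition on all of \<open>(0, \<infinity>)\<close> satisfies it.
\<close>
definition regular_boundary :: "(real \<Rightarrow> real) \<Rightarrow> bool" where
  "regular_boundary c \<longleftrightarrow>
     (\<forall>a>0. \<forall>b\<ge>a. absolutely_continuous_fun_on c {a..b}) \<and>
     antimono_on {0<..} c \<and>
     (\<exists>l :: ereal. ((\<lambda>t. ereal (c t)) \<longlongrightarrow> l) (at_right 0) \<and> 0 < l) \<and>
     (\<exists>F. closed F \<and> F \<in> null_sets lborel \<and> (\<forall>t\<in>{0<..} - F. c differentiable (at t)))"

section \<open>Driftless subordinators\<close>

definition levy_measure :: "real measure \<Rightarrow> bool" where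
  "levy_measure \<nu> \<longleftrightarrow>
     sets \<nu> = sets borel \<and> emeasure \<nu> {..0} = 0 \<and> (\<integral>\<^sup>+x. ennreal (min 1 x) \<partial>\<nu>) < \<infinity>"

text \<open>
  The process is indexed by \<open>t \<ge> 0\<close>; its values at negative times are irrelevant. Left limits
  exist by monotonicity. Absence of drift and the Levy measure are expressed by the
  Levy-Khintchine formula for the Laplace transform.
\<close>
definition driftless_subordinator :: "'a measure \<Rightarrow> real measure \<Rightarrow> (real \<Rightarrow> 'a \<Rightarrow> real) \<Rightarrow> bool" where
  "driftless_subordinator M \<nu> X \<longleftrightarrow>
     prob_space M \<and> levy_measure \<nu> \<and>
     (\<forall>t\<ge>0. X t \<in> borel_measurable M) \<and>
     (\<forall>\<omega>\<in>space M. X 0 \<omega> = 0 \<and> mono_on {0..} (\<lambda>t. X t \<omega>) \<and>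
        (\<forall>t\<ge>0. continuous (at_right t) (\<lambda>t. X t \<omega>))) \<and>
     (\<forall>(n::nat) (u :: nat \<Rightarrow> real). 0 \<le> u 0 \<and> mono u \<longrightarrow>
        prob_space.indep_vars M (\<lambda>_. borel) (\<lambda>i \<omega>. X (u (Suc i)) \<omega> - X (u i) \<omega>) {..<n}) \<and>
     (\<forall>s\<ge>0. \<forall>h\<ge>0. distr M borel (\<lambda>\<omega>. X (s + h) \<omega> - X s \<omega>) = distr M borel (X h)) \<and>
     (\<forall>t\<ge>0. \<forall>\<theta>\<ge>0. prob_space.expectation M (\<lambda>\<omega>. exp (- \<theta> * X t \<omega>)) =
        exp (- t * (\<integral>x. 1 - exp (- \<theta> * x) \<partial>\<nu>)))"

text \<open>
  Values of paths at extended times. At the times \<open>0\<close> and \<open>\<infinity>\<close>, where the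
  quantities have no meaning, they are set to \<open>0\<close>.
\<close>
definition left_limit :: "(real \<Rightarrow> real) \<Rightarrow> ereal \<Rightarrow> real" where
  "left_limit f t = (if 0 < t \<and> t < \<infinity> then Lim (at_left (real_of_ereal t)) f else 0)"

definition jump :: "(real \<Rightarrow> real) \<Rightarrow> ereal \<Rightarrow> real" where
  "jump f t = (if 0 < t \<and> t < \<infinity> then f (real_of_ereal t) - left_limit f t else 0)"

definition passage_time :: "(real \<Rightarrow> real) \<Rightarrow> (real \<Rightarrow> ereal) \<Rightarrow> ereal" where
  "passage_time f \<beta> = Inf {ereal t | t. 0 < t \<and> \<beta> t < ereal (f t)}"

definition first_jump_time :: "(real \<Rightarrow> real) \<Rightarrow> ereal" where
  "first_jump_time f = Inf {ereal t | t. 0 < t \<and> 0 < jump f (ereal t)}"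

section \<open>Conditional distributions\<close>

text \<open>
  \<open>\<kappa>\<close> is a regular version of the conditional distribution of \<open>Y\<close> given \<open>X\<close> on the event \<open>E\<close>.
\<close>
definition reg_cond_dist ::
    "'a measure \<Rightarrow> ('a \<Rightarrow> bool) \<Rightarrow> ('a \<Rightarrow> 'x::topological_space) \<Rightarrow> ('a \<Rightarrow> 'y::topological_space)
      \<Rightarrow> ('x \<Rightarrow> 'y measure) \<Rightarrow> bool" where
  "reg_cond_dist M E X Y \<kappa> \<longleftrightarrow>
     \<kappa> \<in> borel \<rightarrow>\<^sub>M prob_algebra borel \<and>
     (\<forall>A\<in>sets borel. \<forall>B\<in>sets borel.
        emeasure M {\<omega> \<in> space M. E \<omega> \<and> X \<omega> \<in> A \<and> Y \<omega> \<in> B} =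
        (\<integral>\<^sup>+\<omega>. emeasure (\<kappa> (X \<omega>)) B * indicator {\<omega> \<in> space M. E \<omega> \<and> X \<omega> \<in> A} \<omega> \<partial>M))"

text \<open>On the event \<open>E\<close>, given the sub-sigma-algebra \<open>F\<close>, \<open>Y\<close> is a sample from \<open>\<mu> \<omega>\<close>.\<close>
definition sampled_given ::
    "'w measure \<Rightarrow> 'w measure \<Rightarrow> ('w \<Rightarrow> bool) \<Rightarrow> ('w \<Rightarrow> 'y::topological_space)
      \<Rightarrow> ('w \<Rightarrow> 'y measure) \<Rightarrow> bool" where
  "sampled_given N F E Y \<mu> \<longleftrightarrow>
     (\<forall>B\<in>sets borel. AE \<omega> in N. E \<omega> \<longrightarrow>
        real_cond_exp N F (indicat_real {\<omega> \<in> space N. Y \<omega> \<in> B}) \<omega> = measure (\<mu> \<omega>) B)"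

section \<open>The sampling procedure\<close>

text \<open>
  The variables of a run, living on a probability space \<open>'w\<close>. The index \<open>n\<close> is the
  (zero-based) number of the iteration. The \<open>cur\<close> fields are the values when the iteration starts.
  The \<open>smp\<close> fields are the values produced by the sampling steps of that iteration: \<open>smpD\<close>,
  \<open>smpJ\<close> are \<open>D\<close>, \<open>J\<close> after they have been resampled if necessary, and \<open>smp_v\<close> is \<open>v\<close> before
  the jump is accepted or rejected by means of \<open>smp_U\<close>.
\<close>
record 'w run =
  curT :: "nat \<Rightarrow> 'w \<Rightarrow> ereal"
  curH :: "nat \<Rightarrow> 'w \<Rightarrow> real"
  curD :: "nat \<Rightarrow> 'w \<Rightarrow> ereal"
  curJ :: "nat \<Rightarrow> 'w \<Rightarrow> real"
  curA :: "nat \<Rightarrow> 'w \<Rightarrow> ereal"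
  curb :: "nat \<Rightarrow> 'w \<Rightarrow> real \<Rightarrow> ereal"
  smpD :: "nat \<Rightarrow> 'w \<Rightarrow> ereal"
  smpJ :: "nat \<Rightarrow> 'w \<Rightarrow> real"
  smp_t1 :: "nat \<Rightarrow> 'w \<Rightarrow> ereal"
  smp_s :: "nat \<Rightarrow> 'w \<Rightarrow> real"
  smp_v :: "nat \<Rightarrow> 'w \<Rightarrow> real"
  smp_x :: "nat \<Rightarrow> 'w \<Rightarrow> real"
  smp_U :: "nat \<Rightarrow> 'w \<Rightarrow> real"

definition run_t :: "'w run \<Rightarrow> nat \<Rightarrow> 'w \<Rightarrow> ereal" where
  "run_t R n \<omega> = min (smp_t1 R n \<omega>) (smpD R n \<omega>)"

text \<open>The value of \<open>v\<close> after acceptance or rejection.\<close>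
definition run_v :: "real \<Rightarrow> ereal \<Rightarrow> 'w run \<Rightarrow> nat \<Rightarrow> 'w \<Rightarrow> real" where
  "run_v q r R n \<omega> = (let v = smp_v R n \<omega> in
     if 0 < v then v * of_bool (ereal v \<le> r \<and> smp_U R n \<omega> \<le> exp (- q * v)) else v)"

definition run_Delta :: "real \<Rightarrow> ereal \<Rightarrow> 'w run \<Rightarrow> nat \<Rightarrow> 'w \<Rightarrow> real" where
  "run_Delta q r R n \<omega> =
     run_v q r R n \<omega> + of_bool (run_t R n \<omega> = smpD R n \<omega>) * smpJ R n \<omega>"

definition run_z :: "real \<Rightarrow> ereal \<Rightarrow> 'w run \<Rightarrow> nat \<Rightarrow> 'w \<Rightarrow> real" where
  "run_z q r R n \<omega> = smp_x R n \<omega> + run_Delta q r R n \<omega>"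

definition run_stops :: "real \<Rightarrow> ereal \<Rightarrow> 'w run \<Rightarrow> nat \<Rightarrow> 'w \<Rightarrow> bool" where
  "run_stops q r R n \<omega> \<longleftrightarrow>
     \<not> (ereal (run_z q r R n \<omega>) < curb R n \<omega> (real_of_ereal (run_t R n \<omega>)) \<and>
        run_t R n \<omega> < curA R n \<omega>)"

text \<open>Iteration \<open>n\<close> is actually carried out.\<close>
definition run_active :: "real \<Rightarrow> ereal \<Rightarrow> 'w run \<Rightarrow> nat \<Rightarrow> 'w \<Rightarrow> bool" where
  "run_active q r R n \<omega> \<longleftrightarrow> (\<forall>k<n. \<not> run_stops q r R k \<omega>)"

text \<open>Meaningful if the run stops.\<close>
definition run_output :: "real \<Rightarrow> ereal \<Rightarrow> 'w run \<Rightarrow> 'w \<Rightarrow> ereal \<times> real \<times> real" where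
  "run_output q r R \<omega> = (let n = (LEAST n. run_stops q r R n \<omega>) in
     (curT R (Suc n) \<omega>, curH R (Suc n) \<omega> - run_Delta q r R n \<omega>, run_Delta q r R n \<omega>))"

text \<open>The boundary \<open>b \<and> r\<close> used for \<open>S\<close>.\<close>
definition run_bound :: "ereal \<Rightarrow> 'w run \<Rightarrow> nat \<Rightarrow> 'w \<Rightarrow> real \<Rightarrow> ereal" where
  "run_bound r R n \<omega> u = min (curb R n \<omega> u) r"

text \<open>
  The sigma-algebra generated by everything sampled in the iterations before \<open>n\<close>, and by \<open>g\<close>,
  which collects what has already been sampled in iteration \<open>n\<close>.
\<close>
definition run_history ::
    "'w measure \<Rightarrow> 'w run \<Rightarrow> nat \<Rightarrow> ('w \<Rightarrow> 'g::topological_space) \<Rightarrow> 'w measure" where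
  "run_history N R n g = vimage_algebra (space N)
     (\<lambda>\<omega>. (\<lambda>k\<in>{..<n}. (smpD R k \<omega>, smpJ R k \<omega>, smp_t1 R k \<omega>, smp_s R k \<omega>,
                          smp_v R k \<omega>, smp_x R k \<omega>, smp_U R k \<omega>), g \<omega>))
     (Pi\<^sub>M {..<n} (\<lambda>_. borel) \<Otimes>\<^sub>M borel)"

abbreviation run_past :: "'w measure \<Rightarrow> 'w run \<Rightarrow> nat \<Rightarrow> 'w measure" where
  "run_past N R n \<equiv> run_history N R n (\<lambda>_. 0::real)"

text \<open>
  Initialization and deterministic assignments. For uniformity the latter are
  made for every \<open>n\<close>, but the values after the first stopping iteration are never used.
  The value \<open>\<infinity>\<close> of the initial boundary off \<open>(0, \<infinity>)\<close> is arbitrary.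
\<close>
definition run_updates :: "(real \<Rightarrow> ereal) \<Rightarrow> ereal \<Rightarrow> real \<Rightarrow> ereal \<Rightarrow> 'w measure \<Rightarrow> 'w run \<Rightarrow> bool" where
  "run_updates c K q r N R \<longleftrightarrow> (\<forall>\<omega>\<in>space N.
     curT R 0 \<omega> = 0 \<and> curH R 0 \<omega> = 0 \<and> curD R 0 \<omega> = 0 \<and> curA R 0 \<omega> = K \<and>
     curb R 0 \<omega> = (\<lambda>u. if 0 < u then c u else \<infinity>) \<and>
     (\<forall>n. curT R (Suc n) \<omega> = curT R n \<omega> + run_t R n \<omega> \<and>
          curH R (Suc n) \<omega> = curH R n \<omega> + run_z q r R n \<omega> \<and>
          curA R (Suc n) \<omega> = curA R n \<omega> - run_t R n \<omega> \<and>
          curD R (Suc n) \<omega> = smpD R n \<omega> - run_t R n \<omega> \<and>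
          curJ R (Suc n) \<omega> = smpJ R n \<omega> \<and>
          curb R (Suc n) \<omega> = (\<lambda>u. curb R n \<omega> (u + real_of_ereal (run_t R n \<omega>))
                                    - ereal (run_z q r R n \<omega>))))"

definition step1 :: "'a measure \<Rightarrow> (real \<Rightarrow> 'a \<Rightarrow> real) \<Rightarrow> real \<Rightarrow> ereal \<Rightarrow> 'w measure \<Rightarrow> 'w run \<Rightarrow> nat \<Rightarrow> bool" where
  "step1 M Q q r N R n \<longleftrightarrow>
     sampled_given N (run_past N R n) (\<lambda>\<omega>. run_active q r R n \<omega> \<and> curD R n \<omega> = 0)
       (\<lambda>\<omega>. (smpD R n \<omega>, smpJ R n \<omega>))
       (\<lambda>\<omega>. distr M borel (\<lambda>\<omega>'.
          let d = min (first_jump_time (\<lambda>u. Q u \<omega>')) (curA R n \<omega>) in (d, jump (\<lambda>u. Q u \<omega>') d))) \<and>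
     (\<forall>\<omega>\<in>space N. run_active q r R n \<omega> \<and> curD R n \<omega> \<noteq> 0 \<longrightarrow>
        smpD R n \<omega> = curD R n \<omega> \<and> smpJ R n \<omega> = curJ R n \<omega>)"

definition step2 :: "'a measure \<Rightarrow> (real \<Rightarrow> 'a \<Rightarrow> real) \<Rightarrow> real \<Rightarrow> ereal \<Rightarrow> 'w measure \<Rightarrow> 'w run \<Rightarrow> nat \<Rightarrow> bool" where
  "step2 M S q r N R n \<longleftrightarrow>
     sampled_given N (run_history N R n (\<lambda>\<omega>. (smpD R n \<omega>, smpJ R n \<omega>))) (run_active q r R n)
       (smp_t1 R n)
       (\<lambda>\<omega>. distr M borel (\<lambda>\<omega>'. passage_time (\<lambda>u. S u \<omega>') (run_bound r R n \<omega>)))"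

text \<open>
  The version \<open>\<kappa> \<omega>\<close> of the conditional distribution may be any one that depends measurably on
  the past; the current boundary is a function of the past.
\<close>
definition step3 :: "'a measure \<Rightarrow> (real \<Rightarrow> 'a \<Rightarrow> real) \<Rightarrow> real \<Rightarrow> ereal \<Rightarrow> 'w measure \<Rightarrow> 'w run \<Rightarrow> nat \<Rightarrow> bool" where
  "step3 M S q r N R n \<longleftrightarrow>
     (\<exists>\<kappa> :: 'w \<Rightarrow> ereal \<Rightarrow> (real \<times> real) measure.
        (\<lambda>(\<omega>, t). \<kappa> \<omega> t) \<in> run_past N R n \<Otimes>\<^sub>M borel \<rightarrow>\<^sub>M prob_algebra borel \<and>
        (AE \<omega> in N. run_active q r R n \<omega> \<longrightarrow>
           (let \<tau> = (\<lambda>\<omega>'. passage_time (\<lambda>u. S u \<omega>') (run_bound r R n \<omega>)) in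
            reg_cond_dist M (\<lambda>_. True) \<tau>
              (\<lambda>\<omega>'. (left_limit (\<lambda>u. S u \<omega>') (\<tau> \<omega>'), jump (\<lambda>u. S u \<omega>') (\<tau> \<omega>'))) (\<kappa> \<omega>))) \<and>
        sampled_given N (run_history N R n (\<lambda>\<omega>. (smpD R n \<omega>, smpJ R n \<omega>, smp_t1 R n \<omega>)))
          (\<lambda>\<omega>. run_active q r R n \<omega> \<and> smp_t1 R n \<omega> < smpD R n \<omega>)
          (\<lambda>\<omega>. (smp_s R n \<omega>, smp_v R n \<omega>)) (\<lambda>\<omega>. \<kappa> \<omega> (smp_t1 R n \<omega>)))"

definition step4 :: "'a measure \<Rightarrow> (real \<Rightarrow> 'a \<Rightarrow> real) \<Rightarrow> real \<Rightarrow> ereal \<Rightarrow> 'w measure \<Rightarrow> 'w run \<Rightarrow> nat \<Rightarrow> bool" where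
  "step4 M S q r N R n \<longleftrightarrow>
     sampled_given N (run_history N R n (\<lambda>\<omega>. (smpD R n \<omega>, smpJ R n \<omega>, smp_t1 R n \<omega>)))
       (\<lambda>\<omega>. run_active q r R n \<omega> \<and> smpD R n \<omega> < smp_t1 R n \<omega>)
       (smp_s R n)
       (\<lambda>\<omega>. let t = real_of_ereal (smpD R n \<omega>) in
          distr (uniform_measure M {\<omega>' \<in> space M. ereal (S t \<omega>') < run_bound r R n \<omega> t}) borel (S t)) \<and>
     (\<forall>\<omega>\<in>space N. run_active q r R n \<omega> \<and> smpD R n \<omega> < smp_t1 R n \<omega> \<longrightarrow> smp_v R n \<omega> = 0)"

text \<open>
  The version \<open>\<kappa> \<omega> t\<close> is arbitrary subject to one condition on its value at the level
  \<open>\<beta> t = b(t) \<and> r\<close>, a point which, for fixed \<open>t\<close>, is a null set. It is reached with positive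
  probability when \<open>S\<close> crosses a decreasing \<open>\<beta>\<close> continuously, and there \<open>\<kappa> \<omega> t\<close> has to be the
  conditional distribution of \<open>X\<^sub>1(t)\<close> given that \<open>S\<close> crosses \<open>\<beta>\<close> at time \<open>t\<close> without a jump.
\<close>
definition step5 :: "'a measure \<Rightarrow> (real \<Rightarrow> 'a \<Rightarrow> real) \<Rightarrow> (real \<Rightarrow> 'a \<Rightarrow> real) \<Rightarrow> (real \<Rightarrow> 'a \<Rightarrow> real)
    \<Rightarrow> real \<Rightarrow> ereal \<Rightarrow> 'w measure \<Rightarrow> 'w run \<Rightarrow> nat \<Rightarrow> bool" where
  "step5 M X1 X2 S q r N R n \<longleftrightarrow>
     (\<exists>\<kappa> :: 'w \<Rightarrow> real \<Rightarrow> real \<Rightarrow> real measure.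
        (\<lambda>(\<omega>, t, s). \<kappa> \<omega> t s) \<in> run_past N R n \<Otimes>\<^sub>M borel \<Otimes>\<^sub>M borel \<rightarrow>\<^sub>M prob_algebra borel \<and>
        (AE \<omega> in N. run_active q r R n \<omega> \<longrightarrow>
           (\<forall>t>0. reg_cond_dist M (\<lambda>_. True) (\<lambda>\<omega>'. X1 t \<omega>' + X2 t \<omega>') (X1 t) (\<kappa> \<omega> t)) \<and>
           (let \<beta> = run_bound r R n \<omega>; \<tau> = (\<lambda>\<omega>'. passage_time (\<lambda>u. S u \<omega>') \<beta>) in
            reg_cond_dist M (\<lambda>\<omega>'. \<tau> \<omega>' < \<infinity> \<and> jump (\<lambda>u. S u \<omega>') (\<tau> \<omega>') = 0)
              (\<lambda>\<omega>'. real_of_ereal (\<tau> \<omega>')) (\<lambda>\<omega>'. X1 (real_of_ereal (\<tau> \<omega>')) \<omega>')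
              (\<lambda>t. \<kappa> \<omega> t (real_of_ereal (\<beta> t))))) \<and>
        sampled_given N
          (run_history N R n (\<lambda>\<omega>. (smpD R n \<omega>, smpJ R n \<omega>, smp_t1 R n \<omega>, smp_s R n \<omega>, smp_v R n \<omega>)))
          (run_active q r R n) (smp_x R n)
          (\<lambda>\<omega>. \<kappa> \<omega> (real_of_ereal (run_t R n \<omega>)) (smp_s R n \<omega>)))"

definition step6 :: "real \<Rightarrow> ereal \<Rightarrow> 'w measure \<Rightarrow> 'w run \<Rightarrow> nat \<Rightarrow> bool" where
  "step6 q r N R n \<longleftrightarrow>
     sampled_given N
       (run_history N R n (\<lambda>\<omega>. (smpD R n \<omega>, smpJ R n \<omega>, smp_t1 R n \<omega>, smp_s R n \<omega>, smp_v R n \<omega>, smp_x R n \<omega>)))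
       (\<lambda>\<omega>. run_active q r R n \<omega> \<and> 0 < smp_v R n \<omega>)
       (smp_U R n) (\<lambda>_. uniform_measure lborel {0<..<1})"

definition sampling_run ::
    "'a measure \<Rightarrow> (real \<Rightarrow> 'a \<Rightarrow> real) \<Rightarrow> (real \<Rightarrow> 'a \<Rightarrow> real) \<Rightarrow> (real \<Rightarrow> 'a \<Rightarrow> real) \<Rightarrow> (real \<Rightarrow> 'a \<Rightarrow> real)
      \<Rightarrow> real \<Rightarrow> ereal \<Rightarrow> (real \<Rightarrow> ereal) \<Rightarrow> ereal \<Rightarrow> 'w measure \<Rightarrow> 'w run \<Rightarrow> bool" where
  "sampling_run M X1 X2 S Q q r c K N R \<longleftrightarrow>
     prob_space N \<and>
     (\<forall>n. smpD R n \<in> borel_measurable N \<and> smpJ R n \<in> borel_measurable N \<and>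
          smp_t1 R n \<in> borel_measurable N \<and> smp_s R n \<in> borel_measurable N \<and>
          smp_v R n \<in> borel_measurable N \<and> smp_x R n \<in> borel_measurable N \<and>
          smp_U R n \<in> borel_measurable N) \<and>
     run_updates c K q r N R \<and>
     (\<forall>n. step1 M Q q r N R n \<and> step2 M S q r N R n \<and> step3 M S q r N R n \<and>
          step4 M S q r N R n \<and> step5 M X1 X2 S q r N R n \<and> step6 q r N R n)"

end

theory Submission
  imports Defs
begin

text \<open>
  Jumps of \<open>S\<close> are thinned: at a jump time of \<open>S\<close>, the process \<open>X1\<close> takes the whole jump \<open>v\<close> with probability
  \<open>1{v \<le> r} exp (- q v)\<close> and nothing otherwise, independently of the past. This is proved for passage
  times of \<open>S\<close> over the level of an independent uniform variable (after the strictly increasing change of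
  scale \<open>1 - exp (- S)\<close>): both sides of the compensation formula have explicit multivariate Laplace
  transforms, obtained from dyadic approximations of the passage time, and these determine
  the measures. A jump of \<open>S\<close> over an arbitrary barrier is then reached by conditioning on a level that it
  passes. A passage without a jump needs Step 5 only at the point \<open>s = b(t)\<close>; at a fixed time ties have
  probability \<open>0\<close>, because the law of a subordinator with infinite Levy measure has no atoms.

  Given the passage event of \<open>S\<close>, one iteration therefore produces \<open>X1\<close> just before the end of the iteration and its
  jump there with the correct joint law. The strong Markov property at this time, together
  with the lack of memory of the first jump of \<open>Q\<close>, shows that the conditional expectation of a function of
  the target triple, given the current variables, is preserved by every iteration. The procedure stops since a
  weight decaying exponentially in the elapsed time, doubled while a jump of \<open>Q\<close> is pending,
  contracts in expectation by a factor \<open>7/10\<close> in every iteration, whereas the target passage time is finite.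
\<close>

text \<open>A subordinator is given by its increments and its Laplace transform; its jumps do not
  come as a Poisson random measure, so everything about them is read off from transforms. The
  uniform level is a probe: it hits a jump with probability equal to the length that the jump covers
  on the new scale, and dividing by that length undoes the size bias. Each iteration draws
  \<open>S\<close> afresh and keeps one value and one jump of \<open>X1\<close>; no path of
  \<open>Z\<close> is ever built. The comparison is therefore in law, through a value function of
  the current variables that is a martingale along the run. An iteration can be short without ending
  the run for two reasons. One is a passage of \<open>S\<close> that is due to \<open>X2\<close>,
  \<open>X3\<close> or the cap \<open>r\<close>, which is unlikely in a short time. The other is a
  jump of \<open>Q\<close>, which need not be unlikely once it is pending; but it then costs half of
  the weight, which is why a pending jump doubles it. The factor 7/10 is half of 14/10, the bound in
  the pending case.\<close>

notation (input) infinity ("oo")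
notation (input) pair_measure (infixr "><" 80)
notation (input) measurable (infixr "->M" 60)
notation (input) tendsto (infixr "--->" 55)
abbreviation (input) sequence_tendsto (infix "---->" 55) where
 "X ----> l == (X ---> l) sequentially"
abbreviation (input) Borel :: "'a measure => ('a => 'b::topological_space) set" where
 "Borel M == borel_measurable M"
abbreviation (input) iff_ascii (infixr "<->" 25) where "A <-> B == A = B"
syntax "_NINT" :: "pttrn => 'a measure => ennreal => ennreal" ("(3NINT (_)|(_)./ _)" [0, 1000, 10] 10)
translations "NINT x|M. f" == "CONST nn_integral M (%x. f)"

section \<open>Uniqueness of Laplace transforms\<close>

text \<open>The substitution \<open>e x\<close> turns transforms at integers into moments of
  measures on the unit interval. Polynomials are uniformly dense in the continuous functions there,
  so integrals of all continuous functions of \<open>e x\<close> agree, and ramps converge to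
  indicators of half-lines.\<close>

theorem laplace_transform_unique:
 fixes M M' :: "real measure"
 assumes fin: "finite_measure M" "finite_measure M'"
  and sets: "sets M = sets borel" "sets M' = sets borel"
  and pos: "AE x in M. 0 <= x" "AE x in M'. 0 <= x"
  and eq: "!!n::nat. (NINT x|M. ennreal (exp (- real n * x))) = (NINT x|M'. ennreal (exp (- real n * x)))"
 shows "M = M'"
proof -
 note [measurable_cong] = sets
 interpret M: finite_measure M by fact
 interpret M': finite_measure M' by fact
 \<comment> \<open>The truncation makes \<open>e\<close> map every real into the unit interval;
   almost everywhere it changes nothing.\<close>
 define e where "e x = exp (- max 0 x)" for x :: real
 have e: "e x:{0..1}" for x by(simp add: e_def)
 have [measurable]: "e:Borel borel" unfolding e_def by measurable
 have int: "integrable K (%x. g (e x))"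
  if K: "finite_measure K" "sets K = sets borel" and g: "continuous_on UNIV g" for g :: "real => real" and K
 proof -
  interpret K: finite_measure K by fact
  have [measurable]: "g:Borel borel" using g by(rule borel_measurable_continuous_onI)
  have "bounded (g ` {0..1})" using g by(intro compact_imp_bounded compact_continuous_image) (auto intro: continuous_on_subset)
  then obtain B where "ALL x:{0..1}. \<bar>g x\<bar> <= B" unfolding bounded_iff by auto
  thus ?thesis using e K(2)
   by(intro K.integrable_const_bound[where B=B]) (auto cong: measurable_cong_sets)
 qed
 have "(\<integral>x. e x ^ n \<partial>K) = enn2real (NINT x|K. ennreal (exp (- real n * x)))"
  if [measurable_cong]: "sets K = sets borel" and "AE x in K. 0 <= x" for K n
  using that(2) by(subst integral_eq_nn_integral)
   (auto simp: e_def max_def exp_of_nat_mult[symmetric] intro!: arg_cong[where f=enn2real] nn_integral_cong_AE elim!: eventually_mono)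
 hence mono: "(\<integral>x. e x ^ n \<partial>M) = (\<integral>x. e x ^ n \<partial>M')" for n using sets pos eq by simp
 have poly: "(\<integral>x. p (e x) \<partial>M) = (\<integral>x. p (e x) \<partial>M')" if rp: "real_polynomial_function p" for p
 proof -
  obtain a n where p: "p = (%x. \<Sum>i\<le>n. a i * x ^ i)" using rp unfolding real_polynomial_function_iff_sum by blast
  have "(\<integral>x. p (e x) \<partial>K) = (\<Sum>i\<le>n. a i * (\<integral>x. e x ^ i \<partial>K))" if K: "finite_measure K" "sets K = sets borel" for K
  proof -
   have "integrable K (%x. e x ^ i)" for i by(rule int[OF K]) (intro continuous_intros)
   thus ?thesis unfolding p by(subst Bochner_Integration.integral_sum) auto
  qed
  thus ?thesis using fin sets mono by simp
 qed
 have cont: "(\<integral>x. f (e x) \<partial>M) = (\<integral>x. f (e x) \<partial>M')" if f: "continuous_on UNIV f" for f :: "real => real"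
 proof -
  have "\<bar>(\<integral>x. f (e x) \<partial>M) - (\<integral>x. f (e x) \<partial>M')\<bar> <= d * (measure M (space M) + measure M' (space M'))" if d: "0 < d" for d
  proof -
   obtain p where p: "real_polynomial_function p" "!!x. x:{0..1} ==> \<bar>f x - p x\<bar> < d"
    using Stone_Weierstrass_real_polynomial_function[of "{0..1}" f d] continuous_on_subset[OF f] d by auto
   have pc: "continuous_on UNIV p"
    using p(1) by(metis continuous_on_polymonial_function real_polynomial_function_eq)
   have "\<bar>(\<integral>x. f (e x) \<partial>K) - (\<integral>x. p (e x) \<partial>K)\<bar> <= d * measure K (space K)"
    if K: "finite_measure K" "sets K = sets borel" for K
   proof -
    interpret K: finite_measure K by fact
    have "\<bar>(\<integral>x. f (e x) \<partial>K) - (\<integral>x. p (e x) \<partial>K)\<bar> = \<bar>\<integral>x. f (e x) - p (e x) \<partial>K\<bar>"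
     using int[OF K f] int[OF K pc] by simp
    also have "... <= (\<integral>x. d \<partial>K)"
     using int[OF K f] int[OF K pc] p(2)[OF e]
     by(intro order_trans[OF integral_abs_bound] integral_mono) (auto simp: less_imp_le)
    finally show ?thesis by(simp add: mult.commute)
   qed
   from this[OF fin(1) sets(1)] this[OF fin(2) sets(2)] show ?thesis
    using poly[OF p(1)] by(simp add: distrib_left)
  qed
  note bound = this
  define C where "C = measure M (space M) + measure M' (space M')"
  have C: "0 <= C" by(simp add: C_def)
  have "\<bar>(\<integral>x. f (e x) \<partial>M) - (\<integral>x. f (e x) \<partial>M')\<bar> <= 0 + d" if d: "0 < d" for d
  proof -
   have "d / (C + 1) * C <= d" using C d by(simp add: field_simps)
   thus ?thesis using bound[of "d / (C + 1)"] C d unfolding C_def[symmetric] by simp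
  qed
  hence "\<bar>(\<integral>x. f (e x) \<partial>M) - (\<integral>x. f (e x) \<partial>M')\<bar> <= 0" by(rule field_le_epsilon)
  thus ?thesis by simp
 qed
 show ?thesis
 proof(rule measure_eqI_lessThan[OF sets])
  show "emeasure M {x<..} < oo" for x using M.emeasure_finite by(simp add: less_top[symmetric])
  fix a :: real
  \<comment> \<open>A ramp that vanishes for \<open>y >= exp (- a)\<close> and tends to 1 below. In
    terms of \<open>x\<close> its limit is the indicator of \<open>A\<close>, which agrees almost
    everywhere with the half-line \<open>{a<..}\<close>.\<close>
  define f where "f k y = max 0 (min 1 (real k * (exp (- a) - y)))" for k and y :: real
  define A where "A = {x. a < max 0 x}"
  have [measurable]: "A:sets borel" unfolding A_def by measurable
  have f: "continuous_on UNIV (f k)" for k unfolding f_def by(intro continuous_intros)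
  hence [measurable]: "f k:Borel borel" for k by(rule borel_measurable_continuous_onI)
  have lim: "(%k. \<integral>x. f k (e x) \<partial>K) ----> measure K A"
   if K: "finite_measure K" "sets K = sets borel" for K
  proof -
   interpret K: finite_measure K by fact
   note [measurable_cong] = K(2)
   have "(%k. \<integral>x. f k (e x) \<partial>K) ----> (\<integral>x. indicator A x \<partial>K)"
   proof(rule integral_dominated_convergence[where w="%_. 1"])
    show "AE x in K. (%k. f k (e x)) ----> indicat_real A x"
    proof(intro AE_I2)
     fix x
     show "(%k. f k (e x)) ----> indicat_real A x"
     proof(cases "x:A")
      case True
      hence d: "0 < exp (- a) - e x" by(simp add: A_def e_def)
      obtain n :: nat where n: "1 / (exp (- a) - e x) <= real n" using real_arch_simple by blast
      have "1 <= real n * (exp (- a) - e x)" using n d by(simp add: pos_divide_le_eq)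
      hence "1 <= real k * (exp (- a) - e x)" if "n <= k" for k
       using d that by(elim order_trans) (intro mult_right_mono, auto)
      hence "\<forall>\<^sub>F k in sequentially. f k (e x) = indicat_real A x"
       using True by(auto simp: eventually_sequentially f_def intro!: exI[of _ n])
      thus ?thesis by(rule tendsto_eventually)
     next
      case False
      hence "real k * (exp (- a) - e x) <= 0" for k by(intro mult_nonneg_nonpos) (auto simp: A_def e_def)
      hence "f k (e x) = 0" for k unfolding f_def by(intro max_absorb1 min.coboundedI2)
      thus ?thesis using False by simp
     qed
    qed
   qed (auto simp: f_def)
   thus ?thesis using K(2) by(simp add: sets_eq_imp_space_eq[OF K(2)])
  qed
  have "measure M A = measure M' A"
   using lim[OF fin(1) sets(1)] lim[OF fin(2) sets(2)] cont[OF f] by(auto intro: LIMSEQ_unique)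
  moreover have "emeasure K {a<..} = emeasure K A" if "AE x in K. 0 <= x" "sets K = sets borel" for K
   using that by(intro emeasure_eq_AE) (auto simp: A_def max_def elim!: eventually_mono)
  ultimately show "emeasure M {a<..} = emeasure M' {a<..}"
   using pos sets by(metis M.emeasure_eq_measure M'.emeasure_eq_measure)
 qed
qed

lemma nn_integral_split:
 fixes f :: "'a => ennreal"
 assumes [measurable]: "Measurable.pred M A" "Measurable.pred M P" "f:Borel M"
 shows "(NINT w|M. (if A w then f w else 0)) = (NINT w|M. (if A w & P w then f w else 0)) + (NINT w|M. (if A w & ~ P w then f w else 0))"
 by(subst nn_integral_add[symmetric]) (auto intro!: nn_integral_cong)

lemma nn_integral_distr_density:
 assumes "f:M ->M N" "e:Borel M" "G:Borel N"
 shows "(NINT x|(distr (density M e) N f). G x) = (NINT x|M. G (f x) * e x)"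
 using assms by(simp add: nn_integral_distr nn_integral_density mult.commute)

lemma finite_measure_density:
 "e:Borel M ==> (NINT x|M. e x) < oo ==> finite_measure (density M e)"
 by(intro finite_measureI) (auto simp: emeasure_density less_top cong: nn_integral_cong_simp)

text \<open>With the weight as a density this is uniqueness for an image measure. The weights are
  what allows coordinates to be treated one at a time in the multivariate case.\<close>

lemma laplace_weighted_unique:
 fixes f :: "'a => real" and f' :: "'b => real"
 assumes m[measurable]: "f:Borel M" "f':Borel M'"
   "g:Borel M" "g':Borel M'"
  and pos: "AE x in M. 0 <= f x" "AE x in M'. 0 <= f' x"
  and fin: "(NINT x|M. g x) < oo" "(NINT x|M'. g' x) < oo"
  and eq: "!!n::nat. (NINT x|M. ennreal (exp (- real n * f x)) * g x) = (NINT x|M'. ennreal (exp (- real n * f' x)) * g' x)"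
  and A: "A:sets borel"
 shows "(NINT x|M. indicator A (f x) * g x) = (NINT x|M'. indicator A (f' x) * g' x)"
proof -
 note nn = nn_integral_distr_density[OF m(1,3)] nn_integral_distr_density[OF m(2,4)]
 have "distr (density M g) borel f = distr (density M' g') borel f'"
 proof(rule laplace_transform_unique)
  show "(NINT x|(distr (density M g) borel f). ennreal (exp (- real n * x))) =
    (NINT x|(distr (density M' g') borel f'). ennreal (exp (- real n * x)))" for n
   using eq[of n] by(simp add: nn)
 qed (use pos in \<open>auto simp: AE_distr_iff AE_density intro!: finite_measure.finite_measure_distr finite_measure_density fin\<close>)
 from arg_cong[OF this, of "%K. (NINT x|K. indicator A x)"] show ?thesis
  using A by(simp add: nn del: nn_integral_indicator)
qed

text \<open>Induction on the coordinates. With the exponentials in the other coordinates absorbed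
  into the weight, the univariate result trades the exponential in coordinate \<open>j\<close> for
  an indicator. This indicator then joins the weight \<open>g\<close>, over which the induction
  hypothesis is general.\<close>

lemma laplace_rectangle_unique:
 fixes f :: "'i => 'a => real" and f' :: "'i => 'b => real"
 assumes "finite I"
  and f[measurable]: "!!i. i:I ==> f i:Borel M" "!!i. i:I ==> f' i:Borel M'"
  and pos: "!!i. i:I ==> AE x in M. 0 <= f i x" "!!i. i:I ==> AE x in M'. 0 <= f' i x"
  and g[measurable]: "g:Borel M" "g':Borel M'"
  and fin: "(NINT x|M. g x) < oo" "(NINT x|M'. g' x) < oo"
  and eq: "!!n::'i => nat. (NINT x|M. ennreal (exp (- (\<Sum>i\<in>I. real (n i) * f i x))) * g x) =
    (NINT x|M'. ennreal (exp (- (\<Sum>i\<in>I. real (n i) * f' i x))) * g' x)"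
  and A: "!!i. i:I ==> A i:sets borel"
 shows "(NINT x|M. (\<Prod>i\<in>I. indicator (A i) (f i x)) * g x) = (NINT x|M'. (\<Prod>i\<in>I. indicator (A i) (f' i x)) * g' x)"
 using assms
proof(induction I arbitrary: g g' rule: finite_induct)
 case empty
 thus ?case by simp
next
 case (insert j I)
 note [measurable] = insert.prems(1-2,5-6)
 define h where "h x = indicator (A j) (f j x) * g x" for x
 define h' where "h' x = indicator (A j) (f' j x) * g' x" for x
 have Aj[measurable]: "A j:sets borel" using insert by auto
 have [measurable]: "h:Borel M" "h':Borel M'"
  unfolding h_def h'_def using insert.prems by measurable
 have le1: "indicator (A j) y * z <= (z::ennreal)" for y z by(auto simp: indicator_def)
 have "(NINT x|M. (\<Prod>i\<in>I. indicator (A i) (f i x)) * h x) = (NINT x|M'. (\<Prod>i\<in>I. indicator (A i) (f' i x)) * h' x)"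
 proof(rule insert.IH)
  show "(NINT x|M. h x) < oo" unfolding h_def
   using insert.prems(7) by(rule le_less_trans[rotated]) (intro nn_integral_mono le1)
  show "(NINT x|M'. h' x) < oo" unfolding h'_def
   using insert.prems(8) by(rule le_less_trans[rotated]) (intro nn_integral_mono le1)
  fix n :: "'i => nat"
  define k where "k x = ennreal (exp (- (\<Sum>i\<in>I. real (n i) * f i x))) * g x" for x
  define k' where "k' x = ennreal (exp (- (\<Sum>i\<in>I. real (n i) * f' i x))) * g' x" for x
  have bd: "AE x in K. ennreal (exp (- (\<Sum>i\<in>I. real (n i) * F i x))) * G x <= G x"
   if "!!i. i:insert j I ==> AE x in K. 0 <= F i x" for K :: "'c measure" and F :: "'i => 'c => real" and G
  proof -
   have "AE x in K. ALL i:I. 0 <= F i x" using that insert.hyps by(auto simp: AE_ball_countable countable_finite)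
   thus ?thesis
   proof eventually_elim
    case (elim x)
    have "ennreal (exp (- (\<Sum>i\<in>I. real (n i) * F i x))) <= 1"
     using elim by(auto intro!: sum_nonneg simp: ennreal_le_1)
    thus ?case using mult_right_mono[of _ 1 "G x"] by fastforce
   qed
  qed
  have "(NINT x|M. indicator (A j) (f j x) * k x) = (NINT x|M'. indicator (A j) (f' j x) * k' x)"
  proof(rule laplace_weighted_unique)
   show "k:Borel M" "k':Borel M'" unfolding k_def k'_def using insert.prems by measurable
   show "(NINT x|M. k x) < oo"
    using insert.prems(7) unfolding k_def
    by(rule le_less_trans[rotated]) (intro nn_integral_mono_AE bd insert.prems)
   show "(NINT x|M'. k' x) < oo"
    using insert.prems(8) unfolding k'_def
    by(rule le_less_trans[rotated]) (intro nn_integral_mono_AE bd insert.prems)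
   fix m :: nat
   have *: "ennreal (exp (- real m * F j x)) * (ennreal (exp (- (\<Sum>i\<in>I. real (n i) * F i x))) * G) =
     ennreal (exp (- (\<Sum>i\<in>insert j I. real ((n(j := m)) i) * F i x))) * G" for F :: "'i => 'c => real" and x G
   proof -
    have "(\<Sum>i\<in>I. real ((n(j := m)) i) * F i x) = (\<Sum>i\<in>I. real (n i) * F i x)"
     using insert.hyps by(intro sum.cong) auto
    thus ?thesis using insert.hyps
     by(simp add: mult.assoc[symmetric] ennreal_mult'[symmetric] exp_add[symmetric] del: fun_upd_apply)
      (simp add: algebra_simps)
   qed
   show "(NINT x|M. ennreal (exp (- real m * f j x)) * k x) = (NINT x|M'. ennreal (exp (- real m * f' j x)) * k' x)"
    unfolding k_def k'_def * by(rule insert.prems)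
  qed (use insert.prems in auto)
  thus "(NINT x|M. ennreal (exp (- (\<Sum>i\<in>I. real (n i) * f i x))) * h x) =
    (NINT x|M'. ennreal (exp (- (\<Sum>i\<in>I. real (n i) * f' i x))) * h' x)"
   by(simp add: k_def k'_def h_def h'_def ac_simps)
 qed (use insert.prems in auto)
 thus ?case using insert.hyps by(simp add: h_def h'_def ac_simps)
qed


theorem multivariate_laplace_unique:
 fixes f :: "'i => 'a => real" and f' :: "'i => 'b => real"
 assumes I: "finite I"
  and f: "!!i. i:I ==> f i:Borel M" "!!i. i:I ==> f' i:Borel M'"
  and pos: "!!i. i:I ==> AE x in M. 0 <= f i x" "!!i. i:I ==> AE x in M'. 0 <= f' i x"
  and g[measurable]: "g:Borel M" "g':Borel M'"
  and fin: "(NINT x|M. g x) < oo" "(NINT x|M'. g' x) < oo"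
  and eq: "!!n::'i => nat. (NINT x|M. ennreal (exp (- (\<Sum>i\<in>I. real (n i) * f i x))) * g x) =
    (NINT x|M'. ennreal (exp (- (\<Sum>i\<in>I. real (n i) * f' i x))) * g' x)"
  and F: "F:Borel (Pi\<^sub>M I (%_. borel))"
 shows "(NINT x|M. F (\<lambda>i\<in>I. f i x) * g x) = (NINT x|M'. F (\<lambda>i\<in>I. f' i x) * g' x)"
proof -
 let ?P = "Pi\<^sub>M I (%_. borel) :: ('i => real) measure"
 have m: "(%x. \<lambda>i\<in>I. f i x):M ->M ?P" "(%x. \<lambda>i\<in>I. f' i x):M' ->M ?P"
  using f by(auto intro!: measurable_restrict)
 have rect: "emeasure (distr (density K h) ?P (%x. \<lambda>i\<in>I. k i x)) (prod_emb I (%_. borel) J (Pi\<^sub>E J A)) =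
   (NINT x|K. (\<Prod>i\<in>I. indicator (if i:J then A i else UNIV) (k i x)) * h x)"
  if K: "(%x. \<lambda>i\<in>I. k i x):K ->M ?P" "h:Borel K" and J: "finite J" "J \<subseteq> I" "!!i. i:J ==> A i:sets borel"
  for K :: "'c measure" and k h J A
 proof -
  let ?R = "prod_emb I (%_. borel) J (Pi\<^sub>E J A)"
  have s: "?R:sets ?P" using J by(auto intro!: sets_PiM_I)
  have "indicator ?R (\<lambda>i\<in>I. k i x) = (\<Prod>i\<in>I. indicator (if i:J then A i else UNIV) (k i x) :: ennreal)" for x
  proof -
   have "(\<lambda>i\<in>I. k i x):?R <-> (ALL i:I. k i x:(if i:J then A i else UNIV))"
    using J(2) by(auto simp: prod_emb_def PiE_iff extensional_def subset_eq)
   thus ?thesis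
    using I by(cases "ALL i:I. k i x:(if i:J then A i else UNIV)") (auto simp: indicator_def prod_zero_iff)
  qed
  thus ?thesis using nn_integral_distr_density[OF K, of "indicator ?R"] s by simp
 qed
 have "distr (density M g) ?P (%x. \<lambda>i\<in>I. f i x) = distr (density M' g') ?P (%x. \<lambda>i\<in>I. f' i x)"
 proof(rule measure_eqI_PiM_infinite)
  fix A :: "'i => real set" and J assume J: "finite J" "J \<subseteq> I" "!!i. i:J ==> A i:sets borel"
  show "emeasure (distr (density M g) ?P (%x. \<lambda>i\<in>I. f i x)) (prod_emb I (%_. borel) J (Pi\<^sub>E J A)) =
   emeasure (distr (density M' g') ?P (%x. \<lambda>i\<in>I. f' i x)) (prod_emb I (%_. borel) J (Pi\<^sub>E J A))"
   by(rule trans[OF rect[OF m(1) g(1) J] trans[OF laplace_rectangle_unique[OF I f pos g fin eq] rect[OF m(2) g(2) J, symmetric]]])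
    (use J in auto)
 qed (use m fin in \<open>auto intro!: finite_measure.finite_measure_distr finite_measure_density\<close>)
 from arg_cong[OF this, of "%K. nn_integral K F"] show ?thesis
  unfolding nn_integral_distr_density[OF m(1) g(1) F] nn_integral_distr_density[OF m(2) g(2) F] .
qed

section \<open>Paths\<close>

definition subordinator_path :: "(real => real) => bool" where
 "subordinator_path f <-> f 0 = 0 & mono_on {0..} f & (ALL t>=0. continuous (at_right t) f)"

text \<open>Paths are total functions, but their values at negative times carry no meaning; the
  sigma-algebra is pulled back through the restriction to nonnegative times and does not see
  them.\<close>

definition path_space :: "(real => real) measure" where
 "path_space = vimage_algebra {f. subordinator_path f} (%f. restrict f {0..}) (Pi\<^sub>M {0..} (%_. borel))"

lemma subordinator_pathD:
 assumes "subordinator_path f"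
 shows "f 0 = 0" "!!s t. 0 <= s ==> s <= t ==> f s <= f t" "!!t. 0 <= t ==> 0 <= f t"
  "!!t. 0 <= t ==> (f ---> f t) (at_right t)"
 using assms unfolding subordinator_path_def
 by(auto simp: mono_on_def continuous_within) (metis order_refl)

lemma space_path_space: "space path_space = {f. subordinator_path f}"
 by(simp add: path_space_def)

lemma measurable_restrict_path: "(%f. restrict f {0..}):path_space ->M Pi\<^sub>M {0..} (%_. borel)"
 unfolding path_space_def by(rule measurable_vimage_algebra1) (simp add: space_PiM)

lemma measurable_eval_path:
 assumes "X:N ->M path_space" "0 <= t" shows "(%x. X x t):Borel N"
proof -
 have "(%f. restrict f {0..} t):Borel path_space"
  by(rule measurable_compose[OF measurable_restrict_path measurable_component_singleton]) (use assms in simp)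
 hence "(%f. f t):Borel path_space" using assms by simp
 from measurable_compose[OF assms(1) this] show ?thesis .
qed

lemma measurable_into_path_space:
 assumes "!!x. x:space N ==> subordinator_path (X x)" "!!t. 0 <= t ==> (%x. X x t):Borel N"
 shows "X:N ->M path_space"
 unfolding path_space_def
proof(rule measurable_vimage_algebra2)
 show "X:space N \<rightarrow> {f. subordinator_path f}" using assms by auto
 show "(%x. restrict (X x) {0..}):N ->M Pi\<^sub>M {0..} (%_. borel)"
  by(rule measurable_restrict) (use assms in auto)
qed

section \<open>Evaluation of paths at random times\<close>

text \<open>Strictly above \<open>v\<close> even if \<open>v\<close> is dyadic, so that
  right-continuity applies along the sequence; \<open>dyadic_below\<close> is likewise strictly
  below and reaches left limits. Both take countably many values for each \<open>n\<close>, which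
  makes a path evaluated there measurable.\<close>

definition dyadic_above :: "nat => real => real" where
 "dyadic_above n v = (of_int \<lfloor>2 ^ n * v\<rfloor> + 1) / 2 ^ n"

definition dyadic_below :: "nat => real => real" where
 "dyadic_below n v = (of_int \<lceil>2 ^ n * v\<rceil> - 1) / 2 ^ n"

lemma dyadic_above_bounds: "v < dyadic_above n v" "dyadic_above n v <= v + 1 / 2 ^ n"
 unfolding dyadic_above_def by(simp_all add: field_simps) linarith+

lemma dyadic_below_bounds: "dyadic_below n v < v" "v - 1 / 2 ^ n <= dyadic_below n v"
 unfolding dyadic_below_def by(simp_all add: field_simps) linarith+

lemma dyadic_below_nonneg: "0 < v ==> 0 <= dyadic_below n v"
 unfolding dyadic_below_def by(simp add: one_le_ceiling)

lemma inverse_two_power_tendsto: "(%n. 1 / 2 ^ n :: real) ----> 0"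
 using LIMSEQ_power_zero[of "1/2::real"] by(simp add: power_divide)

lemma filterlim_dyadic_above: "filterlim (%n. dyadic_above n v) (at_right v) sequentially"
 unfolding filterlim_at
proof(intro conjI)
 show "(%n. dyadic_above n v) ----> v"
  by(rule tendsto_sandwich[of "%_. v" _ _ "%n. v + 1 / 2 ^ n"])
   (use tendsto_add[OF tendsto_const inverse_two_power_tendsto, of v] in
    \<open>auto intro!: always_eventually dyadic_above_bounds less_imp_le\<close>)
qed (use dyadic_above_bounds(1)[of v, THEN less_imp_neq] in \<open>auto simp: dyadic_above_bounds eq_commute intro!: always_eventually\<close>)

lemma filterlim_dyadic_below: "filterlim (%n. dyadic_below n v) (at_left v) sequentially"
 unfolding filterlim_at
proof(intro conjI)
 show "(%n. dyadic_below n v) ----> v"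
  by(rule tendsto_sandwich[of "%n. v - 1 / 2 ^ n" _ _ "%_. v"])
   (use tendsto_diff[OF tendsto_const inverse_two_power_tendsto, of v] in
    \<open>auto intro!: always_eventually dyadic_below_bounds less_imp_le\<close>)
qed (use dyadic_below_bounds(1)[of _ v, THEN less_imp_neq] in \<open>auto simp: dyadic_below_bounds intro!: always_eventually\<close>)

lemma measurable_path_at_countable:
 fixes i :: "'b => int" and g :: "int => real"
 assumes [measurable]: "X:N ->M path_space" "i:N ->M count_space UNIV"
  and "!!x. x:space N ==> 0 <= g (i x)"
 shows "(%x. X x (g (i x))):Borel N"
proof -
 have "(%x. (%k x. X x (max 0 (g k))) (i x) x):Borel N"
  by(rule measurable_compose_countable) (auto intro: measurable_eval_path)
 thus ?thesis
  by(rule measurable_cong[THEN iffD1, rotated]) (use assms(3) in auto)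
qed

lemma measurable_path_at:
 fixes v :: "'b => real"
 assumes [measurable]: "X:N ->M path_space" "v:Borel N"
  and nonneg: "!!x. x:space N ==> 0 <= v x"
 shows "(%x. X x (v x)):Borel N"
proof(rule borel_measurable_LIMSEQ_real)
 fix n
 have ge: "0 <= (real_of_int \<lfloor>2 ^ n * v x\<rfloor> + 1) / 2 ^ n" if "x:space N" for x
  using nonneg[OF that] by(intro divide_nonneg_nonneg add_nonneg_nonneg) auto
 show "(%x. X x (dyadic_above n (v x))):Borel N"
  unfolding dyadic_above_def
  by(rule measurable_path_at_countable[where g="%k. (of_int k + 1) / 2 ^ n"]) (use ge in auto)
next
 fix x assume x: "x:space N"
 have "subordinator_path (X x)" using measurable_space[OF assms(1) x] by(simp add: space_path_space)
 from subordinator_pathD(4)[OF this nonneg[OF x]]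
 show "(%n. X x (dyadic_above n (v x))) ----> X x (v x)"
  by(rule filterlim_compose[OF _ filterlim_dyadic_above])
qed

section \<open>Left limits and jumps\<close>

lemma left_limit_tendsto:
 assumes f: "subordinator_path f" and v: "0 < v"
 shows "(f ---> left_limit f (ereal v)) (at_left v)"
proof -
 note D = subordinator_pathD[OF f]
 define L where "L = (SUP u\<in>{0..<v}. f u)"
 have bdd: "bdd_above (f ` {0..<v})" using D(2) by(intro bdd_aboveI[of _ "f v"]) auto
 have "(f ---> L) (at_left v)"
 proof(rule order_tendstoI)
  fix a assume "a < L"
  then obtain u where u: "u:{0..<v}" "a < f u" unfolding L_def
   using v by(subst (asm) less_cSUP_iff[OF _ bdd]) auto
  have "\<forall>\<^sub>F x in at_left v. u < x" using u by(auto intro: eventually_at_leftI[of u])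
  thus "\<forall>\<^sub>F x in at_left v. a < f x"
  proof eventually_elim
   case (elim x)
   thus ?case using u D(2)[of u x] by auto
  qed
 next
  fix a assume a: "L < a"
  have "\<forall>\<^sub>F x in at_left v. x:{0<..<v}" using v by(intro eventually_at_leftI[of 0]) auto
  thus "\<forall>\<^sub>F x in at_left v. f x < a"
  proof eventually_elim
   case (elim x)
   hence "f x <= L" unfolding L_def by(intro cSUP_upper bdd) auto
   thus ?case using a by simp
  qed
 qed
 moreover from this have "left_limit f (ereal v) = L"
  unfolding left_limit_def using v by(simp add: tendsto_Lim)
 ultimately show ?thesis by simp
qed

lemma left_limit_bounds:
 assumes f: "subordinator_path f" and v: "0 < v"
 shows "!!u. 0 <= u ==> u < v ==> f u <= left_limit f (ereal v)" "left_limit f (ereal v) <= f v"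
proof -
 note D = subordinator_pathD[OF f]
 fix u assume u: "0 <= u" "u < v"
 have "\<forall>\<^sub>F x in at_left v. f u <= f x"
  by(rule eventually_at_leftI[of u]) (use u D(2) in auto)
 thus "f u <= left_limit f (ereal v)"
  by(rule tendsto_lowerbound[OF left_limit_tendsto[OF f v]]) auto
next
 note D = subordinator_pathD[OF f]
 have "\<forall>\<^sub>F x in at_left v. f x <= f v"
  by(rule eventually_at_leftI[of 0]) (use v D(2) in auto)
 thus "left_limit f (ereal v) <= f v"
  by(rule tendsto_upperbound[OF left_limit_tendsto[OF f v]]) auto
qed

lemma left_limit_nonneg: "subordinator_path f ==> 0 <= left_limit f t"
 using left_limit_bounds(1)[of f _ 0] subordinator_pathD(1)[of f]
 by(cases t) (auto simp: left_limit_def)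

lemma left_limit_eqI:
 assumes f: "subordinator_path f" and v: "0 < v" and le: "!!u. 0 <= u ==> u < v ==> f u <= L"
  and ge: "!!e. 0 < e ==> EX u. 0 <= u & u < v & L - e <= f u"
 shows "left_limit f (ereal v) = L"
proof(rule antisym)
 have "\<forall>\<^sub>F x in at_left v. f x <= L"
  by(rule eventually_at_leftI[of 0]) (use v le in auto)
 thus "left_limit f (ereal v) <= L"
  by(rule tendsto_upperbound[OF left_limit_tendsto[OF f v]]) auto
 show "L <= left_limit f (ereal v)"
 proof(rule field_le_epsilon)
  fix e :: real assume "0 < e"
  from ge[OF this] left_limit_bounds(1)[OF f v] show "L <= left_limit f (ereal v) + e" by force
 qed
qed

lemma left_limit_cong:
 assumes "0 < t" "!!u. 0 <= u ==> u < t ==> f u = g u"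
 shows "left_limit f (ereal t) = left_limit g (ereal t)"
proof -
 have "(f ---> L) (at_left t) <-> (g ---> L) (at_left t)" for L
  by(rule tendsto_cong) (use assms in \<open>auto intro!: eventually_at_leftI[of 0]\<close>)
 thus ?thesis by(simp add: left_limit_def Topological_Spaces.Lim_def)
qed

lemma measurable_left_limit[measurable (raw)]:
 fixes v :: "'b => ereal"
 assumes [measurable]: "X:N ->M path_space" "v:Borel N"
 shows "(%x. left_limit (X x) (v x)):Borel N"
proof -
 \<comment> \<open>The default 1 is an arbitrary positive time; it stands in where
   \<open>left_limit\<close> is 0 by convention.\<close>
 define w where "w x = (if 0 < v x & v x < oo then real_of_ereal (v x) else 1)" for x
 have [measurable]: "w:Borel N" unfolding w_def by measurable
 have w: "0 < w x" for x by(cases "v x") (auto simp: w_def)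
 have "(%x. left_limit (X x) (ereal (w x))):Borel N"
 proof(rule borel_measurable_LIMSEQ_real)
  fix n
  show "(%x. X x (dyadic_below n (w x))):Borel N"
   unfolding dyadic_below_def
  proof(rule measurable_path_at_countable[where g="%k. (of_int k - 1) / 2 ^ n"])
   show "0 <= (real_of_int \<lceil>2 ^ n * w x\<rceil> - 1) / 2 ^ n" for x
    using dyadic_below_nonneg[OF w, of n x] by(simp add: dyadic_below_def)
  qed auto
 next
  fix x assume x: "x:space N"
  have "subordinator_path (X x)" using measurable_space[OF assms(1) x] by(simp add: space_path_space)
  from left_limit_tendsto[OF this w[of x]]
  show "(%n. X x (dyadic_below n (w x))) ----> left_limit (X x) (ereal (w x))"
   by(rule filterlim_compose[OF _ filterlim_dyadic_below])
 qed
 hence "(%x. if 0 < v x & v x < oo then left_limit (X x) (ereal (w x)) else 0):Borel N"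
  by measurable
 also have "(%x. if 0 < v x & v x < oo then left_limit (X x) (ereal (w x)) else 0) = (%x. left_limit (X x) (v x))"
 proof
  fix x show "(if 0 < v x & v x < oo then left_limit (X x) (ereal (w x)) else 0) = left_limit (X x) (v x)"
   by(cases "v x") (auto simp: w_def left_limit_def)
 qed
 finally show ?thesis .
qed

lemma measurable_jump[measurable (raw)]:
 fixes v :: "'b => ereal"
 assumes [measurable]: "X:N ->M path_space" "v:Borel N"
 shows "(%x. jump (X x) (v x)):Borel N"
proof -
 have [measurable]: "(%x. X x (max 0 (real_of_ereal (v x)))):Borel N"
  by(rule measurable_path_at) auto
 have "(%x. if 0 < v x & v x < oo then X x (max 0 (real_of_ereal (v x))) - left_limit (X x) (v x) else 0):Borel N"
  by measurable
 also have "(%x. if 0 < v x & v x < oo then X x (max 0 (real_of_ereal (v x))) - left_limit (X x) (v x) else 0) = (%x. jump (X x) (v x))"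
 proof
  fix x show "(if 0 < v x & v x < oo then X x (max 0 (real_of_ereal (v x))) - left_limit (X x) (v x) else 0) = jump (X x) (v x)"
   by(cases "v x") (auto simp: jump_def)
 qed
 finally show ?thesis .
qed

lemma jump_nonneg: "subordinator_path f ==> 0 <= jump f t"
 using left_limit_bounds(2)[of f] by(cases t) (auto simp: jump_def)

lemma subordinator_path_add:
 assumes "subordinator_path f" "subordinator_path g" shows "subordinator_path (%t. f t + g t)"
 using assms unfolding subordinator_path_def
 by(auto intro!: mono_onI add_mono continuous_intros dest: mono_onD)

lemma measurable_path_add:
 assumes [measurable]: "X:N ->M path_space" "Y:N ->M path_space"
 shows "(%x. (%t. X x t + Y x t)):N ->M path_space"
proof(rule measurable_into_path_space)
 fix x assume "x:space N"
 thus "subordinator_path (%t. X x t + Y x t)"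
  using measurable_space[OF assms(1)] measurable_space[OF assms(2)]
  by(intro subordinator_path_add) (auto simp: space_path_space)
qed (intro borel_measurable_add measurable_eval_path assms)

lemma left_limit_add:
 assumes "subordinator_path f" "subordinator_path g"
 shows "left_limit (%t. f t + g t) v = left_limit f v + left_limit g v"
proof(cases "0 < v & v < oo")
 case True
 then obtain w where w: "v = ereal w" "0 < w" by(cases v) auto
 have "((%t. f t + g t) ---> left_limit f v + left_limit g v) (at_left w)"
  unfolding w(1) using assms w(2) by(intro tendsto_add left_limit_tendsto)
 thus ?thesis unfolding w(1) left_limit_def[of "%t. f t + g t"] using w(2) by(simp add: tendsto_Lim)
qed (auto simp: left_limit_def)

lemma jump_add:
 assumes "subordinator_path f" "subordinator_path g"
 shows "jump (%t. f t + g t) v = jump f v + jump g v"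
 unfolding jump_def by(simp add: left_limit_add[OF assms])

section \<open>Shifted and stopped paths\<close>

definition shift_path :: "real => (real => real) => real => real" where
 "shift_path t f = (%u. f (t + u) - f t)"

definition stop_path :: "real => (real => real) => real => real" where
 "stop_path t f = (%u. f (min u t))"

lemma subordinator_path_shift:
 assumes "subordinator_path f" "0 <= t" shows "subordinator_path (shift_path t f)"
 unfolding subordinator_path_def shift_path_def
proof(intro conjI allI impI)
 note D = subordinator_pathD[OF assms(1)]
 show "mono_on {0..} (%u. f (t + u) - f t)" using D(2) assms(2) by(intro mono_onI) auto
 fix s :: real assume s: "0 <= s"
 have "filterlim (%u. t + u) (at_right (t + s)) (at_right s)"
  by(auto simp: filterlim_at eventually_at_filter intro!: tendsto_eq_intros)
 thus "continuous (at_right s) (%u. f (t + u) - f t)"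
  unfolding continuous_within using D(4)[of "t + s"] s assms(2)
  by(intro tendsto_diff tendsto_const) (auto intro: filterlim_compose)
qed simp

lemma subordinator_path_stop:
 assumes "subordinator_path f" "0 <= t" shows "subordinator_path (stop_path t f)"
 unfolding subordinator_path_def stop_path_def
proof(intro conjI allI impI)
 note D = subordinator_pathD[OF assms(1)]
 show "f (min 0 t) = 0" using D(1) assms(2) by(simp add: min_def)
 show "mono_on {0..} (%u. f (min u t))" using D(2) assms(2) by(intro mono_onI) auto
 fix s :: real assume s: "0 <= s"
 show "continuous (at_right s) (%u. f (min u t))"
 proof(cases "s < t")
  case True
  hence "\<forall>\<^sub>F u in at_right s. f u = f (min u t)"
   by(intro eventually_at_rightI[of s t]) auto
  from tendsto_cong[OF this] True D(4)[OF s] show ?thesis by(simp add: continuous_within)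
 next
  case False
  hence "\<forall>\<^sub>F u in at_right s. f t = f (min u t)"
   by(intro eventually_at_rightI[of s "s + 1"]) auto
  from tendsto_cong[THEN iffD1, OF this tendsto_const] False show ?thesis by(auto simp: continuous_within min_def split: if_splits)
 qed
qed

lemma measurable_shift_path[measurable (raw)]:
 assumes [measurable]: "X:N ->M path_space" "v:Borel N"
  and nonneg: "!!x. x:space N ==> 0 <= v x"
 shows "(%x. shift_path (v x) (X x)):N ->M path_space"
proof(rule measurable_into_path_space)
 fix x assume "x:space N"
 thus "subordinator_path (shift_path (v x) (X x))"
  using measurable_space[OF assms(1)] nonneg by(intro subordinator_path_shift) (auto simp: space_path_space)
next
 fix t :: real assume "0 <= t"
 with nonneg show "(%x. shift_path (v x) (X x) t):Borel N"
  unfolding shift_path_def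
  by(intro borel_measurable_diff measurable_path_at[where X=X and v="%x. v x + t"] measurable_path_at[where X=X and v=v]) auto
qed

lemma measurable_stop_path[measurable (raw)]:
 assumes [measurable]: "X:N ->M path_space" and nonneg: "0 <= v"
 shows "(%x. stop_path v (X x)):N ->M path_space"
proof(rule measurable_into_path_space)
 fix x assume "x:space N"
 thus "subordinator_path (stop_path v (X x))"
  using measurable_space[OF assms(1)] nonneg by(intro subordinator_path_stop) (auto simp: space_path_space)
qed (use nonneg in \<open>simp add: stop_path_def measurable_eval_path[OF assms(1)]\<close>)

section \<open>Laplace functionals determine measures on path space\<close>

definition laplace_functional :: "real set => (real => nat) => (real => real) => ennreal" where
 "laplace_functional J n f = ennreal (exp (- (\<Sum>j\<in>J. real (n j) * f j)))"

lemma measurable_laplace_functional: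
 assumes J: "J \<subseteq> {0..}" shows "laplace_functional J n:Borel path_space"
 unfolding laplace_functional_def
 using J by(intro measurable_compose[OF _ measurable_ennreal] borel_measurable_exp borel_measurable_uminus
  borel_measurable_sum borel_measurable_times borel_measurable_const measurable_eval_path[of "%f. f"]
  measurable_compose[OF _ borel_measurable_exp]) auto

lemma laplace_functional_le_1:
 assumes "subordinator_path f" "J \<subseteq> {0..}" shows "laplace_functional J n f <= 1"
 unfolding laplace_functional_def using assms(2) subordinator_pathD(3)[OF assms(1)] by(auto intro!: sum_nonneg)

text \<open>Transforms at integer points determine the joint law at finitely many times, and the
  rectangles over finitely many times generate the sigma-algebra of
  \<open>path_space\<close>.\<close>

lemma measure_eqI_path_space:
 fixes P Q :: "(real => real) measure"
 assumes sets: "sets P = sets path_space" "sets Q = sets path_space"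
  and fin: "finite_measure P" "finite_measure Q"
  and eq: "!!J n. finite J ==> J \<subseteq> {0..} ==> (NINT f|P. laplace_functional J n f) = (NINT f|Q. laplace_functional J n f)"
 shows "P = Q"
proof -
 interpret P: finite_measure P by fact
 interpret Q: finite_measure Q by fact
 let ?Pi = "Pi\<^sub>M {0..} (%_. borel) :: (real => real) measure"
 let ?r = "%f :: real => real. restrict f {0..}"
 have [measurable_cong]: "sets P = sets path_space" "sets Q = sets path_space" by fact+
 note r[measurable] = measurable_restrict_path
 have sp: "space P = {f. subordinator_path f}" "space Q = {f. subordinator_path f}"
  using sets[THEN sets_eq_imp_space_eq] by(auto simp: space_path_space)
 have "distr P ?Pi ?r = distr Q ?Pi ?r"
 proof(rule measure_eqI_PiM_infinite)
  fix A :: "real => real set" and J :: "real set"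
  assume J: "finite J" "J \<subseteq> {0..}" and A: "!!i. i:J ==> A i:sets borel"
  have *: "emeasure (distr K ?Pi ?r) (prod_emb {0..} (%_. borel) J (Pi\<^sub>E J A)) = (NINT f|K. (\<Prod>j\<in>J. indicator (A j) (f j)) * 1)"
   if K: "sets K = sets path_space" for K
  proof -
   note [measurable_cong] = K
   have "emeasure (distr K ?Pi ?r) (prod_emb {0..} (%_. borel) J (Pi\<^sub>E J A)) =
    emeasure K (?r -` prod_emb {0..} (%_. borel) J (Pi\<^sub>E J A) \<inter> space K)"
    using J A by(intro emeasure_distr) (auto intro!: sets_PiM_I)
   also have "... = (NINT f|K. indicator (?r -` prod_emb {0..} (%_. borel) J (Pi\<^sub>E J A) \<inter> space K) f)"
    using J A by(intro nn_integral_indicator[symmetric] measurable_sets[of _ _ ?Pi]) (auto intro!: sets_PiM_I)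
   also have "... = (NINT f|K. (\<Prod>j\<in>J. indicator (A j) (f j)) * 1)"
   proof(intro nn_integral_cong)
    fix f assume f: "f:space K"
    have "f:?r -` prod_emb {0..} (%_. borel) J (Pi\<^sub>E J A) <-> (ALL j:J. f j:A j)"
     using J(2) by(auto simp: prod_emb_def PiE_iff extensional_def subset_eq)
    thus "indicator (?r -` prod_emb {0..} (%_. borel) J (Pi\<^sub>E J A) \<inter> space K) f = (\<Prod>j\<in>J. indicator (A j) (f j)) * (1::ennreal)"
     using f J(1) by(cases "ALL j:J. f j:A j") (auto simp: indicator_def prod_zero_iff)
   qed
   finally show ?thesis .
  qed
  show "emeasure (distr P ?Pi ?r) (prod_emb {0..} (%_. borel) J (Pi\<^sub>E J A)) = emeasure (distr Q ?Pi ?r) (prod_emb {0..} (%_. borel) J (Pi\<^sub>E J A))"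
   unfolding *[OF sets(1)] *[OF sets(2)]
  proof(rule laplace_rectangle_unique[OF J(1)])
   show "AE f in P. 0 <= f j" "AE f in Q. 0 <= f j" if "j:J" for j
    using that J(2) subordinator_pathD(3) by(auto simp: sp subset_eq intro: AE_I2)
   show "(NINT x|P. 1) < oo" "(NINT x|Q. 1) < oo" using P.emeasure_finite Q.emeasure_finite by(auto simp: less_top[symmetric])
     show "(%f. f j):Borel P" "(%f. f j):Borel Q" if "j:J" for j
    using that J(2) sets by(auto simp: subset_eq intro: measurable_eval_path[of "%f. f"] measurable_ident_sets)
  qed (use J A eq[unfolded laplace_functional_def] in auto)
 next
  show "finite_measure (distr P ?Pi ?r)" by(intro P.finite_measure_distr) simp
 qed auto
 note d = this
 show ?thesis
 proof(rule measure_eqI)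
  fix X assume "X:sets P"
  then obtain A where A: "A:sets ?Pi" "X = ?r -` A \<inter> {f. subordinator_path f}"
   unfolding sets path_space_def by(auto simp: sets_vimage_algebra2 space_PiM)
  have "emeasure P X = emeasure (distr P ?Pi ?r) A" "emeasure Q X = emeasure (distr Q ?Pi ?r) A"
   using A by(simp_all add: emeasure_distr sp)
  thus "emeasure P X = emeasure Q X" using d by simp
 qed (simp add: sets)
qed

section \<open>Processes with independent increments\<close>

lemma nn_integral_indicator_distr:
 assumes "f:M ->M N" "A:sets N"
 shows "(NINT x|M. indicator A (f x)) = emeasure (distr M N f) A"
 using assms by(subst nn_integral_indicator[symmetric]) (auto simp: nn_integral_distr simp del: nn_integral_indicator)

lemma nn_integral_scale_distr:
 assumes "f:M ->M N" "G:Borel N"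
 shows "(NINT x|(scale_measure c (distr M N f)). G x) = (NINT x|M. G (f x)) * c"
 using assms by(simp add: nn_integral_distr nn_integral_scale_measure mult.commute)

abbreviation (input) traj :: "(real => 'a => real) => 'a => real => real" where
 "traj Y w \<equiv> (%t. Y t w)"

lemma measure_eqI_rectangles:
 assumes sets: "sets P = sets (A >< B)" "sets R = sets (A >< B)" and fin: "finite_measure P"
  and eq: "!!X Y. X:sets A ==> Y:sets B ==> emeasure P (X \<times> Y) = emeasure R (X \<times> Y)"
 shows "P = R"
proof -
 interpret P: finite_measure P by fact
 show ?thesis
 proof(rule measure_eqI_generator_eq[OF Int_stable_pair_measure_generator[of A B]])
  show "{a \<times> b |a b. a:sets A & b:sets B} \<subseteq> Pow (space A \<times> space B)"
   by(rule pair_measure_closed)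
  show "sets P = sigma_sets (space A \<times> space B) {a \<times> b |a b. a:sets A & b:sets B}"
   "sets R = sigma_sets (space A \<times> space B) {a \<times> b |a b. a:sets A & b:sets B}"
   using sets by(simp_all add: sets_pair_measure)
  show "range (%_::nat. space A \<times> space B) \<subseteq> {a \<times> b |a b. a:sets A & b:sets B}" by auto
  show "emeasure P ((%_::nat. space A \<times> space B) i) ~= oo" for i using P.emeasure_finite by simp
 qed (use eq in auto)
qed

lemma finite_measure_distr_density:
 assumes M: "finite_measure M" and [measurable]: "Y:M ->M A" "e:Borel M" and le: "!!w. w:space M ==> e w <= 1"
 shows "finite_measure (distr (density M e) A Y)"
proof -
 have "(NINT w|M. e w) <= (NINT w|M. 1)" using le by(intro nn_integral_mono) auto
 hence "finite_measure (density M e)" using finite_measure.emeasure_finite[OF M, of "space M"]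
  by(intro finite_measure_density) (auto simp: less_top[symmetric] top_unique)
 thus ?thesis by(rule finite_measure.finite_measure_distr) simp
qed

text \<open>The form in which uniqueness on path space is applied: the weights hold all factors that
  stay fixed while the functional of the path is generalised.\<close>

lemma weighted_path_eqI:
 assumes M: "finite_measure M" and m: "Y:M ->M path_space" "Y':M ->M path_space" "e:Borel M" "e':Borel M"
  and le: "!!w. w:space M ==> e w <= 1" "!!w. w:space M ==> e' w <= 1"
  and eq: "!!J n. finite J ==> J \<subseteq> {0..} ==>
   (NINT w|M. laplace_functional J n (Y w) * e w) = (NINT w|M. laplace_functional J n (Y' w) * e' w)"
  and F: "F:Borel path_space"
 shows "(NINT w|M. F (Y w) * e w) = (NINT w|M. F (Y' w) * e' w)"
proof -
 note distr = nn_integral_distr_density[OF m(1,3)] nn_integral_distr_density[OF m(2,4)]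
 have "distr (density M e) path_space Y = distr (density M e') path_space Y'"
  by(rule measure_eqI_path_space)
   (auto simp: distr measurable_laplace_functional eq intro: finite_measure_distr_density[OF M] m le)
 from arg_cong[OF this, of "%K. nn_integral K F"] show ?thesis unfolding distr[OF F] .
qed

lemma weighted_rectangle_eqI:
 assumes M: "finite_measure M" "finite_measure M'" and m[measurable]: "X:M ->M A" "Y:M ->M B" "e:Borel M"
   "X':M' ->M A" "Y':M' ->M B" "e':Borel M'"
  and le: "!!w. w:space M ==> e w <= 1" "!!w. w:space M' ==> e' w <= 1"
  and eq: "!!C D. C:sets A ==> D:sets B ==>
   (NINT w|M. indicator C (X w) * indicator D (Y w) * e w) = (NINT w|M'. indicator C (X' w) * indicator D (Y' w) * e' w)"
  and f: "f:Borel (A >< B)"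
 shows "(NINT w|M. f (X w, Y w) * e w) = (NINT w|M'. f (X' w, Y' w) * e' w)"
proof -
 let ?L = "distr (density M e) (A >< B) (%w. (X w, Y w))" and ?R = "distr (density M' e') (A >< B) (%w. (X' w, Y' w))"
 have XY: "(%w. (X w, Y w)):M ->M A >< B" "(%w. (X' w, Y' w)):M' ->M A >< B" by measurable
 note distr = nn_integral_distr_density[OF XY(1) m(3)] nn_integral_distr_density[OF XY(2) m(6)]
 have "?L = ?R"
 proof(rule measure_eqI_rectangles)
  show "finite_measure ?L" by(rule finite_measure_distr_density[OF M(1) XY(1) m(3) le(1)])
  fix C D assume CD: "C:sets A" "D:sets B"
  hence "indicator (C \<times> D):Borel (A >< B)" by simp
  from distr[OF this] have "(NINT z|?L. indicator (C \<times> D) z) = (NINT z|?R. indicator (C \<times> D) z)"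
   using eq[OF CD] by(simp add: indicator_times)
  thus "emeasure ?L (C \<times> D) = emeasure ?R (C \<times> D)" using CD by simp
 qed auto
 from arg_cong[OF this, of "%K. nn_integral K f"] show ?thesis unfolding distr[OF f] .
qed

lemma driftless_subordinatorD:
 assumes "driftless_subordinator M nu X"
 shows "prob_space M" "levy_measure nu" "!!t. 0 <= t ==> X t:Borel M"
  "!!w. w:space M ==> subordinator_path (traj X w)"
  "!!(n::nat) u. 0 <= u 0 ==> mono u ==>
   prob_space.indep_vars M (%_. borel) (%i w. X (u (Suc i)) w - X (u i) w) {..<n}"
  "!!s h. 0 <= s ==> 0 <= h ==> distr M borel (%w. X (s + h) w - X s w) = distr M borel (X h)"
  "!!t th. 0 <= t ==> 0 <= th ==> prob_space.expectation M (%w. exp (- th * X t w)) =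
    exp (- t * (\<integral>x. 1 - exp (- th * x) \<partial>nu))"
 using assms unfolding driftless_subordinator_def subordinator_path_def by blast+

lemma driftless_subordinator_measurable_path:
 assumes "driftless_subordinator M nu X"
 shows "(%w. traj X w):M ->M path_space"
 by(rule measurable_into_path_space) (use driftless_subordinatorD(3,4)[OF assms] in auto)

context
 fixes M :: "'a measure" and nu X
 assumes X: "driftless_subordinator M nu X"
begin

interpretation prob_space M by(rule driftless_subordinatorD[OF X])

lemma subordinator_increments_laplace:
 fixes u :: "nat => real"
 assumes u: "mono u" "0 <= u 0"
 shows "(NINT w|M. ennreal (exp (- (\<Sum>i<N. a i * (X (u (Suc i)) w - X (u i) w))))) =
  (\<Prod>i<N. (NINT w|M. ennreal (exp (- a i * X (u (Suc i) - u i) w))))"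
proof -
 note D = driftless_subordinatorD[OF X]
 have u0: "0 <= u i" "u i <= u (Suc i)" for i using u monoD[OF u(1), of 0 i] monoD[OF u(1), of i "Suc i"] by auto
 have [measurable]: "X (u i):Borel M" "X (u (Suc i) - u i):Borel M" for i using u0[of i] by(auto intro: D(3))
 have inc: "(NINT w|M. ennreal (exp (- a i * (X (u (Suc i)) w - X (u i) w)))) = (NINT w|M. ennreal (exp (- a i * X (u (Suc i) - u i) w)))" for i
 proof -
  have "distr M borel (%w. X (u (Suc i)) w - X (u i) w) = distr M borel (X (u (Suc i) - u i))"
   using D(6)[of "u i" "u (Suc i) - u i"] u0[of i] by simp
  from arg_cong[OF this, of "%K. (NINT x|K. ennreal (exp (- a i * x)))"] show ?thesis by(simp add: nn_integral_distr)
 qed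
 have "(NINT w|M. ennreal (exp (- (\<Sum>i<N. a i * (X (u (Suc i)) w - X (u i) w))))) =
   (NINT w|M. (\<Prod>i<N. ennreal (exp (- a i * (X (u (Suc i)) w - X (u i) w)))))"
  by(simp add: exp_sum sum_negf[symmetric] prod_ennreal)
 also have "... = (\<Prod>i<N. (NINT w|M. ennreal (exp (- a i * (X (u (Suc i)) w - X (u i) w)))))"
  by(intro indep_vars_nn_integral indep_vars_compose2[OF D(5)[OF u(2,1)]]) auto
 finally show ?thesis unfolding inc .
qed

text \<open>Cutting off at \<open>u N\<close> makes the claim inductive in \<open>N\<close>. Cells
  are selected by the values of their endpoints and not by their indices, so repeated grid points do
  no harm: their increments are 0.\<close>

lemma grid_telescope:
 fixes u :: "nat => real" and f :: "real => real"
 assumes u: "mono u" and xy: "u p <= u q"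
 shows "(\<Sum>i<N. of_bool (u p <= u i & u (Suc i) <= u q) * (f (u (Suc i)) - f (u i))) = f (max (u p) (min (u q) (u N))) - f (u p)"
proof(induction N)
 case 0
 thus ?case using monoD[OF u, of 0 p] xy by(auto simp: max_def min_def intro!: arg_cong[where f=f])
next
 case (Suc N)
 have le: "i <= j ==> u i <= u j" for i j using monoD[OF u] .
 have "u N <= u (Suc N)" "u p <= u N \<or> u (Suc N) <= u p" "u q <= u N \<or> u (Suc N) <= u q"
  using le[of p N] le[of "Suc N" p] le[of q N] le[of "Suc N" q] le[of N "Suc N"] not_less_eq_eq by auto
 thus ?case using Suc xy by(auto simp: max_def min_def)
qed

text \<open>
  On a common grid, both functionals are weighted sums of increments. No increment has a
  positive weight in both, except for increments over intervals of length zero.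
\<close>
lemma subordinator_stop_shift_laplace:
 assumes s: "0 <= s" and J: "finite J" "J \<subseteq> {0..}" and K: "finite K" "K \<subseteq> {0..}"
 shows "(NINT w|M. laplace_functional J n (stop_path s (traj X w)) * laplace_functional K m (shift_path s (traj X w))) =
  (NINT w|M. laplace_functional J n (stop_path s (traj X w))) * (NINT w|M. laplace_functional K m (traj X w))"
proof -
 note D = driftless_subordinatorD[OF X]
 \<comment> \<open>All times at which one of the two functionals looks at the path: the stopped path
   is read at \<open>min j s\<close>, the shifted one at \<open>s\<close> and
   \<open>s + k\<close>.\<close>
 define T where "T = insert 0 (insert s ((%j. min j s) ` J \<union> (%k. s + k) ` K))"
 have T: "finite T" "T ~= {}" "0 <= t \<or> t \<notin> T" for t using J K s by(auto simp: T_def)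
 define xs where "xs = sorted_list_of_set T"
 define N where "N = length xs - 1"
 \<comment> \<open>Constant beyond \<open>N\<close>, because independence of increments is assumed
   for monotone sequences indexed by all naturals.\<close>
 define u where "u i = xs ! min i N" for i
 have xs: "set xs = T" "sorted xs" "length xs = Suc N" using T(1,2) card_gt_0_iff[of T] by(auto simp: xs_def N_def simp del: card_gt_0_iff)
 have u: "mono u" using xs(2,3) by(auto simp: u_def mono_def intro!: sorted_nth_mono)
 have uT: "u i:T" for i using xs by(auto simp: u_def)
 have grid: "EX p. t = u p & t <= u N" if t: "t:T" for t
 proof -
  obtain p where p: "p <= N" "xs ! p = t"
   using t xs(3) unfolding xs(1)[symmetric] in_set_conv_nth by(auto simp: less_Suc_eq_le)
  hence "t = u p" by(simp add: u_def)
  thus ?thesis using monoD[OF u p(1)] by blast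
 qed
 have tele: "(\<Sum>i<N. of_bool (x <= u i & u (Suc i) <= y) * (f (u (Suc i)) - f (u i))) = f y - f x"
  if xy: "x:T" "y:T" "x <= y" for x y and f :: "real => real"
 proof -
  obtain p q where "x = u p" "y = u q" "y <= u N" using grid[OF xy(1)] grid[OF xy(2)] by blast
  thus ?thesis using grid_telescope[OF u, of p q f N] xy(3) by simp
 qed
 have u0: "0 <= u i" for i using uT T by auto
 define a where "a i = (\<Sum>j\<in>J. real (n j) * of_bool (0 <= u i & u (Suc i) <= min j s))" for i
 define b where "b i = (\<Sum>k\<in>K. real (m k) * of_bool (s <= u i & u (Suc i) <= s + k))" for i
 define P where "P c h = (NINT w|M. ennreal (exp (- c * X h w)))" for c h
 have P0: "P 0 h = 1" "P c 0 = 1" for c h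
  using subordinator_pathD(1)[OF D(4)] by(simp_all add: P_def emeasure_space_1 cong: nn_integral_cong_simp)
 have swap: "(\<Sum>i<N. (\<Sum>j\<in>I. real (n j) * of_bool (Q i j)) * g i) = (\<Sum>j\<in>I. real (n j) * (\<Sum>i<N. of_bool (Q i j) * g i))" for I n Q and g :: "nat => real"
  unfolding sum_distrib_left sum_distrib_right by(subst sum.swap) (simp add: mult.assoc)
 have A: "(\<Sum>i<N. a i * (X (u (Suc i)) w - X (u i) w)) = (\<Sum>j\<in>J. real (n j) * stop_path s (traj X w) j)" if "w:space M" for w
  unfolding a_def swap using s J(2) subordinator_pathD(1)[OF D(4)[OF that]]
  by(intro sum.cong refl arg_cong2[where f="(*)"]) (subst tele, auto simp: T_def stop_path_def)
 have B: "(\<Sum>i<N. b i * (f (u (Suc i)) - f (u i))) = (\<Sum>k\<in>K. real (m k) * (f (s + k) - f s))" for f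
  unfolding b_def swap using s K(2)
  by(intro sum.cong refl arg_cong2[where f="(*)"]) (subst tele, auto simp: T_def)
 have "(NINT w|M. laplace_functional J n (stop_path s (traj X w)) * laplace_functional K m (shift_path s (traj X w))) =
   (NINT w|M. ennreal (exp (- (\<Sum>i<N. (a i + b i) * (X (u (Suc i)) w - X (u i) w)))))"
  by(intro nn_integral_cong) (simp add: laplace_functional_def shift_path_def A B[of "%t. X t _"] distrib_right sum.distrib exp_add[symmetric] ennreal_mult'[symmetric])
 also have "... = (\<Prod>i<N. P (a i + b i) (u (Suc i) - u i))"
  unfolding P_def by(rule subordinator_increments_laplace[OF u u0])
 also have "... = (\<Prod>i<N. P (a i) (u (Suc i) - u i)) * (\<Prod>i<N. P (b i) (u (Suc i) - u i))"
  unfolding prod.distrib[symmetric]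
 proof(rule prod.cong[OF refl])
  fix i
  have "a i = 0 \<or> u (Suc i) <= s" by(cases "u (Suc i) <= s") (auto simp: a_def)
  moreover have "b i = 0 \<or> s <= u i" by(cases "s <= u i") (auto simp: b_def)
  ultimately have "a i = 0 \<or> b i = 0 \<or> u (Suc i) = u i" using monoD[OF u, of i "Suc i"] by auto
  thus "P (a i + b i) (u (Suc i) - u i) = P (a i) (u (Suc i) - u i) * P (b i) (u (Suc i) - u i)"
   by(auto simp: P0)
 qed
 also have "(\<Prod>i<N. P (a i) (u (Suc i) - u i)) = (NINT w|M. laplace_functional J n (stop_path s (traj X w)))"
  unfolding P_def subordinator_increments_laplace[OF u u0, symmetric]
  by(intro nn_integral_cong) (simp add: A laplace_functional_def)
 \<comment> \<open>Translation of the grid by \<open>s\<close>, with everything before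
   \<open>s\<close> collapsed to 0. Cells that collapse carry the weight \<open>b i = 0\<close>, so
   the product now belongs to the unshifted path.\<close>
 also have "(\<Prod>i<N. P (b i) (u (Suc i) - u i)) = (\<Prod>i<N. P (b i) (max 0 (u (Suc i) - s) - max 0 (u i - s)))"
 proof(rule prod.cong[OF refl])
  fix i
  have "b i = 0 \<or> s <= u i" by(cases "s <= u i") (auto simp: b_def)
  thus "P (b i) (u (Suc i) - u i) = P (b i) (max 0 (u (Suc i) - s) - max 0 (u i - s))"
   using monoD[OF u, of i "Suc i"] by(auto simp: P0 max_def)
 qed
 also have "... = (NINT w|M. ennreal (exp (- (\<Sum>i<N. b i * (X (max 0 (u (Suc i) - s)) w - X (max 0 (u i - s)) w)))))"
  unfolding P_def
  by(intro subordinator_increments_laplace[symmetric, of "%i. max 0 (u i - s)"] monoI max.mono diff_right_mono monoD[OF u]) auto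
 also have "... = (NINT w|M. laplace_functional K m (traj X w))"
  using K(2) subordinator_pathD(1)[OF D(4)] B[of "%t. X (max 0 (t - s)) _"]
  by(intro nn_integral_cong) (auto simp: laplace_functional_def max_def subset_eq intro!: sum.cong)
 finally show ?thesis .
qed

text \<open>Uniqueness is used twice: with a Laplace functional of the shifted path fixed, the
  functional of the stopped path is replaced by \<open>F\<close>; then, with \<open>F\<close> as the
  weight, the functional of the shifted path is replaced by \<open>Phi\<close>.\<close>

lemma subordinator_stop_shift:
 assumes F: "F:Borel path_space" and F1: "!!x. F x <= 1" and s: "0 <= s"
  and Phi: "Phi:Borel path_space"
 shows "(NINT w|M. F (stop_path s (traj X w)) * Phi (shift_path s (traj X w))) =
  (NINT w|M. F (stop_path s (traj X w))) * (NINT w|M. Phi (traj X w))"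
proof -
 note D = driftless_subordinatorD[OF X]
 note Xp[measurable] = driftless_subordinator_measurable_path[OF X]
 have st: "(%w. stop_path s (traj X w)):M ->M path_space"
  using s by(intro measurable_stop_path) auto
 have sh: "(%w. shift_path s (traj X w)):M ->M path_space"
  using s by(intro measurable_shift_path[of _ _ "%_. s"]) auto
 define c where "c = (NINT w|M. F (stop_path s (traj X w)))"
 have "c <= (NINT w|M. 1)" unfolding c_def using F1 by(intro nn_integral_mono) auto
 hence c1: "c <= 1" by(simp add: emeasure_space_1)
 have "(NINT w|M. Phi (shift_path s (traj X w)) * F (stop_path s (traj X w))) = (NINT w|M. Phi (traj X w) * c)"
 proof(rule weighted_path_eqI[OF finite_measure_axioms sh Xp measurable_compose[OF st F] _ F1 c1 _ Phi])
  fix K :: "real set" and m assume K: "finite K" "K \<subseteq> {0..}"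
  note lf = measurable_laplace_functional[OF K(2), of m]
  define d where "d = (NINT w|M. laplace_functional K m (traj X w))"
  have le: "laplace_functional K m (shift_path s (traj X w)) <= 1" "laplace_functional K m (traj X w) <= 1" if "w:space M" for w
   using s K(2) D(4)[OF that] by(auto intro!: laplace_functional_le_1 subordinator_path_shift)
  have "d <= (NINT w|M. 1)" unfolding d_def by(intro nn_integral_mono le)
  hence d1: "d <= 1" by(simp add: emeasure_space_1)
  have "(NINT w|M. F (stop_path s (traj X w)) * laplace_functional K m (shift_path s (traj X w))) =
    (NINT w|M. F (stop_path s (traj X w)) * d)"
  proof(rule weighted_path_eqI[OF finite_measure_axioms st st measurable_compose[OF sh lf] _ le(1) d1 _ F])
   fix J :: "real set" and n assume J: "finite J" "J \<subseteq> {0..}"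
   thus "(NINT w|M. laplace_functional J n (stop_path s (traj X w)) * laplace_functional K m (shift_path s (traj X w))) =
     (NINT w|M. laplace_functional J n (stop_path s (traj X w)) * d)"
    using subordinator_stop_shift_laplace[OF s J K, of n m] measurable_compose[OF st measurable_laplace_functional[OF J(2), of n]]
    by(simp add: nn_integral_multc d_def)
  qed auto
  thus "(NINT w|M. laplace_functional K m (shift_path s (traj X w)) * F (stop_path s (traj X w))) = (NINT w|M. laplace_functional K m (traj X w) * c)"
   using measurable_compose[OF st F] measurable_compose[OF Xp lf] by(simp add: nn_integral_multc c_def d_def mult.commute)
 qed auto
 thus ?thesis using measurable_compose[OF Xp Phi] by(simp add: nn_integral_multc c_def mult.commute)
qed

end

section \<open>Independence, and regeneration at fixed times\<close>

text \<open>Expressed through the joint law, since the two variables have values of different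
  types.\<close>

definition indep_pair :: "'a measure => 'b measure => ('a => 'b) => 'c measure => ('a => 'c) => bool" where
 "indep_pair M A X B Y <-> X:M ->M A & Y:M ->M B &
   distr M (A >< B) (%w. (X w, Y w)) = distr M A X >< distr M B Y"

lemma indep_pairD:
 assumes "indep_pair M A X B Y"
 shows "X:M ->M A" "Y:M ->M B" "distr M (A >< B) (%w. (X w, Y w)) = distr M A X >< distr M B Y"
 using assms by(auto simp: indep_pair_def)

lemma (in prob_space) indep_pair_nn_integral:
 assumes ind: "indep_pair M A X B Y" and f[measurable]: "f:Borel (A >< B)"
 shows "(NINT w|M. f (X w, Y w)) = (NINT w|M. NINT w'|M. f (X w, Y w'))"
proof -
 note D = indep_pairD[OF ind] note [measurable] = D(1,2)
 interpret Y: prob_space "distr M B Y" by(rule prob_space_distr) simp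
 have "(NINT w|M. f (X w, Y w)) = (NINT z|(distr M (A >< B) (%w. (X w, Y w))). f z)"
  by(subst nn_integral_distr) auto
 also have "... = (NINT x|(distr M A X). NINT y|(distr M B Y). f (x, y))"
  unfolding D(3) by(rule Y.nn_integral_fst[symmetric]) simp
 also have "... = (NINT w|M. NINT y|(distr M B Y). f (X w, y))"
  by(rule nn_integral_distr) (auto intro!: Y.borel_measurable_nn_integral_fst)
 also have "... = (NINT w|M. NINT w'|M. f (X w, Y w'))"
 proof(intro nn_integral_cong)
  fix w assume "w:space M"
  hence [measurable]: "X w:space A" using measurable_space[OF D(1)] by simp
  show "(NINT y|(distr M B Y). f (X w, y)) = (NINT w'|M. f (X w, Y w'))"
   by(subst nn_integral_distr) auto
 qed
 finally show ?thesis .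
qed

lemma (in prob_space) indep_pair_compose:
 assumes "indep_var A X B Y" and f[measurable]: "f:A ->M A'" and g[measurable]: "g:B ->M B'"
 shows "indep_pair M A' (%w. f (X w)) B' (%w. g (Y w))"
proof -
 have XY[measurable]: "X:M ->M A" "Y:M ->M B"
  and eq: "distr M (A >< B) (%w. (X w, Y w)) = distr M A X >< distr M B Y"
  using assms(1) unfolding indep_var_distribution_eq by auto
 interpret Y: prob_space "distr M B' (%w. g (Y w))" by(rule prob_space_distr) simp
 have "distr M A' (%w. f (X w)) >< distr M B' (%w. g (Y w)) = distr (distr M A X) A' f >< distr (distr M B Y) B' g"
  by(simp add: distr_distr comp_def)
 also have "... = distr (distr M A X >< distr M B Y) (A' >< B') (%(x, y). (f x, g y))"
  by(rule pair_measure_distr) (simp_all add: distr_distr comp_def Y.sigma_finite_measure_axioms)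
 also have "... = distr M (A' >< B') (%w. (f (X w), g (Y w)))"
  unfolding eq[symmetric] by(simp add: distr_distr comp_def)
 finally show ?thesis by(simp add: indep_pair_def)
qed

text \<open>\<open>W\<close> collects the processes that are independent of \<open>X\<close>, so
  that stopping times may depend on them without restriction. Regeneration is demanded at
  deterministic times only; \<open>strong_markov\<close> lifts it to random ones.\<close>

locale regenerative = prob_space M for M :: "'a measure" +
 fixes W :: "'a => 'w" and EW :: "'w measure" and X :: "'a => real => real"
 assumes W[measurable]: "W:M ->M EW" and X[measurable]: "X:M ->M path_space"
  and regen: "!!s A D. 0 <= s ==> A:sets (EW >< path_space) ==> D:sets path_space ==>
   (NINT w|M. indicator A (W w, stop_path s (X w)) * indicator D (shift_path s (X w))) =
   (NINT w|M. indicator A (W w, stop_path s (X w))) * (NINT w|M. indicator D (X w))"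

text \<open>On rectangles in \<open>EW >< path_space\<close> the independence of \<open>W\<close>
  permits freezing it, and \<open>subordinator_stop_shift\<close> separates the path before
  \<open>s\<close> from the path after \<open>s\<close>.\<close>

lemma regenerativeI:
 assumes X: "driftless_subordinator M nu X"
  and ind: "indep_pair M EW W path_space (%w. traj X w)"
 shows "regenerative M W EW (%w. traj X w)"
proof -
 note D = driftless_subordinatorD[OF X]
 interpret prob_space M by(rule D)
 have W[measurable]: "W:M ->M EW" and Xp[measurable]: "(%w. traj X w):M ->M path_space"
  using ind by(auto dest: indep_pairD)
 show ?thesis
 proof
  fix s :: real and A D assume s: "0 <= s" and A: "A:sets (EW >< path_space)" and D[measurable]: "D:sets path_space"
  have idm[measurable]: "stop_path s:path_space ->M path_space" "shift_path s:path_space ->M path_space"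
   using s measurable_stop_path[of "%f. f" path_space s] measurable_shift_path[of "%f. f" path_space "%_. s"] by auto
  define e where "e w = (indicator D (shift_path s (traj X w)) :: ennreal)" for w
  define c where "c = (NINT w|M. indicator D (traj X w))"
  have [measurable]: "e:Borel M" unfolding e_def by measurable
  have c1: "c <= 1"
   using nn_integral_mono[of M "%w. indicator D (traj X w)" "%_. 1"] emeasure_space_1
   by(simp add: c_def indicator_def cong: if_cong)
  have "(NINT w|M. indicator A (W w, stop_path s (traj X w)) * e w) = (NINT w|M. indicator A (W w, stop_path s (traj X w)) * c)"
  proof(rule weighted_rectangle_eqI[where A=EW and B=path_space])
   fix B C assume [measurable]: "B:sets EW" "C:sets path_space"
   define f where "f z = indicator B (fst z) * (indicator C (stop_path s (snd z)) * indicator D (shift_path s (snd z)) :: ennreal)" for z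
   define g where "g z = indicator B (fst z) * (indicator C (stop_path s (snd z)) :: ennreal)" for z
   have fg: "f:Borel (EW >< path_space)" "g:Borel (EW >< path_space)"
    unfolding f_def g_def by measurable
   have "(NINT w'|M. indicator C (stop_path s (traj X w')) * indicator D (shift_path s (traj X w'))) = (NINT w'|M. indicator C (stop_path s (traj X w'))) * c"
    unfolding c_def by(rule subordinator_stop_shift[OF X _ _ s]) (auto simp: indicator_def)
   hence "(NINT w|M. f (W w, traj X w)) = (NINT w|M. g (W w, traj X w)) * c"
    unfolding indep_pair_nn_integral[OF ind fg(1)] indep_pair_nn_integral[OF ind fg(2)]
    by(simp add: f_def g_def nn_integral_cmult nn_integral_multc mult.assoc)
   thus "(NINT w|M. indicator B (W w) * indicator C (stop_path s (traj X w)) * e w) = (NINT w|M. indicator B (W w) * indicator C (stop_path s (traj X w)) * c)"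
    by(simp add: nn_integral_multc) (simp add: f_def g_def e_def mult.assoc)
  qed (use A c1 in \<open>auto simp: e_def indicator_def finite_measure_axioms\<close>)
  thus "(NINT w|M. indicator A (W w, stop_path s (traj X w)) * indicator D (shift_path s (traj X w))) =
   (NINT w|M. indicator A (W w, stop_path s (traj X w))) * (NINT w|M. indicator D (traj X w))"
   using A by(simp add: nn_integral_multc) (simp add: e_def c_def)
 qed (use W Xp in auto)
qed

lemma (in prob_space) nn_integral_split_nat:
 fixes k :: "'a => nat"
 assumes [measurable]: "f:Borel M" "k:M ->M count_space UNIV"
 shows "(NINT w|M. f w) = (\<Sum>l. (NINT w|M. f w * indicator {w. k w = l} w))"
proof -
 have "(\<Sum>l. f w * indicator {w. k w = l} w) = (\<Sum>l\<in>{k w}. f w * indicator {w. k w = l} w)" for w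
  by(rule suminf_finite) (auto simp: indicator_def)
 thus ?thesis by(subst nn_integral_suminf[symmetric]) auto
qed

context regenerative
begin

lemma path_X: "w:space M ==> subordinator_path (X w)"
 using measurable_space[OF X] by(simp add: space_path_space)

lemma regen_function:
 assumes s: "0 <= s" and A[measurable]: "A:sets (EW >< path_space)" and f: "f:Borel path_space"
 shows "(NINT w|M. indicator A (W w, stop_path s (X w)) * f (shift_path s (X w))) =
   (NINT w|M. indicator A (W w, stop_path s (X w))) * (NINT w|M. f (X w))"
proof -
 have [measurable]: "(%w. stop_path s (X w)):M ->M path_space"
  using s by(intro measurable_stop_path) auto
 have sh: "(%w. shift_path s (X w)):M ->M path_space"
  using s by(intro measurable_shift_path[of _ _ "%_. s"]) auto
 define e where "e w = (indicator A (W w, stop_path s (X w)) :: ennreal)" for w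
 have e: "e:Borel M" unfolding e_def by measurable
 have "distr (density M e) path_space (%w. shift_path s (X w)) = scale_measure (NINT w|M. e w) (distr M path_space X)"
  (is "?L = ?R")
 proof(rule measure_eqI)
  fix D assume "D:sets ?L"
  hence D: "D:sets path_space" by simp
  hence m: "indicator D:Borel path_space" by simp
  show "emeasure ?L D = emeasure ?R D"
   using regen[OF s A D] nn_integral_distr_density[OF sh e m] nn_integral_indicator_distr[OF X D] D
   by(simp add: e_def mult.commute)
 qed simp
 from arg_cong[OF this, of "%K. nn_integral K f"]
 show ?thesis unfolding nn_integral_distr_density[OF sh e f] nn_integral_scale_distr[OF X f]
  unfolding e_def by(simp only: mult.commute)
qed

text \<open>
  The time \<open>\<tau>\<close> and the mark \<open>\<Gamma>\<close> do not anticipate: whether \<open>\<tau> < s\<close>, and the values then, can be read off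
  the path stopped at \<open>s\<close>. The strong Markov property follows by approximating \<open>\<tau>\<close> from the right
  by dyadic times, for which only countably many deterministic times matter.
\<close>
theorem strong_markov:
 fixes tau :: "'w \<times> (real => real) => ereal" and Ga :: "'w \<times> (real => real) => 'e"
 assumes tau[measurable]: "tau:Borel (EW >< path_space)"
  and Ga[measurable]: "Ga:EW >< path_space ->M E"
  and pos: "!!v x. v:space EW ==> subordinator_path x ==> 0 <= tau (v, x)"
  and nonant: "!!v x s. v:space EW ==> subordinator_path x ==> 0 < s ==>
   tau (v, x) < ereal s \<or> tau (v, stop_path s x) < ereal s ==>
   tau (v, stop_path s x) = tau (v, x) & Ga (v, stop_path s x) = Ga (v, x)"
  and Psi[measurable]: "Psi:Borel (E >< path_space)"
 shows "(NINT w|M. indicator {w. tau (W w, X w) < oo} w *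
    Psi (Ga (W w, X w), shift_path (real_of_ereal (tau (W w, X w))) (X w))) =
  (NINT w|M. indicator {w. tau (W w, X w) < oo} w * (NINT w'|M. Psi (Ga (W w, X w), X w')))"
proof -
 define T where "T w = tau (W w, X w)" for w
 define G where "G w = Ga (W w, X w)" for w
 have [measurable]: "T:Borel M" "G:M ->M E" unfolding T_def G_def by measurable
 have T0: "0 <= T w" if "w:space M" for w
  using that measurable_space[OF W] path_X pos by(auto simp: T_def)
 define R where "R w = max 0 (real_of_ereal (T w))" for w
 have [measurable]: "R:Borel M" unfolding R_def by measurable
 have R0: "0 <= R w" for w by(simp add: R_def)
 have R: "T w = ereal (R w)" if "w:space M" "T w < oo" for w
  using T0[OF that(1)] that(2) by(cases "T w") (auto simp: R_def)
 have R': "real_of_ereal (T w) = R w" if "w:space M" for w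
  using T0[OF that] by(cases "T w") (auto simp: R_def)
 have sh[measurable]: "(%w. shift_path (R w) (X w)):M ->M path_space"
  by(intro measurable_shift_path) (auto simp: R_def)
 define i where "i B w = (indicator {w. T w < oo & G w:B} w :: ennreal)" for B w
 have i1: "i B w <= 1" for B w by(simp add: i_def indicator_def)
 have main: "(NINT w|M. f (shift_path (R w) (X w)) * i B w) = (NINT w|M. f (X w) * (NINT w|M. i B w))"
  if B[measurable]: "B:sets E" and f: "f:Borel path_space" for B f
 proof(rule weighted_path_eqI[OF finite_measure_axioms sh X _ _ i1 _ _ f])
  show i[measurable]: "i B:Borel M" unfolding i_def
   by(auto intro!: borel_measurable_indicator')
  define c where "c = (NINT w|M. i B w)"
  have "c <= (NINT w|M. 1)" unfolding c_def by(intro nn_integral_mono i1)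
  thus "(NINT w|M. i B w) <= 1" by(simp add: emeasure_space_1 c_def)
  fix J :: "real set" and n assume J: "finite J" "J \<subseteq> {0..}"
  define e where "e = laplace_functional J n"
  have e[measurable]: "e:Borel path_space" unfolding e_def by(rule measurable_laplace_functional[OF J(2)])
  define Rn where "Rn m w = dyadic_above m (R w)" for m w
  have Rn0: "0 <= Rn m w" for m w
   using dyadic_above_bounds(1)[of "R w" m] R0[of w] by(simp add: Rn_def)
  have [measurable]: "Rn m:Borel M" for m unfolding Rn_def dyadic_above_def by measurable
  have [measurable]: "(%w. shift_path (Rn m w) (X w)):M ->M path_space" for m
   by(intro measurable_shift_path) (auto simp: Rn0)
  define a where "a = (NINT w|M. e (X w))"
  have step: "(NINT w|M. i B w * e (shift_path (Rn m w) (X w))) = c * a" for m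
  proof -
   define k where "k w = nat \<lfloor>2 ^ m * R w\<rfloor>" for w
   have [measurable]: "k:M ->M count_space UNIV" unfolding k_def by measurable
   have Rnk: "Rn m w = (real (k w) + 1) / 2 ^ m" for w
    using R0[of w] by(simp add: Rn_def dyadic_above_def k_def)
   define s where "s l = (real l + 1) / 2 ^ m" for l
   have s: "0 < s l" for l by(simp add: s_def add_nonneg_pos)
   \<comment> \<open>The dyadic approximation of the time equals \<open>s l\<close> when the time
     lies in the \<open>l\<close>-th cell. This event is decided by the path stopped at
     \<open>s l\<close>, the right end of the cell, so regeneration at the fixed time
     \<open>s l\<close> applies.\<close>
   define A where "A l = {z:space (EW >< path_space). tau z < ereal (s l) &
     nat \<lfloor>2 ^ m * max 0 (real_of_ereal (tau z))\<rfloor> = l & Ga z:B}" for l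
   have [measurable]: "A l:sets (EW >< path_space)" for l unfolding A_def by measurable
   have iA: "i B w * indicator {w. k w = l} w = indicator (A l) (W w, stop_path (s l) (X w))" if w: "w:space M" for w l
   proof -
    have v: "W w:space EW" using w measurable_space[OF W] by simp
    note x = path_X[OF w]
    have sp: "(W w, stop_path (s l) (X w)):space (EW >< path_space)"
     using v subordinator_path_stop[OF x] s[of l] by(auto simp: space_pair_measure space_path_space)
    note na = nonant[OF v x s[of l]]
    show ?thesis
    proof(cases "T w < ereal (s l)")
     case True
     hence *: "tau (W w, stop_path (s l) (X w)) = T w" "Ga (W w, stop_path (s l) (X w)) = G w"
      using na by(auto simp: T_def G_def)
     have "T w < oo" using True by(metis ereal_infty_less(1) less_trans order_less_imp_not_eq2)
     thus ?thesis using sp True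
      by(auto simp: A_def * i_def k_def R_def indicator_def)
    next
     case False
     hence "~ tau (W w, stop_path (s l) (X w)) < ereal (s l)" using na by(auto simp: T_def)
     moreover have "k w ~= l" if "T w < oo"
     proof
      assume "k w = l"
      hence "R w < s l" using dyadic_above_bounds(1)[of "R w" m] Rnk[of w] by(simp add: Rn_def s_def)
      thus False using False R[OF w that] by simp
     qed
     ultimately show ?thesis by(auto simp: A_def i_def indicator_def)
    qed
   qed
   have "(NINT w|M. i B w * e (shift_path (Rn m w) (X w)) * indicator {w. k w = l} w) = (NINT w|M. i B w * indicator {w. k w = l} w) * a" for l
   proof -
    have "(NINT w|M. i B w * e (shift_path (Rn m w) (X w)) * indicator {w. k w = l} w) =
     (NINT w|M. indicator (A l) (W w, stop_path (s l) (X w)) * e (shift_path (s l) (X w)))"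
    proof(rule nn_integral_cong, goal_cases)
     case (1 w)
     thus ?case using iA[of w l, symmetric] by(cases "k w = l") (simp_all add: Rnk s_def)
    qed
    also have "... = (NINT w|M. indicator (A l) (W w, stop_path (s l) (X w))) * a"
     unfolding a_def by(rule regen_function) (use s[of l] in auto)
    finally show ?thesis by(simp add: iA cong: nn_integral_cong_simp)
   qed
   hence "(NINT w|M. i B w * e (shift_path (Rn m w) (X w))) = (\<Sum>l. (NINT w|M. i B w * indicator {w. k w = l} w) * a)"
    by(subst nn_integral_split_nat[where k=k]) auto
   also have "... = c * a" unfolding c_def by(subst nn_integral_split_nat[where k=k]) auto
   finally show ?thesis .
  qed
  \<comment> \<open>A Laplace functional is continuous in finitely many path values, so
    right-continuity of the path carries the identity from \<open>Rn m w\<close> to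
    \<open>R w\<close>.\<close>
  have "(%m. (NINT w|M. i B w * e (shift_path (Rn m w) (X w)))) ----> (NINT w|M. i B w * e (shift_path (R w) (X w)))"
  proof(rule nn_integral_dominated_convergence[where w="%_. 1"])
   show "AE w in M. i B w * e (shift_path (Rn m w) (X w)) <= 1" for m
    using J(2) by(intro AE_I2 mult_le_one i1) (auto simp: e_def intro!: laplace_functional_le_1 subordinator_path_shift path_X Rn0)
   show "AE w in M. (%m. i B w * e (shift_path (Rn m w) (X w))) ----> i B w * e (shift_path (R w) (X w))"
   proof(rule AE_I2)
    fix w assume w: "w:space M"
    have lim: "(%m. X w (Rn m w + j)) ----> X w (R w + j)" if "0 <= j" for j
    proof -
     have "filterlim (%m. Rn m w + j) (at_right (R w + j)) sequentially"
      using filterlim_dyadic_above[of "R w"] unfolding filterlim_at Rn_def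
      by(auto intro!: tendsto_eq_intros elim: eventually_mono)
     thus ?thesis
      using subordinator_pathD(4)[OF path_X[OF w], of "R w + j"] R0[of w] that by(auto intro: filterlim_compose)
    qed
    have "(%m. e (shift_path (Rn m w) (X w))) ----> e (shift_path (R w) (X w))"
     unfolding e_def shift_path_def laplace_functional_def
     using J(2) lim lim[of 0] by(intro tendsto_intros tendsto_ennrealI) (auto simp: subset_eq)
    thus "(%m. i B w * e (shift_path (Rn m w) (X w))) ----> i B w * e (shift_path (R w) (X w))"
     by(cases "i B w = 0") (auto simp: i_def indicator_def)
   qed
  qed (auto simp: emeasure_space_1)
  hence "(NINT w|M. i B w * e (shift_path (R w) (X w))) = c * a"
   unfolding step by(simp add: LIMSEQ_const_iff)
  thus "(NINT w|M. laplace_functional J n (shift_path (R w) (X w)) * i B w) = (NINT w|M. laplace_functional J n (X w) * (NINT w|M. i B w))"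
   unfolding e_def[symmetric] c_def[symmetric] a_def by(simp add: nn_integral_cmult mult.commute)
 qed auto
 define t where "t w = (indicator {w. T w < oo} w :: ennreal)" for w
 have t[measurable]: "t:Borel M" unfolding t_def by(auto intro!: borel_measurable_indicator')
 have t1: "t w <= 1" for w by(simp add: t_def indicator_def)
 interpret MM: pair_prob_space M M ..
 \<comment> \<open>Up to here the mark and the shifted path were tested separately. For joint
   functions the comparison is with the product space, whose second factor supplies the fresh
   path.\<close>
 have "(NINT w|M. Psi (G w, shift_path (R w) (X w)) * t w) = (NINT z|(M >< M). Psi (G (fst z), X (snd z)) * t (fst z))"
 proof(rule weighted_rectangle_eqI[OF finite_measure_axioms MM.finite_measure_axioms, where A=E and B=path_space])
  fix B C assume BC[measurable]: "B:sets E" "C:sets path_space"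
  hence C: "indicator C:Borel path_space" by simp
  have it: "indicator B (G w) * t w = i B w" for w by(auto simp: i_def t_def indicator_def)
  have [measurable]: "i B:Borel M" unfolding it[symmetric] by measurable
  have "(NINT w|M. indicator B (G w) * indicator C (shift_path (R w) (X w)) * t w) = (NINT w|M. indicator C (shift_path (R w) (X w)) * i B w)"
   by(simp add: it[symmetric] ac_simps)
  also have "... = (NINT w|M. i B w) * (NINT w|M. indicator C (X w))"
   unfolding main[OF BC(1) C] by(simp add: nn_integral_multc mult.commute del: nn_integral_indicator)
  also have "... = (NINT w|M. NINT w'|M. i B w * indicator C (X w'))" by(simp add: nn_integral_cmult nn_integral_multc)
  also have "... = (NINT w|M. NINT w'|M. indicator B (G w) * indicator C (X w') * t w)" unfolding it[symmetric] by(simp only: mult_ac)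
  also have "... = (NINT z|(M >< M). indicator B (G (fst z)) * indicator C (X (snd z)) * t (fst z))"
   by(subst nn_integral_fst[symmetric]) auto
  finally show "(NINT w|M. indicator B (G w) * indicator C (shift_path (R w) (X w)) * t w) = ..." .
 qed (auto simp: t1)
 also have "... = (NINT w|M. NINT w'|M. Psi (G w, X w') * t w)"
  by(subst nn_integral_fst[symmetric]) auto
 also have "... = (NINT w|M. indicator {w. T w < oo} w * (NINT w'|M. Psi (G w, X w')))"
 proof(intro nn_integral_cong)
  fix w assume w: "w:space M"
  have "(%w'. Psi (G w, X w')):Borel M"
   using measurable_space[OF \<open>G:_\<close> w] by measurable
  thus "(NINT w'|M. Psi (G w, X w') * t w) = indicator {w. T w < oo} w * (NINT w'|M. Psi (G w, X w'))"
   by(simp add: nn_integral_multc t_def mult.commute)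
 qed
 also have "(NINT w|M. Psi (G w, shift_path (R w) (X w)) * t w) =
   (NINT w|M. indicator {w. T w < oo} w * Psi (G w, shift_path (real_of_ereal (T w)) (X w)))"
  by(intro nn_integral_cong) (simp add: R' t_def mult.commute)
 finally show ?thesis unfolding T_def G_def .
qed

end

section \<open>Barriers and passage times\<close>

text \<open>A class closed under the operations of the procedure: capping by \<open>r\<close>, and
  the translation after an iteration that does not stop. Extended values admit the boundary
  \<open>oo\<close>.\<close>

definition barrier :: "(real => ereal) => bool" where
 "barrier be <-> (ALL s t. 0 < s --> s <= t --> be t <= be s) & continuous_on {0<..} be & (ALL t>0. -oo < be t) &
  (EX l>0. (be ---> l) (at_right 0))"

lemma barrierD:
 assumes "barrier be"
 shows "!!s t. 0 < s ==> s <= t ==> be t <= be s" "!!t. 0 < t ==> isCont be t" "!!t. 0 < t ==> -oo < be t"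
  "EX l>0. (be ---> l) (at_right 0)"
 using assms by(auto simp: barrier_def continuous_on_eq_continuous_at)

text \<open>A family that consists of a single interval turns the absolute continuity condition into
  uniform continuity.\<close>

lemma regular_boundary_barrier:
 assumes "regular_boundary f" shows "barrier (%t. ereal (f t))"
proof -
 have ac: "absolutely_continuous_fun_on f {a..b}" if "0 < a" "a <= b" for a b
  using assms that by(auto simp: regular_boundary_def)
 have "isCont f t" if t: "0 < t" for t
 proof -
  let ?S = "{t/2..t+1}"
  have "uniformly_continuous_on ?S f"
   unfolding uniformly_continuous_on_def
  proof(intro allI impI)
   fix e :: real assume "0 < e"
   then obtain d where d: "0 < d" "!!I. finite I & (ALL (x, y):I. x <= y & {x..y} \<subseteq> ?S) &
     pairwise (%(x, y) (x', y'). {x<..<y} \<inter> {x'<..<y'} = {}) I & (\<Sum>(x, y)\<in>I. y - x) < d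
     --> (\<Sum>(x, y)\<in>I. \<bar>f y - f x\<bar>) < e"
    using ac[of "t/2" "t+1"] t unfolding absolutely_continuous_fun_on_def by force
   have *: "\<bar>f y - f x\<bar> < e" if "x:?S" "y:?S" "x <= y" "y - x < d" for x y
    using d(2)[of "{(x, y)}"] that by auto
   show "EX d>0. ALL x:?S. ALL x':?S. dist x' x < d --> dist (f x') (f x) < e"
   proof(intro exI[of _ d] conjI ballI impI)
    fix x x' assume "x:?S" "x':?S" "dist x' x < d"
    thus "dist (f x') (f x) < e"
     using *[of x x'] *[of x' x] by(cases "x <= x'") (auto simp: dist_real_def)
   qed (fact d)
  qed
  hence "continuous_on ?S f" by(rule uniformly_continuous_imp_continuous)
  thus ?thesis using t by(intro continuous_on_interior[of ?S]) auto
 qed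
 hence "continuous_on {0<..} (%t. ereal (f t))"
  by(intro continuous_on_ereal continuous_at_imp_continuous_on) auto
 thus ?thesis
  using assms unfolding barrier_def regular_boundary_def
  by(auto simp: monotone_on_def)
qed

lemma barrier_infinity: "barrier (%_. oo)"
 by(auto simp: barrier_def intro!: exI[of _ oo])

lemma barrier_min:
 assumes "barrier be" "0 < r" shows "barrier (%t. min (be t) r)"
 unfolding barrier_def
proof(intro conjI allI impI)
 note D = barrierD[OF assms(1)]
 show "min (be t) r <= min (be s) r" if "0 < s" "s <= t" for s t
  using D(1)[OF that] by(auto simp: min_def)
 show "continuous_on {0<..} (%t. min (be t) r)"
  using D(2) by(intro continuous_on_min continuous_at_imp_continuous_on) auto
 show "-oo < min (be t) r" if "0 < t" for t using D(3)[OF that] assms(2) by(auto simp: min_def)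
 obtain l where "l > 0" "(be ---> l) (at_right 0)" using D(4) by auto
 thus "EX l>0. ((%t. min (be t) r) ---> l) (at_right 0)"
  using assms(2) by(intro exI[of _ "min l r"]) (auto intro!: tendsto_min)
qed

lemma barrier_shift:
 assumes "barrier c" "0 < T" "ereal H < c T"
 shows "barrier (%u. c (u + T) - ereal H)"
 unfolding barrier_def
proof(intro conjI allI impI)
 note D = barrierD[OF assms(1)]
 have ct: "isCont (%u. c (u + T) - ereal H) u" if "0 < u + T" for u
 proof -
  have "isCont c (u + T)" using D(2) that by simp
  moreover have "isCont (%u. u + T) u" by simp
  ultimately have "isCont (%u. c (u + T)) u" by(rule isCont_o2[where g=c, rotated])
  hence "((%u. c (u + T) + ereal (- H)) ---> c (u + T) + ereal (- H)) (at u)"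
   unfolding isCont_def by(intro tendsto_add_left_ereal) auto
  thus ?thesis unfolding isCont_def minus_ereal_def by simp
 qed
 show "c (t + T) - ereal H <= c (s + T) - ereal H" if "0 < s" "s <= t" for s t
  using D(1)[of "s + T" "t + T"] that assms(2) by(intro ereal_minus_mono) auto
 show "continuous_on {0<..} (%u. c (u + T) - ereal H)"
  using ct assms(2) by(intro continuous_at_imp_continuous_on) auto
 show "-oo < c (t + T) - ereal H" if "0 < t" for t using D(3)[of "t + T"] that assms(2) by(cases "c (t + T)") auto
 have "((%u. c (u + T) - ereal H) ---> c T - ereal H) (at_right 0)"
  using ct[of 0] assms(2) unfolding isCont_def by(auto intro: filterlim_mono at_le)
 moreover have "0 < c T - ereal H" using assms(3) by(cases "c T") auto
 ultimately show "EX l>0. ((%u. c (u + T) - ereal H) ---> l) (at_right 0)" by blast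
qed

lemma barrier_cong:
 assumes "barrier be" "!!t. 0 < t ==> be t = \<gamma> t" shows "barrier \<gamma>"
proof -
 have "continuous_on {0<..} be <-> continuous_on {0<..} \<gamma>" using assms(2) by(intro continuous_on_cong) auto
 moreover have "(be ---> l) (at_right 0) <-> (\<gamma> ---> l) (at_right 0)" for l
  by(intro tendsto_cong) (auto simp: assms(2) eventually_at_filter)
 ultimately show ?thesis using assms unfolding barrier_def by auto
qed

lemma passage_time_cong:
 "(!!t. 0 < t ==> be t = \<gamma> t) ==> passage_time f be = passage_time f \<gamma>"
 unfolding passage_time_def by(metis (no_types, lifting))

lemma passage_time_nonneg: "0 <= passage_time f be"
 unfolding passage_time_def by(intro Inf_greatest) auto

lemma passage_time_le: "0 < t ==> be t < ereal (f t) ==> passage_time f be <= ereal t"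
 unfolding passage_time_def by(intro Inf_lower) auto

lemma passage_time_less_iff: "passage_time f be < s <-> (EX t>0. ereal t < s & be t < ereal (f t))"
 unfolding passage_time_def by(auto simp: Inf_less_iff)

lemma below_barrier: "0 < u ==> ereal u < passage_time f be ==> ereal (f u) <= be u"
 using passage_time_le[of u be f] by(meson leD leI)

lemma passage_time_right_nbhd:
 assumes f: "subordinator_path f" and be: "isCont be t" and t: "0 <= t" and less: "be t < ereal (f t)"
 shows "\<forall>\<^sub>F u in at_right t. be u < ereal (f u)"
proof -
 obtain m where m: "be t < m" "m < ereal (f t)" using less dense by blast
 have "\<forall>\<^sub>F u in at_right t. be u < m"
  using be m(1) unfolding isCont_def by(intro order_tendstoD(2)) (auto intro: filterlim_mono at_le)
 moreover have "\<forall>\<^sub>F u in at_right t. m < ereal (f u)"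
  using subordinator_pathD(4)[OF f t] m(2) by(intro order_tendstoD(1)) auto
 ultimately show ?thesis by eventually_elim auto
qed

context
 fixes be f
 assumes be: "barrier be" and f: "subordinator_path f"
begin

lemma passage_time_pos: "0 < passage_time f be"
proof -
 obtain l where l: "l > 0" "(be ---> l) (at_right 0)" using barrierD(4)[OF be] by auto
 obtain m where m: "0 < m" "m < l" using l(1) dense by blast
 have "\<forall>\<^sub>F u in at_right 0. m < be u" using l m by(intro order_tendstoD(1)) auto
 moreover have "((%u. ereal (f u)) ---> ereal (f 0)) (at_right 0)"
  using subordinator_pathD(4)[OF f, of 0] by simp
 hence "\<forall>\<^sub>F u in at_right 0. ereal (f u) < m"
  using m subordinator_pathD(1)[OF f] by(intro order_tendstoD(2)) (auto simp: zero_ereal_def)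
 ultimately have "\<forall>\<^sub>F u in at_right 0. ereal (f u) < be u" by eventually_elim auto
 then obtain d where d: "0 < d" "!!u. 0 < u ==> u < d ==> ereal (f u) < be u"
  unfolding eventually_at_right_field by auto
 have "ereal d <= passage_time f be"
  unfolding passage_time_def
 proof(intro Inf_greatest)
  fix z assume "z:{ereal t |t. 0 < t & be t < ereal (f t)}"
  thus "ereal d <= z" using d(2) by(fastforce simp: not_less[symmetric])
 qed
 thus ?thesis using d(1) by(metis ereal_less(2) less_le_trans)
qed

lemma above_barrier: "passage_time f be < ereal u ==> be u < ereal (f u)"
proof -
 assume "passage_time f be < ereal u"
 then obtain t where t: "0 < t" "t < u" "be t < ereal (f t)" by(auto simp: passage_time_less_iff)
 have "be u <= be t" using barrierD(1)[OF be] t by auto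
 also have "... < ereal (f t)" by fact
 also have "... <= ereal (f u)" using subordinator_pathD(2)[OF f, of t u] t by auto
 finally show ?thesis .
qed

lemma above_barrier_left: "passage_time f be < ereal u ==> be u < ereal (left_limit f u)"
proof -
 assume "passage_time f be < ereal u"
 then obtain t where t: "0 < t" "t < u" "be t < ereal (f t)" by(auto simp: passage_time_less_iff)
 have "be u <= be t" using barrierD(1)[OF be] t by auto
 also have "... < ereal (f t)" by fact
 also have "... <= ereal (left_limit f u)" using left_limit_bounds(1)[OF f, of u t] t by auto
 finally show ?thesis .
qed

lemma left_limit_passage_time:
 assumes t: "0 < t" "ereal t <= passage_time f be" shows "ereal (left_limit f (ereal t)) <= be t"
proof(rule tendsto_le)
 show "((%u. ereal (f u)) ---> ereal (left_limit f (ereal t))) (at_left t)"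
  using left_limit_tendsto[OF f t(1)] by simp
 show "(be ---> be t) (at_left t)" using barrierD(2)[OF be t(1)] unfolding isCont_def by(auto intro: filterlim_mono at_le)
 show "\<forall>\<^sub>F u in at_left t. ereal (f u) <= be u"
 proof(rule eventually_at_leftI[of 0])
  show "ereal (f u) <= be u" if "u:{0<..<t}" for u
   using that t(2) by(intro below_barrier) (auto intro: less_le_trans[of _ "ereal t"])
 qed (fact t)
qed simp

text \<open>Otherwise right-continuity would keep the path below the barrier for some time after
  \<open>t\<close>, whereas by monotonicity it is above at every time after
  \<open>t\<close>.\<close>

lemma barrier_le_passage_time:
 assumes t: "passage_time f be = ereal t" shows "be t <= ereal (f t)"
proof(rule ccontr)
 assume "~ ?thesis"
 hence less: "ereal (f t) < be t" by simp
 have t0: "0 < t" using passage_time_pos t by simp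
 obtain m where m: "ereal (f t) < m" "m < be t" using less dense by blast
 have "\<forall>\<^sub>F u in at_right t. m < be u"
  using barrierD(2)[OF be t0] m unfolding isCont_def by(intro order_tendstoD(1)) (auto intro: filterlim_mono at_le)
 moreover have "\<forall>\<^sub>F u in at_right t. ereal (f u) < m"
  using subordinator_pathD(4)[OF f, of t] t0 m by(intro order_tendstoD(2)) auto
 ultimately have "\<forall>\<^sub>F u in at_right t. ereal (f u) < be u" by eventually_elim auto
 then obtain d where d: "t < d" "!!u. t < u ==> u < d ==> ereal (f u) < be u"
  unfolding eventually_at_right_field by auto
 hence "be ((t + d) / 2) < ereal (f ((t + d) / 2))" using above_barrier[of "(t + d) / 2"] t by simp
 with d(2)[of "(t + d) / 2"] d(1) show False by auto
qed

lemma passage_time_greater: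
 assumes "0 < t" "ereal (f t) < be t" shows "ereal t < passage_time f be"
proof(rule ccontr)
 assume "~ ?thesis"
 then consider "passage_time f be = ereal t" | "passage_time f be < ereal t" by fastforce
 thus False
  using barrier_le_passage_time[of t] above_barrier[of t] assms by cases auto
qed

end

text \<open>For \<open>z <= s\<close>, whether the passage time is less than \<open>z\<close> is
  decided by the path before \<open>s\<close>, where both paths agree.\<close>

lemma passage_time_stop:
 assumes "passage_time f be < ereal s \<or> passage_time (stop_path s f) be < ereal s"
 shows "passage_time (stop_path s f) be = passage_time f be"
proof -
 have eq: "passage_time (stop_path s f) be < z <-> passage_time f be < z" if "z <= ereal s" for z
 proof -
  have "stop_path s f t = f t" if "ereal t < z" for t
   using less_le_trans[OF that \<open>z <= ereal s\<close>] by(simp add: stop_path_def)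
  thus ?thesis unfolding passage_time_less_iff by metis
 qed
 show ?thesis
 proof(rule ccontr)
  assume "passage_time (stop_path s f) be ~= passage_time f be"
  then consider "passage_time (stop_path s f) be < passage_time f be" | "passage_time f be < passage_time (stop_path s f) be" by fastforce
  thus False
   using assms eq[of "passage_time f be"] eq[of "passage_time (stop_path s f) be"] eq[of "ereal s"]
   by cases (auto dest: less_imp_le)
 qed
qed

text \<open>Strict exceedance persists for a while to the right, so rational times reach the same
  infimum; this yields measurability. With continuity as the only demand on \<open>be\<close>, it
  covers the constant level 0 and the residual boundaries of arbitrary states, which need not be
  barriers.\<close>

lemma passage_time_rational:
 assumes f: "subordinator_path f" and be: "!!t. 0 < t ==> isCont be t"
 shows "passage_time f be = (INF q\<in>{0<..} \<inter> \<rat>. if be q < ereal (f q) then ereal q else oo)" (is "_ = ?R")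
proof(rule antisym)
 show "passage_time f be <= ?R"
  by(intro INF_greatest) (auto intro: passage_time_le)
 show "?R <= passage_time f be"
  unfolding passage_time_def
 proof(intro Inf_greatest)
  fix z assume "z:{ereal t |t. 0 < t & be t < ereal (f t)}"
  then obtain t where t: "z = ereal t" "0 < t" "be t < ereal (f t)" by auto
  have "\<forall>\<^sub>F u in at_right t. be u < ereal (f u)"
   using t by(intro passage_time_right_nbhd f be) auto
  then obtain d where d: "t < d" "!!u. t < u ==> u < d ==> be u < ereal (f u)"
   unfolding eventually_at_right_field by auto
  show "?R <= z" unfolding t(1)
  proof(rule ereal_le_epsilon2)
   fix e :: real assume "0 < e"
   then obtain q where q: "q:\<rat>" "t < q" "q < min d (t + e)"
    using Rats_dense_in_real[of t "min d (t + e)"] d(1) by auto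
   have "?R <= (if be q < ereal (f q) then ereal q else oo)" using q t(2) by(intro INF_lower) auto
   also have "... = ereal q" using d(2)[of q] q by auto
   also have "... <= ereal t + ereal e" using q by simp
   finally show "?R <= ereal t + ereal e" .
  qed
 qed
qed

lemma measurable_passage_time:
 assumes X: "X:N ->M path_space"
  and be: "!!q. 0 < q ==> (%x. be x q):Borel N"
  and cont: "!!x t. x:space N ==> 0 < t ==> isCont (be x) t"
 shows "(%x. passage_time (X x) (be x)):Borel N"
proof -
 have [measurable]: "(%x. X x q):Borel N" if "0 < q" for q
  using that by(intro measurable_eval_path[OF X]) auto
 note be[measurable]
 have "countable ({0<..} \<inter> \<rat> :: real set)" using countable_rat by(auto intro: countable_subset)
 hence "(%x. INF q\<in>{0<..} \<inter> \<rat>. if be x q < ereal (X x q) then ereal q else oo):Borel N"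
  by(intro borel_measurable_INF) auto
 thus ?thesis
  by(rule measurable_cong[THEN iffD2, rotated])
   (use measurable_space[OF X] cont in \<open>simp add: space_path_space passage_time_rational\<close>)
qed

section \<open>Laws of subordinators\<close>

definition laplace_exponent :: "real measure => real => real" where
 "laplace_exponent nu th = (\<integral>x. 1 - exp (- th * x) \<partial>nu)"

context
 fixes nu :: "real measure"
 assumes nu: "levy_measure nu"
begin

lemma levy_sets[measurable_cong]: "sets nu = sets borel"
 using nu by(simp add: levy_measure_def)

lemma levy_AE_pos: "AE x in nu. 0 < x"
proof -
 have "{..0}:null_sets nu" using nu by(auto simp: levy_measure_def null_sets_def)
 thus ?thesis by(rule AE_I') auto
qed

lemma levy_integrable:
 assumes [measurable]: "h:Borel borel" and bound: "!!x. 0 < x ==> \<bar>h x\<bar> <= C * min 1 x"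
 shows "integrable nu h"
proof(rule integrableI_bounded)
 have C: "0 <= C" using bound[of 1] by simp
 have "(NINT x|nu. ennreal (norm (h x))) <= (NINT x|nu. ennreal C * ennreal (min 1 x))"
  using levy_AE_pos by(intro nn_integral_mono_AE) (auto elim!: eventually_mono simp: ennreal_mult'[symmetric] C bound intro!: ennreal_leI)
 also have "... < oo"
  using nu by(subst nn_integral_cmult) (auto simp: levy_measure_def ennreal_mult_less_top)
 finally show "(NINT x|nu. ennreal (norm (h x))) < oo" .
qed (simp add: measurable_cong_sets[OF levy_sets])

lemma one_minus_exp_le_min:
 fixes x :: real assumes "0 <= x" "0 <= th" shows "1 - exp (- th * x) <= max 1 th * min 1 x"
proof(cases "x <= 1")
 case True
 have "1 - exp (- th * x) <= th * x" using exp_ge_add_one_self[of "- th * x"] by simp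
 also have "... <= max 1 th * x" using assms by(intro mult_right_mono) auto
 finally show ?thesis using True by simp
next
 case False
 have "1 - exp (- th * x) <= 1" by simp
 also have "1 <= max 1 th" by simp
 finally show ?thesis using False by simp
qed

lemma integrable_one_minus_exp: "0 <= th ==> integrable nu (%x. 1 - exp (- th * x))"
 using one_minus_exp_le_min by(intro levy_integrable[where C="max 1 th"]) auto

lemma laplace_exponent_nn:
 assumes "0 <= th" shows "ennreal (laplace_exponent nu th) = (NINT x|nu. ennreal (1 - exp (- th * x)))"
 unfolding laplace_exponent_def
 by(rule nn_integral_eq_integral[symmetric, OF integrable_one_minus_exp[OF assms]])
  (use levy_AE_pos assms in \<open>auto elim!: eventually_mono\<close>)

lemma laplace_exponent_nonneg: "0 <= th ==> 0 <= laplace_exponent nu th"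
 unfolding laplace_exponent_def
 by(rule integral_nonneg_AE) (use levy_AE_pos in \<open>auto elim!: eventually_mono\<close>)

lemma levy_emeasure_pos: "emeasure nu {0<..} = emeasure nu (space nu)"
 using levy_AE_pos by(intro emeasure_eq_AE) (auto elim!: eventually_mono simp: sets_eq_imp_space_eq[OF levy_sets])

text \<open>Monotone convergence. The total mass of the Levy measure thus becomes visible in the
  exponent, which is how finite and infinite activity are told apart.\<close>

lemma laplace_exponent_limit: "(%n. ennreal (laplace_exponent nu (real n))) ----> emeasure nu {0<..}"
proof -
 have "(%n. (NINT x|nu. ennreal (1 - exp (- real n * max 0 x)))) ----> (NINT x|nu. indicator {0<..} x)"
 proof(rule nn_integral_LIMSEQ)
  show "incseq (%n x. ennreal (1 - exp (- real n * max 0 x)))"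
   by(auto simp: incseq_def le_fun_def intro!: ennreal_leI mult_right_mono)
  show "(%n. ennreal (1 - exp (- real n * max 0 x))) ----> indicator {0<..} x" for x :: real
  proof(cases "0 < x")
   case True
   have "(%n. exp (- (real n * x))) ----> 0"
   proof -
    have "(%n. exp (- x) ^ n) ----> 0" using True by(intro LIMSEQ_power_zero) auto
    thus ?thesis by(simp add: exp_of_nat_mult[symmetric])
   qed
   from tendsto_ennrealI[OF tendsto_diff[OF tendsto_const[of 1] this]] True show ?thesis by(simp add: max_def)
  qed (simp add: max_def)
 qed auto
 also have "(%n. (NINT x|nu. ennreal (1 - exp (- real n * max 0 x)))) = (%n. ennreal (laplace_exponent nu (real n)))"
  unfolding laplace_exponent_nn[OF of_nat_0_le_iff] using levy_AE_pos
  by(intro ext nn_integral_cong_AE) (auto elim!: eventually_mono simp: max_def)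
 finally show ?thesis by simp
qed

lemma laplace_exponent_pos: assumes "emeasure nu {0<..} ~= 0" shows "0 < laplace_exponent nu 1"
proof(rule ccontr)
 assume "~ ?thesis"
 hence "ennreal (laplace_exponent nu 1) = 0" by(simp add: ennreal_neg)
 hence "AE x in nu. ennreal (1 - exp (- 1 * x)) = 0"
  by(subst (asm) laplace_exponent_nn) (auto simp: nn_integral_0_iff_AE)
 hence "AE x in nu. False" using levy_AE_pos by eventually_elim (auto simp: ennreal_eq_0_iff)
 hence "emeasure nu (space nu) = 0" using emeasure_eq_0_AE[of "%_. True" nu] by simp
 thus False using assms levy_emeasure_pos by simp
qed

end

declare levy_sets[measurable_cong del]

context
 fixes M :: "'a measure" and nu X
 assumes X: "driftless_subordinator M nu X"
begin

interpretation prob_space M by(rule driftless_subordinatorD[OF X])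

lemma subordinator_laplace:
 assumes "0 <= t" "0 <= th"
 shows "expectation (%w. exp (- th * X t w)) = exp (- t * laplace_exponent nu th)"
  and "integrable M (%w. exp (- th * X t w))"
  and "(NINT w|M. ennreal (exp (- th * X t w))) = ennreal (exp (- t * laplace_exponent nu th))"
proof -
 note D = driftless_subordinatorD[OF X]
 show 1: "expectation (%w. exp (- th * X t w)) = exp (- t * laplace_exponent nu th)"
  unfolding laplace_exponent_def by(rule D(7)[OF assms])
 show 2: "integrable M (%w. exp (- th * X t w))"
  using D(3)[OF assms(1)] subordinator_pathD(3)[OF D(4) assms(1)] assms(2)
  by(intro integrable_const_bound[where B=1]) auto
 show "(NINT w|M. ennreal (exp (- th * X t w))) = ennreal (exp (- t * laplace_exponent nu th))"
  unfolding 1[symmetric] by(rule nn_integral_eq_integral[OF 2]) auto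
qed

lemma subordinator_prob_zero:
 assumes t: "0 <= t"
 shows "(%n. exp (- t * laplace_exponent nu (real n))) ----> prob {w:space M. X t w = 0}"
proof -
 note D = driftless_subordinatorD[OF X]
 note [measurable] = D(3)[OF t]
 have "(%n. expectation (%w. exp (- real n * X t w))) ----> expectation (indicator {w:space M. X t w = 0})"
 proof(rule integral_dominated_convergence[where w="%_. 1"])
  show "AE w in M. (%n. exp (- real n * X t w)) ----> indicator {w:space M. X t w = 0} w"
  proof(rule AE_I2)
   fix w assume w: "w:space M"
   show "(%n. exp (- real n * X t w)) ----> indicator {w:space M. X t w = 0} w"
   proof(cases "X t w = 0")
    case False
    hence "0 < X t w" using subordinator_pathD(3)[OF D(4)[OF w] t] by simp
    hence "(%n. exp (- X t w) ^ n) ----> 0" by(intro LIMSEQ_power_zero) auto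
    thus ?thesis using False by(simp add: exp_of_nat_mult[symmetric])
   qed (use w in simp)
  qed
  show "AE w in M. norm (exp (- real n * X t w)) <= 1" for n
   using subordinator_pathD(3)[OF D(4) t] by auto
 qed auto
 thus ?thesis unfolding subordinator_laplace(1)[OF t of_nat_0_le_iff] by simp
qed

lemma subordinator_prob_zero_infinite:
 assumes inf: "emeasure nu {0<..} = oo" and t: "0 < t"
 shows "AE w in M. 0 < X t w"
proof -
 note D = driftless_subordinatorD[OF X]
 have [measurable]: "X t:Borel M" using D(3) t by simp
 have "(%n. ennreal (laplace_exponent nu (real n))) ----> oo"
  using laplace_exponent_limit[OF D(2)] inf by simp
 hence "filterlim (%n. laplace_exponent nu (real n)) at_top sequentially"
  using laplace_exponent_nonneg[OF D(2)]
  by(simp add: ennreal_tendsto_top_eq_at_top)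
 hence "filterlim (%n. t * laplace_exponent nu (real n)) at_top sequentially"
  by(rule filterlim_tendsto_pos_mult_at_top[OF tendsto_const t])
 hence "(%n. exp (- (t * laplace_exponent nu (real n)))) ----> 0"
  by(intro filterlim_compose[OF exp_at_bot]) (simp add: filterlim_uminus_at_bot)
 with subordinator_prob_zero[of t] t have "prob {w:space M. X t w = 0} = 0"
  by(auto intro: LIMSEQ_unique)
 hence "AE w in M. X t w ~= 0"
  by(subst (asm) prob_eq_0) auto
 thus ?thesis using subordinator_pathD(3)[OF D(4), of _ t] t
  by(auto elim!: AE_mp intro!: AE_I2 simp: less_le)
qed

lemma subordinator_prob_zero_finite:
 assumes fin: "emeasure nu {0<..} < oo" and t: "0 <= t"
 shows "prob {w:space M. X t w = 0} = exp (- t * measure nu {0<..})"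
proof -
 note D = driftless_subordinatorD[OF X]
 have "(%n. ennreal (laplace_exponent nu (real n))) ----> ennreal (measure nu {0<..})"
  using laplace_exponent_limit[OF D(2)] fin by(simp add: emeasure_eq_ennreal_measure less_top)
 hence "(%n. laplace_exponent nu (real n)) ----> measure nu {0<..}"
  using laplace_exponent_nonneg[OF D(2)] by(subst (asm) tendsto_ennreal_iff) auto
 hence "(%n. exp (- t * laplace_exponent nu (real n))) ----> exp (- t * measure nu {0<..})"
  by(intro tendsto_intros)
 with subordinator_prob_zero[OF t] show ?thesis by(auto intro: LIMSEQ_unique)
qed

text \<open>The transform is continuous in time, so the left limit and the value have equal
  expectations under \<open>exp (- x)\<close>; since one is at most the other, they agree almost
  surely.\<close>

lemma subordinator_no_fixed_jump:
 assumes t: "0 < t" shows "AE w in M. left_limit (%t. X t w) (ereal t) = X t w"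
proof -
 note D = driftless_subordinatorD[OF X]
 note Xp = driftless_subordinator_measurable_path[OF X]
 define L where "L w = left_limit (%t. X t w) (ereal t)" for w
 have [measurable]: "L:Borel M" unfolding L_def by(rule measurable_left_limit[OF Xp]) simp
 have [measurable]: "X t:Borel M" using D(3) t by simp
 have L: "0 <= L w" "L w <= X t w" if "w:space M" for w
  unfolding L_def using left_limit_nonneg left_limit_bounds(2)[OF _ t] D(4)[OF that] by auto
 have iL: "integrable M (%w. exp (- L w))"
  using L by(intro integrable_const_bound[where B=1]) auto
 have iX: "integrable M (%w. exp (- X t w))"
  using subordinator_laplace(2)[of t 1] t by simp
 have "(%n. expectation (%w. exp (- X (dyadic_below n t) w))) ----> expectation (%w. exp (- L w))"
 proof(rule integral_dominated_convergence[where w="%_. 1"])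
  show "AE w in M. (%n. exp (- X (dyadic_below n t) w)) ----> exp (- L w)"
  proof(rule AE_I2)
   fix w assume w: "w:space M"
   have "(%n. X (dyadic_below n t) w) ----> L w" unfolding L_def
    by(rule filterlim_compose[OF left_limit_tendsto[OF D(4)[OF w] t] filterlim_dyadic_below])
   thus "(%n. exp (- X (dyadic_below n t) w)) ----> exp (- L w)" by(intro tendsto_intros)
  qed
  show "AE w in M. norm (exp (- X (dyadic_below n t) w)) <= 1" for n
   using subordinator_pathD(3)[OF D(4)] dyadic_below_nonneg[OF t] by auto
  show "(%w. exp (- X (dyadic_below n t) w)):Borel M" for n
   using D(3)[OF dyadic_below_nonneg[OF t]] by measurable
 qed auto
 moreover have "(%n. expectation (%w. exp (- X (dyadic_below n t) w))) ----> expectation (%w. exp (- X t w))"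
 proof -
  have *: "expectation (%w. exp (- X s w)) = exp (- s * laplace_exponent nu 1)" if "0 <= s" for s
   using subordinator_laplace(1)[OF that, of 1] by simp
  have "(%n. dyadic_below n t) ----> t"
   using filterlim_dyadic_below[of t] by(auto simp: filterlim_at)
  hence "(%n. exp (- dyadic_below n t * laplace_exponent nu 1)) ----> exp (- t * laplace_exponent nu 1)"
   by(intro tendsto_intros)
  thus ?thesis using *[of t] *[OF dyadic_below_nonneg[OF t]] t by simp
 qed
 ultimately have "expectation (%w. exp (- L w)) = expectation (%w. exp (- X t w))" by(rule LIMSEQ_unique)
 hence "expectation (%w. exp (- L w) - exp (- X t w)) = 0" using iL iX by simp
 hence "AE w in M. exp (- L w) - exp (- X t w) = 0"
  using iL iX L by(subst (asm) integral_nonneg_eq_0_iff_AE) auto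
 thus ?thesis by(auto simp: L_def elim!: eventually_mono)
qed

lemma subordinator_strict_mono:
 assumes inf: "emeasure nu {0<..} = oo"
 shows "AE w in M. ALL s t. 0 <= s --> s < t --> X s w < X t w"
proof -
 note D = driftless_subordinatorD[OF X]
 have *: "AE w in M. X s w < X t w" if "0 <= s" "s < t" for s t
 proof -
  have [measurable]: "X s:Borel M" "X t:Borel M" "X (t - s):Borel M"
   using D(3) that by auto
  have "AE x in distr M borel (X (t - s)). 0 < x"
   using subordinator_prob_zero_infinite[OF inf, of "t - s"] that by(simp add: AE_distr_iff)
  moreover have "distr M borel (%w. X t w - X s w) = distr M borel (X (t - s))"
   using D(6)[of s "t - s"] that by simp
  ultimately have "AE x in distr M borel (%w. X t w - X s w). 0 < x" by(simp only:)
  thus ?thesis by(subst (asm) AE_distr_iff) auto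
 qed
 have "AE w in M. ALL p:\<rat> \<times> \<rat>. 0 <= fst p --> fst p < snd p --> X (fst p) w < X (snd p) w"
  using * by(subst AE_ball_countable) (auto intro!: countable_SIGMA countable_rat)
 with AE_space show ?thesis
 proof eventually_elim
  case (elim w)
  note mono = subordinator_pathD(2)[OF D(4)[OF elim(1)]]
  show ?case
  proof(intro allI impI)
   fix s t :: real assume s: "0 <= s" "s < t"
   obtain q where q: "q:\<rat>" "s < q" "q < t" using Rats_dense_in_real[OF s(2)] by auto
   obtain q' where q': "q':\<rat>" "q < q'" "q' < t" using Rats_dense_in_real[OF q(3)] by auto
   have "X s w <= X q w" using mono[of s q] s q by auto
   also have "X q w < X q' w" using elim(2)[THEN bspec, of "(q, q')"] q q' s by auto
   also have "X q' w <= X t w" using mono[of q' t] s q q' by auto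
   finally show "X s w < X t w" .
  qed
 qed
qed

text \<open>The infimum of \<open>exp (- X n)\<close> over all naturals has expectation at most
  \<open>exp (- n * laplace_exponent nu 1)\<close> for each \<open>n\<close>, hence 0.\<close>

lemma subordinator_unbounded:
 assumes pos: "emeasure nu {0<..} ~= 0"
 shows "AE w in M. ALL B. EX t>0. B < X t w"
proof -
 note D = driftless_subordinatorD[OF X]
 have phi: "0 < laplace_exponent nu 1" by(rule laplace_exponent_pos[OF D(2) pos])
 have [measurable]: "X (real n):Borel M" for n using D(3) by simp
 define I where "I w = (INF n. ennreal (exp (- X (real n) w)))" for w
 have [measurable]: "I:Borel M" unfolding I_def by measurable
 have le: "(NINT w|M. I w) <= ennreal (exp (- real n * laplace_exponent nu 1))" for n
 proof -
  have "(NINT w|M. I w) <= (NINT w|M. ennreal (exp (- X (real n) w)))"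
   by(intro nn_integral_mono) (auto simp: I_def intro: INF_lower)
  also have "... = ennreal (exp (- real n * laplace_exponent nu 1))"
   using subordinator_laplace(3)[of "real n" 1] by simp
  finally show ?thesis .
 qed
 have "(%n. ennreal (exp (- real n * laplace_exponent nu 1))) ----> ennreal 0"
 proof(rule tendsto_ennrealI)
  have "(%n. exp (- laplace_exponent nu 1) ^ n) ----> 0" using phi by(intro LIMSEQ_power_zero) auto
  thus "(%n. exp (- real n * laplace_exponent nu 1)) ----> 0" by(simp add: exp_of_nat_mult[symmetric])
 qed
 hence "(NINT w|M. I w) <= ennreal 0"
  by(rule LIMSEQ_le_const) (use le in auto)
 hence "AE w in M. I w = 0" by(simp add: nn_integral_0_iff_AE)
 with AE_space show ?thesis
 proof eventually_elim
  case (elim w)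
  show ?case
  proof
   fix B :: real
   have "I w < ennreal (exp (- (max 0 B)))" using elim(2) by simp
   then obtain n where n: "ennreal (exp (- X (real n) w)) < ennreal (exp (- (max 0 B)))"
    unfolding I_def by(auto simp: INF_less_iff)
   hence "max 0 B < X (real n) w" by(simp add: ennreal_less_iff)
   moreover from this have "n ~= 0" using subordinator_pathD(1)[OF D(4)[OF elim(1)]] by(cases "n = 0") auto
   ultimately show "EX t>0. B < X t w" by(auto intro!: exI[of _ "real n"])
  qed
 qed
qed

text \<open>Let \<open>m\<close> be the total mass, which is finite. The transform at
  \<open>th\<close> dominates P(X = 0) + exp(- th r) P(0 < X <= r), and it exceeds P(X = 0) = exp(-
  t m) by at most t exp(- th r) \<open>y th\<close>. Therefore P(0 < X <= r) <= t
  \<open>y th\<close>, and \<open>y\<close> tends to 0 because all jumps exceed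
  \<open>r\<close>.\<close>

lemma subordinator_gap:
 assumes t: "0 <= t" and r: "0 < r" and gap: "AE x in nu. r < x"
 shows "AE w in M. X t w = 0 \<or> r < X t w"
proof -
 note D = driftless_subordinatorD[OF X]
 note [measurable_cong] = levy_sets[OF D(2)]
 have [measurable]: "X t:Borel M" using D(3) t by simp
 have Xpos: "0 <= X t w" if "w:space M" for w using subordinator_pathD(3)[OF D(4)[OF that] t] .
 have "integrable nu (indicat_real {r<..})"
  by(rule levy_integrable[OF D(2), where C="1 / min 1 r"]) (use r in \<open>auto simp: indicator_def field_simps\<close>)
 hence one: "integrable nu (%_. 1::real)"
  by(rule Bochner_Integration.integrable_cong_AE_imp) (use gap in \<open>auto elim!: eventually_mono\<close>)
 define m where "m = measure nu (space nu)"
 have fin: "emeasure nu {0<..} < oo" "measure nu {0<..} = m"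
  using one levy_emeasure_pos[OF D(2)] by(auto simp: integrable_iff_bounded m_def measure_def)
 define y where "y th = (\<integral>x. exp (- th * (x - r)) \<partial>nu)" for th
 have le1: "AE x in nu. norm (exp (- th * (x - r))) <= 1" if "0 <= th" for th using gap that by(auto elim!: eventually_mono)
 have ex: "laplace_exponent nu th = m - exp (- th * r) * y th" if "0 <= th" for th
 proof -
  have "integrable nu (%x. exp (- th * (x - r)))"
   by(rule Bochner_Integration.integrable_bound[OF one]) (use le1[OF that] in auto)
  moreover have "laplace_exponent nu th = (\<integral>x. 1 - exp (- th * r) * exp (- th * (x - r)) \<partial>nu)"
   unfolding laplace_exponent_def by(simp add: exp_add[symmetric] algebra_simps)
  ultimately show ?thesis using one by(simp add: y_def m_def)
 qed
 have "(%n. y (real n)) ----> (\<integral>x. 0 \<partial>nu)" unfolding y_def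
 proof(rule integral_dominated_convergence[where w="%_. 1", OF _ _ one])
  show "AE x in nu. (%n. exp (- real n * (x - r))) ----> 0"
   using gap
  proof eventually_elim
   case (elim x)
   hence "(%n. exp (- (x - r)) ^ n) ----> 0" by(intro LIMSEQ_power_zero) auto
   thus ?case by(simp add: exp_of_nat_mult[symmetric] algebra_simps)
  qed
 qed (use le1 in auto)
 hence lim: "(%n. t * y (real n)) ----> t * 0" by(intro tendsto_intros) simp
 let ?Z = "{w:space M. X t w = 0}" and ?E = "{w:space M. 0 < X t w & X t w <= r}"
 have le: "prob ?E <= t * y th" if th: "0 <= th" for th
 proof -
  define v where "v = t * (exp (- th * r) * y th)"
  have "exp (- th * r) * prob ?E + prob ?Z = expectation (%w. exp (- th * r) * indicator ?E w + indicator ?Z w)"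
   by(subst Bochner_Integration.integral_add) (auto simp: less_top[symmetric])
  also have "... <= expectation (%w. exp (- th * X t w))"
  proof(intro integral_mono Bochner_Integration.integrable_add)
   show "exp (- th * r) * indicator ?E w + indicator ?Z w <= exp (- th * X t w)" if "w:space M" for w
    using Xpos[OF that] th by(auto simp: indicator_def mult_left_mono)
  qed (use subordinator_laplace(2)[OF t th] in \<open>auto simp: less_top[symmetric]\<close>)
  also have "... = exp (v - t * m)"
   using subordinator_laplace(1)[OF t th] by(simp add: ex[OF th] v_def algebra_simps)
  also have "prob ?Z = exp (- t * m)" using subordinator_prob_zero_finite[OF fin(1) t] fin(2) by simp
  finally have "exp (- th * r) * prob ?E <= exp (v - t * m) * (1 - exp (- v))"
   by(simp add: algebra_simps exp_add[symmetric])
  also have "... <= 1 * v"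
  proof(rule mult_mono)
   show "exp (v - t * m) <= 1"
    using laplace_exponent_nonneg[OF D(2) th] t unfolding v_def ex[OF th] by(auto intro!: mult_left_mono)
   show "1 - exp (- v) <= v" using exp_ge_add_one_self[of "- v"] by simp
   show "0 <= 1 - exp (- v)" using t by(simp add: v_def y_def)
  qed simp
  finally show ?thesis by(simp add: v_def mult.left_commute)
 qed
 have "prob ?E <= t * 0" by(rule LIMSEQ_le_const[OF lim]) (use le in auto)
 hence "AE w in M. ~ (0 < X t w & X t w <= r)" by(simp add: measure_le_0_iff prob_eq_0)
 with AE_space show ?thesis by eventually_elim (use Xpos in force)
qed

end

section \<open>Absence of atoms for infinite Levy measures\<close>

text \<open>The largest Poisson weight is small for a large parameter. If \<open>k\<close> is small,
  the weight at \<open>k\<close> is \<open>(k + 1) / a\<close> times the next one, and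
  \<open>a\<close> was taken large enough. If \<open>k >= 2 * m ^ 2\<close>, the weight is at most
  the one for parameter \<open>k\<close>, and there the weights at \<open>k, ..., k + m - 1\<close>
  are all at least half of the weight at \<open>k\<close> while their sum is at most 1.\<close>

lemma poisson_weight_le:
 assumes m: "0 < m" and a: "real (m * (2 * m\<^sup>2 + 1)) <= a"
 shows "pmf (poisson_pmf a) k <= 2 / real m"
proof -
 have "0 < real (m * (2 * m\<^sup>2 + 1))" using m by(simp add: add_pos_nonneg)
 hence a0: "0 < a" using a by linarith
 show ?thesis
 proof(cases "k < 2 * m\<^sup>2")
  case True
  have "pmf (poisson_pmf a) k * a = real (Suc k) * pmf (poisson_pmf a) (Suc k)"
   unfolding pmf_poisson[OF a0] fact_Suc power_Suc by(simp del: of_nat_Suc)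
  also have "... <= real (Suc k) * 1" by(intro mult_left_mono pmf_le_1) simp
  also have "real (Suc k) * 1 <= real (2 * m\<^sup>2 + 1)" using True unfolding mult_1_right of_nat_le_iff by simp
  finally have "real m * (pmf (poisson_pmf a) k * a) <= real m * real (2 * m\<^sup>2 + 1)"
   by(rule mult_left_mono) simp
  also have "... <= a" using a by(simp only: of_nat_mult)
  finally have "(real m * pmf (poisson_pmf a) k) * a <= 1 * a" by(simp add: mult.assoc)
  hence "real m * pmf (poisson_pmf a) k <= 1" using a0 by(simp only: mult_le_cancel_right_pos)
  thus ?thesis using m by(simp add: field_simps)
 next
  case False
  let ?p = "pmf (poisson_pmf (real k))"
  have k0: "0 < real k" using False m by(cases k) auto
  have mk: "2 * real m ^ 2 <= real k" using False of_nat_mono[of "2 * m\<^sup>2" k, where 'a=real] by simp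
  \<comment> \<open>As a function of its parameter, the Poisson weight at \<open>k\<close> is
    largest for the parameter \<open>k\<close>.\<close>
  have "a / real k <= exp (a / real k - 1)" using exp_ge_add_one_self[of "a / real k - 1"] by simp
  hence "(a / real k) ^ k <= exp (a / real k - 1) ^ k" using a0 by(intro power_mono) auto
  also have "... = exp (a - real k)" using k0 by(simp add: exp_of_nat_mult[symmetric] right_diff_distrib)
  finally have "a ^ k * exp (- a) <= real k ^ k * exp (- real k)"
   using k0 by(simp add: exp_diff exp_minus power_divide field_simps)
  hence 1: "pmf (poisson_pmf a) k <= ?p k"
   using a0 k0 by(simp add: divide_right_mono mult.commute times_divide_eq_right del: times_divide_eq_left)
  \<comment> \<open>Consecutive weights have the ratio \<open>k / (k + j + 1)\<close>, which is at
    least \<open>1 - (j + 1) / k\<close>; the product of these bounds dominates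
    \<open>1 - j ^ 2 / k\<close>, and with \<open>k >= 2 * m ^ 2\<close> it is at least one
    half.\<close>
  have 2: "(1 - real j ^ 2 / real k) * ?p k <= ?p (k + j)" if "j <= m" for j
   using that
  proof(induction j)
   case (Suc j)
   have "real j ^ 2 <= real m ^ 2" using Suc.prems by(intro power_mono) auto
   hence j: "0 <= 1 - real j ^ 2 / real k" using mk k0 zero_le_power2[of "real m"] by(subst diff_ge_0_iff_ge, subst divide_le_eq_1_pos) linarith+
   have "1 - real (Suc j) ^ 2 / real k <= (1 - real j ^ 2 / real k) * (1 - real (Suc j) / real k)"
    using k0 by(simp add: field_simps power2_eq_square)
   also have "... <= (1 - real j ^ 2 / real k) * (real k / real (k + Suc j))"
    using k0 j by(intro mult_left_mono) (auto simp: field_simps)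
   finally have "(1 - real (Suc j) ^ 2 / real k) * ?p k <= (1 - real j ^ 2 / real k) * (real k / real (k + Suc j)) * ?p k"
    by(rule mult_right_mono) simp
   hence "(1 - real (Suc j) ^ 2 / real k) * ?p k <= (1 - real j ^ 2 / real k) * ?p k * (real k / real (k + Suc j))"
    by(simp only: mult.assoc mult.commute mult.left_commute)
   also have "... <= ?p (k + j) * (real k / real (k + Suc j))" using Suc by(intro mult_right_mono) auto
   also have "... = ?p (k + Suc j)" using k0 by(simp add: field_simps)
   finally show ?case .
  qed simp
  have "?p k / 2 <= ?p (k + j)" if "j < m" for j
  proof -
   have "real j ^ 2 <= real m ^ 2" using that by(intro power_mono) auto
   hence "real j ^ 2 / real k <= 1 / 2" using mk by(subst pos_divide_le_eq[OF k0]) linarith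
   hence "1 / 2 <= 1 - real j ^ 2 / real k" by linarith
   hence "1 / 2 * ?p k <= (1 - real j ^ 2 / real k) * ?p k" by(intro mult_right_mono) auto
   from order_trans[OF this 2[of j]] that show ?thesis by simp
  qed
  hence "(\<Sum>j<m. ?p k / 2) <= (\<Sum>j<m. ?p (k + j))" by(intro sum_mono) auto
  also have "... = sum ?p ((+) k ` {..<m})" by(simp add: sum.reindex)
  also have "... <= 1" by(subst measure_measure_pmf_finite[symmetric]) auto
  finally have "?p k <= 2 / real m" using m by(simp add: field_simps)
  thus ?thesis using 1 by simp
 qed
qed

lemma convolution_nonneg:
 assumes "finite_measure M" "finite_measure N" and [measurable_cong]: "sets M = sets borel" "sets N = sets borel"
  and 1: "AE x in M. 0 <= x" and 2: "AE y in N. (0::real) <= y"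
 shows "AE x in convolution M N. 0 <= x"
proof -
 have "(NINT x|M. NINT y|N. indicator {..<0} (x + y)) = (NINT x|M. 0)"
  using 1
 proof(intro nn_integral_cong_AE, eventually_elim)
  case (elim x)
  have "AE y in N. 0 <= x + y" using 2 by eventually_elim (use elim in auto)
  thus ?case by(subst nn_integral_0_iff_AE) (auto elim!: eventually_mono)
 qed
 hence "(NINT x|(convolution M N). indicator {..<0} x) = 0"
  using assms by(subst nn_integral_convolution) auto
 thus ?thesis by(subst (asm) nn_integral_0_iff_AE) (auto elim!: eventually_mono simp: indicator_def split: if_splits)
qed

lemma convolution_laplace:
 assumes "finite_measure M" "finite_measure N" and [measurable_cong]: "sets M = sets borel" "sets N = sets borel"
 shows "(NINT x|(convolution M N). ennreal (exp (- th * x))) = (NINT x|M. ennreal (exp (- th * x))) * (NINT x|N. ennreal (exp (- th * x)))"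
 using assms by(subst nn_integral_convolution)
  (simp_all add: distrib_left exp_add[of "- (th * _)" "- (th * _)", simplified] ennreal_mult' nn_integral_cmult nn_integral_multc)

primrec conv_power :: "real measure => nat => real measure" where
 "conv_power F 0 = return borel 0"
| "conv_power F (Suc k) = convolution F (conv_power F k)"

definition compound_poisson :: "real => real measure => real measure" where
 "compound_poisson a F = measure_pmf (poisson_pmf a) \<bind> conv_power F"

context
 fixes F :: "real measure"
 assumes F: "prob_space F" "sets F = sets borel"
begin

interpretation F: prob_space F by(fact F)

lemma conv_power: "prob_space (conv_power F k)" "sets (conv_power F k) = sets borel"
proof(induction k)
 case (Suc k)
 interpret C: prob_space "conv_power F k" by fact
 interpret pair_prob_space F "conv_power F k" ..
 case 1
 show ?case unfolding conv_power.simps convolution_def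
  using F(2) Suc by(intro prob_space_distr) (simp cong: measurable_cong_sets add: borel_prod)
qed (auto intro: prob_space_return)

lemma nn_integral_conv_power_Suc:
 "f:Borel borel ==> (NINT x|(conv_power F (Suc k)). f x) = (NINT x|F. NINT y|(conv_power F k). f (x + y))"
 unfolding conv_power.simps using conv_power[of k] F
 by(intro nn_integral_convolution) (auto dest: prob_space.axioms(1))

lemma conv_power_laplace:
 "(NINT x|(conv_power F k). ennreal (exp (- th * x))) = (NINT x|F. ennreal (exp (- th * x))) ^ k"
proof(induction k)
 case (Suc k)
 thus ?case unfolding conv_power.simps
  by(subst convolution_laplace) (use F conv_power[of k] in \<open>auto dest: prob_space.axioms(1)\<close>)
qed (simp add: nn_integral_return)

lemma conv_power_gap:
 assumes "AE x in F. r < x" "0 <= r" shows "AE x in conv_power F k. x = 0 \<or> r < x"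
proof(induction k)
 case (Suc k)
 note [measurable_cong] = F(2) conv_power(2)
 have "(NINT x|F. NINT y|(conv_power F k). indicator {x. ~ (x = 0 \<or> r < x)} (x + y)) = (NINT x|F. 0)"
  using assms(1)
 proof(intro nn_integral_cong_AE, eventually_elim)
  case (elim x)
  have "AE y in conv_power F k. x + y = 0 \<or> r < x + y"
   using Suc by eventually_elim (use elim assms(2) in auto)
  thus ?case by(subst nn_integral_0_iff_AE) (auto elim!: eventually_mono)
 qed
 hence "(NINT x|(conv_power F (Suc k)). indicator {x. ~ (x = 0 \<or> r < x)} x) = 0"
  by(subst nn_integral_conv_power_Suc) auto
 thus ?case by(subst (asm) nn_integral_0_iff_AE) (auto elim!: eventually_mono simp: indicator_def split: if_splits)
qed (unfold conv_power.simps, subst AE_return, auto)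

text \<open>A random walk with positive steps visits a point at most once.\<close>
lemma sum_conv_power_atom_le:
 assumes pos: "AE x in F. 0 < x" shows "(\<Sum>k<n. emeasure (conv_power F k) {z}) <= 1"
proof(induction n arbitrary: z)
 case (Suc n)
 note [measurable_cong] = F(2) conv_power(2)
 have step: "emeasure (conv_power F (Suc k)) {z} = (NINT x|F. emeasure (conv_power F k) {z - x})" for k
 proof -
  have "emeasure (conv_power F (Suc k)) {z} = (NINT x|(conv_power F (Suc k)). indicator {z} x)"
   using conv_power(2)[of "Suc k"] by(subst nn_integral_indicator) auto
  also have "... = (NINT x|F. NINT y|(conv_power F k). indicator {z - x} y)"
   by(subst nn_integral_conv_power_Suc) (auto intro!: nn_integral_cong split: split_indicator simp del: nn_integral_indicator)
  finally show ?thesis using conv_power(2)[of k] by simp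
 qed
 show ?case
 proof(cases "z = 0")
  case True
  have "emeasure (conv_power F (Suc k)) {z} = (NINT x|F. 0)" for k
   unfolding step using pos
  proof(intro nn_integral_cong_AE, eventually_elim)
   case (elim x)
   have "AE y in conv_power F k. y ~= z - x"
    using conv_power_gap[OF pos order_refl] by eventually_elim (use elim True in auto)
   thus ?case
    using emeasure_eq_0_AE[of "%y. y = z - x" "conv_power F k"] sets_eq_imp_space_eq[OF conv_power(2)] by simp
  qed
  thus ?thesis by(simp add: sum.lessThan_Suc_shift True del: conv_power.simps(2) sum.lessThan_Suc)
 next
  case False
  have [measurable]: "(%x. emeasure (conv_power F k) {z - x}):Borel F" for k
  proof -
   interpret C: prob_space "conv_power F k" by(rule conv_power)
   have "(%x. (NINT y|(conv_power F k). indicator {0} (z - x - y))):Borel F" by measurable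
   also have "(%x. (NINT y|(conv_power F k). indicator {0} (z - x - y))) = (%x. (NINT y|(conv_power F k). indicator {z - x} y))"
    by(intro ext nn_integral_cong) (auto split: split_indicator)
   finally show ?thesis using conv_power(2)[of k] by simp
  qed
  \<comment> \<open>The zeroth power has no mass at \<open>z\<close>, as \<open>z\<close> is not 0.
    Conditioning the others on the first step leaves one power fewer, at the point
    \<open>z - x\<close>.\<close>
  have "(\<Sum>k<Suc n. emeasure (conv_power F k) {z}) = (NINT x|F. (\<Sum>k<n. emeasure (conv_power F k) {z - x}))"
   by(simp add: sum.lessThan_Suc_shift step nn_integral_sum False del: conv_power.simps(2) sum.lessThan_Suc)
  also have "... <= (NINT x|F. 1)" by(intro nn_integral_mono Suc)
  finally show ?thesis by(simp add: F.emeasure_space_1)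
 qed
qed simp

lemma nn_integral_compound_poisson:
 assumes "0 < a" "f:Borel borel"
 shows "(NINT x|(compound_poisson a F). f x) = (\<Sum>k. ennreal (pmf (poisson_pmf a) k) * (NINT x|(conv_power F k). f x))"
 unfolding compound_poisson_def using assms conv_power
 by(subst nn_integral_bind[where B=borel])
  (auto simp: nn_integral_measure_pmf nn_integral_count_space_nat space_subprob_algebra prob_space_imp_subprob_space)

lemma compound_poisson: "prob_space (compound_poisson a F)" "sets (compound_poisson a F) = sets borel"
 unfolding compound_poisson_def using conv_power
 by(auto intro!: measure_pmf.prob_space_bind[where S=borel] sets_bind[where N=borel]
   simp: space_subprob_algebra prob_space_imp_subprob_space)

lemma compound_poisson_nonneg:
 assumes a: "0 < a" and pos: "AE x in F. 0 < x" shows "AE x in compound_poisson a F. 0 <= x"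
proof -
 note [measurable_cong] = conv_power(2) compound_poisson(2)
 have "(NINT x|(conv_power F k). indicator {..<0} x) = 0" for k
  using conv_power_gap[OF pos order_refl, of k]
  by(subst nn_integral_0_iff_AE) (auto elim!: eventually_mono)
 hence "(NINT x|(compound_poisson a F). indicator {..<0} x) = 0"
  by(subst nn_integral_compound_poisson[OF a]) (simp_all del: nn_integral_indicator)
 thus ?thesis by(subst (asm) nn_integral_0_iff_AE) (auto elim!: eventually_mono simp: indicator_def split: if_splits)
qed

lemma compound_poisson_laplace:
 assumes a: "0 < a" and pos: "AE x in F. 0 < x"
 shows "(NINT x|(compound_poisson a F). ennreal (exp (- real n * x))) =
  ennreal (exp (- a * (1 - enn2real (NINT x|F. ennreal (exp (- real n * x))))))"
proof -
 define l where "l = enn2real (NINT x|F. ennreal (exp (- real n * x)))"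
 have "(NINT x|F. ennreal (exp (- real n * x))) <= (NINT x|F. 1)"
  using pos by(intro nn_integral_mono_AE) (auto elim!: eventually_mono)
 hence l: "(NINT x|F. ennreal (exp (- real n * x))) = ennreal l"
  unfolding l_def by(simp add: F.emeasure_space_1 le_less_trans[of _ 1])
 have l0: "0 <= l" by(simp add: l_def)
 have "(%k. (a * l) ^ k / fact k * exp (- a)) sums (exp (a * l) * exp (- a))"
  using exp_converges[of "a * l"] by(intro sums_mult2) (simp add: divide_inverse mult.commute)
 hence "(\<Sum>k. ennreal ((a * l) ^ k / fact k * exp (- a))) = ennreal (exp (- a * (1 - l)))"
  using a l0 by(subst suminf_ennreal_eq[where x="exp (a * l) * exp (- a)"]) (auto simp: exp_add[symmetric] algebra_simps)
 moreover have "(NINT x|(conv_power F k). ennreal (exp (- real n * x))) = ennreal (l ^ k)" for k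
  unfolding conv_power_laplace l using l0 by(simp add: ennreal_power)
 hence "(NINT x|(compound_poisson a F). ennreal (exp (- real n * x))) = (\<Sum>k. ennreal (pmf (poisson_pmf a) k) * ennreal (l ^ k))"
  by(subst nn_integral_compound_poisson[OF a]) simp_all
 ultimately show ?thesis unfolding l_def[symmetric]
  using a l0 by(simp add: ennreal_mult'[symmetric] power_mult_distrib mult_ac)
qed

end

context
 fixes M :: "'a measure" and nu X
 assumes X: "driftless_subordinator M nu X"
begin

interpretation prob_space M by(rule driftless_subordinatorD[OF X])

text \<open>
  The exponential tilt of the law of \<open>X t\<close> by \<open>exp (- m x)\<close> has the exponent of the
  Levy measure \<open>exp (- m x) \<nu>(dx)\<close>; the remaining part \<open>(1 - exp (- m x)) \<nu>(dx)\<close> of \<open>\<nu>\<close> is finite.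
\<close>
lemma subordinator_law_convolution:
 assumes t: "0 < t" and pos: "0 < laplace_exponent nu (real m)"
 obtains rho F where "prob_space rho" "sets rho = sets borel" "prob_space F" "sets F = sets borel" "AE x in F. 0 < x"
  "distr M borel (X t) = convolution rho (compound_poisson (t * laplace_exponent nu (real m)) F)"
proof -
 define phi where "phi = laplace_exponent nu"
 let ?mu = "distr M borel (X t)" and ?a = "t * phi (real m)"
 \<comment> \<open>\<open>?rho\<close> is the tilted law, normalised by \<open>exp ?a\<close>;
   \<open>?F\<close> is the remaining part of \<open>nu\<close>, normalised by its mass
   \<open>phi (real m)\<close>.\<close>
 let ?rho = "density ?mu (%x. ennreal (exp ?a * exp (- real m * x)))"
 let ?F = "density nu (%x. ennreal ((1 - exp (- real m * x)) / phi (real m)))"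
 note D = driftless_subordinatorD[OF X]
 note [measurable_cong] = levy_sets[OF D(2)]
 have [measurable]: "X t:Borel M" using D(3) t by simp
 have L: "(NINT x|?mu. ennreal (exp (- th * x))) = ennreal (exp (- t * phi th))" if "0 <= th" for th
  using subordinator_laplace(3)[OF X _ that, of t] t by(simp add: nn_integral_distr phi_def)
 have p: "0 < phi (real m)" using pos by(simp add: phi_def)
 have rho: "(NINT x|?rho. ennreal (exp (- th * x))) = ennreal (exp (- t * (phi (th + real m) - phi (real m))))" if "0 <= th" for th
 proof -
  have "(NINT x|?rho. ennreal (exp (- th * x))) = (NINT x|?mu. ennreal (exp (t * phi (real m))) * ennreal (exp (- (th + real m) * x)))"
   by(subst nn_integral_density) (auto intro!: nn_integral_cong simp: ennreal_mult'[symmetric] exp_add[symmetric] algebra_simps)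
  also have "... = ennreal (exp (t * phi (real m))) * ennreal (exp (- t * phi (th + real m)))"
   using L[of "th + real m"] that by(subst nn_integral_cmult) auto
  finally show ?thesis by(simp add: ennreal_mult'[symmetric] exp_add[symmetric] algebra_simps)
 qed
 have P: "prob_space ?rho" by(rule prob_spaceI) (use rho[of 0] in \<open>simp add: emeasure_density nn_integral_density\<close>)
 have F: "prob_space ?F"
 proof(rule prob_spaceI)
  have "(NINT x|nu. ennreal ((1 - exp (- real m * x)) / phi (real m))) = (NINT x|nu. ennreal (1 - exp (- real m * x)) / ennreal (phi (real m)))"
   using levy_AE_pos[OF D(2)] p by(intro nn_integral_cong_AE) (auto elim!: eventually_mono simp: divide_ennreal)
  also have "... = (NINT x|nu. ennreal (1 - exp (- real m * x))) / ennreal (phi (real m))" by(rule nn_integral_divide) measurable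
  also have "... = 1"
   unfolding phi_def laplace_exponent_nn[OF D(2) of_nat_0_le_iff, symmetric] using p by(simp add: divide_ennreal phi_def)
  finally show "emeasure ?F (space ?F) = 1" by(simp add: emeasure_density cong: nn_integral_cong_simp)
 qed
 have pF: "AE x in ?F. 0 < x" using levy_AE_pos[OF D(2)] by(auto simp: AE_density elim!: eventually_mono)
 have sF: "sets ?F = sets borel" by(simp add: levy_sets[OF D(2)])
 let ?C = "compound_poisson ?a ?F"
 have a: "0 < ?a" using t p by simp
 interpret C: prob_space ?C by(rule compound_poisson[OF F sF])
 interpret P: prob_space ?rho by(rule P)
 note sC = compound_poisson(2)[OF F sF, of ?a]
 note [measurable_cong] = sC
 have eF: "phi (real m) * (1 - enn2real (NINT x|?F. ennreal (exp (- real n * x)))) = phi (real m) + phi (real n) - phi (real n + real m)" for n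
 proof -
  have i: "integrable nu (%x. 1 - exp (- th * x))" if "0 <= th" for th by(rule integrable_one_minus_exp[OF D(2) that])
  have e: "(1 - exp (- real m * x)) / phi (real m) * exp (- real n * x) =
    ((1 - exp (- (real n + real m) * x)) - (1 - exp (- real n * x))) / phi (real m)" for x
   by(simp add: algebra_simps diff_divide_distrib exp_add[symmetric])
  have "(NINT x|?F. ennreal (exp (- real n * x))) = (NINT x|nu. ennreal ((1 - exp (- real m * x)) / phi (real m) * exp (- real n * x)))"
   using levy_AE_pos[OF D(2)] p
   by(subst nn_integral_density) (auto intro!: nn_integral_cong_AE elim!: eventually_mono simp: ennreal_mult'[symmetric])
  also have "enn2real ... = (\<integral>x. (1 - exp (- real m * x)) / phi (real m) * exp (- real n * x) \<partial>nu)"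
   using levy_AE_pos[OF D(2)] p by(subst integral_eq_nn_integral) (auto elim!: eventually_mono)
  also have "... = (phi (real n + real m) - phi (real n)) / phi (real m)"
   unfolding e using Bochner_Integration.integral_diff[OF i[of "real n + real m"] i[of "real n"]] by(simp add: phi_def laplace_exponent_def)
  finally show ?thesis using p by(simp add: field_simps)
 qed
 have "?mu = convolution ?rho ?C"
 proof(rule laplace_transform_unique)
  show "finite_measure ?mu" by(intro finite_measure_distr) simp
  show fc: "finite_measure (convolution ?rho ?C)" by(intro convolution_finite P.finite_measure_axioms C.finite_measure_axioms sC) simp
  show "AE x in ?mu. 0 <= x"
   using subordinator_pathD(3)[OF D(4)] t by(subst AE_distr_iff) auto
  hence 1: "AE x in ?rho. 0 <= x" by(simp add: AE_density)
  have 2: "AE y in ?C. 0 <= y" by(rule compound_poisson_nonneg[OF F sF a pF])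
  show "AE x in convolution ?rho ?C. 0 <= x"
   by(rule convolution_nonneg[OF P.finite_measure_axioms C.finite_measure_axioms _ sC 1 2]) simp
  fix n :: nat
  have "(NINT x|(convolution ?rho ?C). ennreal (exp (- real n * x))) =
    (NINT x|?rho. ennreal (exp (- real n * x))) * (NINT x|?C. ennreal (exp (- real n * x)))"
   by(rule convolution_laplace[OF P.finite_measure_axioms C.finite_measure_axioms _ sC]) simp
  also have "... = ennreal (exp (- t * phi (real n)))"
   unfolding compound_poisson_laplace[OF F sF a pF] rho[OF of_nat_0_le_iff]
   using eF[of n] by(simp add: ennreal_mult'[symmetric] exp_add[symmetric] mult.assoc) (simp add: algebra_simps)
  finally show "(NINT x|?mu. ennreal (exp (- real n * x))) = (NINT x|(convolution ?rho ?C). ennreal (exp (- real n * x)))"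
   using L[of "real n"] by simp
 qed simp_all
 thus thesis using that[OF P _ F sF pF] by(simp add: phi_def)
qed

text \<open>The law is a convolution with a compound Poisson law whose rate may be taken arbitrarily
  large, because the exponent is unbounded. An atom of the latter is at most the largest Poisson
  weight times the expected number of visits of the random walk to a point, which is at most 1.
  Convolution does not enlarge atoms.\<close>

lemma subordinator_no_atom:
 assumes inf: "emeasure nu {0<..} = oo" and t: "0 < t"
 shows "AE w in M. X t w ~= z"
proof -
 note D = driftless_subordinatorD[OF X]
 have [measurable]: "X t:Borel M" using D(3) t by simp
 have bound: "prob {w:space M. X t w = z} <= 2 / real (Suc l)" for l
 proof -
  \<comment> \<open>The threshold of \<open>poisson_weight_le\<close> with
    \<open>m = Suc l\<close>.\<close>
  define b where "b = real (Suc l * (2 * (Suc l)\<^sup>2 + 1))"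
  have b0: "0 < b" by(simp add: b_def add_pos_nonneg)
  have "filterlim (%n. laplace_exponent nu (real n)) at_top sequentially"
   using laplace_exponent_limit[OF D(2)] inf by(simp add: ennreal_tendsto_top_eq_at_top)
  hence "\<forall>\<^sub>F n in sequentially. b / t <= laplace_exponent nu (real n)" by(simp add: filterlim_at_top)
  then obtain n where n: "b / t <= laplace_exponent nu (real n)" by(auto simp: eventually_sequentially)
  define a where "a = t * laplace_exponent nu (real n)"
  have ab: "b <= a" using n t by(simp add: a_def field_simps)
  have pos: "0 < laplace_exponent nu (real n)" using n b0 t by(auto intro: less_le_trans[OF divide_pos_pos])
  obtain rho F where C: "prob_space rho" "sets rho = sets borel" "prob_space F" "sets F = sets borel" "AE x in F. 0 < x"
   "distr M borel (X t) = convolution rho (compound_poisson a F)"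
   using subordinator_law_convolution[OF t pos] unfolding a_def by blast
  note F = C(3,4)
  interpret P: prob_space rho by(rule C)
  interpret C: prob_space "compound_poisson a F" by(rule compound_poisson[OF F])
  have sC: "sets (compound_poisson a F) = sets borel" by(rule compound_poisson[OF F])
  have le: "emeasure (compound_poisson a F) {y} <= ennreal (2 / real (Suc l))" for y
  proof -
   have "emeasure (compound_poisson a F) {y} = (NINT x|(compound_poisson a F). indicator {y} x)"
    using sC by(subst nn_integral_indicator) auto
   also have "... = (\<Sum>k. ennreal (pmf (poisson_pmf a) k) * emeasure (conv_power F k) {y})"
    using ab b0 conv_power(2)[OF F] by(subst nn_integral_compound_poisson[OF F]) auto
   also have "... <= (\<Sum>k. ennreal (2 / real (Suc l)) * emeasure (conv_power F k) {y})"
    using ab by(intro suminf_le mult_right_mono ennreal_leI poisson_weight_le) (auto simp: b_def)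
   also have "... <= ennreal (2 / real (Suc l)) * 1"
    unfolding ennreal_suminf_cmult
    by(intro mult_left_mono suminf_le_const sum_conv_power_atom_le[OF F C(5)]) auto
   finally show ?thesis by simp
  qed
  have "emeasure M {w:space M. X t w = z} = emeasure (distr M borel (X t)) {z}"
   by(subst emeasure_distr) (auto intro!: arg_cong[where f="emeasure M"])
  also have "... = (NINT x|rho. emeasure (compound_poisson a F) {y. y + x:{z}})"
   using sC C(2) by(subst C(6), subst convolution_emeasure)
    (auto simp: P.finite_measure_axioms C.finite_measure_axioms dest: sets_eq_imp_space_eq)
  also have "... <= (NINT x|rho. ennreal (2 / real (Suc l)))"
  proof(intro nn_integral_mono)
   fix x
   have "{y. y + x:{z}} = {z - x}" by auto
   thus "emeasure (compound_poisson a F) {y. y + x:{z}} <= ennreal (2 / real (Suc l))" by(simp only: le)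
  qed
  finally show ?thesis by(simp add: P.emeasure_space_1 emeasure_eq_measure)
 qed
 have "(%l. 2 / real (Suc l)) ----> 0"
  using LIMSEQ_Suc[OF tendsto_mult[OF tendsto_const[of 2] lim_1_over_n]] by simp
 hence "prob {w:space M. X t w = z} <= 0"
  by(rule LIMSEQ_le_const) (use bound in auto)
 hence "prob {w:space M. X t w = z} = 0" by(simp add: measure_le_0_iff)
 thus ?thesis by(subst (asm) prob_eq_0) auto
qed

end

section \<open>The joint construction of the component processes\<close>

text \<open>Preimages under \<open>Y i\<close> of events in path space are the preimages under its
  restriction of events in the product space, so the two notions of independence concern the same
  families of events.\<close>

lemma (in prob_space) indep_vars_path_space:
 assumes ind: "indep_vars (%_. Pi\<^sub>M {0..} (%_. borel)) (%i w. restrict (Y i w) {0..}) I"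
  and Y: "!!i. i:I ==> Y i:M ->M path_space"
 shows "indep_vars (%_. path_space) Y I"
proof -
 have "{Y i -` A \<inter> space M |A. A:sets path_space} =
   {(%w. restrict (Y i w) {0..}) -` A \<inter> space M |A. A:sets (Pi\<^sub>M {0..} (%_. borel))}" if i: "i:I" for i
 proof -
  have sp: "subordinator_path (Y i w)" if "w:space M" for w
   using measurable_space[OF Y[OF i] that] by(simp add: space_path_space)
  have s: "sets path_space = (%A. (%f. restrict f {0..}) -` A \<inter> {f. subordinator_path f}) ` sets (Pi\<^sub>M {0..} (%_. borel))"
   unfolding path_space_def by(subst sets_vimage_algebra2) (auto simp: space_PiM)
  have e: "Y i -` ((%f. restrict f {0..}) -` A \<inter> {f. subordinator_path f}) \<inter> space M =
    (%w. restrict (Y i w) {0..}) -` A \<inter> space M" for A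
   using sp by auto
  show ?thesis unfolding setcompr_eq_image s by(simp only: Collect_mem_eq image_image e)
 qed
 thus ?thesis using ind Y unfolding indep_vars_def2 by(simp cong: indep_sets_cong)
qed

locale decomposition = prob_space M for M :: "'a measure" +
 fixes X1 X2 X3 Q S :: "real => 'a => real" and Lam chi :: "real measure" and q :: real and r :: ereal
 assumes q: "0 <= q" and r: "0 < r"
  and chi: "sets chi = sets borel" "emeasure chi {0<..} < oo"
  and Lam_inf: "emeasure (density Lam (%x. ennreal (exp (- q * x)) * indicator {x. ereal x <= r} x)) {0<..} = oo"
  and S: "driftless_subordinator M Lam S"
  and X1: "driftless_subordinator M
   (density Lam (%x. ennreal (exp (- q * x)) * indicator {x. ereal x <= r} x)) X1"
  and X2: "driftless_subordinator M
   (density Lam (%x. ennreal (1 - exp (- q * x)) * indicator {x. ereal x <= r} x)) X2"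
  and X3: "driftless_subordinator M (density Lam (indicator {x. r < ereal x})) X3"
  and Q: "driftless_subordinator M chi Q"
  and indep: "indep_vars (%_. Pi\<^sub>M {0..} (%_. borel))
   (%i w. \<lambda>t\<in>{0..}. ([X1, X2, X3, Q] ! i) t w) {..<4::nat}"
  and S_eq: "S = (%t w. X1 t w + X2 t w + X3 t w)"
begin


lemma path_measurable[measurable]:
 "(%w. traj X1 w):M ->M path_space" "(%w. traj X2 w):M ->M path_space" "(%w. traj X3 w):M ->M path_space"
 "(%w. traj Q w):M ->M path_space" "(%w. traj S w):M ->M path_space"
 using X1 X2 X3 Q S by(auto intro: driftless_subordinator_measurable_path)

lemma path_nice:
 assumes "w:space M"
 shows "subordinator_path (traj X1 w)" "subordinator_path (traj X2 w)" "subordinator_path (traj X3 w)"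
  "subordinator_path (traj Q w)" "subordinator_path (traj S w)"
 using X1 X2 X3 Q S by(auto intro: driftless_subordinatorD(4) assms)

lemma indep_paths: "indep_vars (%_. path_space) (%i w. traj ([X1, X2, X3, Q] ! i) w) {..<4}"
proof(rule indep_vars_path_space)
 show "indep_vars (%_. Pi\<^sub>M {0..} (%_. borel)) (%i w. restrict (traj ([X1, X2, X3, Q] ! i) w) {0..}) {..<4}"
  using indep .
 show "(%w. traj ([X1, X2, X3, Q] ! i) w):M ->M path_space" if "i:{..<4}" for i
 proof -
  have "i = 0 \<or> i = 1 \<or> i = 2 \<or> i = 3" using that by auto
  thus ?thesis by(auto simp: numeral_3_eq_3)
 qed
qed

lemma indep_X1: "indep_pair M (path_space >< path_space >< path_space) (%w. (traj X2 w, traj X3 w, traj Q w))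
  path_space (%w. traj X1 w)"
proof -
 have "indep_var (Pi\<^sub>M {1,2,3} (%_. path_space)) (%w. \<lambda>i\<in>{1,2,3}. traj ([X1, X2, X3, Q] ! i) w)
   (Pi\<^sub>M {0} (%_. path_space)) (%w. \<lambda>i\<in>{0}. traj ([X1, X2, X3, Q] ! i) w)"
  by(rule indep_var_restrict[OF indep_paths]) auto
 from indep_pair_compose[OF this, of "%x. (x 1, x 2, x 3)" "path_space >< path_space >< path_space" "%x. x 0" path_space]
 show ?thesis by(simp add: numeral_3_eq_3 measurable_component_singleton)
qed

lemma indep_Q: "indep_pair M (path_space >< path_space >< path_space) (%w. (traj X1 w, traj X2 w, traj X3 w))
  path_space (%w. traj Q w)"
proof -
 have "indep_var (Pi\<^sub>M {0,1,2} (%_. path_space)) (%w. \<lambda>i\<in>{0,1,2}. traj ([X1, X2, X3, Q] ! i) w)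
   (Pi\<^sub>M {3} (%_. path_space)) (%w. \<lambda>i\<in>{3}. traj ([X1, X2, X3, Q] ! i) w)"
  by(rule indep_var_restrict[OF indep_paths]) auto
 from indep_pair_compose[OF this, of "%x. (x 0, x 1, x 2)" "path_space >< path_space >< path_space" "%x. x 3" path_space]
 show ?thesis by(simp add: numeral_3_eq_3 measurable_component_singleton)
qed

lemma indep_X3: "indep_pair M (path_space >< path_space) (%w. (traj X1 w, traj X2 w)) path_space (%w. traj X3 w)"
proof -
 have "indep_var (Pi\<^sub>M {0,1} (%_. path_space)) (%w. \<lambda>i\<in>{0,1}. traj ([X1, X2, X3, Q] ! i) w)
   (Pi\<^sub>M {2} (%_. path_space)) (%w. \<lambda>i\<in>{2}. traj ([X1, X2, X3, Q] ! i) w)"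
  by(rule indep_var_restrict[OF indep_paths]) auto
 from indep_pair_compose[OF this, of "%x. (x 0, x 1)" "path_space >< path_space" "%x. x 2" path_space]
 show ?thesis by(simp add: numeral_3_eq_3 measurable_component_singleton)
qed

lemma indep_product:
 assumes "f1:Borel path_space" "f2:Borel path_space" "f3:Borel path_space"
 shows "(NINT w|M. f1 (traj X1 w) * f2 (traj X2 w) * f3 (traj X3 w)) =
  (NINT w|M. f1 (traj X1 w)) * (NINT w|M. f2 (traj X2 w)) * ((NINT w|M. f3 (traj X3 w)) :: ennreal)"
proof -
 have "indep_vars (%_. borel) (%i w. ([f1, f2, f3] ! i) (traj ([X1, X2, X3, Q] ! i) w)) {..<3}"
 proof(rule indep_vars_compose2[OF indep_vars_subset[OF indep_paths]])
  fix i :: nat assume "i:{..<3}"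
  hence "i = 0 \<or> i = 1 \<or> i = 2" by auto
  thus "[f1, f2, f3] ! i:Borel path_space" using assms by auto
 qed auto
 from indep_vars_nn_integral[OF _ this] show ?thesis
  by(simp add: numeral_3_eq_3)
qed

lemma infinite_measures:
 "emeasure (density Lam (%x. ennreal (exp (- q * x)) * indicator {x. ereal x <= r} x)) {0<..} = oo"
 "emeasure Lam {0<..} = oo"
proof -
 show "emeasure (density Lam (%x. ennreal (exp (- q * x)) * indicator {x. ereal x <= r} x)) {0<..} = oo" by(rule Lam_inf)
 have s: "sets Lam = sets borel" using driftless_subordinatorD(2)[OF S] by(rule levy_sets)
 note [measurable_cong] = s
 have "oo = (NINT x|Lam. (ennreal (exp (- q * x)) * indicator {x. ereal x <= r} x) * indicator {0<..} x)"
  unfolding Lam_inf[symmetric] by(rule emeasure_density) auto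
 also have "... <= (NINT x|Lam. indicator {0<..} x)"
  using q by(intro nn_integral_mono) (auto simp: indicator_def)
 also have "... = emeasure Lam {0<..}" by simp
 finally show "emeasure Lam {0<..} = oo" by(simp add: top_unique)
qed

end

section \<open>The compensation formula\<close>

lemma path_tendsto_above:
 assumes f: "subordinator_path f" and T: "0 <= T" and b: "b ----> T" "!!n. T <= b n"
 shows "(%n. f (b n)) ----> f T"
proof -
 have "(f ---> f T) (at T within {T..})"
  using subordinator_pathD(4)[OF f T] by(simp add: at_within_Ici_at_right)
 moreover have "filterlim b (at T within {T..}) sequentially \<or> True" by simp
 ultimately have "((f ---> f T) (inf (nhds T) (principal {T..})))"
  by(simp add: at_within_Ici_at_right[symmetric]) (metis (no_types, lifting) at_within_def insert_Diff_single tendsto_at_iff_tendsto_nhds_within)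
 thus ?thesis
  by(rule filterlim_compose) (use b in \<open>auto simp: filterlim_inf filterlim_principal\<close>)
qed

lemma path_tendsto_below:
 assumes f: "subordinator_path f" and T: "0 < T" and a: "a ----> T" "!!n. a n < T"
 shows "(%n. f (a n)) ----> left_limit f (ereal T)"
 by(rule filterlim_compose[OF left_limit_tendsto[OF f T]])
  (use a in \<open>auto simp: filterlim_at less_le\<close>)

lemma path_tendsto_no_jump:
 assumes f: "subordinator_path f" and T: "0 < T" and a: "a ----> T" "!!n. a n <= T" and j: "left_limit f (ereal T) = f T"
 shows "(%n. f (a n)) ----> f T"
proof -
 have "(f ---> f T) (at_left T)" using left_limit_tendsto[OF f T] j by simp
 hence "isCont f T" using subordinator_pathD(4)[OF f, of T] T unfolding isCont_def
  by(auto simp: filterlim_at_split)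
 thus ?thesis using a(1) by(rule isCont_tendsto_compose)
qed

section \<open>Dyadic approximation of the passage over a level\<close>

text \<open>The range becomes part of the unit interval, so one uniform variable probes every level.
  The gain over a cell is \<open>exp (- S a) * (1 - exp (- (S b - S a)))\<close>, a combination of
  exponentials with explicit expectation; this is the reason for this particular scale.\<close>

definition saturation :: "(real => real) => real => real" where
 "saturation f t = 1 - exp (- f t)"

lemma subordinator_path_saturation: "subordinator_path f ==> subordinator_path (saturation f)"
 unfolding subordinator_path_def saturation_def
 by(auto intro!: mono_onI continuous_intros dest: mono_onD)

lemma measurable_saturation:
 assumes "X:N ->M path_space" shows "(%x. saturation (X x)):N ->M path_space"
proof(rule measurable_into_path_space)
 show "subordinator_path (saturation (X x))" if "x:space N" for x
  using measurable_space[OF assms that] by(intro subordinator_path_saturation) (simp add: space_path_space)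
 show "(%x. saturation (X x) t):Borel N" if "0 <= t" for t
  unfolding saturation_def using measurable_eval_path[OF assms that] by measurable
qed

lemma barrier_const: "0 < w ==> barrier (%_. w)"
 by(auto simp: barrier_def intro!: exI[of _ w])

text \<open>The five multipliers belong to the time, the values of \<open>x\<close> and
  \<open>s\<close> at the left end, and their increments over the cell. In the limit these become
  the time, the two left limits and the two jumps.\<close>

definition grid_term :: "(nat => nat) => (real => real) => (real => real) => real => real => real" where
 "grid_term n x s a b = exp (- (real (n 0) * a + real (n 1) * x a + real (n 2) * s a +
   real (n 3) * (x b - x a) + real (n 4) * (s b - s a)))"

text \<open>At most one cell contains the level \<open>w\<close>. The factor
  \<open>1 - exp (- increment)\<close> makes its term vanish in the limit when the level is passed
  without a jump, in accordance with the factor in \<open>jump_mark\<close>.\<close>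

definition grid_sum :: "(nat => nat) => (real => real) => (real => real) => nat => real => ennreal" where
 "grid_sum n x s m w = (\<Sum>k. indicator {saturation s (real k / 2 ^ m)..<saturation s (real (Suc k) / 2 ^ m)} w *
   ennreal ((1 - exp (- (s (real (Suc k) / 2 ^ m) - s (real k / 2 ^ m)))) * grid_term n x s (real k / 2 ^ m) (real (Suc k) / 2 ^ m)))"

definition jump_mark :: "(nat => nat) => (real => real) => (real => real) => ereal => ennreal" where
 "jump_mark n x s tau = (if tau < oo then ennreal (1 - exp (- jump s tau)) *
   ennreal (exp (- (real (n 0) * real_of_ereal tau + real (n 1) * left_limit x tau + real (n 2) * left_limit s tau +
   real (n 3) * jump x tau + real (n 4) * jump s tau))) else 0)"

lemma grid_term_bounds:
 assumes x: "subordinator_path x" and s: "subordinator_path s" and "0 <= a" "a <= b"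
 shows "0 <= grid_term n x s a b" "grid_term n x s a b <= 1" "0 <= 1 - exp (- (s b - s a))" "1 - exp (- (s b - s a)) <= 1"
proof -
 have "0 <= real (n 0) * a + real (n 1) * x a + real (n 2) * s a + real (n 3) * (x b - x a) + real (n 4) * (s b - s a)"
  using subordinator_pathD(2,3)[OF x] subordinator_pathD(2,3)[OF s] assms(3,4)
  by(intro add_nonneg_nonneg mult_nonneg_nonneg) auto
 thus "grid_term n x s a b <= 1" unfolding grid_term_def by simp
 show "0 <= 1 - exp (- (s b - s a))" using subordinator_pathD(2)[OF s assms(3,4)] by simp
qed (simp_all add: grid_term_def)

context
 fixes x s :: "real => real" and w :: real
 assumes x: "subordinator_path x" and s: "subordinator_path s" and w: "0 < w"
begin

lemma cell_unique:
 assumes "w:{saturation s (real k / 2 ^ m)..<saturation s (real (Suc k) / 2 ^ m)}"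
  "w:{saturation s (real l / 2 ^ m)..<saturation s (real (Suc l) / 2 ^ m)}"
 shows "k = l"
proof(rule ccontr)
 note y = subordinator_pathD(2)[OF subordinator_path_saturation[OF s]]
 assume "k ~= l"
 then consider "Suc k <= l" | "Suc l <= k" by linarith
 thus False
 proof cases
  case 1
  hence "saturation s (real (Suc k) / 2 ^ m) <= saturation s (real l / 2 ^ m)"
   by(intro y divide_right_mono) (simp_all del: of_nat_Suc)
  thus ?thesis using assms by auto
 next
  case 2
  hence "saturation s (real (Suc l) / 2 ^ m) <= saturation s (real k / 2 ^ m)"
   by(intro y divide_right_mono) (simp_all del: of_nat_Suc)
  thus ?thesis using assms by auto
 qed
qed

lemma grid_sum_cell:
 assumes "w:{saturation s (real k / 2 ^ m)..<saturation s (real (Suc k) / 2 ^ m)}"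
 shows "grid_sum n x s m w = ennreal ((1 - exp (- (s (real (Suc k) / 2 ^ m) - s (real k / 2 ^ m)))) *
   grid_term n x s (real k / 2 ^ m) (real (Suc k) / 2 ^ m))"
proof -
 define F where "F l = indicator {saturation s (real l / 2 ^ m)..<saturation s (real (Suc l) / 2 ^ m)} w *
   ennreal ((1 - exp (- (s (real (Suc l) / 2 ^ m) - s (real l / 2 ^ m)))) * grid_term n x s (real l / 2 ^ m) (real (Suc l) / 2 ^ m))" for l
 have "(\<Sum>l. F l) = (\<Sum>l\<in>{k}. F l)"
 proof(rule suminf_finite)
  fix l assume "l \<notin> {k}"
  hence "w \<notin> {saturation s (real l / 2 ^ m)..<saturation s (real (Suc l) / 2 ^ m)}"
   using cell_unique[OF assms, of l] by auto
  thus "F l = 0" unfolding F_def by(simp del: of_nat_Suc)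
 qed simp
 also have "... = F k" by simp
 finally show ?thesis using assms unfolding F_def grid_sum_def by(simp del: of_nat_Suc)
qed

lemma grid_sum_le_1: "grid_sum n x s m w <= 1"
proof(cases "EX k. w:{saturation s (real k / 2 ^ m)..<saturation s (real (Suc k) / 2 ^ m)}")
 case True
 then obtain k where k: "w:{saturation s (real k / 2 ^ m)..<saturation s (real (Suc k) / 2 ^ m)}" by auto
 have ab: "0 <= real k / 2 ^ m" "real k / 2 ^ m <= real (Suc k) / 2 ^ m" by(auto intro!: divide_right_mono)
 show ?thesis unfolding grid_sum_cell[OF k]
  using mult_mono[OF grid_term_bounds(4,2)[OF x s ab] _ grid_term_bounds(1)[OF x s ab]]
  by(simp add: ennreal_le_1)
next
 case False
 thus ?thesis by(simp add: grid_sum_def)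
qed

text \<open>The cell that contains \<open>w\<close> brackets the passage time and shrinks to it. If
  its left end coincided with the passage time, the value after the jump would be seen there;
  \<open>dyadic\<close> rules out a jump at such a time.\<close>

lemma grid_sum_tendsto:
 assumes dyadic: "!!k m. 0 < k ==> left_limit s (ereal (real k / 2 ^ m)) = s (real k / 2 ^ m)"
 shows "(%m. grid_sum n x s m w) ----> jump_mark n x s (passage_time (saturation s) (%_. ereal w))"
proof -
 note ys = subordinator_path_saturation[OF s]
 note y = subordinator_pathD[OF ys]
 note wb = barrier_const[of "ereal w"]
 define tau where "tau = passage_time (saturation s) (%_. ereal w)"
 show ?thesis
 proof(cases "tau = oo")
  case True
  have "saturation s t <= w" if "0 <= t" for t
  proof(cases "t = 0")
   case False
   thus ?thesis using below_barrier[of t "saturation s" "%_. ereal w"] that True by(simp add: tau_def)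
  qed (use y(1) w in simp)
  hence "w \<notin> {saturation s (real k / 2 ^ m)..<saturation s (real (Suc k) / 2 ^ m)}" for k m
   by(auto simp: not_less simp del: of_nat_Suc)
  hence "grid_sum n x s m w = 0" for m unfolding grid_sum_def by simp
  thus ?thesis using True by(simp add: jump_mark_def tau_def[symmetric])
 next
  case False
  then obtain T where T: "tau = ereal T" "0 < T"
   using passage_time_pos[OF wb ys] w unfolding tau_def[symmetric] by(cases tau) auto
  have above: "w < saturation s u" if "T < u" for u
   using above_barrier[OF wb ys, of u] w that T(1) by(simp add: tau_def[symmetric])
  have "EX k. w:{saturation s (real k / 2 ^ m)..<saturation s (real (Suc k) / 2 ^ m)}" for m
  proof -
   obtain K :: nat where K: "2 ^ m * T < real K" using reals_Archimedean2 by blast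
   hence "w < saturation s (real K / 2 ^ m)" by(intro above) (simp add: field_simps)
   hence ex: "EX K. w < saturation s (real K / 2 ^ m)" by blast
   define K0 where "K0 = (LEAST K. w < saturation s (real K / 2 ^ m))"
   have K0: "w < saturation s (real K0 / 2 ^ m)" unfolding K0_def using ex by(rule LeastI_ex)
   hence "K0 ~= 0" using y(1) w by(cases "K0 = 0") auto
   then obtain k where k: "K0 = Suc k" by(cases K0) auto
   hence "~ w < saturation s (real k / 2 ^ m)" using not_less_Least[of k "%K. w < saturation s (real K / 2 ^ m)"]
    by(simp add: K0_def)
   thus ?thesis using K0 k by(intro exI[of _ k]) (auto simp del: of_nat_Suc)
  qed
  then obtain k where k: "!!m. w:{saturation s (real (k m) / 2 ^ m)..<saturation s (real (Suc (k m)) / 2 ^ m)}" by metis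
  define a where "a m = real (k m) / 2 ^ m" for m
  define b where "b m = real (Suc (k m)) / 2 ^ m" for m
  have ab: "b m = a m + 1 / 2 ^ m" for m by(simp add: a_def b_def add_divide_distrib)
  have aT: "a m <= T" for m
   using above[of "a m"] k[of m] by(force simp: a_def)
  have Tb: "T <= b m" for m
  proof -
   have "tau <= ereal (b m)" unfolding tau_def using k[of m] by(intro passage_time_le) (auto simp: b_def)
   thus ?thesis using T by simp
  qed
  have alim: "a ----> T"
  proof(rule tendsto_sandwich[of "%m. T - 1 / 2 ^ m" _ _ "%_. T"])
   show "\<forall>\<^sub>F m in sequentially. T - 1 / 2 ^ m <= a m" using Tb ab by(auto simp: algebra_simps)
   show "(%m. T - 1 / 2 ^ m) ----> T" using tendsto_diff[OF tendsto_const inverse_two_power_tendsto, of T] by simp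
  qed (use aT in auto)
  have blim: "b ----> T"
   using tendsto_add[OF alim inverse_two_power_tendsto] by(simp add: ab[abs_def])
  have sb: "(%m. s (b m)) ----> s T" and xb: "(%m. x (b m)) ----> x T"
   using path_tendsto_above[OF s less_imp_le[OF T(2)] blim Tb] path_tendsto_above[OF x less_imp_le[OF T(2)] blim Tb] by auto
  have gs: "grid_sum n x s m w = ennreal ((1 - exp (- (s (b m) - s (a m)))) * grid_term n x s (a m) (b m))" for m
   unfolding a_def b_def by(rule grid_sum_cell[OF k])
  have jm: "jump_mark n x s tau = ennreal (1 - exp (- jump s T)) *
    ennreal (exp (- (real (n 0) * T + real (n 1) * left_limit x T + real (n 2) * left_limit s T + real (n 3) * jump x T + real (n 4) * jump s T)))"
   by(simp add: jump_mark_def T)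
  show ?thesis
  proof(cases "jump s T = 0")
   case True
   hence "left_limit s (ereal T) = s T" using T by(simp add: jump_def)
   hence sa: "(%m. s (a m)) ----> s T" by(rule path_tendsto_no_jump[OF s T(2) alim aT])
   have 1: "(%m. 1 - exp (- (s (b m) - s (a m)))) ----> 1 - exp (- (s T - s T))"
    by(intro tendsto_intros sa sb)
   have "(%m. (1 - exp (- (s (b m) - s (a m)))) * grid_term n x s (a m) (b m)) ----> 0"
   proof(rule tendsto_sandwich[OF _ _ tendsto_const])
    have ab': "0 <= a m" "a m <= b m" for m by(auto simp: a_def b_def intro!: divide_right_mono)
    show "\<forall>\<^sub>F m in sequentially. 0 <= (1 - exp (- (s (b m) - s (a m)))) * grid_term n x s (a m) (b m)"
     using grid_term_bounds[OF x s ab'] by(auto intro!: mult_nonneg_nonneg)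
    show "\<forall>\<^sub>F m in sequentially. (1 - exp (- (s (b m) - s (a m)))) * grid_term n x s (a m) (b m) <= 1 - exp (- (s (b m) - s (a m)))"
     using grid_term_bounds[OF x s ab'] by(intro always_eventually allI mult_left_le) auto
    show "(%m. 1 - exp (- (s (b m) - s (a m)))) ----> 0" using 1 by simp
   qed
   from tendsto_ennrealI[OF this] show ?thesis unfolding tau_def[symmetric] jm by(simp add: gs True)
  next
   case False
   have "a m ~= T" for m
   proof
    assume aT: "a m = T"
    hence "0 < k m" using T(2) by(cases "k m = 0") (auto simp: a_def)
    from dyadic[OF this, of m] have "jump s T = 0" using T(2) aT by(simp add: a_def jump_def)
    thus False using False by simp
   qed
   hence aT': "a m < T" for m using aT[of m] by(auto simp: less_le)
   have sa: "(%m. s (a m)) ----> left_limit s T" and xa: "(%m. x (a m)) ----> left_limit x T"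
    using path_tendsto_below[OF s T(2) alim aT'] path_tendsto_below[OF x T(2) alim aT'] by auto
   have js: "jump s T = s T - left_limit s T" "jump x T = x T - left_limit x T" using T by(auto simp: jump_def)
   have "(%m. (1 - exp (- (s (b m) - s (a m)))) * grid_term n x s (a m) (b m)) ---->
     (1 - exp (- jump s T)) * exp (- (real (n 0) * T + real (n 1) * left_limit x T + real (n 2) * left_limit s T + real (n 3) * jump x T + real (n 4) * jump s T))"
    unfolding grid_term_def js by(intro tendsto_intros sa sb xa xb alim)
   from tendsto_ennrealI[OF this] show ?thesis unfolding tau_def[symmetric] jm
    using jump_nonneg[OF s, of T] by(simp add: gs ennreal_mult)
  qed
 qed
qed

end

lemma subordinator_laplace_increment:
 assumes X: "driftless_subordinator M nu X" and s: "0 <= s" "0 <= h"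
 shows "(NINT w|M. ennreal (exp (- (real a * X s w + real b * (X (s + h) w - X s w))))) =
   ennreal (exp (- (s * laplace_exponent nu (real a) + h * laplace_exponent nu (real b))))"
proof -
 define u where "u i = (if i = 0 then 0 else if i = 1 then s else s + h)" for i :: nat
 have "mono u" using s by(auto simp: u_def mono_def)
 from subordinator_increments_laplace[OF X this, of "%i. if i = 0 then real a else real b" "Suc (Suc 0)"]
 show ?thesis
  using subordinator_laplace(3)[OF X s(1), of "real a"] subordinator_laplace(3)[OF X s(2), of "real b"]
   subordinator_pathD(1)[OF driftless_subordinatorD(4)[OF X]]
  by(simp add: u_def ennreal_mult'[symmetric] exp_add[symmetric] cong: nn_integral_cong_simp)
qed

section \<open>Joint transforms of X1 and S\<close>

context decomposition
begin

definition thin :: "real => real" where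
 "thin x = (if ereal x <= r then exp (- q * x) else 0)"

text \<open>The joint Laplace exponent of \<open>X1\<close> and \<open>S\<close> at
  \<open>(a, b)\<close>: a jump \<open>x\<close> of \<open>S\<close> also belongs to
  \<open>X1\<close> with the acceptance probability \<open>thin x\<close> of Step 6, and to
  \<open>S\<close> alone otherwise.\<close>

definition Phi :: "real => real => real" where
 "Phi a b = (\<integral>x. thin x * (1 - exp (- (a + b) * x)) + (1 - thin x) * (1 - exp (- b * x)) \<partial>Lam)"

lemma measurable_thin[measurable]: "thin:Borel borel"
 unfolding thin_def by measurable

lemma thin_bounds: "0 <= thin x" "0 <= x ==> thin x <= 1"
 using q by(auto simp: thin_def)

lemma levy_Lam: "levy_measure Lam" using S by(rule driftless_subordinatorD)

lemma sets_Lam[measurable_cong]: "sets Lam = sets borel" by(rule levy_sets[OF levy_Lam])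

lemma sigma_finite_Lam: "sigma_finite_measure Lam"
proof
 let ?A = "insert {..0} (range (%n::nat. {1 / real (Suc n)..}))"
 have fin: "emeasure Lam {1 / real (Suc n)..} ~= oo" for n
 proof -
  let ?c = "1 / real (Suc n)"
  have "ennreal ?c * emeasure Lam {?c..} = (NINT x|Lam. ennreal ?c * indicator {?c..} x)"
   by(subst nn_integral_cmult_indicator) auto
  also have "... <= (NINT x|Lam. ennreal (min 1 x))"
   by(intro nn_integral_mono) (auto simp: indicator_def intro!: ennreal_leI)
  also have "... < oo" using levy_Lam by(simp add: levy_measure_def)
  finally show ?thesis by(auto simp: ennreal_mult_less_top ennreal_mult_eq_top_iff)
 qed
 show "EX A. countable A & A \<subseteq> sets Lam & \<Union> A = space Lam & (ALL a:A. emeasure Lam a ~= oo)"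
 proof(intro exI[of _ ?A] conjI ballI)
  show "\<Union> ?A = space Lam"
  proof -
   have "EX n. 1 / real (Suc n) <= x" if "0 < x" for x :: real
    using that by(metis less_imp_le nat_approx_posE)
   hence "x:\<Union> ?A" for x :: real by(cases "0 < x") (auto simp del: of_nat_Suc simp: not_less)
   thus ?thesis by(auto simp: sets_eq_imp_space_eq[OF sets_Lam])
  qed
  show "emeasure Lam a ~= oo" if "a:?A" for a
   using that fin levy_Lam by(auto simp: levy_measure_def)
 qed auto
qed

lemma Lam_AE_pos: "AE x in Lam. 0 < x" by(rule levy_AE_pos[OF levy_Lam])

lemma one_minus_exp_integrable:
 assumes [measurable]: "h:Borel borel" and h: "!!x. 0 < x ==> \<bar>h x\<bar> <= 1" and th: "0 <= th"
 shows "integrable Lam (%x. h x * (1 - exp (- th * x)))"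
proof(rule levy_integrable[OF levy_Lam, where C="max 1 th"])
 fix x :: real assume x: "0 < x"
 have "\<bar>h x * (1 - exp (- th * x))\<bar> <= 1 * (1 - exp (- th * x))"
  unfolding abs_mult using h[OF x] th x by(intro mult_mono) auto
 also have "... <= max 1 th * min 1 x" using one_minus_exp_le_min[OF levy_Lam, of x th] th x by simp
 finally show "\<bar>h x * (1 - exp (- th * x))\<bar> <= max 1 th * min 1 x" .
qed measurable

text \<open>\<open>X1\<close> is part of both coordinates, hence the argument \<open>a + b\<close>;
  \<open>X2\<close> and \<open>X3\<close> enter \<open>S\<close> only, and their densities add up to
  \<open>1 - thin\<close>.\<close>

lemma laplace_exponents:
 assumes "0 <= a" "0 <= b"
 shows "laplace_exponent (density Lam (%x. ennreal (exp (- q * x)) * indicator {x. ereal x <= r} x)) (a + b) +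
  laplace_exponent (density Lam (%x. ennreal (1 - exp (- q * x)) * indicator {x. ereal x <= r} x)) b +
  laplace_exponent (density Lam (indicator {x. r < ereal x})) b = Phi a b"
proof -
 define h2 where "h2 x = (if ereal x <= r then 1 - exp (- q * x) else 0)" for x
 define h3 where "h3 x = (if r < ereal x then 1 else (0::real))" for x
 have [measurable]: "h2:Borel borel" "h3:Borel borel" unfolding h2_def h3_def by measurable
 have e: "(%x. ennreal (exp (- q * x)) * indicator {x. ereal x <= r} x) = (%x. ennreal (thin x))"
  "(%x. ennreal (1 - exp (- q * x)) * indicator {x. ereal x <= r} x) = (%x. ennreal (h2 x))"
  "indicator {x. r < ereal x} = (%x. ennreal (h3 x))"
  by(auto simp: thin_def h2_def h3_def fun_eq_iff)
 have le: "laplace_exponent (density Lam (%x. ennreal (h x))) th = (\<integral>x. h x * (1 - exp (- th * x)) \<partial>Lam)"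
  if [measurable]: "h:Borel borel" and "!!x. 0 < x ==> 0 <= h x" for h th
  unfolding laplace_exponent_def using that(2) Lam_AE_pos
  by(subst integral_density) (auto elim!: eventually_mono)
 have sum: "h2 x + h3 x = 1 - thin x" for x by(auto simp: h2_def h3_def thin_def)
 have i: "integrable Lam (%x. thin x * (1 - exp (- (a + b) * x)))" "integrable Lam (%x. h2 x * (1 - exp (- b * x)))"
  "integrable Lam (%x. h3 x * (1 - exp (- b * x)))"
  using assms q by(intro one_minus_exp_integrable; auto simp: thin_def h2_def h3_def)+
 have "Phi a b = (\<integral>x. thin x * (1 - exp (- (a + b) * x)) + h2 x * (1 - exp (- b * x)) + h3 x * (1 - exp (- b * x)) \<partial>Lam)"
  unfolding Phi_def sum[symmetric] by(simp add: algebra_simps)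
 also have "... = (\<integral>x. thin x * (1 - exp (- (a + b) * x)) \<partial>Lam) + (\<integral>x. h2 x * (1 - exp (- b * x)) \<partial>Lam) + (\<integral>x. h3 x * (1 - exp (- b * x)) \<partial>Lam)"
  using i by simp
 also have "... = laplace_exponent (density Lam (%x. ennreal (thin x))) (a + b) + laplace_exponent (density Lam (%x. ennreal (h2 x))) b +
  laplace_exponent (density Lam (%x. ennreal (h3 x))) b"
  using q by(subst (1 2 3) le) (auto simp: thin_bounds h2_def h3_def)
 finally show ?thesis unfolding e by simp
qed

lemma grid_laplace:
 assumes s: "0 <= s" "0 <= h"
 shows "(NINT w|M. ennreal (exp (- (real a * X1 s w + real b * S s w + real c * (X1 (s + h) w - X1 s w) +
   real d * (S (s + h) w - S s w))))) =
  ennreal (exp (- (s * Phi (real a) (real b) + h * Phi (real c) (real d))))"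
proof -
 define f where "f i j x = ennreal (exp (- (real i * x s + real j * (x (s + h) - x s))))" for i j :: nat and x :: "real => real"
 have f: "f i j:Borel path_space" for i j
 proof -
  have [measurable]: "(%x. x s):Borel path_space" "(%x. x (s + h)):Borel path_space"
   using s by(auto intro: measurable_eval_path[of "%x. x"])
  show ?thesis unfolding f_def by measurable
 qed
 have "(NINT w|M. ennreal (exp (- (real a * X1 s w + real b * S s w + real c * (X1 (s + h) w - X1 s w) +
   real d * (S (s + h) w - S s w))))) = (NINT w|M. f (a + b) (c + d) (traj X1 w) * f b d (traj X2 w) * f b d (traj X3 w))"
  by(intro nn_integral_cong)
   (simp add: f_def S_eq ennreal_mult'[symmetric] exp_add[symmetric], simp add: algebra_simps)
 also have "... = (NINT w|M. f (a + b) (c + d) (traj X1 w)) * (NINT w|M. f b d (traj X2 w)) * (NINT w|M. f b d (traj X3 w))"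
  by(rule indep_product) (rule f)+
 also have "... = ennreal (exp (- (s * Phi (real a) (real b) + h * Phi (real c) (real d))))"
  unfolding f_def subordinator_laplace_increment[OF X1 s] subordinator_laplace_increment[OF X2 s] subordinator_laplace_increment[OF X3 s]
   laplace_exponents[OF of_nat_0_le_iff of_nat_0_le_iff, symmetric]
  by(simp add: ennreal_mult'[symmetric] exp_add[symmetric], simp add: algebra_simps)
 finally show ?thesis .
qed

lemma Phi_integrable:
 assumes "0 <= a" "0 <= b"
 shows "integrable Lam (%x. thin x * (1 - exp (- (a + b) * x)) + (1 - thin x) * (1 - exp (- b * x)))"
proof -
 have "\<bar>thin x\<bar> <= 1 & \<bar>1 - thin x\<bar> <= 1" if "0 < x" for x
  using thin_bounds(1)[of x] thin_bounds(2)[of x] that by auto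
 thus ?thesis
  using assms by(intro Bochner_Integration.integrable_add one_minus_exp_integrable) auto
qed

lemma Phi_pos: assumes "0 <= a" "1 <= b" shows "0 < Phi a b"
proof -
 have "laplace_exponent Lam 1 <= Phi a b"
  unfolding laplace_exponent_def Phi_def
 proof(rule integral_mono_AE[OF integrable_one_minus_exp[OF levy_Lam] Phi_integrable])
  show "AE x in Lam. 1 - exp (- 1 * x) <= thin x * (1 - exp (- (a + b) * x)) + (1 - thin x) * (1 - exp (- b * x))"
   using Lam_AE_pos
  proof eventually_elim
   case (elim x)
   have "x * 1 <= x * b" "x * 1 <= x * (a + b)" using elim assms by(auto intro!: mult_left_mono)
   hence "thin x * (1 - exp (- 1 * x)) + (1 - thin x) * (1 - exp (- 1 * x)) <=
     thin x * (1 - exp (- (a + b) * x)) + (1 - thin x) * (1 - exp (- b * x))"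
    using thin_bounds[of x] elim by(intro add_mono mult_left_mono) (auto simp: algebra_simps)
   thus ?case by(simp add: algebra_simps)
  qed
 qed (use assms in auto)
 moreover have "0 < laplace_exponent Lam 1" using laplace_exponent_pos[OF levy_Lam] infinite_measures(2) by simp
 ultimately show ?thesis by simp
qed

text \<open>Minus the second difference of \<open>Phi\<close> in its second argument. By
  \<open>jump_rate_nn\<close> it is an integral over jump sizes with weight
  \<open>(1 - exp (- x)) ^ 2\<close>: one factor is due to the level hitting the jump, the other one
  to the factor put into \<open>grid_sum\<close>.\<close>

definition jump_rate :: "nat => nat => real" where
 "jump_rate c d = 2 * Phi (real c) (real (d + 1)) - Phi (real c) (real d) - Phi (real c) (real (d + 2))"

lemma jump_rate_nn:
 "(NINT x|Lam. ennreal ((1 - exp (- x))\<^sup>2 * exp (- real d * x) * (thin x * exp (- real c * x) + (1 - thin x)))) = ennreal (jump_rate c d)"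
proof -
 let ?g = "%j x. thin x * (1 - exp (- (real c + real (d + j)) * x)) + (1 - thin x) * (1 - exp (- real (d + j) * x))"
 have i: "integrable Lam (?g j)" for j by(rule Phi_integrable) auto
 have eq: "(1 - exp (- x))\<^sup>2 * exp (- real d * x) * (thin x * exp (- real c * x) + (1 - thin x)) = 2 * ?g 1 x - ?g 0 x - ?g 2 x" for x
 proof -
  define z where "z = exp (- x)"
  define E where "E = exp (- real d * x)"
  define C where "C = exp (- real c * x)"
  have g: "?g j x = thin x * (1 - C * E * z ^ j) + (1 - thin x) * (1 - E * z ^ j)" for j
   unfolding z_def E_def C_def by(simp add: exp_of_nat_mult[symmetric] exp_add[symmetric] algebra_simps)
  show ?thesis unfolding g z_def[symmetric] E_def[symmetric] C_def[symmetric] by(simp add: power2_eq_square algebra_simps)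
 qed
 have "(NINT x|Lam. ennreal ((1 - exp (- x))\<^sup>2 * exp (- real d * x) * (thin x * exp (- real c * x) + (1 - thin x)))) =
   ennreal (\<integral>x. 2 * ?g 1 x - ?g 0 x - ?g 2 x \<partial>Lam)"
  unfolding eq
 proof(rule nn_integral_eq_integral)
  show "AE x in Lam. 0 <= 2 * ?g 1 x - ?g 0 x - ?g 2 x"
   unfolding eq[symmetric] using Lam_AE_pos
   by eventually_elim (auto intro!: mult_nonneg_nonneg add_nonneg_nonneg thin_bounds simp: thin_bounds(2))
 qed (intro Bochner_Integration.integrable_diff integrable_mult_right i)
 also have "(\<integral>x. 2 * ?g 1 x - ?g 0 x - ?g 2 x \<partial>Lam) = jump_rate c d"
 proof -
  have *: "(\<integral>x. 2 * f1 x - f0 x - f2 x \<partial>Lam) = 2 * (\<integral>x. f1 x \<partial>Lam) - (\<integral>x. f0 x \<partial>Lam) - (\<integral>x. f2 x \<partial>Lam)"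
   if "integrable Lam f0" "integrable Lam f1" "integrable Lam f2" for f0 f1 f2 :: "real => real"
   using that by simp
  show ?thesis using *[OF i i i, of 1 0 2] by(simp add: jump_rate_def Phi_def)
 qed
 finally show ?thesis .
qed

end

context decomposition
begin

lemma sigma_finite_M: "sigma_finite_measure M" by unfold_locales

lemma path_at_measurable:
 assumes "v:Borel N" "!!z. z:space N ==> 0 <= v z" "g:N ->M M"
 shows "(%z. X1 (v z) (g z)):Borel N" "(%z. S (v z) (g z)):Borel N"
 using measurable_path_at[where X="%z. traj X1 (g z)" and v=v] measurable_path_at[where X="%z. traj S (g z)" and v=v] assms
  measurable_compose[OF assms(3) path_measurable(1)] measurable_compose[OF assms(3) path_measurable(5)]
 by auto

definition level_time :: "real \<times> 'a => ereal" where
 "level_time z = passage_time (saturation (traj S (snd z))) (%_. ereal (fst z))"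

lemma measurable_level_time[measurable]: "level_time:Borel (lborel >< M)"
 unfolding level_time_def
 by(rule measurable_passage_time)
  (auto intro!: measurable_saturation measurable_compose[OF measurable_snd path_measurable(5)])

text \<open>The saturation gain and the factor in \<open>grid_sum\<close> together give
  \<open>exp (- S a)\<close> times the square of \<open>1 - exp (- increment)\<close>. Expanded, the
  square leaves three exponentials, each of which is known from \<open>grid_laplace\<close>. The
  factor \<open>exp (- S a)\<close> accounts for \<open>n 2 + 1\<close> in \<open>A\<close>.\<close>

lemma grid_expectation:
 fixes n :: "nat => nat"
 assumes a: "0 <= a" "0 <= h"
 defines "A \<equiv> real (n 0) + Phi (real (n 1)) (real (n 2 + 1))"
  and "B j \<equiv> Phi (real (n 3)) (real (n 4 + j))"
 shows "(NINT w|M. ennreal (saturation (traj S w) (a + h) - saturation (traj S w) a) *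
   ennreal ((1 - exp (- (S (a + h) w - S a w))) * grid_term n (traj X1 w) (traj S w) a (a + h))) =
  ennreal (exp (- a * A) * (exp (- h * B 0) - 2 * exp (- h * B 1) + exp (- h * B 2)))"
  and "0 <= exp (- h * B 0) - 2 * exp (- h * B 1) + exp (- h * B 2)"
proof -
 let ?g = "%w. grid_term n (traj X1 w) (traj S w) a (a + h)" and ?D = "%w. S (a + h) w - S a w"
 let ?X = "%j w. real (n 1) * X1 a w + real (n 2 + 1) * S a w + real (n 3) * (X1 (a + h) w - X1 a w) + real (n 4 + j) * ?D w"
 let ?B = "exp (- h * B 0) - 2 * exp (- h * B 1) + exp (- h * B 2)"
 let ?I = "%w. ennreal (saturation (traj S w) (a + h) - saturation (traj S w) a) * ennreal ((1 - exp (- ?D w)) * ?g w)"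
 define T where "T w = exp (- S a w) * (1 - exp (- ?D w))\<^sup>2 * ?g w" for w
 define E where "E j w = exp (- (real (n 0) * a)) * exp (- ?X j w)" for j w
 define v where "v j = exp (- a * A) * exp (- h * B j)" for j
 have [measurable]: "S a:Borel M" "S (a + h):Borel M" "X1 a:Borel M" "X1 (a + h):Borel M"
  using a by(auto intro: driftless_subordinatorD(3)[OF S] driftless_subordinatorD(3)[OF X1])
 have [measurable]: "T:Borel M" "E j:Borel M" for j
  unfolding T_def E_def grid_term_def by measurable
 have T0: "0 <= T w" if "w:space M" for w by(simp add: T_def grid_term_def)
 \<comment> \<open>The expanded square is arranged without subtraction, which would be truncated for
   extended nonnegative integrals.\<close>
 have TE: "T w + 2 * E 1 w = E 0 w + E 2 w" for w
 proof -
  define z where "z = exp (- ?D w)"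
  define c where "c = exp (- S a w) * ?g w"
  have E: "E j w = c * z ^ j" for j
   unfolding E_def c_def z_def grid_term_def
   by(simp add: exp_of_nat_mult[symmetric] exp_add[symmetric]) (simp add: algebra_simps)
  have "T w = c * (1 - z)\<^sup>2" by(simp add: T_def c_def z_def)
  thus ?thesis by(simp add: E power2_eq_square algebra_simps)
 qed
 have nE: "(NINT w|M. ennreal (E j w)) = ennreal (v j)" for j
 proof -
  have "(NINT w|M. ennreal (E j w)) = ennreal (exp (- (real (n 0) * a))) *
    (NINT w|M. ennreal (exp (- ?X j w)))"
   unfolding E_def by(subst nn_integral_cmult[symmetric]) (auto simp: ennreal_mult')
  also have "... = ennreal (v j)"
   unfolding grid_laplace[OF a] v_def A_def B_def
   by(simp add: ennreal_mult'[symmetric] exp_add[symmetric] del: of_nat_add) (simp add: algebra_simps)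
  finally show ?thesis .
 qed
 let ?T = "(NINT w|M. ennreal (T w))"
 have "(NINT w|M. ennreal (T w) + 2 * ennreal (E 1 w)) = (NINT w|M. ennreal (E 0 w) + ennreal (E 2 w))"
 proof(intro nn_integral_cong)
  fix w assume w: "w:space M"
  have E0: "0 <= E j w" for j by(simp add: E_def)
  have "ennreal (T w) + 2 * ennreal (E 1 w) = ennreal (T w + 2 * E 1 w)"
   using T0[OF w] E0[of 1] by(simp add: ennreal_plus ennreal_mult ennreal_numeral[symmetric] del: ennreal_numeral)
  also have "... = ennreal (E 0 w) + ennreal (E 2 w)" unfolding TE using E0 by(simp add: ennreal_plus)
  finally show "ennreal (T w) + 2 * ennreal (E 1 w) = ennreal (E 0 w) + ennreal (E 2 w)" .
 qed
 hence "?T + 2 * ennreal (v 1) = ennreal (v 0) + ennreal (v 2)"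
  by(simp add: nn_integral_add nn_integral_cmult nE)
 hence *: "?T + ennreal (2 * v 1) = ennreal (v 0 + v 2)"
 proof -
  have "ennreal (2 * v 1) = 2 * ennreal (v 1)" by(subst ennreal_mult) (auto simp: v_def)
  moreover have "ennreal (v 0 + v 2) = ennreal (v 0) + ennreal (v 2)" by(rule ennreal_plus) (auto simp: v_def)
  ultimately show ?thesis using \<open>?T + 2 * ennreal (v 1) = ennreal (v 0) + ennreal (v 2)\<close> by simp
 qed
 have "ennreal (2 * v 1) <= ennreal (v 0 + v 2)" unfolding *[symmetric] by(rule add_increasing) auto
 hence le: "2 * v 1 <= v 0 + v 2" by(subst (asm) ennreal_le_iff) (auto simp: v_def)
 hence "exp (- a * A) * (?B) >= 0" by(simp add: v_def algebra_simps)
 thus pos: "0 <= ?B" by(simp add: zero_le_mult_iff)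
 have "?T = ennreal (v 0 + v 2) - ennreal (2 * v 1)"
  unfolding *[symmetric] by(rule ennreal_add_diff_cancel_right[symmetric]) simp
 also have "... = ennreal (v 0 + v 2 - 2 * v 1)" by(rule ennreal_minus) (simp add: v_def)
 also have "v 0 + v 2 - 2 * v 1 = exp (- a * A) * (?B)" by(simp add: v_def algebra_simps)
 finally have "?T = ennreal (exp (- a * A) * (?B))" .
 moreover have "(NINT w|M. ?I w) = ?T"
 proof(intro nn_integral_cong)
  fix w assume "w:space M"
  define z where "z = 1 - exp (- ?D w)"
  define g where "g = ?g w"
  have "saturation (traj S w) (a + h) - saturation (traj S w) a = exp (- S a w) * z"
   by(simp add: saturation_def z_def algebra_simps exp_add[symmetric])
  moreover have "0 <= exp (- S a w) * z"
   using subordinator_pathD(2)[OF path_nice(5)[OF \<open>w:space M\<close>], of a "a + h"] a by(auto simp: z_def)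
  moreover have "T w = exp (- S a w) * z * (z * g)"
   unfolding T_def z_def[symmetric] g_def[symmetric] by(simp add: power2_eq_square)
  ultimately show "?I w = ennreal (T w)"
   unfolding z_def[symmetric] g_def[symmetric] by(simp only: ennreal_mult'[symmetric])
 qed
 ultimately show "(NINT w|M. ?I w) =
  ennreal (exp (- a * A) * (?B))" by simp
qed

lemma nn_integral_cell:
 assumes "0 <= a" "a <= b" "b <= 1"
 shows "(NINT p|lborel. indicator {0<..<1} p * indicator {a..<b} p) = ennreal (b - a)"
proof -
 have "(NINT p|lborel. indicator {0<..<1} p * indicator {a..<b} p) = (NINT p|lborel. indicator {a..<b} p)"
 proof(intro nn_integral_cong_AE)
  show "AE p in lborel. indicator {0<..<1} p * indicator {a..<b} p = (indicator {a..<b} p :: ennreal)"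
   using AE_lborel_singleton[of 0] by eventually_elim (use assms in \<open>auto simp: indicator_def\<close>)
 qed
 thus ?thesis using assms by simp
qed

lemma AE_snd_lborel:
 assumes "AE w in M. P w" shows "AE z in lborel >< M. P (snd z)"
proof -
 obtain N where N: "{w:space M. ~ P w} \<subseteq> N" "N:sets M" "emeasure M N = 0"
  using assms by(rule AE_E)
 have "emeasure (lborel >< M) (UNIV \<times> N) = 0"
  using N by(subst emeasure_pair_measure_Times) auto
 hence "UNIV \<times> N:null_sets (lborel >< M)" using N(2) by(auto simp: null_sets_def)
 thus ?thesis by(rule AE_I') (use N(1) in \<open>auto simp: space_pair_measure\<close>)
qed

text \<open>At mesh \<open>h\<close> the expectation of the grid sum is a geometric series over the
  cells with ratio \<open>exp (- h * A)\<close>, times the three-term combination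
  \<open>?g h\<close>. As \<open>h\<close> tends to 0, the quotient tends to that of the derivatives
  at 0, which are \<open>jump_rate\<close> and \<open>A\<close>.\<close>

lemma level_laplace:
 fixes n :: "nat => nat"
 shows "(NINT z|(lborel >< M). indicator {0<..<1} (fst z) * jump_mark n (traj X1 (snd z)) (traj S (snd z)) (level_time z)) =
  ennreal (jump_rate (n 3) (n 4) / (real (n 0) + Phi (real (n 1)) (real (n 2 + 1))))"
proof -
 define A where "A = real (n 0) + Phi (real (n 1)) (real (n 2 + 1))"
 define B where "B j = Phi (real (n 3)) (real (n 4 + j))" for j
 have A: "0 < A" unfolding A_def using Phi_pos[of "real (n 1)" "real (n 2 + 1)"] by(intro add_nonneg_pos) auto
 let ?P = "lborel >< M" and ?p = "%m k. real k / 2 ^ m" and ?s = "%w. saturation (traj S w)" and ?r = "jump_rate (n 3) (n 4)"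
 let ?i = "%z. indicator {0<..<1} (fst z) :: ennreal" and ?J = "%z. jump_mark n (traj X1 (snd z)) (traj S (snd z)) (level_time z)"
 let ?g = "%h. exp (- h * B 0) - 2 * exp (- h * B 1) + exp (- h * B 2)"
 define G where "G m z = ?i z * grid_sum n (traj X1 (snd z)) (traj S (snd z)) m (fst z)" for m and z :: "real \<times> 'a"
 define cell where "cell m k z = (indicator {?s (snd z) (?p m k)..<?s (snd z) (?p m (Suc k))} (fst z) :: ennreal)"
  for m k and z :: "real \<times> 'a"
 define trm where "trm m k w = ennreal ((1 - exp (- (S (?p m (Suc k)) w - S (?p m k) w))) * grid_term n (traj X1 w) (traj S w) (?p m k) (?p m (Suc k)))"
  for m k w
 have G_eq: "G m z = (\<Sum>k. ?i z * (cell m k z * trm m k (snd z)))" for m z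
  unfolding G_def grid_sum_def cell_def trm_def by(rule ennreal_suminf_cmult[symmetric])
 have pos: "0 <= ?p m k" for k m :: nat by simp
 note m1 = driftless_subordinatorD(3)[OF X1 pos] driftless_subordinatorD(3)[OF S pos]
 note [measurable] = m1(1)[of k m for k m] m1(2)[of k m for k m]
 have mt[measurable]: "trm m k:Borel M" for m k
  unfolding trm_def grid_term_def by measurable
 have mc[measurable]: "cell m k:Borel (?P)" for m k
 proof -
  have "(%z. if 1 - exp (- S (?p m k) (snd z)) <= fst z & fst z < 1 - exp (- S (?p m (Suc k)) (snd z)) then 1 else 0 :: ennreal)
   :Borel (?P)" by measurable
  also have "(%z. if 1 - exp (- S (?p m k) (snd z)) <= fst z & fst z < 1 - exp (- S (?p m (Suc k)) (snd z)) then 1 else 0 :: ennreal) = cell m k"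
   by(auto simp: cell_def saturation_def fun_eq_iff)
  finally show ?thesis .
 qed
 have [measurable]: "G m:Borel (?P)" for m
  unfolding G_eq[abs_def] by measurable
 interpret P: pair_sigma_finite lborel M ..
 have int_G: "(NINT z|?P. G m z) = ennreal ((?g (1 / 2 ^ m)) / (1 - exp (- (1 / 2 ^ m) * A)))" for m
 proof -
  define h where "h = (1 / 2 ^ m :: real)"
  have h: "0 < h" by(simp add: h_def)
  define c where "c = ?g h"
  have "(NINT z|?P. G m z) = (\<Sum>k. (NINT z|?P. ?i z * (cell m k z * trm m k (snd z))))"
   unfolding G_eq by(rule nn_integral_suminf) measurable
  also have "... = (\<Sum>k. ennreal (exp (- h * A) ^ k * c))"
  proof(intro suminf_cong)
   fix k
   define a where "a = ?p m k"
   have a: "0 <= a" "?p m (Suc k) = a + h" "a = real k * h" by(simp_all add: a_def h_def field_simps)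
   let ?d = "%w. ?s w (a + h) - ?s w a"
   have "(NINT z|?P. ?i z * (cell m k z * trm m k (snd z))) =
    (NINT w|M. NINT p|lborel. indicator {0<..<1} p * (cell m k (p, w) * trm m k w))"
    by(subst P.nn_integral_snd[symmetric]) (auto simp: split_beta')
   also have "... = (NINT w|M. ennreal (?d w) * trm m k w)"
   proof(intro nn_integral_cong)
    fix w assume w: "w:space M"
    note y = subordinator_pathD[OF subordinator_path_saturation[OF path_nice(5)[OF w]]]
    have ci: "cell m k (p, w) = indicator {?s w a..<?s w (a + h)} p" for p
     unfolding cell_def a(2) a_def by simp
    have "(NINT p|lborel. indicator {0<..<1} p * (cell m k (p, w) * trm m k w)) =
     (NINT p|lborel. (indicator {0<..<1} p * indicator {?s w a..<?s w (a + h)} p) * trm m k w)"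
     by(simp add: ci mult.assoc)
    also have "... = (NINT p|lborel. indicator {0<..<1} p * indicator {?s w a..<?s w (a + h)} p) * trm m k w"
     by(rule nn_integral_multc) simp
    also have "(NINT p|lborel. indicator {0<..<1} p * indicator {?s w a..<?s w (a + h)} p) =
      ennreal (?d w)"
     using y(2)[of a "a + h"] y(3)[of a] a h by(intro nn_integral_cell) (auto simp: saturation_def)
    finally show "(NINT p|lborel. indicator {0<..<1} p * (cell m k (p, w) * trm m k w)) = ennreal (?d w) * trm m k w" .
   qed
   also have "... = ennreal (exp (- a * A) * c)"
    unfolding trm_def a(2) unfolding a_def[symmetric] A_def B_def c_def using a(1) h by(intro grid_expectation) auto
   also have "exp (- a * A) = exp (- h * A) ^ k" by(simp add: a(3) exp_of_nat_mult[symmetric] algebra_simps)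
   finally show "(NINT z|?P. ?i z * (cell m k z * trm m k (snd z))) = ennreal (exp (- h * A) ^ k * c)" .
  qed
  also have "... = ennreal (c / (1 - exp (- h * A)))"
  proof -
   have c0: "0 <= c" using grid_expectation(2)[of 0 h n] h by(simp add: c_def B_def)
   have sm: "(%k. exp (- h * A) ^ k) sums (1 / (1 - exp (- h * A)))"
    using A h by(intro geometric_sums) auto
   have "(%k. exp (- h * A) ^ k * c) sums (c / (1 - exp (- h * A)))"
    using sums_mult2[OF sm, of c] by simp
   thus ?thesis using c0 by(intro suminf_ennreal_eq) auto
  qed
  finally show ?thesis by(simp add: c_def h_def)
 qed
 have "(%m. (?g (1 / 2 ^ m)) / (1 - exp (- (1 / 2 ^ m) * A)))
   ----> ?r / A"
 proof -
  have "(?g has_field_derivative (- B 0 + 2 * B 1 - B 2)) (at 0)" by(auto intro!: derivative_eq_intros)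
  hence 1: "((%h. ?g h / h) ---> ?r) (at 0)"
   by(simp add: has_field_derivative_iff jump_rate_def B_def algebra_simps)
  have "((%h. 1 - exp (- h * A)) has_field_derivative A) (at 0)" by(auto intro!: derivative_eq_intros)
  hence 2: "((%h. (1 - exp (- h * A)) / h) ---> A) (at 0)" by(simp add: has_field_derivative_iff)
  have "((%h. (?g h / h) / ((1 - exp (- h * A)) / h)) ---> ?r / A) (at 0)"
   using A by(intro tendsto_divide 1 2) simp
  moreover have "filterlim (%m. 1 / 2 ^ m :: real) (at 0) sequentially"
   using inverse_two_power_tendsto by(simp add: filterlim_at)
  ultimately have "(%m. (?g (1 / 2 ^ m) / (1 / 2 ^ m)) / ((1 - exp (- (1 / 2 ^ m) * A)) / (1 / 2 ^ m))) ----> ?r / A"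
   by(rule filterlim_compose)
  moreover have "(?g (1 / 2 ^ m) / (1 / 2 ^ m)) / ((1 - exp (- (1 / 2 ^ m) * A)) / (1 / 2 ^ m)) = ?g (1 / 2 ^ m) / (1 - exp (- (1 / 2 ^ m) * A))" for m :: nat
   by simp
  ultimately show ?thesis by simp
 qed
 hence lim1: "(%m. (NINT z|?P. G m z)) ----> ennreal (?r / A)"
  unfolding int_G by(rule tendsto_ennrealI)
 have "(%m. (NINT z|?P. G m z)) ----> (NINT z|?P. ?i z * ?J z)"
 proof(rule nn_integral_dominated_convergence[where w="%z. ?i z"])
  show "(%z. ?i z * ?J z):Borel (?P)"
  proof -
   have [measurable]: "(%z. traj X1 (snd z)):?P ->M path_space" "(%z. traj S (snd z)):?P ->M path_space"
    by(rule measurable_compose[OF measurable_snd path_measurable(1)] measurable_compose[OF measurable_snd path_measurable(5)])+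
   show ?thesis unfolding jump_mark_def by measurable
  qed
  have "(NINT z|?P. indicator {0<..<1::real} (fst z)) = (NINT p|lborel. NINT w|M. indicator {0<..<1::real} (fst (p, w)))"
   by(rule sigma_finite_measure.nn_integral_fst[OF sigma_finite_M, symmetric]) measurable
  also have "... = 1" by(simp add: emeasure_space_1)
  finally show "(NINT z|?P. indicator {0<..<1::real} (fst z)) < oo" by simp
  have sp: "snd z:space M" if "z:space (?P)" for z :: "real \<times> 'a" using that by(auto simp: space_pair_measure)
  show "AE z in ?P. G m z <= ?i z" for m
  proof(rule AE_I2)
   fix z :: "real \<times> 'a" assume "z:space (?P)"
   thus "G m z <= ?i z"
    using grid_sum_le_1[OF path_nice(1)[OF sp] path_nice(5)[OF sp], of z z "fst z" n m]
    by(auto simp: G_def indicator_def)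
  qed
  have dy: "AE w in M. ALL k m. 0 < k --> left_limit (traj S w) (ereal (?p m k)) = S (?p m k) w"
   unfolding AE_all_countable
  proof(intro allI)
   fix k m :: nat
   show "AE w in M. 0 < k --> left_limit (traj S w) (ereal (?p m k)) = S (?p m k) w"
    by(cases "0 < k") (auto intro!: subordinator_no_fixed_jump[OF S])
  qed
  hence "AE z in ?P. ALL k m. 0 < k --> left_limit (traj S (snd z)) (ereal (?p m k)) = S (?p m k) (snd z)"
   by(rule AE_snd_lborel)
  thus "AE z in ?P. (%m. G m z) ----> ?i z * ?J z"
   using AE_space
  proof eventually_elim
   case (elim z)
   show ?case
   proof(cases "fst z:{0<..<1}")
    case True
    thus ?thesis
     using grid_sum_tendsto[OF path_nice(1)[OF sp] path_nice(5)[OF sp], of z z "fst z" n] elim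
     by(simp add: G_def level_time_def)
   qed (simp add: G_def)
  qed
 qed auto
 from LIMSEQ_unique[OF this lim1] show ?thesis by(simp add: A_def)
qed

end

section \<open>Both sides of the compensation formula\<close>

context decomposition
begin

definition jump_functional :: "(real \<times> real \<times> real \<times> real \<times> real => ennreal) => ereal => 'a => ennreal" where
 "jump_functional F tau w = (if tau < oo then ennreal (1 - exp (- jump (traj S w) tau)) *
   F (real_of_ereal tau, left_limit (traj X1 w) tau, left_limit (traj S w) tau, jump (traj X1 w) tau, jump (traj S w) tau) else 0)"

lemma nn_integral_exp_Ici:
 assumes "0 < A"
 shows "(NINT t|lborel. indicator {0<..} t * ennreal (exp (- t * A))) = ennreal (1 / A)"
proof -
 have "(NINT t|lborel. indicator {0<..} t * ennreal (exp (- t * A))) = (NINT t|lborel. ennreal (exp (- t * A)) * indicator {0..} t)"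
  using AE_lborel_singleton[of 0]
  by(intro nn_integral_cong_AE) (auto elim!: eventually_mono simp: indicator_def)
 also have "... = ennreal (0 - (- exp (- 0 * A) / A))"
 proof(rule nn_integral_FTC_atLeast[where F="%t. - exp (- t * A) / A"])
  show "((%t. - exp (- t * A) / A) has_real_derivative exp (- t * A)) (at t)" for t
   using assms by(auto intro!: derivative_eq_intros)
  have "filterlim (%t. - (A * t)) at_bot at_top"
   using assms by(intro filterlim_uminus_at_top[THEN iffD1] filterlim_tendsto_pos_mult_at_top[OF tendsto_const]) (auto simp: filterlim_ident)
  hence "((%t. exp (- (A * t))) ---> 0) at_top" by(intro filterlim_compose[OF exp_at_bot])
  hence "((%t. - exp (- (A * t)) / A) ---> - 0 / A) at_top" using assms by(intro tendsto_intros) auto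
  thus "((%t. - exp (- t * A) / A) ---> 0) at_top" by(simp add: mult.commute)
 qed auto
 finally show ?thesis by simp
qed

text \<open>Carries the right side of the compensation formula: a time, a point of \<open>M\<close>,
  a jump size, and a Boolean that tells whether \<open>X1\<close> takes the jump.\<close>

abbreviation mark_space :: "(real \<times> 'a \<times> real \<times> bool) measure" where
 "mark_space \<equiv> lborel >< (M >< (Lam >< count_space UNIV))"

text \<open>The truncations make the coordinates nonnegative and measurable everywhere;
  \<open>mark_weight\<close> vanishes for \<open>t <= 0\<close>, and \<open>Lam\<close> is carried
  by the positive half-line.\<close>

definition mark_coords :: "real \<times> 'a \<times> real \<times> bool => nat => real" where
 "mark_coords z i = (case z of (t, w, x, b) =>
   [max 0 t, X1 (max 0 t) w, S (max 0 t) w, if b then max 0 x else 0, max 0 x] ! i)"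

definition mark_weight :: "real \<times> 'a \<times> real \<times> bool => ennreal" where
 "mark_weight z = (case z of (t, w, x, b) => indicator {0<..} t * ennreal (exp (- S (max 0 t) w)) *
   (ennreal ((1 - exp (- max 0 x))\<^sup>2) * ennreal (if b then thin (max 0 x) else 1 - thin (max 0 x))))"

lemma mark_nn_integral:
 fixes H :: "real \<times> 'a \<times> real \<times> bool => ennreal"
 assumes H[measurable]: "H:Borel mark_space"
 shows "(NINT z|mark_space. H z) =
  (NINT t|lborel. NINT w|M. NINT x|Lam. H (t, w, x, True) + H (t, w, x, False))"
proof -
 let ?C = "count_space (UNIV :: bool set)"
 interpret L: sigma_finite_measure Lam by(rule sigma_finite_Lam)
 interpret C: sigma_finite_measure ?C by(rule sigma_finite_measure_count_space_finite) simp
 interpret LC: pair_sigma_finite Lam ?C ..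
 have s1: "sigma_finite_measure (Lam >< ?C)" by(rule LC.sigma_finite_measure_axioms)
 interpret MLC: pair_sigma_finite M "Lam >< ?C"
  by(rule pair_sigma_finite.intro[OF sigma_finite_M s1])
 have "(NINT z|mark_space. H z) =
   (NINT t|lborel. NINT y|(M >< (Lam >< ?C)). H (t, y))"
  by(rule sigma_finite_measure.nn_integral_fst[symmetric, OF MLC.sigma_finite_measure_axioms]) simp
 also have "... = (NINT t|lborel. NINT w|M. NINT y|(Lam >< ?C). H (t, w, y))"
  by(intro nn_integral_cong sigma_finite_measure.nn_integral_fst[symmetric, OF s1]) measurable
 also have "... = (NINT t|lborel. NINT w|M. NINT x|Lam. NINT b|(count_space UNIV). H (t, w, x, b))"
 proof(intro nn_integral_cong)
  fix t :: real and w assume [measurable]: "w:space M"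
  show "(NINT y|(Lam >< ?C). H (t, w, y)) = (NINT x|Lam. NINT b|(count_space UNIV). H (t, w, x, b))"
   by(rule C.nn_integral_fst[symmetric]) measurable
 qed
 also have "... = (NINT t|lborel. NINT w|M. NINT x|Lam. H (t, w, x, True) + H (t, w, x, False))"
  by(simp add: nn_integral_count_space_finite UNIV_bool add.commute)
 finally show ?thesis .
qed

lemma measurable_mark_paths:
 "(%z :: real \<times> 'a \<times> real \<times> bool. X1 (max 0 (fst z)) (fst (snd z))):Borel mark_space"
 "(%z :: real \<times> 'a \<times> real \<times> bool. S (max 0 (fst z)) (fst (snd z))):Borel mark_space"
 by(rule path_at_measurable; measurable)+

lemma measurable_mark:
 assumes "i < 5"
 shows "(%z. mark_coords z i):Borel mark_space"
proof -
 note [measurable] = measurable_mark_paths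
 have "i = 0 \<or> i = 1 \<or> i = 2 \<or> i = 3 \<or> i = 4" using assms by linarith
 moreover have "(%z :: real \<times> 'a \<times> real \<times> bool. if snd (snd (snd z)) then max 0 (fst (snd (snd z))) else 0):Borel mark_space"
  by measurable
 ultimately show ?thesis by(auto simp: mark_coords_def split_beta' numeral_eq_Suc)
qed

lemma measurable_mark_weight[measurable]: "mark_weight:Borel mark_space"
proof -
 note [measurable] = measurable_mark_paths
 show ?thesis unfolding mark_weight_def split_beta' by measurable
qed

text \<open>At a fixed time the jump size is separate from the path, so the transform factorises;
  the path contributes \<open>exp (- t * A)\<close>, whose integral over time is the
  \<open>1 / A\<close> also found in \<open>level_laplace\<close>.\<close>

lemma mark_laplace:
 "(NINT z|mark_space. ennreal (exp (- (\<Sum>i<5. real (n i) * mark_coords z i))) * mark_weight z) =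
  ennreal (jump_rate (n 3) (n 4) / (real (n 0) + Phi (real (n 1)) (real (n 2 + 1))))"
proof -
 define A where "A = real (n 0) + Phi (real (n 1)) (real (n 2 + 1))"
 have A: "0 < A" unfolding A_def using Phi_pos[of "real (n 1)" "real (n 2 + 1)"] by(intro add_nonneg_pos) auto
 let ?X = "%t w. real (n 1) * X1 t w + real (n 2 + 1) * S t w" and ?r = "ennreal (jump_rate (n 3) (n 4))"
 let ?y = "%x. thin x * exp (- real (n 3) * x) + (1 - thin x)" and ?t = "%t. exp (- real (n 0) * t)"
 define J where "J x = ennreal ((1 - exp (- x))\<^sup>2 * exp (- real (n 4) * x) * ?y x)" for x
 define K where "K t w = ennreal (exp (- ?X t w))" for t w
 let ?I = "%t. indicator {0<..} t * ennreal (?t t)" and ?I' = "%t. indicator {0<..} t * ennreal (exp (- t * A))"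
 let ?H = "%z. ennreal (exp (- (\<Sum>i<5. real (n i) * mark_coords z i))) * mark_weight z"
 have [measurable]: "J:Borel Lam" unfolding J_def by measurable
 have H: "?H (t, w, x, True) + ?H (t, w, x, False) = ?I t * K t w * J x" if x: "0 < x" for t w x
 proof(cases "0 < t")
  case True
  have m: "max 0 x = x" "max 0 t = t" using x True by auto
  have th: "0 <= 1 - thin x" "0 <= thin x" using thin_bounds[of x] x by auto
  define e where "e b = exp (- (\<Sum>i<5. real (n i) * mark_coords (t, w, x, b) i)) * (exp (- S t w) * ((1 - exp (- x))\<^sup>2 * (if b then thin x else 1 - thin x)))" for b
  have He: "?H (t, w, x, b) = ennreal (e b)" for b
   using True th by(auto simp: mark_weight_def m e_def ennreal_mult'[symmetric] mult.assoc)
  have sum5: "(\<Sum>i<5. g i) = g 0 + g 1 + g 2 + g 3 + g 4" for g :: "nat => real"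
   by(simp add: numeral_eq_Suc)
  have e0: "0 <= e b" for b using th by(simp add: e_def)
  have "?H (t, w, x, True) + ?H (t, w, x, False) = ennreal (e True + e False)" unfolding He using e0 by(simp add: ennreal_plus)
  also have "e True + e False = ?t t * (exp (- ?X t w) *
    ((1 - exp (- x))\<^sup>2 * exp (- real (n 4) * x) * ?y x))"
  proof -
   have s: "exp (- (\<Sum>i<5. real (n i) * mark_coords (t, w, x, b) i)) * exp (- S t w) =
    ?t t * exp (- ?X t w) * exp (- real (n 4) * x) * (if b then exp (- real (n 3) * x) else 1)" for b
    unfolding sum5 by(simp add: mark_coords_def m exp_add[symmetric] numeral_eq_Suc, simp add: algebra_simps)
   show ?thesis unfolding e_def mult.assoc[symmetric] s by(simp add: algebra_simps)
  qed
  finally show ?thesis using True th by(simp add: K_def J_def ennreal_mult'[symmetric] mult.assoc)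
 qed (simp add: mark_weight_def)
 have [measurable]: "K t:Borel M" if "0 < t" for t
 proof -
  have [measurable]: "X1 t:Borel M" "S t:Borel M"
   using that driftless_subordinatorD(3)[OF X1, of t] driftless_subordinatorD(3)[OF S, of t] by auto
  show ?thesis unfolding K_def by measurable
 qed
 have "(NINT z|mark_space. ?H z) = (NINT t|lborel. NINT w|M. NINT x|Lam. ?H (t, w, x, True) + ?H (t, w, x, False))"
 proof(rule mark_nn_integral)
  have [measurable]: "(%z. mark_coords z i):Borel mark_space" if "i:{..<5}" for i
   using that by(intro measurable_mark) auto
  show "?H:Borel mark_space" by measurable
 qed
 also have "... = (NINT t|lborel. NINT w|M. NINT x|Lam. ?I t * K t w * J x)"
  using Lam_AE_pos by(intro nn_integral_cong nn_integral_cong_AE) (auto elim!: eventually_mono simp only: H)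
 also have "... = (NINT t|lborel. NINT w|M. ?I t * K t w * ?r)"
 proof -
  have "(NINT x|Lam. J x) = ?r" unfolding J_def by(rule jump_rate_nn)
  thus ?thesis by(simp add: nn_integral_cmult)
 qed
 also have "... = (NINT t|lborel. ?I' t * ?r)"
 proof(intro nn_integral_cong)
  fix t :: real
  show "(NINT w|M. ?I t * K t w * ?r) =
   ?I' t * ?r"
  proof(cases "0 < t")
   case True
   have "(NINT w|M. K t w) = ennreal (exp (- (t * Phi (real (n 1)) (real (n 2 + 1)))))"
    using grid_laplace[of t 0 "n 1" "n 2 + 1" 0 0] True by(simp add: K_def)
   moreover have "ennreal (?t t) * ennreal (exp (- (t * Phi (real (n 1)) (real (n 2 + 1))))) = ennreal (exp (- t * A))"
    by(simp add: ennreal_mult'[symmetric] exp_add[symmetric] A_def algebra_simps)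
   moreover have "(NINT w|M. ?I t * K t w * ?r) =
    indicator {0<..} t * (ennreal (?t t) * (NINT w|M. K t w)) * ?r"
    using True by(simp add: nn_integral_multc nn_integral_cmult mult.assoc)
   ultimately show ?thesis by simp
  qed simp
 qed
 also have "... = ennreal (1 / A) * ?r"
  by(subst nn_integral_multc) (use nn_integral_exp_Ici[OF A] in simp_all)
 also have "... = ennreal (jump_rate (n 3) (n 4) / A)"
  using A by(subst ennreal_mult'[symmetric]) auto
 finally show ?thesis by(simp add: A_def)
qed

text \<open>\<open>level_laplace\<close> and \<open>mark_laplace\<close> give the same value for all
  multipliers of the five coordinates, and for multipliers 0 this value is the finite total mass, so
  \<open>multivariate_laplace_unique\<close> applies.\<close>

theorem compensation:
 assumes F[measurable]: "F:Borel borel"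
 shows "(NINT p|lborel. NINT w|M. indicator {0<..<1} p * jump_functional F (level_time (p, w)) w) =
  (NINT t|lborel. NINT w|M. NINT x|Lam. indicator {0<..} t * (ennreal (exp (- S t w)) * (ennreal ((1 - exp (- x))\<^sup>2) *
    (ennreal (thin x) * F (t, X1 t w, S t w, x, x) + ennreal (1 - thin x) * F (t, X1 t w, S t w, 0, x)))))"
proof -
 let ?P = "lborel >< M"
 let ?F = "%t w x. indicator {0<..} t * (ennreal (exp (- S t w)) * (ennreal ((1 - exp (- x))\<^sup>2) *
    (ennreal (thin x) * F (t, X1 t w, S t w, x, x) + ennreal (1 - thin x) * F (t, X1 t w, S t w, 0, x))))"
 define f where "f i z = [real_of_ereal (level_time z), left_limit (traj X1 (snd z)) (level_time z), left_limit (traj S (snd z)) (level_time z),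
   jump (traj X1 (snd z)) (level_time z), jump (traj S (snd z)) (level_time z)] ! i" for i and z :: "real \<times> 'a"
 define g where "g z = indicator {0<..<1} (fst z) * (if level_time z < oo then ennreal (1 - exp (- jump (traj S (snd z)) (level_time z))) else 0)" for z :: "real \<times> 'a"
 define G where "G v = F (v 0, v 1, v 2, v 3, v 4)" for v :: "nat => real"
 have cases5: "i = 0 \<or> i = 1 \<or> i = 2 \<or> i = 3 \<or> i = 4" if "i < 5" for i :: nat using that by linarith
 have [measurable]: "(%z. traj X1 (snd z)):?P ->M path_space" "(%z. traj S (snd z)):?P ->M path_space"
  by(rule measurable_compose[OF measurable_snd path_measurable(1)] measurable_compose[OF measurable_snd path_measurable(5)])+
 have fm: "f i:Borel ?P" if "i < 5" for i
  using cases5[OF that] by(auto simp: f_def[abs_def] numeral_eq_Suc)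
 have gm[measurable]: "g:Borel ?P" unfolding g_def by measurable
 have sp: "snd z:space M" if "z:space ?P" for z using that by(auto simp: space_pair_measure)
 have sN: "fst (snd z):space M" if "z:space mark_space" for z using that by(auto simp: space_pair_measure)
 have f0: "0 <= f i z" if i: "i < 5" and z: "z:space ?P" for i z
 proof -
  note n1 = path_nice(1)[OF sp[OF z]] and n5 = path_nice(5)[OF sp[OF z]]
  have "0 <= real_of_ereal (level_time z)" unfolding level_time_def by(rule real_of_ereal_pos[OF passage_time_nonneg])
  thus ?thesis
   using cases5[OF i] left_limit_nonneg[OF n1, of "level_time z"] left_limit_nonneg[OF n5, of "level_time z"]
    jump_nonneg[OF n1, of "level_time z"] jump_nonneg[OF n5, of "level_time z"]
   unfolding f_def by(elim disjE) (simp_all add: numeral_eq_Suc)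
 qed
 have c0: "0 <= mark_coords z i" if i: "i < 5" and z: "z:space mark_space" for i z
 proof -
  have "0 <= X1 (max 0 (fst z)) (fst (snd z))" "0 <= S (max 0 (fst z)) (fst (snd z))"
   using subordinator_pathD(3)[OF path_nice(1)[OF sN[OF z]], of "max 0 (fst z)"]
    subordinator_pathD(3)[OF path_nice(5)[OF sN[OF z]], of "max 0 (fst z)"] by auto
  thus ?thesis
   using cases5[OF i] unfolding mark_coords_def split_beta' by(elim disjE) (simp_all add: numeral_eq_Suc)
 qed
 let ?m = "%z. G (\<lambda>i\<in>{..<5}. mark_coords z i) * mark_weight z"
 let ?L = "%n. (NINT z|?P. ennreal (exp (- (\<Sum>i<5. real (n i) * f i z))) * g z)"
 have lap: "?L n = (NINT z|mark_space. ennreal (exp (- (\<Sum>i<5. real (n i) * mark_coords z i))) * mark_weight z)" for n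
 proof -
  have "?L n =
   (NINT z|?P. indicator {0<..<1} (fst z) * jump_mark n (traj X1 (snd z)) (traj S (snd z)) (level_time z))"
   by(intro nn_integral_cong) (simp add: g_def jump_mark_def f_def numeral_eq_Suc ac_simps)
  thus ?thesis unfolding level_laplace mark_laplace .
 qed
 have fin: "(NINT z|mark_space. mark_weight z) < oo" using mark_laplace[of "%_. 0"] by simp
 have lap0: "(NINT z|?P. g z) = (NINT z|mark_space. mark_weight z)" using lap[of "%_. 0"] by simp
 have main: "(NINT z|?P. G (\<lambda>i\<in>{..<5}. f i z) * g z) = (NINT z|mark_space. ?m z)"
 proof(rule multivariate_laplace_unique[OF _ _ _ _ _ gm measurable_mark_weight _ fin lap])
  show "G:Borel (Pi\<^sub>M {..<5} (%_. borel))"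
   unfolding G_def by(intro measurable_compose[OF _ F] borel_measurable_Pair measurable_component_singleton) auto
 qed (use fm f0 c0 measurable_mark lap0 fin in auto)
 interpret P: pair_sigma_finite lborel M ..
 have Gm[measurable]: "(%z. G (\<lambda>i\<in>{..<5}. f i z)):Borel ?P"
  unfolding G_def by(intro measurable_compose[OF _ F] borel_measurable_Pair) (auto simp: fm)
 have "(NINT p|lborel. NINT w|M. indicator {0<..<1} p * jump_functional F (level_time (p, w)) w) = (NINT p|lborel. NINT w|M. G (\<lambda>i\<in>{..<5}. f i (p, w)) * g (p, w))"
  by(intro nn_integral_cong) (simp add: jump_functional_def G_def g_def f_def numeral_eq_Suc ac_simps)
 also have "... = (NINT z|?P. G (\<lambda>i\<in>{..<5}. f i z) * g z)"
  by(rule sigma_finite_measure.nn_integral_fst[OF sigma_finite_M]) auto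
 also have "... = (NINT t|lborel. NINT w|M. NINT x|Lam. ?m (t, w, x, True) +
   ?m (t, w, x, False))"
  unfolding main
 proof(rule mark_nn_integral)
  have "(%z. G (\<lambda>i\<in>{..<5}. mark_coords z i)):Borel mark_space"
   unfolding G_def by(intro measurable_compose[OF _ F] borel_measurable_Pair) (auto simp: measurable_mark)
  thus "(%z. ?m z):Borel mark_space" by measurable
 qed
 also have "... = (NINT t|lborel. NINT w|M. NINT x|Lam. ?F t w x)"
 proof(rule nn_integral_cong, rule nn_integral_cong, rule nn_integral_cong_AE)
  fix t :: real and w
  show "AE x in Lam. ?m (t, w, x, True) +
   ?m (t, w, x, False) =
   ?F t w x"
   using Lam_AE_pos
  proof eventually_elim
   case (elim x)
   show ?case
   proof(cases "0 < t")
    case True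
    have m: "max 0 x = x" "max 0 t = t" using elim True by auto
    show ?thesis using True by(simp add: G_def mark_coords_def mark_weight_def m numeral_eq_Suc) (simp add: algebra_simps)
   qed (simp add: mark_weight_def)
  qed
 qed
 finally show ?thesis .
qed

end

section \<open>The passage of a barrier by the dominating subordinator\<close>

text \<open>Passage requires strict exceedance. If the barrier is merely met at \<open>u\<close>, it
  is the strict increase of the path after \<open>u\<close> that puts the passage time
  there.\<close>

lemma passage_time_eqI:
 assumes be: "barrier be" and f: "subordinator_path f" and u: "0 < u" and inc: "!!v. u < v ==> f u < f v"
  and le: "ereal (left_limit f (ereal u)) <= be u" "be u <= ereal (f u)"
 shows "passage_time f be = ereal u"
proof(rule antisym)
 show "ereal u <= passage_time f be"
  using above_barrier_left[OF be f, of u] le(1) by(meson leD leI)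
 show "passage_time f be <= ereal u"
 proof(rule ereal_le_epsilon2)
  fix e :: real assume "0 < e"
  have "be (u + e) <= be u" using barrierD(1)[OF be u] \<open>0 < e\<close> by simp
  also have "... <= ereal (f u)" by(rule le)
  also have "... < ereal (f (u + e))" using inc[of "u + e"] \<open>0 < e\<close> by simp
  finally show "passage_time f be <= ereal u + ereal e"
   using passage_time_le[of "u + e" be f] u \<open>0 < e\<close> by simp
 qed
qed

lemma left_limit_saturation:
 assumes "subordinator_path f" "0 < t"
 shows "left_limit (saturation f) (ereal t) = 1 - exp (- left_limit f (ereal t))"
proof -
 have "(saturation f ---> 1 - exp (- left_limit f (ereal t))) (at_left t)"
  unfolding saturation_def[abs_def] by(intro tendsto_intros left_limit_tendsto assms)
 thus ?thesis using assms(2) unfolding left_limit_def[of "saturation f"] by(simp add: tendsto_Lim)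
qed

lemma barrier_measurable:
 assumes "barrier be" shows "(%t. if 0 < t then be t else oo):Borel borel"
proof -
 have "(%t. if t:{0<..} then be t else oo):Borel borel"
  using assms by(intro borel_measurable_continuous_on_if) (auto simp: barrier_def)
 thus ?thesis by simp
qed

lemma measurable_passage_time_const:
 assumes "X:N ->M path_space" "barrier be"
 shows "(%x. passage_time (X x) be):Borel N"
 using assms barrierD(2) by(intro measurable_passage_time) auto

text \<open>Both sides are integrals against finite measures on the product that agree on
  rectangles; \<open>R\<close> is the one whose second coordinate is drawn from the kernel.\<close>

lemma kernel_nn_integral:
 fixes X :: "'a => 'x" and Y :: "'a => 'y"
 assumes M: "finite_measure M" and X[measurable]: "X:M ->M A" and Y[measurable]: "Y:M ->M B"
  and kas[measurable]: "ka:A ->M subprob_algebra B" and e[measurable]: "e:Borel M" and e1: "!!w. e w <= 1"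
  and eq: "!!C D. C:sets A ==> D:sets B ==>
   (NINT w|M. e w * (indicator C (X w) * indicator D (Y w))) = (NINT w|M. e w * (indicator C (X w) * emeasure (ka (X w)) D))"
  and f[measurable]: "f:Borel (A >< B)"
 shows "(NINT w|M. e w * f (X w, Y w)) = (NINT w|M. e w * (NINT y|(ka (X w)). f (X w, y)))"
proof(cases "space M = {}")
 case True
 thus ?thesis by(simp add: nn_integral_empty)
next
 case False
 let ?P = "distr (density M e) (A >< B) (%w. (X w, Y w))"
 define R where "R = density M e \<bind> (%w. distr (ka (X w)) (A >< B) (Pair (X w)))"
 have k2: "(%w. distr (ka (X w)) (A >< B) (Pair (X w))):density M e ->M subprob_algebra (A >< B)"
  by(intro measurable_distr2[where M=B]) measurable
 have ks: "sets (ka (X w)) = sets B" if "w:space M" for w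
  using subprob_measurableD(2)[OF kas] measurable_space[OF X that] .
 have nnR: "(NINT z|R. g z) = (NINT w|M. e w * (NINT y|(ka (X w)). g (X w, y)))"
  if g[measurable]: "g:Borel (A >< B)" for g
 proof -
  have "(NINT z|R. g z) = (NINT w|(density M e). NINT z|(distr (ka (X w)) (A >< B) (Pair (X w))). g z)"
   unfolding R_def by(rule nn_integral_bind[OF g k2])
  also have "... = (NINT w|(density M e). NINT y|(ka (X w)). g (X w, y))"
  proof(rule nn_integral_cong)
   fix w assume "w:space (density M e)"
   hence w: "w:space M" by simp
   have "Pair (X w):ka (X w) ->M A >< B"
    using measurable_space[OF X w] unfolding measurable_cong_sets[OF ks[OF w] refl] by measurable
   thus "(NINT z|(distr (ka (X w)) (A >< B) (Pair (X w))). g z) = (NINT y|(ka (X w)). g (X w, y))"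
    by(rule nn_integral_distr) simp
  qed
  also have "... = (NINT w|M. e w * (NINT y|(ka (X w)). g (X w, y)))"
   by(rule nn_integral_density[OF e]) (rule nn_integral_measurable_subprob_algebra2[where N=B], measurable)
  finally show ?thesis .
 qed
 have nnP: "(NINT z|?P. g z) = (NINT w|M. e w * g (X w, Y w))" if "g:Borel (A >< B)" for g
  using that by(subst nn_integral_distr_density) (auto simp: mult.commute)
 have sR: "sets R = sets (A >< B)" unfolding R_def using False by(intro sets_bind[OF sets_kernel[OF k2]]) auto
 have "?P = R"
 proof(rule measure_eqI_rectangles)
  show "finite_measure ?P" using e1 by(intro finite_measure_distr_density[OF M]) auto
  fix C D assume CD: "C:sets A" "D:sets B"
  hence i: "indicator (C \<times> D):Borel (A >< B)" by simp
  have "(NINT y|(ka (X w)). indicator (C \<times> D) (X w, y)) = indicator C (X w) * emeasure (ka (X w)) D" if "w:space M" for w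
   using ks[OF that] CD by(cases "X w:C") (simp_all add: indicator_times nn_integral_cmult_indicator)
  hence "(NINT z|?P. indicator (C \<times> D) z) = (NINT z|R. indicator (C \<times> D) z)"
   unfolding nnP[OF i] nnR[OF i] using eq[OF CD] by(simp add: indicator_times cong: nn_integral_cong_simp)
  thus "emeasure ?P (C \<times> D) = emeasure R (C \<times> D)" using CD sR by simp
 qed (simp_all add: sR)
 from arg_cong[OF this, of "%K. nn_integral K f"] show ?thesis unfolding nnP[OF f] nnR[OF f] .
qed

lemma reg_cond_dist_nn_integral:
 fixes X :: "'a => 'x::second_countable_topology" and Y :: "'a => 'y::second_countable_topology"
 assumes M: "prob_space M" and rc: "reg_cond_dist M E X Y ka"
  and [measurable]: "X:Borel M" "Y:Borel M" "Measurable.pred M E"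
  and f: "f:Borel (borel >< borel)"
 shows "(NINT w|M. (if E w then f (X w, Y w) else 0)) = (NINT w|M. (if E w then (NINT y|(ka (X w)). f (X w, y)) else 0))"
proof -
 define e where "e w = (if E w then 1 else 0 :: ennreal)" for w
 have [measurable]: "e:Borel M" unfolding e_def by measurable
 have ka: "ka:borel ->M prob_algebra borel" using rc by(simp add: reg_cond_dist_def)
 have "(NINT w|M. e w * f (X w, Y w)) = (NINT w|M. e w * (NINT y|(ka (X w)). f (X w, y)))"
 proof(rule kernel_nn_integral[OF prob_space.finite_measure[OF M] _ _ measurable_prob_algebraD[OF ka] _ _ _ f])
  fix C :: "'x set" and D :: "'y set" assume CD[measurable]: "C:sets borel" "D:sets borel"
  have "(NINT w|M. e w * (indicator C (X w) * indicator D (Y w))) = (NINT w|M. indicator {w:space M. E w & X w:C & Y w:D} w)"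
   by(intro nn_integral_cong) (auto simp: e_def indicator_def)
  also have "... = emeasure M {w:space M. E w & X w:C & Y w:D}"
   by(rule nn_integral_indicator) measurable
  also have "... = (NINT w|M. emeasure (ka (X w)) D * indicator {w:space M. E w & X w:C} w)"
   using rc CD by(simp add: reg_cond_dist_def)
  also have "... = (NINT w|M. e w * (indicator C (X w) * emeasure (ka (X w)) D))"
   by(intro nn_integral_cong) (auto simp: e_def indicator_def)
  finally show "(NINT w|M. e w * (indicator C (X w) * indicator D (Y w))) = (NINT w|M. e w * (indicator C (X w) * emeasure (ka (X w)) D))" .
 qed (auto simp: e_def)
 thus ?thesis by(simp add: e_def if_distrib[of "%x. x * _"] cong: if_cong)
qed

context decomposition
begin

lemma S_strict_mono: "AE w in M. ALL s t. 0 <= s --> s < t --> S s w < S t w"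
 by(rule subordinator_strict_mono[OF S infinite_measures(2)])

text \<open>The levels inside a jump from \<open>l\<close> to \<open>l + d\<close> have length
  \<open>exp (- l) * (1 - exp (- d))\<close> on the saturated scale, and
  \<open>jump_functional\<close> contributes a further \<open>1 - exp (- d)\<close>. So
  \<open>compensation\<close> is applied to \<open>G\<close> divided by \<open>C l d\<close> and
  restricted to jumps that bridge the barrier. As \<open>S\<close> increases strictly, such a jump
  takes place at the passage time and nowhere else.\<close>

theorem jump_at_passage:
 assumes be: "barrier be" and G[measurable]: "G:Borel borel"
 defines "tau \<equiv> %w. passage_time (traj S w) be"
 shows "(NINT w|M. (if tau w < oo & 0 < jump (traj S w) (tau w) then G (real_of_ereal (tau w), left_limit (traj X1 w) (tau w),
   left_limit (traj S w) (tau w), jump (traj X1 w) (tau w), jump (traj S w) (tau w)) else 0)) =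
  (NINT t|lborel. NINT w|M. NINT x|Lam. (if 0 < t & ereal (S t w) <= be t & be t <= ereal (S t w + x) then
    ennreal (thin x) * G (t, X1 t w, S t w, x, x) + ennreal (1 - thin x) * G (t, X1 t w, S t w, 0, x) else 0))"
  (is "integral\<^sup>N M ?g = (NINT t|lborel. NINT w|M. NINT x|Lam. ?h t w x)")
proof -
 note [measurable] = barrier_measurable[OF be]
 define b where "b t = (if 0 < t then be t else oo)" for t
 have [measurable]: "b:Borel borel" unfolding b_def by measurable
 define C where "C s d = exp (- s) * (1 - exp (- d))\<^sup>2" for s d :: real
 define F where "F = (%(t, x, s, d1, d). if 0 < t & 0 < d & ereal s <= b t & b t <= ereal (s + d)
   then G (t, x, s, d1, d) * ennreal (1 / C s d) else 0)"
 have [measurable]: "F:Borel borel"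
 proof -
  have G': "G:Borel (borel >< borel >< borel >< borel >< borel)" by(simp add: borel_prod)
  show ?thesis unfolding borel_prod[symmetric] F_def C_def split_beta' using G' by measurable
 qed
 have "(NINT p|lborel. NINT w|M. indicator {0<..<1} p * jump_functional F (level_time (p, w)) w) =
   (NINT w|M. NINT p|lborel. indicator {0<..<1} p * jump_functional F (level_time (p, w)) w)"
 proof -
  interpret P: pair_sigma_finite lborel M ..
  have [measurable]: "(%z. traj X1 (snd z)):lborel >< M ->M path_space" "(%z. traj S (snd z)):lborel >< M ->M path_space"
   by(rule measurable_compose[OF measurable_snd path_measurable(1)] measurable_compose[OF measurable_snd path_measurable(5)])+
  have m: "(%z. indicator {0<..<1::real} (fst z) * jump_functional F (level_time z) (snd z)):Borel (lborel >< M)"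
   unfolding jump_functional_def by measurable
  show ?thesis by(rule P.Fubini'[symmetric]) (use m in \<open>simp add: split_beta'\<close>)
 qed
 also have "... = integral\<^sup>N M ?g"
 proof(rule nn_integral_cong_AE, goal_cases)
  case 1 show ?case
   using S_strict_mono AE_space
  proof eventually_elim
   case (elim w)
   note s = path_nice(5)[OF elim(2)] and x = path_nice(1)[OF elim(2)]
   note ys = subordinator_path_saturation[OF s]
   define K where "K = (if tau w < oo & 0 < jump (traj S w) (tau w) then jump_functional F (tau w) w else 0)"
   \<comment> \<open>If \<open>F\<close> does not vanish at the passage over level \<open>p\<close>,
     then the jump made there bridges the barrier and therefore occurs at
     \<open>tau w\<close>.\<close>
   have zero: "jump_functional F (level_time (p, w)) w = (if level_time (p, w) = tau w then K else 0)" if p: "0 < p" for p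
   proof(cases "level_time (p, w) < oo & 0 < jump (traj S w) (level_time (p, w))")
    case True
    then obtain u where u: "level_time (p, w) = ereal u" "0 < u"
     using passage_time_pos[OF barrier_const ys, of "ereal p"] p by(cases "level_time (p, w)") (auto simp: level_time_def)
    have Su: "left_limit (traj S w) (ereal u) + jump (traj S w) (ereal u) = S u w" using u by(simp add: jump_def)
    show ?thesis
    proof(cases "ereal (left_limit (traj S w) (ereal u)) <= be u & be u <= ereal (S u w)")
     case True
     hence "tau w = ereal u" unfolding tau_def using elim u by(intro passage_time_eqI[OF be s]) auto
     thus ?thesis using u \<open>level_time (p, w) < oo & _\<close> by(simp add: K_def)
    next
     case False
     hence "F (u, x', left_limit (traj S w) (ereal u), d1, jump (traj S w) (ereal u)) = 0" for x' d1
      using u by(auto simp: F_def Su b_def)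
     hence "jump_functional F (ereal u) w = 0" by(simp add: jump_functional_def)
     thus ?thesis using u by(auto simp: K_def)
    qed
   next
    case False
    hence "jump_functional F (level_time (p, w)) w = 0"
     using jump_nonneg[OF s, of "level_time (p, w)"] by(auto simp: jump_functional_def not_less)
    thus ?thesis using False by(auto simp: K_def)
   qed
   have "(NINT p|lborel. indicator {0<..<1} p * jump_functional F (level_time (p, w)) w) =
    (NINT p|lborel. indicator {0<..<1} p * (if level_time (p, w) = tau w then K else 0))"
    by(intro nn_integral_cong) (use zero in \<open>fastforce simp: indicator_def\<close>)
   also have "... = ?g w"
   proof(cases "tau w < oo & 0 < jump (traj S w) (tau w)")
    case True
    then obtain u where u: "tau w = ereal u" "0 < u"
     using passage_time_pos[OF be s] by(cases "tau w") (auto simp: tau_def)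
    define l where "l = left_limit (traj S w) (ereal u)"
    define d where "d = jump (traj S w) (ereal u)"
    define g where "g = G (u, left_limit (traj X1 w) u, l, jump (traj X1 w) u, d)"
    have d: "0 < d" using True u by(simp add: d_def)
    have Su: "S u w = l + d" using u by(simp add: jump_def l_def d_def)
    have l0: "0 <= l" unfolding l_def by(rule left_limit_nonneg[OF s])
    have Cp: "0 < C l d" using d by(simp add: C_def)
    define yl where "yl = left_limit (saturation (traj S w)) (ereal u)"
    define yr where "yr = saturation (traj S w) u"
    have y: "yl = 1 - exp (- l)" "yr = 1 - exp (- (l + d))"
     using left_limit_saturation[OF s u(2)] by(simp_all add: yl_def yr_def l_def[symmetric] saturation_def Su)
    have yb: "0 <= yl" "yl <= yr" "yr <= 1" using l0 d by(simp_all add: y)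
    \<comment> \<open>Up to the two endpoints, which are null, the levels passed at time
      \<open>tau w\<close> are the ones inside the jump.\<close>
    have lev: "level_time (p, w) = tau w <-> p:{yl..<yr}" if p: "0 < p" "p ~= yr" "p ~= yl" for p
    proof
     note wb = barrier_const[of "ereal p"]
     show "p:{yl..<yr}" if eq: "level_time (p, w) = tau w"
      using left_limit_passage_time[OF wb ys u(2)] barrier_le_passage_time[OF wb ys, of u] p eq u
      by(simp add: level_time_def yl_def yr_def)
     assume "p:{yl..<yr}"
     hence p': "yl < p" "p < yr" using p by auto
     have "level_time (p, w) <= ereal u" unfolding level_time_def
      using p' u(2) by(intro passage_time_le) (auto simp: yr_def)
     moreover have "~ level_time (p, w) < ereal u"
      using above_barrier_left[OF wb ys, of u] p p' by(auto simp: level_time_def yl_def)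
     ultimately show "level_time (p, w) = tau w" using u by simp
    qed
    have K: "K = ennreal (1 - exp (- d)) * (g * ennreal (1 / C l d))"
    proof -
     have "ereal l <= be u" unfolding l_def using left_limit_passage_time[OF be s u(2)] u by(simp add: tau_def)
     moreover have "be u <= ereal (l + d)" using barrier_le_passage_time[OF be s, of u] u Su by(simp add: tau_def)
     ultimately show ?thesis using True u d unfolding K_def jump_functional_def F_def g_def
      by(simp add: l_def[symmetric] d_def[symmetric] b_def)
    qed
    have "(NINT p|lborel. indicator {0<..<1} p * (if level_time (p, w) = tau w then K else 0)) =
     (NINT p|lborel. indicator {0<..<1} p * indicator {yl..<yr} p * K)"
    proof(rule nn_integral_cong_AE, goal_cases)
     case 1 show ?case
      using AE_lborel_singleton[of yl] AE_lborel_singleton[of yr]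
     proof eventually_elim
      case (elim p)
      show ?case using lev[of p] elim by(cases "0 < p") (auto simp: indicator_def)
     qed
    qed
    also have "... = ennreal (yr - yl) * K"
     using nn_integral_cell[OF yb] by(subst nn_integral_multc) auto
    also have "... = g * (ennreal (yr - yl) * ennreal (1 - exp (- d)) * ennreal (1 / C l d))"
     unfolding K by(simp add: ac_simps)
    also have "ennreal (yr - yl) * ennreal (1 - exp (- d)) * ennreal (1 / C l d) = ennreal ((yr - yl) * (1 - exp (- d)) * (1 / C l d))"
    proof -
     have "0 <= 1 - exp (- d)" "0 <= 1 / C l d" using d Cp by auto
     thus ?thesis by(simp only: ennreal_mult''[symmetric])
    qed
    also have "(yr - yl) * (1 - exp (- d)) = C l d"
     unfolding y C_def by(simp add: power2_eq_square algebra_simps exp_add[symmetric])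
    also have "C l d * (1 / C l d) = 1" using Cp by simp
    finally show ?thesis using True u by(simp add: g_def l_def d_def)
   next
    case False
    hence K0: "K = 0" by(auto simp: K_def)
    show ?thesis unfolding K0 using False by auto
   qed
   finally show ?case .
  qed
 qed
 also have "(NINT p|lborel. NINT w|M. indicator {0<..<1} p * jump_functional F (level_time (p, w)) w) =
  (NINT t|lborel. NINT w|M. NINT x|Lam. indicator {0<..} t * (ennreal (exp (- S t w)) * (ennreal ((1 - exp (- x))\<^sup>2) *
    (ennreal (thin x) * F (t, X1 t w, S t w, x, x) + ennreal (1 - thin x) * F (t, X1 t w, S t w, 0, x)))))"
  by(rule compensation) simp
 also have "... = (NINT t|lborel. NINT w|M. NINT x|Lam. ?h t w x)"
 proof(rule nn_integral_cong, rule nn_integral_cong, rule nn_integral_cong_AE, goal_cases)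
  case (1 t w)
  show ?case
   using Lam_AE_pos
  proof eventually_elim
   case (elim x)
   show ?case
   proof(cases "0 < t & ereal (S t w) <= be t & be t <= ereal (S t w + x)")
    case True
    have F: "F (t, X1 t w, S t w, d1, x) = G (t, X1 t w, S t w, d1, x) * ennreal (1 / C (S t w) x)" for d1
     using True elim by(simp add: F_def b_def)
    have "ennreal (exp (- S t w)) * ennreal ((1 - exp (- x))\<^sup>2) * ennreal (1 / C (S t w) x) = ennreal (C (S t w) x * (1 / C (S t w) x))"
     unfolding C_def by(simp add: ennreal_mult'[symmetric])
    also have "C (S t w) x * (1 / C (S t w) x) = 1" using elim by(simp add: C_def)
    finally have c: "ennreal (exp (- S t w)) * (ennreal ((1 - exp (- x))\<^sup>2) * (ennreal (1 / C (S t w) x) * y)) = y" for y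
     by(simp add: mult.assoc[symmetric])
    show ?thesis using True c[of "ennreal (thin x) * G (t, X1 t w, S t w, x, x) + ennreal (1 - thin x) * G (t, X1 t w, S t w, 0, x)"]
     unfolding F by(simp add: algebra_simps)
   next
    case False
    have "F (t, X1 t w, S t w, d1, x) = 0" if "0 < t" for d1
     using False that by(auto simp: F_def b_def)
    thus ?thesis using False by(cases "0 < t") (auto simp del: not_less)
   qed
  qed
 qed
 finally show ?thesis by simp
qed

end

section \<open>One iteration, given the passage of S\<close>

text \<open>The average over acceptance and rejection in Step 6, with acceptance probability
  \<open>p v\<close>; as in \<open>run_v\<close>, a value that is not positive bypasses the
  draw.\<close>

definition thinned :: "(real => real) => (real \<times> real \<times> real => ennreal) => real => real => real => ennreal" where
 "thinned p g t x v = (if 0 < v then ennreal (p v) * g (t, x, v) + ennreal (1 - p v) * g (t, x, 0) else g (t, x, v))"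

context decomposition
begin

abbreviation (input) passed :: "'a => ereal => real \<times> real \<times> real" where
 "passed w t \<equiv> (real_of_ereal t, left_limit (traj X1 w) t, jump (traj X1 w) t)"

text \<open>All jumps of \<open>X3\<close> exceed \<open>r\<close>; if \<open>r\<close> is infinite,
  its Levy measure is 0.\<close>

lemma X3_dichotomy:
 assumes "0 <= t" shows "AE w in M. X3 t w = 0 \<or> r < ereal (X3 t w)"
proof(cases r)
 case (real r')
 have "AE x in density Lam (indicator {x. r < ereal x}). r' < x"
  unfolding real by(subst AE_density) (auto simp: indicator_def)
 from subordinator_gap[OF X3 assms _ this] r show ?thesis by(simp add: real)
next
 case PInf
 have "emeasure (density Lam (indicator {x. r < ereal x})) {0<..} = 0"
  unfolding PInf by(subst emeasure_density) auto
 hence "prob {w:space M. X3 t w = 0} = 1"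
  using subordinator_prob_zero_finite[OF X3 _ assms] by(simp add: measure_def)
 hence "AE w in M. X3 t w = 0"
  using driftless_subordinatorD(3)[OF X3 assms] by(subst (asm) prob_eq_1) auto
 thus ?thesis by(auto elim!: eventually_mono)
qed (use r in auto)

text \<open>Step 5 conditions on \<open>X1 + X2\<close>, but is given a value of \<open>S\<close>.
  Where \<open>a\<close> does not vanish, \<open>S\<close> is at most \<open>r\<close>, which forces
  \<open>X3 t = 0\<close> almost surely. The probability of \<open>X3 t = 0\<close> factors out of
  both sides by independence (\<open>red\<close>), and what is left is the defining property of
  \<open>ka\<close>.\<close>

lemma conditional_X1:
 assumes t: "0 < t" and ka: "reg_cond_dist M (%_. True) (%w. X1 t w + X2 t w) (X1 t) ka"
  and [measurable]: "a:Borel borel" "k:Borel borel"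
  and a: "!!s. r < ereal s ==> a s = 0"
 shows "(NINT w|M. a (S t w) * (NINT x|(ka (S t w)). k x)) = (NINT w|M. a (S t w) * k (X1 t w))"
proof -
 have t0: "0 <= t" using t by simp
 have m[measurable]: "X1 t:Borel M" "X2 t:Borel M" "X3 t:Borel M"
  using t by(auto intro: driftless_subordinatorD(3) X1 X2 X3)
 have kam: "ka:borel ->M prob_algebra borel" using ka by(simp add: reg_cond_dist_def)
 hence kam[measurable]: "ka:borel ->M subprob_algebra borel" by(rule measurable_prob_algebraD)
 define K where "K s = (NINT x|(ka s). k x)" for s
 have [measurable]: "K:Borel borel"
  unfolding K_def by(rule nn_integral_measurable_subprob_algebra2[OF _ kam]) simp
 let ?Y = "%w. X1 t w + X2 t w"
 have red: "(NINT w|M. a (S t w) * h (S t w) (X1 t w)) = (NINT w|M. a (?Y w) * h (?Y w) (X1 t w)) * (NINT w|M. indicator {0} (X3 t w))"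
  if h[measurable]: "(%(s, x). h s x):Borel (borel >< borel)" for h
 proof -
  have "(NINT w|M. a (S t w) * h (S t w) (X1 t w)) =
   (NINT w|M. a (?Y w) * h (?Y w) (X1 t w) * indicator {0} (X3 t w))"
  proof(rule nn_integral_cong_AE, goal_cases)
   case 1 show ?case
    using X3_dichotomy[OF t0] AE_space
   proof eventually_elim
    case (elim w)
    show ?case
    proof(cases "X3 t w = 0")
     case False
     hence "r < ereal (X3 t w)" using elim by simp
     also have "X3 t w <= S t w"
      using subordinator_pathD(3)[OF path_nice(1)[OF elim(2)] t0] subordinator_pathD(3)[OF path_nice(2)[OF elim(2)] t0]
      by(simp add: S_eq)
     finally have "a (S t w) = 0" by(simp add: a)
     thus ?thesis using False by simp
    qed (simp add: S_eq)
   qed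
  qed
  also have "... = (NINT w|M. NINT w'|M. a (?Y w) * h (?Y w) (X1 t w) * indicator {0} (X3 t w'))"
  proof -
   define f where "f = (%(p :: (real => real) \<times> (real => real), z :: real => real).
     a (fst p t + snd p t) * h (fst p t + snd p t) (fst p t) * indicator {0} (z t))"
   let ?P = "(path_space >< path_space) >< path_space"
   have [measurable]: "(%z. (fst (fst z)) t):Borel ?P" "(%z. (snd (fst z)) t):Borel ?P"
    "(%z. (snd z) t):Borel ?P"
    using t0 by(auto intro!: measurable_eval_path)
   have "(%z. h (fst (fst z) t + snd (fst z) t) (fst (fst z) t)):Borel ?P"
    by(rule measurable_compose[where f="%z. (fst (fst z) t + snd (fst z) t, fst (fst z) t)", OF _ h, simplified]) measurable
   hence "f:Borel ?P" unfolding f_def split_beta' by measurable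
   from indep_pair_nn_integral[OF indep_X3 this] show ?thesis by(simp add: f_def)
  qed
  also have "... = (NINT w|M. a (?Y w) * h (?Y w) (X1 t w) * (NINT w'|M. indicator {0} (X3 t w')))"
   by(intro nn_integral_cong nn_integral_cmult) measurable
  also have "... = (NINT w|M. a (?Y w) * h (?Y w) (X1 t w)) * (NINT w|M. indicator {0} (X3 t w))"
  proof(rule nn_integral_multc)
   have "(%w. h (?Y w) (X1 t w)):Borel M"
    by(rule measurable_compose[where f="%w. (?Y w, X1 t w)", OF _ h, simplified]) measurable
   thus "(%w. a (?Y w) * h (?Y w) (X1 t w)):Borel M" by measurable
  qed
  finally show ?thesis .
 qed
 have "(NINT w|M. a (S t w) * K (S t w)) =
   (NINT w|M. a (?Y w) * K (?Y w)) * (NINT w|M. indicator {0} (X3 t w))"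
  by(rule red) measurable
 also have "(NINT w|M. a (?Y w) * K (?Y w)) = (NINT w|M. a (?Y w) * k (X1 t w))"
 proof -
  define f where "f z = a (fst z) * k (snd z)" for z
  have f: "f:Borel (borel >< borel)" unfolding f_def by measurable
  have inner: "(NINT y|(ka s). f (s, y)) = a s * K s" for s
  proof -
   have [measurable_cong]: "sets (ka s) = sets borel" using subprob_measurableD(2)[OF kam, of s] by simp
   have "k:Borel (ka s)" by measurable
   then
   show ?thesis by(simp add: f_def K_def nn_integral_cmult)
  qed
  have "(NINT w|M. (if True then f (?Y w, X1 t w) else 0)) =
   (NINT w|M. (if True then (NINT y|(ka (?Y w)). f (?Y w, y)) else 0))"
   by(rule reg_cond_dist_nn_integral[OF prob_space_axioms ka _ _ _ f]) measurable
  thus ?thesis by(simp add: inner) (simp add: f_def)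
 qed
 also have "... * (NINT w|M. indicator {0} (X3 t w)) = (NINT w|M. a (S t w) * k (X1 t w))"
  by(rule red[symmetric]) measurable
 finally show ?thesis by(simp add: K_def)
qed

lemma jump_X1_le: assumes "w:space M" shows "jump (traj X1 w) t <= jump (traj S w) t"
proof -
 note n = path_nice[OF assms]
 have "jump (traj S w) t = jump (traj X1 w) t + jump (traj X2 w) t + jump (traj X3 w) t"
  using jump_add[OF subordinator_path_add[OF n(1,2)] n(3), of t] jump_add[OF n(1,2), of t] by(simp add: S_eq)
 thus ?thesis using jump_nonneg[OF n(2)] jump_nonneg[OF n(3)] by simp
qed

lemma passage_time_finite:
 assumes be: "barrier be" and fin: "EX t>0. be t < oo"
 shows "AE w in M. passage_time (traj S w) be < oo"
proof -
 obtain t where t: "0 < t" "be t < oo" using fin by auto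
 then obtain z where z: "be t = ereal z" using barrierD(3)[OF be t(1)] by(cases "be t") auto
 have "emeasure Lam {0<..} ~= 0" using infinite_measures(2) by simp
 from subordinator_unbounded[OF S this] AE_space show ?thesis
 proof eventually_elim
  case (elim w)
  obtain u where u: "0 < u" "z < S u w" using elim(1) by blast
  have "be (max t u) <= ereal z" using barrierD(1)[OF be t(1), of "max t u"] z by simp
  also have "... < ereal (S (max t u) w)"
   using u subordinator_pathD(2)[OF path_nice(5)[OF elim(2)], of u "max t u"] by auto
  finally have "passage_time (traj S w) be <= ereal (max t u)" using t u by(intro passage_time_le) auto
  thus ?case by(rule le_less_trans) (simp add: max_def)
 qed
qed

text \<open>\<open>S\<close> has no atom at the height of the barrier and no jump at the fixed time
  \<open>d\<close>, so a passage exactly at \<open>d\<close> has probability 0 and the value at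
  \<open>d\<close> decides the order.\<close>

lemma passage_time_iff:
 assumes be: "barrier be" and d0: "0 < d"
 shows "AE w in M. passage_time (traj S w) be ~= ereal d & (ereal d < passage_time (traj S w) be <-> ereal (S d w) < be d)"
proof -
 have "AE w in M. S d w ~= real_of_ereal (be d)"
  by(rule subordinator_no_atom[OF S infinite_measures(2) d0])
 thus ?thesis using AE_space subordinator_no_fixed_jump[OF S d0]
 proof eventually_elim
  case (elim w)
  note s = path_nice(5)[OF elim(2)]
  have ne: "ereal (S d w) ~= be d" using elim(1) by(metis real_of_ereal.simps(1))
  show ?case
  proof(cases "ereal (S d w) < be d")
   case True
   thus ?thesis using passage_time_greater[OF be s d0] by auto
  next
   case False
   hence less: "be d < ereal (S d w)" using ne by auto
   have "passage_time (traj S w) be <= ereal d" using d0 less by(intro passage_time_le) auto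
   moreover have "passage_time (traj S w) be ~= ereal d"
    using left_limit_passage_time[OF be s d0] less elim(3) by auto
   ultimately show ?thesis using less by auto
  qed
 qed
qed

context
 fixes be :: "real => ereal" and D :: ereal and ka :: "real => real => real measure"
 assumes be: "barrier be" and ber: "!!t. be t <= r" and D: "0 < D" and fin: "D < oo \<or> (EX t>0. be t < oo)"
  and kam: "(%(t, s). ka t s):borel >< borel ->M prob_algebra borel"
  and ka1: "!!t. 0 < t ==> reg_cond_dist M (%_. True) (%w. X1 t w + X2 t w) (X1 t) (ka t)"
  and ka2: "reg_cond_dist M (%w. passage_time (traj S w) be < oo & jump (traj S w) (passage_time (traj S w) be) = 0)
    (%w. real_of_ereal (passage_time (traj S w) be)) (%w. X1 (real_of_ereal (passage_time (traj S w) be)) w)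
    (%t. ka t (real_of_ereal (be t)))"
begin

abbreviation (input) tau :: "'a => ereal" where "tau w \<equiv> passage_time (traj S w) be"
abbreviation (input) kaS :: "'a => real measure" where "kaS w \<equiv> ka (real_of_ereal (tau w)) (left_limit (traj S w) (tau w))"
abbreviation (input) S_law :: "real measure" where
 "S_law \<equiv> distr (uniform_measure M {w:space M. ereal (S (real_of_ereal D) w) < be (real_of_ereal D)}) borel (S (real_of_ereal D))"

lemma passage_time_deadline:
 assumes "D = ereal d"
 shows "AE w in M. tau w ~= D & (D < tau w <-> ereal (S d w) < be d)"
 using passage_time_iff[OF be, of d] D assms by simp

text \<open>Both sides become integrals over a fixed time \<open>t\<close> and a jump size by
  \<open>jump_at_passage\<close>. There the state before the jump is the state at time
  \<open>t\<close>, with \<open>S t\<close> at most \<open>be t\<close> and hence at most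
  \<open>r\<close>, so \<open>conditional_X1\<close> applies. The two terms of
  \<open>thinned\<close> match the two branches of the compensation formula.\<close>

lemma jump_part:
 assumes [measurable]: "g:Borel borel"
 shows "(NINT w|M. (if tau w < D & 0 < jump (traj S w) (tau w)
   then (NINT x|(kaS w). thinned thin g (real_of_ereal (tau w)) x (jump (traj S w) (tau w))) else 0)) =
  (NINT w|M. (if tau w < D & 0 < jump (traj S w) (tau w) then g (passed w (tau w)) else 0))" (is "?L = ?R")
proof -
 note [measurable] = barrier_measurable[OF be]
 note [measurable_cong] = sets_Lam
 have g3[measurable]: "g:Borel (borel >< borel >< borel)" by(simp add: borel_prod)
 have kas[measurable]: "(%(t, s). ka t s):borel >< borel ->M subprob_algebra borel"
  using kam by(rule measurable_prob_algebraD)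
 define H where "H t s d = (NINT x|(ka t s). thinned thin g t x d)" for t s d
 have H[measurable]: "(%(t, s, d). H t s d):Borel (borel >< borel >< borel)"
 proof -
  have 1: "(%((t, s, d), x). thinned thin g t x d):Borel ((borel >< borel >< borel) >< borel)"
   unfolding thinned_def split_beta' by measurable
  have 2: "(%(t, s, d :: real). ka t s):borel >< borel >< borel ->M subprob_algebra borel"
   using measurable_compose[OF _ kas, of "%(t, s, d :: real). (t, s)" "borel >< borel >< borel"] by(simp add: split_beta')
  show ?thesis using nn_integral_measurable_subprob_algebra2[OF 1 2] by(simp add: H_def split_beta')
 qed
 have Hc[measurable]: "(%z. H (e z) (f z) (h z)):Borel L"
  if [measurable]: "e:Borel L" "f:Borel L" "h:Borel L" for e f h and L :: "'c measure"
  using measurable_compose[OF _ H, of "%z. (e z, f z, h z)" L] by simp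
 define G where "G = (%(t :: real, x :: real, s, d1 :: real, d). if ereal t < D then H t s d else 0)"
 define G' where "G' = (%(t, x, s :: real, d1, d :: real). if ereal t < D then g (t, x, d1) else 0)"
 have G: "G:Borel borel" "G':Borel borel"
  unfolding borel_prod[symmetric] G_def G'_def split_beta' by measurable
 define cross where "cross t w x <-> 0 < t & ereal (S t w) <= be t & be t <= ereal (S t w + x)" for t w x
 define mix where "mix F t w x = ennreal (thin x) * F (t, X1 t w, S t w, x, x) + ennreal (1 - thin x) * F (t, X1 t w, S t w, 0, x)"
  for F :: "real \<times> real \<times> real \<times> real \<times> real => ennreal" and t w x
 have fix_t: "(NINT w|M. NINT x|Lam. (if cross t w x then mix G t w x else 0)) =
  (NINT w|M. NINT x|Lam. (if cross t w x then mix G' t w x else 0))" (is "?l = ?r") for t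
 proof(cases "0 < t & ereal t < D")
  case True
  hence t: "0 < t" by simp
  interpret L: sigma_finite_measure Lam by(rule sigma_finite_Lam)
  interpret P: pair_sigma_finite M Lam ..
  have [measurable]: "S t:Borel M" "X1 t:Borel M"
   using t by(auto intro: driftless_subordinatorD(3) X1 S)
  define a :: "real => real => ennreal" where "a x s = indicator {s. ereal s <= be t & be t <= ereal (s + x)} s" for x s
  define k where "k x y = ennreal (thin x) * g (t, y, x) + ennreal (1 - thin x) * g (t, y, 0)" for x y
  have [measurable]: "(%z. a (f z) (h z)):Borel L" "(%z. k (f z) (h z)):Borel L"
   if [measurable]: "f:Borel L" "h:Borel L" for f h and L :: "'c measure"
   unfolding a_def k_def indicator_def by measurable
  have thin1: "ennreal (thin x) + ennreal (1 - thin x) = 1" if "0 < x" for x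
   using thin_bounds[of x] that by(simp add: ennreal_plus[symmetric] del: ennreal_plus)
  have "?l = (NINT w|M. NINT x|Lam. a x (S t w) * H t (S t w) x)"
  proof(rule nn_integral_cong, rule nn_integral_cong_AE, goal_cases)
   case (1 w)
   show ?case using Lam_AE_pos
    by eventually_elim (use True in \<open>auto simp: G_def a_def cross_def mix_def distrib_right[symmetric] thin1\<close>)
  qed
  also have "... = (NINT x|Lam. NINT w|M. a x (S t w) * H t (S t w) x)"
   by(rule P.Fubini'[symmetric]) (simp add: split_beta')
  also have "... = (NINT x|Lam. NINT w|M. a x (S t w) * k x (X1 t w))"
  proof(rule nn_integral_cong_AE, goal_cases)
   case 1 show ?case
    using Lam_AE_pos
   proof eventually_elim
    case (elim x)
    have Hk: "H t s x = (NINT y|(ka t s). k x y)" for s using elim by(simp add: H_def k_def thinned_def)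
    show ?case unfolding Hk
    proof(rule conditional_X1[OF t ka1[OF t]])
     show "a x s = 0" if "r < ereal s" for s
      using that ber[of t] by(auto simp: a_def indicator_def)
    qed measurable
   qed
  qed
  also have "... = (NINT w|M. NINT x|Lam. a x (S t w) * k x (X1 t w))"
   by(rule P.Fubini') (simp add: split_beta')
  also have "... = ?r"
   using True by(intro nn_integral_cong) (auto simp: G'_def a_def k_def cross_def mix_def)
  finally show ?thesis .
 next
  case False
  thus ?thesis by(intro nn_integral_cong) (auto simp: G_def G'_def cross_def mix_def)
 qed
 have "?L = (NINT w|M. (if tau w < oo & 0 < jump (traj S w) (tau w)
   then G (real_of_ereal (tau w), left_limit (traj X1 w) (tau w), left_limit (traj S w) (tau w), jump (traj X1 w) (tau w), jump (traj S w) (tau w)) else 0))"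
  using passage_time_nonneg by(intro nn_integral_cong) (auto simp: G_def H_def ereal_real)
 also have "... = (NINT w|M. (if tau w < oo & 0 < jump (traj S w) (tau w)
   then G' (real_of_ereal (tau w), left_limit (traj X1 w) (tau w), left_limit (traj S w) (tau w), jump (traj X1 w) (tau w), jump (traj S w) (tau w)) else 0))"
  unfolding jump_at_passage[OF be G(1)] jump_at_passage[OF be G(2)]
  by(intro nn_integral_cong fix_t[unfolded cross_def mix_def])
 also have "... = ?R"
  using passage_time_nonneg by(intro nn_integral_cong) (auto simp: G'_def ereal_real)
 finally show ?thesis .
qed

text \<open>Without a jump the value of \<open>S\<close> is that of the barrier, so the kernel is
  evaluated on the curve \<open>s = be t\<close>, where \<open>ka2\<close> governs it. A jump of
  \<open>X1\<close> is at most that of \<open>S\<close>; therefore \<open>X1\<close> does not jump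
  either.\<close>

lemma creeping_part:
 assumes [measurable]: "g:Borel borel"
 shows "(NINT w|M. (if tau w < D & jump (traj S w) (tau w) = 0 then (NINT x|(kaS w). g (real_of_ereal (tau w), x, 0)) else 0)) =
  (NINT w|M. (if tau w < D & jump (traj S w) (tau w) = 0 then g (passed w (tau w)) else 0))" (is "?L = ?R")
proof -
 have [measurable]: "tau:Borel M" by(rule measurable_passage_time_const[OF path_measurable(5) be])
 have X1m: "(%w. X1 (real_of_ereal (tau w)) w):Borel M"
  by(rule measurable_path_at[OF path_measurable(1)]) (measurable, auto simp: passage_time_nonneg real_of_ereal_pos)
 define f where "f z = (if ereal (fst z) < D then g (fst z, snd z, 0) else 0)" for z
 have f: "f:Borel (borel >< borel)"
 proof -
  have [measurable]: "g:Borel (borel >< borel >< borel)" by(simp add: borel_prod)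
  show ?thesis unfolding f_def by measurable
 qed
 have *: "EX u. tau w = ereal u & 0 < u & left_limit (traj S w) (ereal u) = real_of_ereal (be u) &
   left_limit (traj X1 w) (ereal u) = X1 u w & jump (traj X1 w) (ereal u) = 0"
  if b: "w:space M" "tau w < oo" "jump (traj S w) (tau w) = 0" for w
 proof -
  note s = path_nice(5)[OF b(1)]
  obtain u where u: "tau w = ereal u" "0 < u"
   using passage_time_pos[OF be s] b(2) by(cases "tau w") auto
  have S: "left_limit (traj S w) (ereal u) = S u w" using b(3) u by(simp add: jump_def)
  have "ereal (S u w) <= be u" using left_limit_passage_time[OF be s u(2)] u S by simp
  moreover have "be u <= ereal (S u w)" using barrier_le_passage_time[OF be s, of u] u by simp
  ultimately have "be u = ereal (S u w)" by simp
  moreover have "jump (traj X1 w) (ereal u) = 0"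
   using jump_X1_le[OF b(1), of "ereal u"] jump_nonneg[OF path_nice(1)[OF b(1)], of "ereal u"] b(3) u by simp
  ultimately show ?thesis using u S by(auto simp: jump_def)
 qed
 have "?L = (NINT w|M. (if tau w < oo & jump (traj S w) (tau w) = 0
   then (NINT y|(ka (real_of_ereal (tau w)) (real_of_ereal (be (real_of_ereal (tau w))))). f (real_of_ereal (tau w), y)) else 0))"
 proof(rule nn_integral_cong, goal_cases)
  case (1 w)
  from *[OF this] show ?case
   by(cases "tau w < oo & jump (traj S w) (tau w) = 0") (auto simp: f_def)
 qed
 also have "... = (NINT w|M. (if tau w < oo & jump (traj S w) (tau w) = 0
   then f (real_of_ereal (tau w), X1 (real_of_ereal (tau w)) w) else 0))"
  by(rule reg_cond_dist_nn_integral[OF prob_space_axioms ka2 _ X1m _ f, symmetric]) measurable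
 also have "... = ?R"
 proof(rule nn_integral_cong, goal_cases)
  case (1 w)
  from *[OF this] show ?case
   by(cases "tau w < oo & jump (traj S w) (tau w) = 0") (auto simp: f_def)
 qed
 finally show ?thesis .
qed

text \<open>The deadline is a fixed time: conditioning on \<open>S d < be d\<close> is elementary,
  and as \<open>X1\<close> almost surely has no jump there, its value may replace its left
  limit.\<close>

lemma deadline_part:
 assumes g[measurable]: "g:Borel borel"
 shows "(NINT w|M. (if D < tau w then (NINT s|S_law. NINT x|(ka (real_of_ereal D) s). g (real_of_ereal D, x, 0)) else 0)) =
  (NINT w|M. (if D < tau w then g (passed w D) else 0))"
proof(cases "D < oo")
 case True
 then obtain d where d: "D = ereal d" "0 < d" using D by(cases D) auto
 have [measurable]: "S d:Borel M" "X1 d:Borel M"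
  using d by(auto intro: driftless_subordinatorD(3) X1 S)
 have g3[measurable]: "g:Borel (borel >< borel >< borel)" by(simp add: borel_prod)
 have kas: "ka d:borel ->M prob_algebra borel" using ka1[OF d(2)] by(simp add: reg_cond_dist_def)
 note [measurable] = measurable_prob_algebraD[OF kas]
 define E where "E = {w:space M. ereal (S d w) < be d}"
 have E[measurable]: "E:sets M" unfolding E_def by measurable
 define h where "h s = (NINT x|(ka d s). g (d, x, 0))" for s
 have [measurable]: "h:Borel borel" unfolding h_def
  by(rule nn_integral_measurable_subprob_algebra2) measurable
 have "(NINT w|M. (if D < tau w then (NINT s|(distr (uniform_measure M E) borel (S d)). h s) else 0)) =
  (NINT w|M. (NINT s|(distr (uniform_measure M E) borel (S d)). h s) * indicator E w)"
 proof(rule nn_integral_cong_AE, goal_cases)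
  case 1 show ?case
   using passage_time_deadline[OF d(1)] AE_space by eventually_elim (auto simp: E_def)
 qed
 also have "... = (NINT s|(distr (uniform_measure M E) borel (S d)). h s) * emeasure M E"
  by(rule nn_integral_cmult_indicator) simp
 also have "... = (NINT w|M. h (S d w) * indicator E w) / emeasure M E * emeasure M E"
  by(subst nn_integral_distr) (auto simp: nn_integral_uniform_measure)
 also have "... = (NINT w|M. h (S d w) * indicator E w)"
 \<comment> \<open>For a null conditioning event both sides are 0; otherwise the normalisation
   cancels.\<close>
 proof(cases "emeasure M E = 0")
  case True
  hence "(NINT w|M. h (S d w) * indicator E w) = 0"
   by(intro nn_integral_zero') (auto intro!: AE_I'[of E] simp: null_sets_def)
  thus ?thesis using True by simp
 next
  case False
  thus ?thesis by(simp add: ennreal_divide_times emeasure_eq_measure ennreal_mult_divide_eq)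
 qed
 also have "... = (NINT w|M. indicator {s. ereal s < be d} (S d w) * (NINT x|(ka d (S d w)). g (d, x, 0)))"
  by(intro nn_integral_cong) (auto simp: h_def E_def indicator_def)
 also have "... = (NINT w|M. indicator {s. ereal s < be d} (S d w) * g (d, X1 d w, 0))"
 proof(rule conditional_X1[OF d(2) ka1[OF d(2)]])
  show "indicator {s. ereal s < be d} s = (0 :: ennreal)" if "r < ereal s" for s
   using that ber[of d] by(auto simp: indicator_def)
 qed measurable
 also have "... = (NINT w|M. (if D < tau w then g (d, left_limit (traj X1 w) D, jump (traj X1 w) D) else 0))"
 proof(rule nn_integral_cong_AE, goal_cases)
  case 1 show ?case
   using passage_time_deadline[OF d(1)] AE_space subordinator_no_fixed_jump[OF X1 d(2)]
   by eventually_elim (auto simp: d jump_def indicator_def)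
 qed
 finally show ?thesis unfolding d(1) real_of_ereal.simps E_def h_def .
qed simp

text \<open>The arbitrary \<open>h\<close> is the value at a tie of the passage time and
  \<open>D\<close>. Ties are null: for finite \<open>D\<close> by
  \<open>passage_time_deadline\<close>, for infinite \<open>D\<close> because the passage time is
  then almost surely finite.\<close>

theorem iteration_identity:
 assumes g[measurable]: "g:Borel borel"
 shows "(NINT w|M. (let tau = passage_time (traj S w) be in
   if tau < D then (NINT x|(ka (real_of_ereal tau) (left_limit (traj S w) tau)). thinned thin g (real_of_ereal tau) x (jump (traj S w) tau))
   else if D < tau then (NINT s|S_law. NINT x|(ka (real_of_ereal D) s). g (real_of_ereal D, x, 0)) else h)) =
  (NINT w|M. (let t = min (passage_time (traj S w) be) D in g (passed w t)))" (is "?L = ?R")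
proof -
 have [measurable]: "tau:Borel M" by(rule measurable_passage_time_const[OF path_measurable(5) be])
 have g3[measurable]: "g:Borel (borel >< borel >< borel)" by(simp add: borel_prod)
 have kas[measurable]: "(%(t, s). ka t s):borel >< borel ->M subprob_algebra borel"
  using kam by(rule measurable_prob_algebraD)
 have kac[measurable]: "(%z. ka (f z) (h z)):L ->M subprob_algebra borel"
  if [measurable]: "f:Borel L" "h:Borel L" for f h and L :: "'c measure"
  using measurable_compose[OF _ kas, of "%z. (f z, h z)" L] by simp
 have "AE w in M. tau w ~= D"
 proof(cases D)
  case (real d)
  thus ?thesis using passage_time_deadline[OF real] by auto
 next
  case PInf
  hence "EX t>0. be t < oo" using fin by auto
  from passage_time_finite[OF be this] show ?thesis unfolding PInf by eventually_elim auto
 qed (use D in auto)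
 with AE_space have cases: "AE w in M. (tau w < D & 0 < jump (traj S w) (tau w)) \<or> (tau w < D & jump (traj S w) (tau w) = 0) \<or> D < tau w"
  by eventually_elim (use jump_nonneg[OF path_nice(5)] in \<open>fastforce simp: less_le\<close>)
 define A where "A f = (%w. if tau w < D & 0 < jump (traj S w) (tau w) then f w else 0 :: ennreal)" for f
 define B where "B f = (%w. if tau w < D & jump (traj S w) (tau w) = 0 then f w else 0 :: ennreal)" for f
 define C where "C f = (%w. if D < tau w then f w else 0 :: ennreal)" for f
 have ABC[measurable]: "A f:Borel M" "B f:Borel M" "C f:Borel M"
  if [measurable]: "f:Borel M" for f
  unfolding A_def B_def C_def by measurable
 have m1: "(%w. (NINT x|(kaS w). thinned thin g (real_of_ereal (tau w)) x (jump (traj S w) (tau w)))):Borel M"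
  by(rule nn_integral_measurable_subprob_algebra2[where N=borel]) (unfold thinned_def, measurable)
 have m2: "(%w. (NINT x|(kaS w). g (real_of_ereal (tau w), x, 0))):Borel M"
  by(rule nn_integral_measurable_subprob_algebra2[where N=borel]) measurable
 have sum: "(NINT w|M. A a w + B b w + C c w) = (NINT w|M. A a w) + (NINT w|M. B b w) + (NINT w|M. C c w)"
  if "a:Borel M" "b:Borel M" "c:Borel M" for a b c
  using that by(simp add: nn_integral_add)
 have "?L = (NINT w|M. A (%w. (NINT x|(kaS w). thinned thin g (real_of_ereal (tau w)) x (jump (traj S w) (tau w)))) w +
   B (%w. (NINT x|(kaS w). g (real_of_ereal (tau w), x, 0))) w +
   C (%w. (NINT s|S_law. NINT x|(ka (real_of_ereal D) s). g (real_of_ereal D, x, 0))) w)"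
  using cases by(intro nn_integral_cong_AE) (auto simp: A_def B_def C_def Let_def thinned_def elim!: eventually_mono)
 also have "... = (NINT w|M. A (%w. g (passed w (tau w))) w) + (NINT w|M. B (%w. g (passed w (tau w))) w) + (NINT w|M. C (%w. g (passed w D)) w)"
  unfolding sum[OF m1 m2 borel_measurable_const] unfolding A_def B_def C_def jump_part[OF g] creeping_part[OF g] deadline_part[OF g] ..
 also have "... = (NINT w|M. A (%w. g (passed w (tau w))) w + B (%w. g (passed w (tau w))) w + C (%w. g (passed w D)) w)"
  by(rule sum[symmetric]) measurable
 also have "... = ?R"
  using cases by(intro nn_integral_cong_AE) (auto simp: A_def B_def C_def Let_def min_def elim!: eventually_mono)
 finally show ?thesis .
qed

end

end

section \<open>The jumps of Q\<close>

lemma first_jump_time_less_iff: "first_jump_time f < s <-> (EX t>0. ereal t < s & 0 < jump f (ereal t))"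
 unfolding first_jump_time_def by(auto simp: Inf_less_iff)

lemma first_jump_time_nonneg: "0 <= first_jump_time f"
 unfolding first_jump_time_def by(intro Inf_greatest) auto

text \<open>A jump is passed by the passage over any level between its two ends.\<close>
lemma first_jump_time_levels:
 assumes f: "subordinator_path f"
 defines "tau p \<equiv> passage_time f (%_. ereal (real_of_rat p))"
 shows "first_jump_time f < s <-> (EX p>0. tau p < s & 0 < jump f (tau p))"
proof
 assume "first_jump_time f < s"
 then obtain t where t: "0 < t" "ereal t < s" "0 < jump f (ereal t)" by(auto simp: first_jump_time_less_iff)
 hence "left_limit f (ereal t) < f t" by(simp add: jump_def)
 then obtain p where p: "left_limit f (ereal t) < real_of_rat p" "real_of_rat p < f t" using of_rat_dense by blast
 hence p0: "0 < real_of_rat p" using left_limit_nonneg[OF f, of "ereal t"] by linarith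
 have "tau p <= ereal t" unfolding tau_def using t p by(intro passage_time_le) auto
 moreover have "~ tau p < ereal t"
  using above_barrier_left[OF barrier_const f, of "ereal (real_of_rat p)" t] p p0 by(auto simp: tau_def)
 ultimately have "tau p = ereal t" by simp
 thus "EX p>0. tau p < s & 0 < jump f (tau p)" using t p0 by auto
next
 assume "EX p>0. tau p < s & 0 < jump f (tau p)"
 then obtain p where p: "tau p < s" "0 < jump f (tau p)" by blast
 then obtain t where "tau p = ereal t" "0 < t" by(cases "tau p") (auto simp: jump_def left_limit_def split: if_splits)
 thus "first_jump_time f < s" using p by(auto simp: first_jump_time_less_iff)
qed

lemma measurable_first_jump_time[measurable (raw)]:
 assumes X[measurable]: "X:N ->M path_space"
 shows "(%x. first_jump_time (X x)):Borel N"
proof(rule borel_measurableI_less)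
 fix s :: ereal
 let ?tau = "%p x. passage_time (X x) (%_. ereal (real_of_rat p))"
 have [measurable]: "?tau p:Borel N" for p by(rule measurable_passage_time[OF X]) auto
 have "{x:space N. first_jump_time (X x) < s} = {x:space N. EX p>0. ?tau p x < s & 0 < jump (X x) (?tau p x)}"
  using measurable_space[OF X] by(auto simp: space_path_space first_jump_time_levels)
 also have "...:sets N" by measurable
 finally show "{x:space N. first_jump_time (X x) < s}:sets N" .
qed

lemma left_limit_stop: "0 < t ==> t <= s ==> left_limit (stop_path s f) (ereal t) = left_limit f (ereal t)"
 by(rule left_limit_cong) (auto simp: stop_path_def)

lemma jump_stop: "0 < t ==> t <= s ==> jump (stop_path s f) (ereal t) = jump f (ereal t)"
 by(simp add: jump_def left_limit_stop) (simp add: stop_path_def)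

lemma first_jump_time_stop_less: "z <= ereal s ==> first_jump_time (stop_path s f) < z <-> first_jump_time f < z"
 unfolding first_jump_time_less_iff using jump_stop by(metis ereal_less_eq(3) less_le_trans order.strict_implies_order)

text \<open>Meant for a time truncated at a constant \<open>A\<close>, computed from a path and from
  the stopped path. Agreement on all events \<open>a < z\<close> with \<open>z <= s\<close> settles
  the minimum also when \<open>A\<close> alone lies below \<open>s\<close>.\<close>

lemma min_eq_if_agree_below:
 fixes a b A s :: "'a::linorder"
 assumes eq: "!!z. z <= s ==> a < z <-> b < z" and "min a A < s \<or> min b A < s"
 shows "min a A = min b A"
proof(cases "a < s")
 case True
 hence "b < s" using eq[of s] by simp
 hence "a = b" using True eq[of a] eq[of b] by(metis less_imp_le neqE less_irrefl)
 thus ?thesis by simp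
next
 case False
 hence "~ b < s" using eq[of s] by simp
 hence "A < s" using False assms(2) by(auto simp: min_less_iff_disj)
 hence "A < a" "A < b" using False \<open>~ b < s\<close> by auto
 thus ?thesis by(simp add: min.absorb2)
qed

context decomposition
begin

abbreviation (input) first_jump :: "'a => ereal => ereal \<times> real" where
 "first_jump w a \<equiv> (let d = min (first_jump_time (traj Q w)) a in (d, jump (traj Q w) d))"

lemma regenerative_Q: "regenerative M (%w. (traj X1 w, traj X2 w, traj X3 w)) (path_space >< path_space >< path_space) (%w. traj Q w)"
 by(rule regenerativeI[OF Q indep_Q])

lemma regenerative_X1: "regenerative M (%w. (traj X2 w, traj X3 w, traj Q w)) (path_space >< path_space >< path_space) (%w. traj X1 w)"
 by(rule regenerativeI[OF X1 indep_X1])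

text \<open>The Levy measure of \<open>Q\<close> is finite, so at a small time \<open>Q\<close> is
  still 0 with probability close to 1.\<close>

lemma Q_positive_null: "(NINT w|M. indicator {f. ALL n::nat. 0 < f (1 / Suc n)} (traj Q w)) = 0"
proof -
 have m[measurable]: "Q t:Borel M" if "0 <= t" for t using driftless_subordinatorD(3)[OF Q that] .
 have [measurable]: "Q (1 / real (Suc n)):Borel M" for n by(rule m) simp
 define A where "A = {w:space M. ALL n::nat. 0 < Q (1 / Suc n) w}"
 have [measurable]: "A:sets M" unfolding A_def by measurable
 define c where "c = measure chi {0<..}"
 have "prob A <= 1 - exp (- (1 / Suc n) * c)" for n
 proof -
  have "prob {w:space M. Q (1 / Suc n) w = 0} = exp (- (1 / Suc n) * c)"
   unfolding c_def by(rule subordinator_prob_zero_finite[OF Q chi(2)]) simp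
  moreover have "prob A <= prob (space M - {w:space M. Q (1 / Suc n) w = 0})"
   by(rule finite_measure_mono) (auto simp: A_def simp del: of_nat_Suc, metis less_irrefl)
  ultimately show ?thesis by(simp add: prob_compl)
 qed
 moreover have "(%n. 1 - exp (- (1 / Suc n) * c)) ----> 1 - exp (- 0 * c)"
  by(intro tendsto_intros LIMSEQ_inverse_real_of_nat[unfolded inverse_eq_divide])
 ultimately have "prob A <= 1 - exp (- 0 * c)"
  by(intro tendsto_lowerbound[where F=sequentially and f="%n. 1 - exp (- (1 / Suc n) * c)"]) auto
 hence "emeasure M A = 0" by(simp add: emeasure_eq_measure measure_le_0_iff)
 moreover have "(NINT w|M. indicator {f. ALL n::nat. 0 < f (1 / Suc n)} (traj Q w)) = (NINT w|M. indicator A w)"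
  by(intro nn_integral_cong) (auto simp: A_def indicator_def)
 ultimately show ?thesis by simp
qed

text \<open>By the strong Markov property the path after the passage over 0 is a fresh copy of
  \<open>Q\<close>, which by \<open>Q_positive_null\<close> stays at 0 for a while. The purpose is
  to show that \<open>Q\<close> can leave 0 only by a jump.\<close>

lemma Q_not_immediately_positive: "AE w in M. passage_time (traj Q w) (%_. 0) < oo -->
  (EX n::nat. Q (real_of_ereal (passage_time (traj Q w) (%_. 0)) + 1 / Suc n) w = Q (real_of_ereal (passage_time (traj Q w) (%_. 0))) w)"
proof -
 let ?z = "%w. ((traj X1 w, traj X2 w, traj X3 w), traj Q w)" and ?sg = "%w. passage_time (traj Q w) (%_. 0)"
  and ?P = "{f :: real => real. ALL n::nat. 0 < f (1 / Suc n)}"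
 interpret regenerative M "%w. (traj X1 w, traj X2 w, traj X3 w)" "path_space >< path_space >< path_space" "%w. traj Q w"
  by(rule regenerative_Q)
 define Psi where "Psi = (%(_::unit, f :: real => real). indicator ?P f :: ennreal)"
 define tau where "tau = (%(p :: (real => real) \<times> (real => real) \<times> (real => real), x). passage_time x (%_. 0))"
 let ?Ga = "%z :: ((real => real) \<times> (real => real) \<times> (real => real)) \<times> (real => real). ()"
 let ?E = "count_space UNIV :: unit measure" let ?P3 = "path_space >< path_space >< path_space"
 have ev: "(%z. (snd z) (1 / real (Suc n))):Borel (?E >< path_space)" for n
  by(rule measurable_eval_path) auto
 have Psi: "Psi:Borel (?E >< path_space)"
  unfolding Psi_def split_beta' indicator_def using ev by(simp del: of_nat_Suc)
 have tau: "tau:Borel (?P3 >< path_space)" unfolding tau_def split_beta'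
  by(rule measurable_passage_time) auto
 have "(NINT w|M. indicator {w. tau (?z w) < oo} w *
   Psi (?Ga (?z w), shift_path (real_of_ereal (tau (?z w))) (traj Q w))) =
  (NINT w|M. indicator {w. tau (?z w) < oo} w * (NINT w'|M. Psi (?Ga (?z w), traj Q w')))"
 proof(rule strong_markov[OF tau _ _ _ Psi])
  show "?Ga:?P3 >< path_space ->M ?E" by simp
  show "0 <= tau (p, x)" for p x by(simp add: tau_def passage_time_nonneg)
  show "tau (p, stop_path s x) = tau (p, x) & ?Ga (p, stop_path s x) = ?Ga (p, x)"
   if "tau (p, x) < ereal s \<or> tau (p, stop_path s x) < ereal s" for p x s
   using passage_time_stop[of x _ s] that by(simp add: tau_def)
 qed
 also have "... = 0" using Q_positive_null by(simp add: Psi_def)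
 finally have *: "(NINT w|M. indicator {w. ?sg w < oo} w *
   indicator ?P (shift_path (real_of_ereal (?sg w)) (traj Q w))) = 0"
  by(simp add: tau_def Psi_def)
 have pm[measurable]: "(%w. ?sg w):Borel M"
  by(rule measurable_passage_time) auto
 have sh: "(%w. shift_path (real_of_ereal (?sg w)) (traj Q w)):M ->M path_space"
  using passage_time_nonneg by(intro measurable_shift_path) (auto simp: real_of_ereal_pos)
 have ev: "(%w. shift_path (real_of_ereal (?sg w)) (traj Q w) (1 / real (Suc n))):Borel M" for n
  by(rule measurable_eval_path[OF sh]) simp
 have "(%w. indicator {w. ?sg w < oo} w *
   indicator ?P (shift_path (real_of_ereal (?sg w)) (traj Q w)) :: ennreal):Borel M"
  using ev by(simp add: indicator_def del: of_nat_Suc)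
 from *[unfolded nn_integral_0_iff_AE[OF this]] AE_space show ?thesis
 proof eventually_elim
  case (elim w)
  note f = path_nice(4)[OF elim(2)]
  show ?case
  proof(intro impI)
   let ?u = "real_of_ereal (?sg w)"
   assume "?sg w < oo"
   then obtain n :: nat where n: "~ 0 < shift_path ?u (traj Q w) (1 / Suc n)"
    using elim(1) by(auto simp: indicator_def simp del: of_nat_Suc split: if_splits)
   have "0 <= ?u" using passage_time_nonneg by(rule real_of_ereal_pos)
   hence "Q ?u w <= Q (?u + 1 / Suc n) w" using subordinator_pathD(2)[OF f, of ?u "?u + 1 / Suc n"] by simp
   thus "EX n::nat. Q (?u + 1 / Suc n) w = Q ?u w"
    using n by(intro exI[of _ n]) (simp add: shift_path_def)
  qed
 qed
qed

text \<open>Let \<open>u\<close> be the passage time over 0. The path is constant right after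
  \<open>u\<close> and positive at times arbitrarily close to it on the right, so it is positive at
  \<open>u\<close>; before \<open>u\<close> it is 0. Hence \<open>u\<close> is a jump time.\<close>

lemma Q_zero_before_jump: "AE w in M. ALL t. 0 <= t --> ereal t < first_jump_time (traj Q w) --> Q t w = 0"
 using Q_not_immediately_positive AE_space
proof eventually_elim
 case (elim w)
 note f = path_nice(4)[OF elim(2)]
 show ?case
 proof(intro allI impI)
  fix t :: real assume t: "0 <= t" "ereal t < first_jump_time (traj Q w)"
  show "Q t w = 0"
  proof(rule ccontr)
   assume "Q t w ~= 0"
   hence Qt: "0 < Q t w" using subordinator_pathD(3)[OF f t(1)] by simp
   hence "t ~= 0" using subordinator_pathD(1)[OF f] by auto
   hence le: "passage_time (traj Q w) (%_. 0) <= ereal t" using t Qt by(intro passage_time_le) auto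
   then obtain u where u: "passage_time (traj Q w) (%_. 0) = ereal u" "0 <= u" "u <= t"
    using passage_time_nonneg[of "traj Q w" "%_. 0"] by(cases "passage_time (traj Q w) (%_. 0)") auto
   then obtain n :: nat where n: "Q (u + 1 / Suc n) w = Q u w" using elim(1) by auto
   have "passage_time (traj Q w) (%_. 0) < ereal (u + 1 / Suc n)" using u by simp
   then obtain s where s: "0 < s" "s < u + 1 / Suc n" "0 < Q s w" by(auto simp: passage_time_less_iff)
   have Qu: "0 < Q u w" using subordinator_pathD(2)[OF f, of s "u + 1 / Suc n"] s n by simp
   hence u0: "0 < u" using u subordinator_pathD(1)[OF f] by(cases "u = 0") auto
   have z: "Q v w = 0" if "0 <= v" "v < u" for v
   proof(cases "v = 0")
    case False
    hence "ereal (Q v w) <= 0" using below_barrier[of v "traj Q w" "%_. 0"] that u by simp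
    thus ?thesis using subordinator_pathD(3)[OF f that(1)] by simp
   qed (use subordinator_pathD(1)[OF f] in simp)
   have "left_limit (traj Q w) (ereal u) = 0"
    by(rule left_limit_eqI[OF f u0]) (use z u0 in \<open>auto intro!: exI[of _ 0]\<close>)
   hence "0 < jump (traj Q w) (ereal u)" using u0 Qu by(simp add: jump_def)
   hence "first_jump_time (traj Q w) <= ereal u"
    unfolding first_jump_time_def using u0 by(intro Inf_lower) auto
   thus False using t(2) u(3) by(metis ereal_less_eq(3) less_le_not_le order_trans)
  qed
 qed
qed

lemma first_jump_time_ge:
 assumes "w:space M" "0 <= eta" "Q eta w = 0" shows "ereal eta <= first_jump_time (traj Q w)"
proof(rule ccontr)
 note f = path_nice(4)[OF assms(1)]
 assume "~ ?thesis"
 then obtain t where t: "0 < t" "t < eta" "0 < jump (traj Q w) (ereal t)"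
  by(auto simp: first_jump_time_less_iff not_le)
 hence "0 < Q t w" using left_limit_nonneg[OF f, of "ereal t"] by(simp add: jump_def)
 thus False using subordinator_pathD(2)[OF f, of t eta] t assms by simp
qed

lemma first_jump_time_pos: "AE w in M. 0 < first_jump_time (traj Q w)"
proof -
 have ev: "Q (1 / real (Suc n)):Borel M" for n by(rule driftless_subordinatorD(3)[OF Q]) simp
 have "(%w. indicator {f. ALL n::nat. 0 < f (1 / Suc n)} (traj Q w) :: ennreal):Borel M"
  using ev by(simp add: indicator_def del: of_nat_Suc)
 from Q_positive_null[unfolded nn_integral_0_iff_AE[OF this]] AE_space show ?thesis
 proof eventually_elim
  case (elim w)
  then obtain n :: nat where "Q (1 / Suc n) w <= 0" by(auto simp: indicator_def not_less simp del: of_nat_Suc split: if_splits)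
  hence "Q (1 / Suc n) w = 0" using subordinator_pathD(3)[OF path_nice(4)[OF elim(2)], of "1 / Suc n"] by simp
  from first_jump_time_ge[OF elim(2) _ this] have "ereal (1 / Suc n) <= first_jump_time (traj Q w)" by simp
  thus ?case by(rule less_le_trans[rotated]) simp
 qed
qed

end

section \<open>Restarting after an iteration\<close>

lemma isCont_shift_minus:
 fixes c :: "real => ereal"
 assumes "isCont c (u + T)" shows "isCont (%u. c (u + T) - ereal H) u"
proof -
 have "isCont (%u. u + T) u" by simp
 hence "isCont (%u. c (u + T)) u" using assms by(rule isCont_o2[where g=c])
 hence "((%u. c (u + T) + ereal (- H)) ---> c (u + T) + ereal (- H)) (at u)"
  unfolding isCont_def by(intro tendsto_add_left_ereal) auto
 thus ?thesis unfolding isCont_def minus_ereal_def by simp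
qed

lemma left_limit_shift:
 assumes f: "subordinator_path f" and t: "0 <= t" and u: "0 < u"
 shows "left_limit (shift_path t f) (ereal u) = left_limit f (ereal (t + u)) - f t"
proof(rule left_limit_eqI[OF subordinator_path_shift[OF f t] u])
 show "shift_path t f v <= left_limit f (ereal (t + u)) - f t" if "0 <= v" "v < u" for v
  using left_limit_bounds(1)[OF f, of "t + u" "t + v"] t u that by(simp add: shift_path_def)
 fix e :: real assume "0 < e"
 hence "\<forall>\<^sub>F x in at_left (t + u). left_limit f (ereal (t + u)) - e < f x"
  using t u by(intro order_tendstoD(1)[OF left_limit_tendsto[OF f]]) auto
 moreover have "\<forall>\<^sub>F x in at_left (t + u). t < x & x < t + u"
  using u by(intro eventually_at_leftI[of t]) auto
 ultimately have "\<forall>\<^sub>F x in at_left (t + u). left_limit f (ereal (t + u)) - e < f x & t < x & x < t + u" by eventually_elim auto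
 then obtain x where "left_limit f (ereal (t + u)) - e < f x" "t < x" "x < t + u"
  using eventually_happens by fastforce
 thus "EX v. 0 <= v & v < u & left_limit f (ereal (t + u)) - f t - e <= shift_path t f v"
  by(intro exI[of _ "x - t"]) (auto simp: shift_path_def)
qed

lemma jump_shift:
 assumes "subordinator_path f" "0 <= t" "0 < u"
 shows "jump (shift_path t f) (ereal u) = jump f (ereal (t + u))"
 using assms by(simp add: jump_def left_limit_shift) (simp add: shift_path_def)

text \<open>Models \<open>X1 + Q\<close> when the next jump of \<open>Q\<close> is already known:
  \<open>x\<close> alone until time \<open>D\<close>, then the jump \<open>J\<close> and a fresh
  path \<open>y\<close>. For infinite \<open>D\<close> nothing is added. \<open>max 0 J\<close> and
  the guard \<open>0 < D\<close> make it a path for all parameters, as measurability in them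
  demands.\<close>

definition graft :: "ereal => real => (real => real) => (real => real) => real => real" where
 "graft D J x y u = x u + (if 0 < D & D <= ereal u then max 0 J + y (u - real_of_ereal D) else 0)"

lemma subordinator_path_graft:
 assumes x: "subordinator_path x" and y: "subordinator_path y"
 shows "subordinator_path (graft D J x y)"
proof(cases D)
 case (real d)
 show ?thesis
 proof(cases "0 < d")
  case True
  define g where "g u = (if d <= u then max 0 J + y (u - d) else 0)" for u
  have "subordinator_path g" unfolding subordinator_path_def
  proof(intro conjI allI impI)
   show "g 0 = 0" using True by(simp add: g_def)
   show "mono_on {0..} g"
    using subordinator_pathD(2,3)[OF y] by(intro mono_onI) (auto simp: g_def intro!: add_nonneg_nonneg)
   fix t :: real assume "0 <= t"
   show "continuous (at_right t) g"
   proof(cases "d <= t")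
    case True
    have "filterlim (%u. u - d) (at_right (t - d)) (at_right t)"
     unfolding filterlim_at by(auto intro!: tendsto_intros simp: eventually_at_filter)
    hence "((%u. max 0 J + y (u - d)) ---> max 0 J + y (t - d)) (at_right t)"
     using True by(intro tendsto_intros filterlim_compose[OF subordinator_pathD(4)[OF y]]) auto
    moreover have "\<forall>\<^sub>F u in at_right t. max 0 J + y (u - d) = g u"
     using True by(auto simp: g_def eventually_at_filter)
    ultimately have "(g ---> max 0 J + y (t - d)) (at_right t)" by(rule Lim_transform_eventually)
    thus ?thesis using True by(simp add: continuous_within g_def)
   next
    case False
    have "\<forall>\<^sub>F u in at_right t. u < d" using False by(auto simp: eventually_at_right_field intro!: exI[of _ d])
    hence "\<forall>\<^sub>F u in at_right t. 0 = g u" by eventually_elim (simp add: g_def)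
    hence "(g ---> 0) (at_right t)" by(rule Lim_transform_eventually[OF tendsto_const])
    thus ?thesis using False by(simp add: continuous_within g_def)
   qed
  qed
  from subordinator_path_add[OF x this] show ?thesis
   unfolding graft_def[abs_def] g_def real using True by(simp cong: if_cong)
 qed (use x in \<open>simp add: graft_def[abs_def] real\<close>)
qed (use x in \<open>simp_all add: graft_def[abs_def]\<close>)

lemma measurable_graft:
 assumes [measurable]: "D:Borel N" "J:Borel N"
  and x: "X:N ->M path_space" and y: "Y:N ->M path_space"
 shows "(%w. graft (D w) (J w) (X w) (Y w)):N ->M path_space"
proof(rule measurable_into_path_space)
 show "subordinator_path (graft (D w) (J w) (X w) (Y w))" if "w:space N" for w
  using measurable_space[OF x that] measurable_space[OF y that] by(intro subordinator_path_graft) (auto simp: space_path_space)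
 fix t :: real assume t: "0 <= t"
 have [measurable]: "(%w. X w t):Borel N" by(rule measurable_eval_path[OF x t])
 have [measurable]: "(%w. Y w (max 0 (t - real_of_ereal (D w)))):Borel N"
  by(rule measurable_path_at[OF y]) auto
 have "(%w. X w t + (if 0 < D w & D w <= ereal t then max 0 (J w) + Y w (max 0 (t - real_of_ereal (D w))) else 0)):Borel N"
  by measurable
 also have "(%w. X w t + (if 0 < D w & D w <= ereal t then max 0 (J w) + Y w (max 0 (t - real_of_ereal (D w))) else 0)) =
   (%w. graft (D w) (J w) (X w) (Y w) t)"
 proof
  fix w show "X w t + (if 0 < D w & D w <= ereal t then max 0 (J w) + Y w (max 0 (t - real_of_ereal (D w))) else 0) =
   graft (D w) (J w) (X w) (Y w) t"
   by(cases "D w") (auto simp: graft_def max_def)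
 qed
 finally show "(%w. graft (D w) (J w) (X w) (Y w) t):Borel N" .
qed

lemma graft_before: "ereal u < D ==> graft D J x y u = x u"
 by(auto simp: graft_def)

lemma shift_graft_before:
 assumes "ereal t < D" "0 <= t"
 shows "shift_path t (graft D J x y) u = graft (D - ereal t) J (shift_path t x) y u"
 using assms by(cases D) (auto simp: shift_path_def graft_def algebra_simps)

lemma shift_graft_at:
 assumes "0 < t" "0 <= u" "y 0 = 0"
 shows "shift_path t (graft (ereal t) J x y) u = shift_path t x u + y u"
 using assms by(auto simp: shift_path_def graft_def)

locale crossing = decomposition M X1 X2 X3 Q S Lam chi q r
 for M :: "'a measure" and X1 X2 X3 Q S :: "real => 'a => real" and Lam chi q r +
 fixes c :: "real => ereal" and K :: ereal
 assumes c: "barrier c" and K: "0 < K" and fin: "K < oo \<or> (ALL t>0. c t < oo)"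
begin

text \<open>The boundary that is left after time \<open>T\<close> at height \<open>H\<close>. With
  \<open>max 0 T\<close> it is continuous on the positive half-line for every real \<open>T\<close>,
  which makes passage times measurable in the state.\<close>

definition residual :: "real => real => real => ereal" where
 "residual T H u = (if 0 < u + max 0 T then c (u + max 0 T) else oo) - ereal H"

text \<open>The initial state is listed separately because \<open>c\<close> has a limit, but no
  meaningful value, at 0. In both cases the residual boundary has a positive limit at 0.\<close>

definition admissible :: "real => real => bool" where
 "admissible T H <-> ereal T < K & (T = 0 & H = 0 \<or> 0 < T & ereal H < c T)"

text \<open>The target triple in absolute time and height, for a process that has reached
  \<open>H\<close> at time \<open>T\<close> and continues with the increments
  \<open>f\<close>.\<close>

definition outcome :: "real => real => (real => real) => ereal \<times> real \<times> real" where
 "outcome T H f = (let tau = min (passage_time f (residual T H)) (K - ereal T) in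
   (ereal T + tau, H + left_limit f tau, jump f tau))"

lemma residual_continuous: assumes "0 < u" shows "isCont (residual T H) u"
proof -
 have u: "0 < u + max 0 T" using assms by simp
 have 1: "isCont (%u. c (u + max 0 T) - ereal H) u"
  using barrierD(2)[OF c u] by(rule isCont_shift_minus)
 have "\<forall>\<^sub>F v in nhds u. residual T H v = c (v + max 0 T) - ereal H"
 proof -
  have "\<forall>\<^sub>F v in nhds u. 0 < v" using eventually_nhds_in_open[of "{0<..}" u] assms by simp
  thus ?thesis by eventually_elim (auto simp: residual_def max_def)
 qed
 from isCont_cong[OF this] 1 show ?thesis by simp
qed

lemma residual_measurable:
 assumes [measurable]: "T:Borel N" "H:Borel N" "u:Borel N"
 shows "(%x. residual (T x) (H x) (u x)):Borel N"
proof -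
 note [measurable] = barrier_measurable[OF c]
 have "(%x. (%t. if 0 < t then c t else oo) (u x + max 0 (T x)) - ereal (H x)):Borel N" by measurable
 thus ?thesis by(simp add: residual_def)
qed

lemma residual_barrier:
 assumes "admissible T H" shows "barrier (residual T H)"
proof(cases "T = 0")
 case True
 hence "H = 0" using assms by(auto simp: admissible_def)
 show ?thesis by(rule barrier_cong[OF c]) (simp add: residual_def True \<open>H = 0\<close>)
next
 case False
 hence T: "0 < T" "ereal H < c T" using assms by(auto simp: admissible_def)
 show ?thesis by(rule barrier_cong[OF barrier_shift[OF c T]]) (use T in \<open>simp add: residual_def\<close>)
qed

lemma residual_finite: assumes "K = oo" "0 < t" shows "residual T H t < oo"
proof -
 have "c (t + max 0 T) < oo" using fin assms by auto
 thus ?thesis using assms by(cases "c (t + max 0 T)") (auto simp: residual_def)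
qed

lemma residual_add:
 assumes "0 <= T" "0 <= t" "0 < u"
 shows "residual (T + t) (H + z) u = residual T H (u + t) - ereal z"
proof -
 have "u + max 0 (T + t) = (u + t) + max 0 T" using assms by simp
 thus ?thesis using assms unfolding residual_def by(cases "c ((u + t) + max 0 T)") (auto simp: add.assoc simp del: max.absorb2 max.absorb1)
qed

lemma outcome_cong:
 assumes eq: "!!u. 0 <= u ==> f u = g u" shows "outcome T H f = outcome T H g"
proof -
 have "passage_time f be = passage_time g be" for be
  unfolding passage_time_def using eq by(metis (no_types, lifting) less_imp_le)
 moreover have l: "left_limit f t = left_limit g t" for t
  using left_limit_cong[of "real_of_ereal t" f g] eq by(cases t) (auto simp: left_limit_def)
 moreover have "jump f t = jump g t" for t
  using eq[of "real_of_ereal t"] l by(cases t) (auto simp: jump_def)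
 ultimately show ?thesis by(simp add: outcome_def Let_def)
qed

lemma measurable_outcome:
 assumes [measurable]: "T:Borel N" "H:Borel N" "X:N ->M path_space"
 shows "(%x. outcome (T x) (H x) (X x)):Borel N"
proof -
 have [measurable]: "(%x. passage_time (X x) (residual (T x) (H x))):Borel N"
  by(rule measurable_passage_time) (auto intro: residual_measurable residual_continuous)
 show ?thesis unfolding outcome_def Let_def by(simp add: borel_prod[symmetric])
qed

text \<open>Since the path is strictly below the boundary at \<open>t\<close>, the passage is
  strictly later. The remaining problem is the same one for the shifted path, whose left limits and
  jumps at positive times are those of \<open>f\<close>, up to the height already reached.\<close>

lemma outcome_restart:
 assumes f: "subordinator_path f" and T: "0 <= T" and adm: "admissible T H" and t: "0 < t" "ereal t <= passage_time f (residual T H)"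
  and below: "ereal (f t) < residual T H t" and tK: "ereal t < K - ereal T"
  and fin: "K < oo \<or> passage_time f (residual T H) < oo"
 shows "outcome T H f = outcome (T + t) (H + f t) (shift_path t f)"
proof -
 note be = residual_barrier[OF adm]
 define g where "g = shift_path t f"
 have g: "subordinator_path g" unfolding g_def using f t by(intro subordinator_path_shift) auto
 define p where "p = passage_time g (residual (T + t) (H + f t))"
 have greater: "ereal t < passage_time f (residual T H)" by(rule passage_time_greater[OF be f t(1) below])
 have p0: "0 <= p" unfolding p_def by(rule passage_time_nonneg)
 have pass: "residual T H (u + t) < ereal (f (u + t)) <-> residual (T + t) (H + f t) u < ereal (g u)" if "0 < u" for u
  using T t that by(cases "residual T H (u + t)") (auto simp: residual_add g_def shift_path_def add.commute)
 have passage: "passage_time f (residual T H) = ereal t + p"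
 proof(rule antisym)
  show "passage_time f (residual T H) <= ereal t + p"
  proof(rule dense_ge)
   fix z assume z: "ereal t + p < z"
   have "p < z - ereal t" using z p0 by(cases z; cases p) auto
   then obtain u where u: "0 < u" "ereal u < z - ereal t" "residual (T + t) (H + f t) u < ereal (g u)"
    by(auto simp: p_def passage_time_less_iff)
   have "passage_time f (residual T H) <= ereal (u + t)" using u t pass[OF u(1)] by(intro passage_time_le) auto
   also have "... <= z" using u(2) by(cases z) auto
   finally show "passage_time f (residual T H) <= z" .
  qed
  show "ereal t + p <= passage_time f (residual T H)"
  proof(rule dense_ge)
   fix z assume z: "passage_time f (residual T H) < z"
   then obtain s where s: "0 < s" "ereal s < z" "residual T H s < ereal (f s)" by(auto simp: passage_time_less_iff)
   have "t < s" using less_le_trans[OF greater passage_time_le[of s "residual T H" f, OF s(1,3)]] by simp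
   hence "p <= ereal (s - t)" unfolding p_def using pass[of "s - t"] s by(intro passage_time_le) auto
   hence "ereal t + p <= ereal t + ereal (s - t)" by(rule add_left_mono)
   also have "... <= z" using s(2) by simp
   finally show "ereal t + p <= z" .
  qed
 qed
 define tau where "tau = min p (K - ereal (T + t))"
 have Kt: "K - ereal T = ereal t + (K - ereal (T + t))" by(cases K) auto
 have min: "min (passage_time f (residual T H)) (K - ereal T) = ereal t + tau"
  unfolding passage Kt tau_def by(auto simp: min_def ereal_add_le_add_iff)
 have "p ~= 0" using greater passage by auto
 hence "0 < p" using p0 by auto
 hence "0 < tau" using tK by(cases K) (auto simp: tau_def min_def)
 moreover have "tau < oo" using fin passage K tK by(cases K) (auto simp: tau_def min_def split: if_splits)
 ultimately obtain u where u: "tau = ereal u" "0 < u" by(cases tau) auto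
 have t0: "0 <= t" using t by simp
 have "left_limit g tau = left_limit f (ereal t + tau) - f t" "jump g tau = jump f (ereal t + tau)"
  using left_limit_shift[OF f t0 u(2)] jump_shift[OF f t0 u(2)] by(simp_all add: u g_def)
 hence "outcome T H f = (ereal T + (ereal t + tau), (H + f t) + left_limit g tau, jump g tau)"
  unfolding outcome_def min Let_def by simp
 also have "ereal T + (ereal t + tau) = ereal (T + t) + tau" by(simp add: u)
 finally have "outcome T H f = (ereal (T + t) + tau, (H + f t) + left_limit g tau, jump g tau)" .
 also have "... = outcome (T + t) (H + f t) g" by(simp add: outcome_def Let_def p_def[symmetric] tau_def)
 finally show ?thesis by(simp add: g_def)
qed

text \<open>Step 8 also stops when the boundary is merely touched. The strict increase
  \<open>inc\<close> after \<open>t\<close> makes \<open>t\<close> the passage time in this case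
  too.\<close>

lemma outcome_stop:
 assumes f: "subordinator_path f" and inc: "!!u. t < u ==> f t < f u" and adm: "admissible T H"
  and t: "0 < t" "ereal t <= passage_time f (residual T H)" "ereal t <= K - ereal T"
  and stop: "residual T H t <= ereal (f t) \<or> ereal t = K - ereal T"
 shows "outcome T H f = (ereal (T + t), H + left_limit f (ereal t), jump f (ereal t))"
proof -
 note be = residual_barrier[OF adm]
 have "min (passage_time f (residual T H)) (K - ereal T) = ereal t"
 proof(cases "ereal t = K - ereal T")
  case True
  thus ?thesis using t(2) by(metis min.absorb2)
 next
  case False
  hence "passage_time f (residual T H) = ereal t"
   using stop left_limit_passage_time[OF be f t(1,2)] by(intro passage_time_eqI[OF be f t(1) inc]) auto
  thus ?thesis using t(3) by(simp add: min.absorb1)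
 qed
 thus ?thesis by(simp add: outcome_def Let_def)
qed

end

section \<open>Value functions of the current state\<close>

context crossing
begin

lemma nn_integral_X1_Q:
 assumes [measurable]: "f:Borel (path_space >< path_space)"
 shows "(NINT w|M. f (traj X1 w, traj Q w)) = (NINT w|M. NINT w'|M. f (traj X1 w, traj Q w'))"
  and "(NINT w|M. f (traj X1 w, traj Q w)) = (NINT w|M. NINT w'|M. f (traj X1 w', traj Q w))"
proof -
 have 1: "(%(p, y). f (fst p, y)):Borel ((path_space >< path_space >< path_space) >< path_space)" by measurable
 show "(NINT w|M. f (traj X1 w, traj Q w)) = (NINT w|M. NINT w'|M. f (traj X1 w, traj Q w'))"
  using indep_pair_nn_integral[OF indep_Q 1] by simp
 have 2: "(%(p, x). f (x, snd (snd p))):Borel ((path_space >< path_space >< path_space) >< path_space)" by measurable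
 show "(NINT w|M. f (traj X1 w, traj Q w)) = (NINT w|M. NINT w'|M. f (traj X1 w', traj Q w))"
  using indep_pair_nn_integral[OF indep_X1 2] by simp
qed

text \<open>Conditional expectation of \<open>F\<close> of the target triple in state
  \<open>(T, H)\<close> while nothing is known about the next jump of \<open>Q\<close>;
  \<open>pending_value\<close> is its counterpart after Step 1 has drawn that jump.\<close>

definition fresh_value :: "(ereal \<times> real \<times> real => ennreal) => real => real => ennreal" where
 "fresh_value F T H = (NINT w|M. F (outcome T H (%u. X1 u w + Q u w)))"

definition pending_value :: "(ereal \<times> real \<times> real => ennreal) => real => real => ereal => real => ennreal" where
 "pending_value F T H D J = (NINT w|M. F (outcome T H (graft D J (traj X1 w) (traj Q w))))"

definition continues :: "real => real => ereal => real => real => real => real => bool" where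
 "continues T H D J t x v <-> ereal (x + v + (if ereal t = D then J else 0)) < residual T H t & ereal t < K - ereal T"

definition step_value :: "(ereal \<times> real \<times> real => ennreal) => real => real => ereal => real => real => real => real => ennreal" where
 "step_value F T H D J t x v =
   (if continues T H D J t x v
   then if ereal t = D then fresh_value F (T + t) (H + (x + v + J)) else pending_value F (T + t) (H + (x + v)) (D - ereal t) J
   else F (ereal (T + t), H + x, v + (if ereal t = D then J else 0)))"

lemma measurable_continues:
 assumes [measurable]: "T:Borel N" "H:Borel N" "D:Borel N" "J:Borel N"
  "t:Borel N" "x:Borel N" "v:Borel N"
 shows "Measurable.pred N (%p. continues (T p) (H p) (D p) (J p) (t p) (x p) (v p))"
proof -
 have [measurable]: "(%p. residual (T p) (H p) (t p)):Borel N" by(rule residual_measurable) measurable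
 show ?thesis unfolding continues_def by measurable
qed

context
 fixes F :: "ereal \<times> real \<times> real => ennreal"
 assumes F[measurable]: "F:Borel borel"
begin

lemma measurable_fresh_value:
 assumes [measurable]: "T:Borel N" "H:Borel N"
 shows "(%x. fresh_value F (T x) (H x)):Borel N"
 unfolding fresh_value_def
proof(rule sigma_finite_measure.borel_measurable_nn_integral[OF sigma_finite_M])
 have [measurable]: "(%z. (%u. X1 u (snd z) + Q u (snd z))):N >< M ->M path_space"
  by(rule measurable_path_add) (auto intro: measurable_compose[OF measurable_snd] path_measurable)
 have "(%z. outcome (T (fst z)) (H (fst z)) (%u. X1 u (snd z) + Q u (snd z))):Borel (N >< M)"
  by(rule measurable_outcome) measurable
 from measurable_compose[OF this F] show "(%(x, w). F (outcome (T x) (H x) (%u. X1 u w + Q u w))):Borel (N >< M)"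
  by(simp add: split_beta')
qed

lemma measurable_pending_value:
 assumes [measurable]: "T:Borel N" "H:Borel N" "D:Borel N" "J:Borel N"
 shows "(%x. pending_value F (T x) (H x) (D x) (J x)):Borel N"
 unfolding pending_value_def
proof(rule sigma_finite_measure.borel_measurable_nn_integral[OF sigma_finite_M])
 have [measurable]: "(%z. graft (D (fst z)) (J (fst z)) (traj X1 (snd z)) (traj Q (snd z))):N >< M ->M path_space"
  by(rule measurable_graft) (auto intro: measurable_compose[OF measurable_snd] path_measurable)
 have "(%z. outcome (T (fst z)) (H (fst z)) (graft (D (fst z)) (J (fst z)) (traj X1 (snd z)) (traj Q (snd z)))):Borel (N >< M)"
  by(rule measurable_outcome) measurable
 from measurable_compose[OF this F] show "(%(x, w). F (outcome (T x) (H x) (graft (D x) (J x) (traj X1 w) (traj Q w)))):Borel (N >< M)"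
  by(simp add: split_beta')
qed

lemma measurable_step_value:
 assumes [measurable]: "T:Borel N" "H:Borel N" "D:Borel N" "J:Borel N"
  "t:Borel N" "x:Borel N" "v:Borel N"
 shows "(%p. step_value F (T p) (H p) (D p) (J p) (t p) (x p) (v p)):Borel N"
proof -
 have [measurable]: "Measurable.pred N (%p. continues (T p) (H p) (D p) (J p) (t p) (x p) (v p))"
  by(rule measurable_continues) measurable
 have [measurable]: "(%p. fresh_value F (T p + t p) (H p + (x p + v p + J p))):Borel N"
  by(rule measurable_fresh_value) measurable
 have [measurable]: "(%p. pending_value F (T p + t p) (H p + (x p + v p)) (D p - ereal (t p)) (J p)):Borel N"
  by(rule measurable_pending_value) measurable
 have F3[measurable]: "F:Borel (borel >< borel >< borel)" by(simp add: borel_prod)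
 show ?thesis unfolding step_value_def by measurable
qed

text \<open>Strong Markov property of \<open>Q\<close> at its first jump, truncated at the remaining
  horizon. Up to then \<open>Q\<close> is 0, at that time it equals its jump, and afterwards it may
  be replaced by a fresh copy: this is \<open>graft\<close> with the pair drawn in Step 1. If the
  truncated time is infinite, \<open>Q\<close> vanishes.\<close>

lemma fresh_value_first_jump:
 assumes T: "ereal T < K"
 shows "fresh_value F T H = (NINT w|M. (let d = min (first_jump_time (traj Q w)) (K - ereal T) in
   pending_value F T H d (jump (traj Q w) d)))"
proof -
 define A where "A = K - ereal T"
 have A: "0 < A" using T by(cases K) (auto simp: A_def)
 define d where "d y = min (first_jump_time y) A" for y
 have dm[measurable]: "(%z. d (Y z)):Borel N" if [measurable]: "Y:N ->M path_space" for Y and N :: "'z measure"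
  unfolding d_def by measurable
 let ?P3 = "path_space >< path_space >< path_space" let ?E = "borel >< borel >< path_space"
 define tau where "tau = (%(p :: (real => real) \<times> (real => real) \<times> (real => real), y). d y)"
 define Ga where "Ga = (%(p :: (real => real) \<times> (real => real) \<times> (real => real), y). (d y, jump y (d y), fst p))"
 define Psi where "Psi = (%((D, J, x), y). F (outcome T H (graft D J x y)))"
 have m1: "(%z. F (outcome T H (graft (D z) (J z) (X z) (Y z)))):Borel N"
  if [measurable]: "D:Borel N" "J:Borel N" "X:N ->M path_space" "Y:N ->M path_space"
  for D J X Y and N :: "'z measure"
  by(intro measurable_compose[OF _ F] measurable_outcome measurable_graft) measurable
 have Psi: "Psi:Borel (?E >< path_space)"
  unfolding Psi_def split_beta' by(rule m1) measurable
 interpret R: regenerative M "%w. (traj X1 w, traj X2 w, traj X3 w)" ?P3 "%w. traj Q w"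
  by(rule regenerative_Q)
 let ?z = "%w. ((traj X1 w, traj X2 w, traj X3 w), traj Q w)"
 let ?o = "%w. F (outcome T H (%u. X1 u w + Q u w))" and ?A = "%w. d (traj Q w) < oo"
 have SM: "(NINT w|M. indicator {w. tau (?z w) < oo} w * Psi (Ga (?z w), shift_path (real_of_ereal (tau (?z w))) (traj Q w))) =
  (NINT w|M. indicator {w. tau (?z w) < oo} w * (NINT w'|M. Psi (Ga (?z w), traj Q w')))"
 proof(rule R.strong_markov[OF _ _ _ _ Psi])
  show "tau:Borel (?P3 >< path_space)" unfolding tau_def split_beta' by measurable
  show "Ga:?P3 >< path_space ->M ?E" unfolding Ga_def split_beta' by measurable
  show "0 <= tau (p, y)" for p y using A first_jump_time_nonneg[of y] by(auto simp: tau_def d_def)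
  fix p :: "(real => real) \<times> (real => real) \<times> (real => real)" and y s
  assume s: "0 < s" and less: "tau (p, y) < ereal s \<or> tau (p, stop_path s y) < ereal s"
  have eq: "d (stop_path s y) = d y"
   unfolding d_def
  proof(rule min_eq_if_agree_below)
   show "first_jump_time (stop_path s y) < z <-> first_jump_time y < z" if "z <= ereal s" for z
    by(rule first_jump_time_stop_less[OF that])
   show "min (first_jump_time (stop_path s y)) A < ereal s \<or> min (first_jump_time y) A < ereal s"
    using less by(auto simp: tau_def d_def)
  qed
  hence "d y < ereal s" using less by(auto simp: tau_def)
  hence "jump (stop_path s y) (d y) = jump y (d y)"
   using jump_stop[of "real_of_ereal (d y)" s y] by(cases "d y") (auto simp: jump_def)
  thus "tau (p, stop_path s y) = tau (p, y) & Ga (p, stop_path s y) = Ga (p, y)"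
   using eq by(simp add: tau_def Ga_def)
 qed
 define G where "G x D J = (NINT w'|M. F (outcome T H (graft D J x (traj Q w'))))" for x D J
 have Gm[measurable]: "(%z. G (X z) (D z) (J z)):Borel N"
  if [measurable]: "D:Borel N" "J:Borel N" "X:N ->M path_space" for D J X and N :: "'z measure"
 proof -
  have "(%(z, w). F (outcome T H (graft (D z) (J z) (X z) (traj Q w)))):Borel (N >< M)"
   unfolding split_beta' by(rule m1) measurable
  thus ?thesis unfolding G_def
   by(rule sigma_finite_measure.borel_measurable_nn_integral[OF sigma_finite_M])
 qed
 let ?g = "%w. G (traj X1 w) (d (traj Q w)) (jump (traj Q w) (d (traj Q w)))"
 have [measurable]: "?o:Borel M"
  by(intro measurable_compose[OF _ F] measurable_outcome measurable_path_add) auto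
 note split = nn_integral_split[where A="%_. True" and P="?A" and M=M]
 have "fresh_value F T H = (NINT w|M. (if ?A w then ?o w else 0)) + (NINT w|M. (if ~ ?A w then ?o w else 0))"
  unfolding fresh_value_def using split[where f="?o"] by simp
 also have "(NINT w|M. (if ?A w then ?o w else 0)) =
  (NINT w|M. indicator {w. tau (?z w) < oo} w * Psi (Ga (?z w), shift_path (real_of_ereal (tau (?z w))) (traj Q w)))"
 proof(rule nn_integral_cong_AE, goal_cases)
  case 1 show ?case
   using Q_zero_before_jump first_jump_time_pos AE_space
  proof eventually_elim
   case (elim w)
   note f = path_nice(4)[OF elim(3)]
   show ?case
   proof(cases "d (traj Q w) < oo")
    case True
    have "0 < d (traj Q w)" using elim(2) A by(simp add: d_def)
    then obtain e where e: "d (traj Q w) = ereal e" "0 < e" using True by(cases "d (traj Q w)") auto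
    have z: "Q v w = 0" if "0 <= v" "v < e" for v
    proof -
     have "ereal v < d (traj Q w)" using e that by simp
     also have "... <= first_jump_time (traj Q w)" by(simp add: d_def)
     finally show ?thesis using elim(1) that by auto
    qed
    have "left_limit (traj Q w) (ereal e) = 0"
     by(rule left_limit_eqI[OF f e(2)]) (use z e in \<open>auto intro!: exI[of _ 0]\<close>)
    hence j: "jump (traj Q w) (ereal e) = Q e w" using e by(simp add: jump_def)
    have "0 <= Q e w" using subordinator_pathD(3)[OF f, of e] e by simp
    hence "outcome T H (graft (ereal e) (Q e w) (traj X1 w) (shift_path e (traj Q w))) = outcome T H (%u. X1 u w + Q u w)"
     using z e by(intro outcome_cong) (auto simp: graft_def shift_path_def)
    thus ?thesis using True by(simp add: e tau_def Ga_def Psi_def j)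
   qed (simp add: tau_def)
  qed
 qed
 also have "... = (NINT w|M. (if ?A w then ?g w else 0))"
  unfolding SM by(intro nn_integral_cong) (auto simp: G_def tau_def Ga_def Psi_def)
 also have "(NINT w|M. (if ~ ?A w then ?o w else 0)) = (NINT w|M. (if ~ ?A w then ?g w else 0))"
 proof(rule nn_integral_cong_AE, goal_cases)
  case 1 show ?case
   using Q_zero_before_jump
  proof eventually_elim
   case (elim w)
   show ?case
   proof(cases "d (traj Q w) < oo")
    case False
    hence dinf: "d (traj Q w) = oo" by simp
    hence "first_jump_time (traj Q w) = oo" by(auto simp: d_def min_def split: if_splits)
    hence "outcome T H (%u. X1 u w + Q u w) = outcome T H (traj X1 w)"
     using elim by(intro outcome_cong) auto
    moreover have "graft oo J x y = x" for J x y by(simp add: graft_def fun_eq_iff)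
    ultimately show ?thesis by(simp add: dinf G_def emeasure_space_1)
   qed simp
  qed
 qed
 also have "(NINT w|M. (if ?A w then ?g w else 0)) + ... = (NINT w|M. ?g w)"
  using split[where f="?g"] by simp
 also have "... = (NINT w|M. NINT w'|M. G (traj X1 w') (d (traj Q w)) (jump (traj Q w) (d (traj Q w))))"
 proof -
  have "(%(x, y). G x (d y) (jump y (d y))):Borel (path_space >< path_space)"
   unfolding split_beta' by measurable
  from nn_integral_X1_Q(2)[OF this] show ?thesis by simp
 qed
 also have "... = (NINT w|M. pending_value F T H (d (traj Q w)) (jump (traj Q w) (d (traj Q w))))"
 proof(intro nn_integral_cong)
  fix w
  have "(%(x, y). F (outcome T H (graft (d (traj Q w)) (jump (traj Q w) (d (traj Q w))) x y))):Borel (path_space >< path_space)"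
   unfolding split_beta' by(rule m1) measurable
  from nn_integral_X1_Q(1)[OF this] show "(NINT w'|M. G (traj X1 w') (d (traj Q w)) (jump (traj Q w) (d (traj Q w)))) =
   pending_value F T H (d (traj Q w)) (jump (traj Q w) (d (traj Q w)))"
   by(simp add: G_def pending_value_def)
 qed
 finally show ?thesis by(simp add: d_def A_def Let_def)
qed

end

end

section \<open>The strong Markov property at the end of an iteration\<close>

lemma passage_time_less_cong:
 assumes "!!u. 0 < u ==> ereal u < z ==> f u = g u" shows "passage_time f be < z <-> passage_time g be < z"
 unfolding passage_time_less_iff using assms by metis

lemma passage_time_unbounded:
 assumes be: "barrier be" and t: "0 < t" "be t < oo" and f: "subordinator_path f" and unbounded: "!!B. EX u>0. B < f u"
 shows "passage_time f be < oo"
proof -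
 obtain z where z: "be t = ereal z" using barrierD(3)[OF be t(1)] t(2) by(cases "be t") auto
 obtain u where u: "0 < u" "z < f u" using unbounded by blast
 have "be (max t u) <= ereal z" using barrierD(1)[OF be t(1), of "max t u"] z by simp
 also have "... < ereal (f (max t u))"
  using u subordinator_pathD(2)[OF f, of u "max t u"] by auto
 finally have "passage_time f be <= ereal (max t u)" using t u by(intro passage_time_le) auto
 thus ?thesis by(rule le_less_trans) (simp add: max_def)
qed

lemma graft_diff_ge:
 assumes y: "subordinator_path y" and "0 <= s" "s <= t"
 shows "x t - x s <= graft D J x y t - graft D J x y s" "x t <= graft D J x y t"
proof -
 have g: "subordinator_path (graft D J (%_. 0) y)"
  using y by(intro subordinator_path_graft) (auto simp: subordinator_path_def mono_on_def)
 have eq: "graft D J x y u = x u + graft D J (%_. 0) y u" for u by(simp add: graft_def)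
 show "x t - x s <= graft D J x y t - graft D J x y s" "x t <= graft D J x y t"
  unfolding eq using subordinator_pathD(2,3)[OF g] assms by auto
qed

context crossing
begin

text \<open>The pathwise content of Step 8. Before \<open>t\<close> the graft coincides with
  \<open>x\<close>, which is below the boundary, so the passage is not earlier than
  \<open>t\<close>; then either \<open>outcome_restart\<close> or \<open>outcome_stop\<close>
  applies.\<close>

lemma outcome_graft:
 assumes x: "subordinator_path x" and y: "subordinator_path y" and inc: "!!u. t < u ==> x t < x u"
  and adm: "admissible T H" and D: "ereal t <= D" "D <= K - ereal T" and J: "0 <= J" and t: "0 < t"
  and below: "!!s. 0 < s ==> s < t ==> ereal (x s) <= residual T H s"
  and fin: "K < oo \<or> passage_time (graft D J x y) (residual T H) < oo"
 shows "outcome T H (graft D J x y) =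
  (if continues T H D J t (left_limit x (ereal t)) (jump x (ereal t))
   then if ereal t = D then outcome (T + t) (H + (left_limit x (ereal t) + jump x (ereal t) + J)) (%u. shift_path t x u + y u)
    else outcome (T + t) (H + (left_limit x (ereal t) + jump x (ereal t))) (graft (D - ereal t) J (shift_path t x) y)
   else (ereal (T + t), H + left_limit x (ereal t), jump x (ereal t) + (if ereal t = D then J else 0)))"
proof -
 define f where "f = graft D J x y"
 have T: "0 <= T" using adm by(auto simp: admissible_def)
 have f: "subordinator_path f" unfolding f_def by(rule subordinator_path_graft[OF x y])
 have bef: "f u = x u" if "u < t" for u
  using that D(1) by(auto simp: f_def intro!: graft_before intro: less_le_trans[of _ "ereal t"])
 have L: "left_limit f (ereal t) = left_limit x (ereal t)"
  using t bef by(intro left_limit_cong) auto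
 have ft: "f t = x t + (if ereal t = D then J else 0)"
  using D(1) t J subordinator_pathD(1)[OF y] by(auto simp: f_def graft_def)
 have jf: "jump f (ereal t) = jump x (ereal t) + (if ereal t = D then J else 0)"
  using t by(simp add: jump_def L ft)
 have xt: "left_limit x (ereal t) + jump x (ereal t) = x t" using t by(simp add: jump_def)
 have pass: "ereal t <= passage_time f (residual T H)"
 proof(rule ccontr)
  assume "~ ?thesis"
  then obtain s where s: "0 < s" "s < t" "residual T H s < ereal (f s)" by(auto simp: passage_time_less_iff not_le)
  thus False using below[of s] bef[of s] by(simp add: leD)
 qed
 have tK: "ereal t <= K - ereal T" using D by(rule order_trans)
 have cont: "continues T H D J t (left_limit x (ereal t)) (jump x (ereal t)) <-> ereal (f t) < residual T H t & ereal t < K - ereal T"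
  by(simp add: continues_def ft xt)
 show ?thesis
 proof(cases "continues T H D J t (left_limit x (ereal t)) (jump x (ereal t))")
  case True
  hence "outcome T H f = outcome (T + t) (H + f t) (shift_path t f)"
   using cont fin by(intro outcome_restart f T adm t pass) (auto simp: f_def)
  also have "... = (if ereal t = D then outcome (T + t) (H + f t) (%u. shift_path t x u + y u)
    else outcome (T + t) (H + f t) (graft (D - ereal t) J (shift_path t x) y))"
  proof(cases "ereal t = D")
   case True
   thus ?thesis unfolding f_def using t subordinator_pathD(1)[OF y]
    by(auto intro!: outcome_cong shift_graft_at)
  next
   case False
   hence "ereal t < D" using D(1) by auto
   thus ?thesis unfolding f_def using t False by(auto intro!: outcome_cong shift_graft_before)
  qed
  finally show ?thesis using True unfolding f_def[symmetric] xt by(simp add: ft)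
 next
  case False
  have "f t < f u" if "t < u" for u
   using graft_diff_ge(1)[OF y, of t u x D J] inc[OF that] that t by(simp add: f_def)
  hence "outcome T H f = (ereal (T + t), H + left_limit f (ereal t), jump f (ereal t))"
   using False cont tK by(intro outcome_stop[OF f _ adm t pass tK]) auto
  thus ?thesis using False unfolding f_def[symmetric] by(simp add: L jf)
 qed
qed

abbreviation capped_residual :: "real => real => real => ereal" where
 "capped_residual T H \<equiv> (%u. min (residual T H u) r)"

lemma capped_barrier: "admissible T H ==> barrier (capped_residual T H)"
 by(intro barrier_min residual_barrier r)

lemma capped_finite: "K = oo ==> 0 < t ==> capped_residual T H t < oo"
 using residual_finite[of t T H] by(metis min_less_iff_disj)

context
 fixes F :: "ereal \<times> real \<times> real => ennreal"
 assumes F[measurable]: "F:Borel borel"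
begin

text \<open>The regenerating process is \<open>X1\<close> alone. The whole paths of
  \<open>X2\<close>, \<open>X3\<close> and \<open>Q\<close> are treated as given data, so the end of
  the iteration, a passage of \<open>S\<close>, has to be nonanticipating in \<open>X1\<close>
  only.\<close>

lemma pending_value_iteration:
 assumes adm: "admissible T H" and D: "0 < D" "D <= K - ereal T" and J: "0 <= J"
 shows "pending_value F T H D J = (NINT w|M. (let t = min (passage_time (traj S w) (capped_residual T H)) D in
   step_value F T H D J (real_of_ereal t) (left_limit (traj X1 w) t) (jump (traj X1 w) t)))"
proof -
 define be where "be = capped_residual T H"
 have be: "barrier be" unfolding be_def by(rule capped_barrier[OF adm])
 have K_inf: "K = oo" if "D = oo" using D(2) that by(cases K) auto
 let ?P3 = "path_space >< path_space >< path_space" let ?E = "borel >< borel >< borel >< path_space"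
 define sg where "sg x x2 x3 = min (passage_time (%u. x u + x2 u + x3 u) be) D" for x x2 x3
 have sg0: "0 < sg x x2 x3" if "subordinator_path x" "subordinator_path x2" "subordinator_path x3" for x x2 x3
  unfolding sg_def using D(1) passage_time_pos[OF be subordinator_path_add[OF subordinator_path_add[OF that(1,2)] that(3)]] by simp
 have sgm[measurable]: "(%z. sg (X z) (Y z) (Z z)):Borel N"
  if [measurable]: "X:N ->M path_space" "Y:N ->M path_space" "Z:N ->M path_space" for X Y Z and N :: "'z measure"
 proof -
  have "(%z. (%u. X z u + Y z u + Z z u)):N ->M path_space" by(intro measurable_path_add) measurable
  from measurable_passage_time_const[OF this be] show ?thesis unfolding sg_def by measurable
 qed
 let ?z = "%w. ((traj X2 w, traj X3 w, traj Q w), traj X1 w)"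
 define tau where "tau = (%((x2, x3, y :: real => real), x). sg x x2 x3)"
 define Ga where "Ga = (%((x2, x3, y :: real => real), x). (real_of_ereal (sg x x2 x3), left_limit x (sg x x2 x3), jump x (sg x x2 x3), y))"
 define Psi where "Psi = (%((t, l, v, y), x). if continues T H D J t l v
   then if ereal t = D then F (outcome (T + t) (H + (l + v + J)) (%u. x u + y u))
    else F (outcome (T + t) (H + (l + v)) (graft (D - ereal t) J x y))
   else F (ereal (T + t), H + l, v + (if ereal t = D then J else 0)))"
 have F3[measurable]: "F:Borel (borel >< borel >< borel)" by(simp add: borel_prod)
 have Psim: "(%z. Psi ((t z, l z, v z, Y z), X z)):Borel N"
  if [measurable]: "t:Borel N" "l:Borel N" "v:Borel N" "X:N ->M path_space" "Y:N ->M path_space"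
  for t l v X Y and N :: "'z measure"
 proof -
  have [measurable]: "Measurable.pred N (%z. continues T H D J (t z) (l z) (v z))"
   by(rule measurable_continues) measurable
  have [measurable]: "(%z. F (outcome (T + t z) (H + (l z + v z + J)) (%u. X z u + Y z u))):Borel N"
   by(intro measurable_compose[OF _ F] measurable_outcome measurable_path_add) measurable
  have [measurable]: "(%z. F (outcome (T + t z) (H + (l z + v z)) (graft (D - ereal (t z)) J (X z) (Y z)))):Borel N"
   by(intro measurable_compose[OF _ F] measurable_outcome measurable_graft) measurable
  show ?thesis unfolding Psi_def split_conv fst_conv snd_conv by measurable
 qed
 have Psi: "Psi:Borel (?E >< path_space)"
 proof -
  have "(%z. Psi ((fst (fst z), fst (snd (fst z)), fst (snd (snd (fst z))), snd (snd (snd (fst z)))), snd z)):Borel (?E >< path_space)"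
   by(rule Psim) measurable
  thus ?thesis by simp
 qed
 interpret R: regenerative M "%w. (traj X2 w, traj X3 w, traj Q w)" ?P3 "%w. traj X1 w"
  by(rule regenerative_X1)
 define t where "t w = min (passage_time (traj S w) be) D" for w
 have tsg: "sg (traj X1 w) (traj X2 w) (traj X3 w) = t w" for w by(simp add: t_def sg_def S_eq)
 have t_fin: "AE w in M. t w < oo"
 proof(cases "D = oo")
  case True
  hence "EX t>0. be t < oo" using capped_finite[OF K_inf, of 1] by(intro exI[of _ 1]) (simp add: be_def)
  from passage_time_finite[OF be this] show ?thesis by eventually_elim (auto simp: t_def min_def)
 next
  case False
  thus ?thesis by(cases D) (auto simp: t_def min_def)
 qed
 have [measurable]: "t:Borel M" unfolding tsg[symmetric] by measurable
 let ?Psi = "%w. indicator {w. tau (?z w) < oo} w * Psi (Ga (?z w), shift_path (real_of_ereal (tau (?z w))) (traj X1 w))"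
 have SM: "(NINT w|M. ?Psi w) =
  (NINT w|M. indicator {w. tau (?z w) < oo} w * (NINT w'|M. Psi (Ga (?z w), traj X1 w')))"
 proof(rule R.strong_markov[OF _ _ _ _ Psi])
  show "tau:Borel (?P3 >< path_space)" unfolding tau_def split_beta' by measurable
  show "Ga:?P3 >< path_space ->M ?E" unfolding Ga_def split_beta' by measurable
  show "0 <= tau (p, x)" if "p:space ?P3" "subordinator_path x" for p x
   using that sg0[of x "fst p" "fst (snd p)"] by(auto simp: tau_def space_pair_measure space_path_space split_beta')
  fix p x s
  assume p: "p:space ?P3" "subordinator_path x" and s: "0 < s" and less: "tau (p, x) < ereal s \<or> tau (p, stop_path s x) < ereal s"
  obtain x2 x3 y where wd: "p = (x2, x3, y)" by(cases p) auto
  have eq: "sg (stop_path s x) x2 x3 = sg x x2 x3"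
   unfolding sg_def
  proof(rule min_eq_if_agree_below)
   show "passage_time (%u. stop_path s x u + x2 u + x3 u) be < z <-> passage_time (%u. x u + x2 u + x3 u) be < z" if "z <= ereal s" for z
   proof(rule passage_time_less_cong)
    fix u assume "0 < u" "ereal u < z"
    hence "ereal u < ereal s" using that by(metis less_le_trans)
    thus "stop_path s x u + x2 u + x3 u = x u + x2 u + x3 u" by(simp add: stop_path_def)
   qed
   show "min (passage_time (%u. stop_path s x u + x2 u + x3 u) be) D < ereal s \<or> min (passage_time (%u. x u + x2 u + x3 u) be) D < ereal s"
    using less by(auto simp: tau_def sg_def wd)
  qed
  hence "sg x x2 x3 < ereal s" using less by(auto simp: tau_def wd)
  moreover have "0 < sg x x2 x3" using p by(intro sg0) (auto simp: wd space_pair_measure space_path_space)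
  ultimately obtain v where v: "sg x x2 x3 = ereal v" "0 < v" "v < s" by(cases "sg x x2 x3") auto
  show "tau (p, stop_path s x) = tau (p, x) & Ga (p, stop_path s x) = Ga (p, x)"
   using v left_limit_stop[of v s x] jump_stop[of v s x] by(simp add: tau_def Ga_def eq wd)
 qed
 have "pending_value F T H D J = (NINT w|M. ?Psi w)"
  unfolding pending_value_def
 proof(rule nn_integral_cong_AE)
  have unb: "AE w in M. ALL B. EX t>0. B < X1 t w"
   using infinite_measures(1) by(intro subordinator_unbounded[OF X1]) simp
  have "AE w in M. ALL s t. 0 <= s --> s < t --> X1 s w < X1 t w"
   by(rule subordinator_strict_mono[OF X1 infinite_measures(1)])
  thus "AE w in M. F (outcome T H (graft D J (traj X1 w) (traj Q w))) =
   ?Psi w"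
   using unb t_fin AE_space
  proof eventually_elim
   case (elim w)
   note n = path_nice[OF elim(4)]
   have "0 < t w" using sg0[OF n(1-3)] by(simp add: tsg)
   then obtain u where u: "t w = ereal u" "0 < u" using elim(3) by(cases "t w") auto
   have uD: "ereal u <= D" using u by(metis t_def min.cobounded2)
   have up: "ereal u <= passage_time (traj S w) be" using u by(metis t_def min.cobounded1)
   have below: "ereal (X1 s w) <= residual T H s" if "0 < s" "s < u" for s
   proof -
    have "X1 s w <= S s w" using subordinator_pathD(3)[OF n(2), of s] subordinator_pathD(3)[OF n(3), of s] that by(simp add: S_eq)
    moreover have "ereal (S s w) <= be s"
     using that(2) by(intro below_barrier that less_le_trans[OF _ up]) simp
    ultimately show ?thesis using order_trans[of "ereal (X1 s w)" "ereal (S s w)"] by(auto simp: be_def)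
   qed
   have fin: "K < oo \<or> passage_time (graft D J (traj X1 w) (traj Q w)) (residual T H) < oo"
   proof(cases "K = oo")
    case True
    have "passage_time (graft D J (traj X1 w) (traj Q w)) (residual T H) < oo"
    proof(rule passage_time_unbounded[OF residual_barrier[OF adm], of 1])
     show "residual T H 1 < oo" using True by(intro residual_finite) auto
     show "subordinator_path (graft D J (traj X1 w) (traj Q w))" by(rule subordinator_path_graft[OF n(1,4)])
     fix B
     obtain s where s: "0 < s" "B < X1 s w" using elim(2) by blast
     have "X1 s w <= graft D J (traj X1 w) (traj Q w) s"
      using s(1) by(intro graft_diff_ge(2)[OF n(4), of s s]) auto
     thus "EX s>0. B < graft D J (traj X1 w) (traj Q w) s" using s by(intro exI[of _ s]) simp
    qed simp
    thus ?thesis ..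
   qed auto
   note outcome_graft[OF n(1,4) _ adm uD D(2) J u(2) below fin]
   thus ?case using elim(1) u(2) by(simp add: tau_def Ga_def Psi_def tsg u)
  qed
 qed
 also have "... = (NINT w|M. (NINT w'|M. Psi (Ga (?z w), traj X1 w')))"
  unfolding SM
 proof(rule nn_integral_cong_AE, goal_cases)
  case 1 show ?case
   using t_fin by eventually_elim (simp add: tau_def tsg)
 qed
 \<comment> \<open>\<open>Q\<close> is independent of \<open>X1\<close>, \<open>X2\<close> and
   \<open>X3\<close>, which determine the end of the iteration; it may therefore be drawn
   separately.\<close>
 also have "... = (NINT w|M. NINT w''|M. NINT w'|M. Psi ((real_of_ereal (t w), left_limit (traj X1 w) (t w), jump (traj X1 w) (t w), traj Q w''), traj X1 w'))"
 proof -
  define f where "f = (%((x, x2, x3), y). (NINT w'|M. Psi ((real_of_ereal (sg x x2 x3), left_limit x (sg x x2 x3), jump x (sg x x2 x3), y), traj X1 w')))"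
  have "f:Borel (?P3 >< path_space)"
   unfolding f_def split_beta'
  proof(rule sigma_finite_measure.borel_measurable_nn_integral[OF sigma_finite_M])
   show "(%(z, w'). Psi ((real_of_ereal (sg (fst (fst z)) (fst (snd (fst z))) (snd (snd (fst z)))), left_limit (fst (fst z)) (sg (fst (fst z)) (fst (snd (fst z))) (snd (snd (fst z)))),
     jump (fst (fst z)) (sg (fst (fst z)) (fst (snd (fst z))) (snd (snd (fst z)))), snd z), traj X1 w')):Borel ((?P3 >< path_space) >< M)"
    unfolding split_beta' by(rule Psim) measurable
  qed
  from indep_pair_nn_integral[OF indep_Q this] show ?thesis by(simp add: f_def Ga_def tsg)
 qed
 \<comment> \<open>With the end of the iteration frozen, the fresh copies of \<open>X1\<close> and
   \<open>Q\<close> recombine into one expectation, which is a value of the next state.\<close>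
 also have "... = (NINT w|M. step_value F T H D J (real_of_ereal (t w)) (left_limit (traj X1 w) (t w)) (jump (traj X1 w) (t w)))"
 proof(intro nn_integral_cong)
  fix w
  define u l v where "u = real_of_ereal (t w)" and "l = left_limit (traj X1 w) (t w)" and "v = jump (traj X1 w) (t w)"
  have "(%(x, y). Psi ((u, l, v, y), x)):Borel (path_space >< path_space)"
   unfolding split_beta' by(rule Psim) measurable
  from nn_integral_X1_Q(2)[OF this]
  have "(NINT w''|M. NINT w'|M. Psi ((u, l, v, traj Q w''), traj X1 w')) = (NINT w|M. Psi ((u, l, v, traj Q w), traj X1 w))" by simp
  also have "... = step_value F T H D J u l v"
   by(auto simp: Psi_def step_value_def fresh_value_def pending_value_def emeasure_space_1)
  finally show "(NINT w''|M. NINT w'|M. Psi ((real_of_ereal (t w), left_limit (traj X1 w) (t w), jump (traj X1 w) (t w), traj Q w''), traj X1 w')) =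
   step_value F T H D J (real_of_ereal (t w)) (left_limit (traj X1 w) (t w)) (jump (traj X1 w) (t w))"
   by(simp add: u_def l_def v_def)
 qed
 finally show ?thesis by(simp add: t_def be_def Let_def)
qed

end

end

section \<open>The sampled variables\<close>

text \<open>\<open>sampled_given\<close> speaks about conditional probabilities of one set at a
  time; rectangles in \<open>F >< borel\<close> extend it to functions of the past and the sample.
  \<open>mu\<close> need only agree with a measurable kernel \<open>ka\<close> almost everywhere on
  \<open>E\<close>.\<close>

lemma sampled_given_nn_integral:
 fixes Y :: "'w => 'y::topological_space"
 assumes N: "prob_space N" and sub: "subalgebra N F" and Y[measurable]: "Y:Borel N" and E: "Measurable.pred F E"
  and ka: "ka:F ->M subprob_algebra borel" and sg: "sampled_given N F E Y mu" and eq: "AE w in N. E w --> mu w = ka w"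
  and f: "f:Borel (F >< borel)"
 shows "(NINT w|N. (if E w then f (w, Y w) else 0)) = (NINT w|N. (if E w then (NINT y|(ka w). f (w, y)) else 0))"
proof -
 interpret prob_space N by fact
 interpret finite_measure_subalgebra N F by unfold_locales fact
 have sp: "space F = space N" using sub by(simp add: subalgebra_def)
 have id[measurable]: "(%w. w):N ->M F"
  using measurable_from_subalg[OF sub measurable_ident] by(simp add: id_def)
 have EN[measurable]: "Measurable.pred N E" using measurable_from_subalg[OF sub E] .
 define e where "e w = (if E w then 1 else 0 :: ennreal)" for w
 have [measurable]: "e:Borel N" unfolding e_def by measurable
 have "(NINT w|N. e w * f (w, Y w)) = (NINT w|N. e w * (NINT y|(ka w). f (w, y)))"
 proof(rule kernel_nn_integral[OF finite_measure_axioms id Y ka _ _ _ f])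
  fix C :: "'w set" and D :: "'y set" assume C: "C:sets F" and D[measurable]: "D:sets borel"
  have CN[measurable]: "C:sets N" using C sub by(auto simp: subalgebra_def)
  define G where "G = {w:space N. E w} \<inter> C"
  have G: "G:sets F"
  proof -
   have "{w:space F. E w} \<inter> C:sets F" using E C by measurable
   thus ?thesis by(simp add: G_def sp)
  qed
  hence [measurable]: "G:sets N" using sub by(auto simp: subalgebra_def)
  define A where "A = {w:space N. Y w:D}"
  have [measurable]: "A:sets N" unfolding A_def by measurable
  define m where "m w = measure (ka w) D" for w
  have [measurable]: "m:Borel N"
   using measurable_compose[OF id measurable_compose[OF ka measurable_measure_subprob_algebra[OF D]]] by(simp add: m_def[abs_def])
  have km: "emeasure (ka w) D = ennreal (m w)" "m w <= 1" if "w:space N" for w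
  proof -
   interpret k: subprob_space "ka w" using subprob_measurableD(1) subprob_space_kernel[OF ka] that sp by auto
   show "emeasure (ka w) D = ennreal (m w)" "m w <= 1" by(simp_all add: m_def k.emeasure_eq_measure k.subprob_measure_le_1)
  qed
  have int: "integrable N (indicat_real A)" by(rule integrable_const_bound[where B=1]) auto
  have "(NINT w|N. e w * (indicator C w * indicator D (Y w))) = (NINT w|N. indicator (G \<inter> A) w)"
   by(intro nn_integral_cong) (auto simp: e_def G_def A_def indicator_def)
  also have "... = ennreal (prob (G \<inter> A))" by(simp add: emeasure_eq_measure)
  also have "prob (G \<inter> A) = (\<integral>w\<in>G. indicat_real A w \<partial>N)"
   by(simp add: set_lebesgue_integral_def indicator_inter_arith[symmetric])
  also have "... = (\<integral>w\<in>G. real_cond_exp N F (indicat_real A) w \<partial>N)"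
   by(rule real_cond_exp_intA[OF int G])
  also have "... = (\<integral>w\<in>G. m w \<partial>N)"
  proof(rule set_lebesgue_integral_cong_AE)
   have "AE w in N. E w --> real_cond_exp N F (indicat_real A) w = measure (mu w) D"
    using sg D unfolding sampled_given_def A_def by blast
   thus "AE w\<in>G in N. real_cond_exp N F (indicat_real A) w = m w"
    using eq by eventually_elim (auto simp: G_def m_def)
   show "real_cond_exp N F (indicat_real A):Borel N" by simp
  qed auto
  also have "ennreal (\<integral>w\<in>G. m w \<partial>N) = (NINT w|N. ennreal (indicator G w * m w))"
   unfolding set_lebesgue_integral_def
  proof(subst nn_integral_eq_integral)
   have "AE w in N. norm (indicator G w * m w) <= 1"
    using AE_space
   proof eventually_elim
    case (elim w)
    have "0 <= m w" by(simp add: m_def)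
    thus ?case using km(2)[OF elim] by(auto simp: indicator_def)
   qed
   thus "integrable N (%w. indicator G w * m w)"
    by(rule integrable_const_bound) measurable
  qed (auto simp: m_def)
  also have "... = (NINT w|N. e w * (indicator C w * emeasure (ka w) D))"
   by(intro nn_integral_cong) (auto simp: e_def G_def indicator_def km)
  finally show "(NINT w|N. e w * (indicator C w * indicator D (Y w))) = (NINT w|N. e w * (indicator C w * emeasure (ka w) D))" .
 qed (auto simp: e_def)
 thus ?thesis by(simp add: e_def if_distrib[of "%x. x * _"] cong: if_cong)
qed

definition samples :: "'w run => nat => 'w => ereal \<times> real \<times> ereal \<times> real \<times> real \<times> real \<times> real" where
 "samples R k w = (smpD R k w, smpJ R k w, smp_t1 R k w, smp_s R k w, smp_v R k w, smp_x R k w, smp_U R k w)"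

text \<open>A real substitute for \<open>curT\<close>, equal to it as long as the run is active and
  the invariant \<open>state_ok\<close> holds.\<close>

definition elapsed :: "'w run => nat => 'w => real" where
 "elapsed R n w = (\<Sum>j<n. real_of_ereal (run_t R j w))"

lemma measurable_samples:
 assumes "samples R k:Borel G"
 shows "smpD R k:Borel G" "smpJ R k:Borel G" "smp_t1 R k:Borel G"
  "smp_s R k:Borel G" "smp_v R k:Borel G" "smp_x R k:Borel G" "smp_U R k:Borel G"
proof -
 have [measurable]: "samples R k:G ->M borel >< borel >< borel >< borel >< borel >< borel >< borel"
  using assms by(simp add: borel_prod)
 have "(%w. fst (samples R k w)):Borel G" "(%w. fst (snd (samples R k w))):Borel G"
  "(%w. fst (snd (snd (samples R k w)))):Borel G" "(%w. fst (snd (snd (snd (samples R k w))))):Borel G"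
  "(%w. fst (snd (snd (snd (snd (samples R k w)))))):Borel G"
  "(%w. fst (snd (snd (snd (snd (snd (samples R k w))))))):Borel G"
  "(%w. snd (snd (snd (snd (snd (snd (samples R k w))))))):Borel G" by measurable
 thus "smpD R k:Borel G" "smpJ R k:Borel G" "smp_t1 R k:Borel G"
  "smp_s R k:Borel G" "smp_v R k:Borel G" "smp_x R k:Borel G" "smp_U R k:Borel G"
  by(simp_all add: samples_def)
qed

locale sampler = crossing M X1 X2 X3 Q S Lam chi q r c K
 for M :: "'a measure" and X1 X2 X3 Q S :: "real => 'a => real" and Lam chi q r c K +
 fixes N :: "'w measure" and R :: "'w run"
 assumes sampling_run: "sampling_run M X1 X2 S Q q r c K N R"
begin

lemma prob_space_N: "prob_space N" using sampling_run by(simp add: sampling_run_def)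

sublocale N: prob_space N by(rule prob_space_N)

lemma samples_N: "samples R k:Borel N"
 unfolding samples_def[abs_def] using sampling_run by(intro borel_measurable_Pair) (auto simp: sampling_run_def)

lemma updates:
 assumes "w:space N"
 shows "curT R 0 w = 0" "curH R 0 w = 0" "curD R 0 w = 0" "curA R 0 w = K"
  "curb R 0 w = (%u. if 0 < u then c u else oo)"
  "curT R (Suc n) w = curT R n w + run_t R n w" "curH R (Suc n) w = curH R n w + run_z q r R n w"
  "curA R (Suc n) w = curA R n w - run_t R n w" "curD R (Suc n) w = smpD R n w - run_t R n w"
  "curJ R (Suc n) w = smpJ R n w"
  "curb R (Suc n) w = (%u. curb R n w (u + real_of_ereal (run_t R n w)) - ereal (run_z q r R n w))"
 using sampling_run assms by(auto simp: sampling_run_def run_updates_def)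

lemma steps:
 "step1 M Q q r N R n" "step2 M S q r N R n" "step3 M S q r N R n" "step4 M S q r N R n" "step5 M X1 X2 S q r N R n" "step6 q r N R n"
 using sampling_run by(auto simp: sampling_run_def)

lemma curb_eq:
 assumes "w:space N"
 shows "curb R n w u = (if 0 < u + elapsed R n w then c (u + elapsed R n w) else oo) - ereal (curH R n w)"
proof(induction n arbitrary: u)
 case 0
 thus ?case by(simp add: updates[OF assms] elapsed_def)
next
 case (Suc n)
 have "u + elapsed R (Suc n) w = u + real_of_ereal (run_t R n w) + elapsed R n w" by(simp add: elapsed_def)
 moreover have "a - ereal x - ereal y = a - ereal (x + y)" for a x y by(cases a) auto
 ultimately show ?case by(simp add: updates[OF assms] Suc add.assoc)
qed

text \<open>Stated for any sigma-algebra \<open>G\<close> that contains the samples of the first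
  \<open>n\<close> iterations; it is used with \<open>N\<close> and with the past of the
  run.\<close>

context
 fixes G n assumes space_G: "space G = space N" and samples_G: "!!k. k < n ==> samples R k:Borel G"
begin

lemma measurable_derived:
 assumes k: "k < n"
 shows "run_t R k:Borel G" "run_v q r R k:Borel G" "run_Delta q r R k:Borel G"
  "run_z q r R k:Borel G"
proof -
 note [measurable] = measurable_samples[OF samples_G[OF k]]
 show [measurable]: "run_t R k:Borel G" unfolding run_t_def[abs_def] by measurable
 show [measurable]: "run_v q r R k:Borel G" unfolding run_v_def[abs_def] Let_def of_bool_def by measurable
 show [measurable]: "run_Delta q r R k:Borel G" unfolding run_Delta_def[abs_def] of_bool_def by measurable
 show "run_z q r R k:Borel G" unfolding run_z_def[abs_def] by measurable
qed

lemma measurable_state: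
 assumes k: "k <= n"
 shows "elapsed R k:Borel G" "curH R k:Borel G" "curT R k:Borel G"
  "curA R k:Borel G" "curD R k:Borel G"
proof -
 show "elapsed R k:Borel G" unfolding elapsed_def[abs_def]
  using measurable_derived(1) k by(intro borel_measurable_sum borel_measurable_real_of_ereal) auto
 have "curH R k:Borel G & curT R k:Borel G & curA R k:Borel G & curD R k:Borel G"
  using k
 proof(induction k)
  case 0
  have "curH R 0:Borel G <-> (%w. 0 :: real):Borel G"
   "curT R 0:Borel G <-> (%w. 0 :: ereal):Borel G"
   "curA R 0:Borel G <-> (%w. K):Borel G"
   "curD R 0:Borel G <-> (%w. 0 :: ereal):Borel G"
   by(intro measurable_cong; simp add: space_G updates)+
  thus ?case by simp
 next
  case (Suc k)
  hence k: "k < n" by simp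
  note [measurable] = measurable_samples[OF samples_G[OF k]] measurable_derived[OF k]
  have [measurable]: "curH R k:Borel G" "curT R k:Borel G" "curA R k:Borel G" using Suc by auto
  have "curH R (Suc k):Borel G <-> (%w. curH R k w + run_z q r R k w):Borel G"
   "curT R (Suc k):Borel G <-> (%w. curT R k w + run_t R k w):Borel G"
   "curA R (Suc k):Borel G <-> (%w. curA R k w - run_t R k w):Borel G"
   "curD R (Suc k):Borel G <-> (%w. smpD R k w - run_t R k w):Borel G"
   by(intro measurable_cong; simp add: space_G updates)+
  moreover have "(%w. curH R k w + run_z q r R k w):Borel G" "(%w. curT R k w + run_t R k w):Borel G"
   "(%w. curA R k w - run_t R k w):Borel G" "(%w. smpD R k w - run_t R k w):Borel G" by measurable
  ultimately show ?case by simp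
 qed
 thus "curH R k:Borel G" "curT R k:Borel G" "curA R k:Borel G" "curD R k:Borel G" by auto
qed

lemma measurable_stops: assumes k: "k < n" shows "Measurable.pred G (run_stops q r R k)"
proof -
 note [measurable] = measurable_derived[OF k] measurable_state[OF less_imp_le[OF k]] barrier_measurable[OF c]
 have "(%w. (%t. if 0 < t then c t else oo) (real_of_ereal (run_t R k w) + elapsed R k w) - ereal (curH R k w)):Borel G"
  by measurable
 hence [measurable]: "(%w. curb R k w (real_of_ereal (run_t R k w))):Borel G"
  by(rule measurable_cong[THEN iffD1, rotated]) (simp add: space_G curb_eq)
 show ?thesis unfolding run_stops_def[abs_def] by measurable
qed

lemma measurable_active: assumes "k <= n" shows "Measurable.pred G (run_active q r R k)"
 using assms
proof(induction k)
 case 0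
 show ?case by(simp add: run_active_def[abs_def])
next
 case (Suc k)
 hence [measurable]: "Measurable.pred G (run_active q r R k)" "Measurable.pred G (run_stops q r R k)"
  by(auto intro: measurable_stops)
 have "run_active q r R (Suc k) = (%w. run_active q r R k w & ~ run_stops q r R k w)"
  by(auto simp: run_active_def fun_eq_iff less_Suc_eq)
 thus ?case by simp
qed

end

lemma measurable_history:
 fixes g :: "'w => 'g::topological_space"
 shows "k < n ==> samples R k:Borel (run_history N R n g)" "g:Borel (run_history N R n g)"
proof -
 let ?f = "%w. (\<lambda>k\<in>{..<n}. samples R k w, g w)"
 have f: "?f:run_history N R n g ->M Pi\<^sub>M {..<n} (%_. borel) >< borel"
  unfolding run_history_def samples_def by(rule measurable_vimage_algebra1) (auto simp: space_pair_measure space_PiM)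
 from measurable_compose[OF f measurable_snd] show "g:Borel (run_history N R n g)" by simp
 assume "k < n"
 hence "(%p. p k):Borel (Pi\<^sub>M {..<n} (%_. borel))" by(intro measurable_component_singleton) simp
 from measurable_compose[OF measurable_compose[OF f measurable_fst] this] \<open>k < n\<close>
 show "samples R k:Borel (run_history N R n g)" by simp
qed

lemma space_history: "space (run_history N R n g) = space N"
 by(simp add: run_history_def)

lemma subalgebra_history:
 fixes g :: "'w => 'g::topological_space"
 assumes g: "g:Borel N" shows "subalgebra N (run_history N R n g)"
proof -
 have "(%w. w):N ->M run_history N R n g"
  unfolding run_history_def
 proof(rule measurable_vimage_algebra2)
  show "(%w. (\<lambda>k\<in>{..<n}. (smpD R k w, smpJ R k w, smp_t1 R k w, smp_s R k w, smp_v R k w, smp_x R k w, smp_U R k w), g w))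
   :N ->M Pi\<^sub>M {..<n} (%_. borel) >< borel"
   using g samples_N unfolding samples_def[abs_def] by(intro measurable_Pair measurable_restrict) auto
 qed simp
 show ?thesis
  unfolding subalgebra_def
 proof(intro conjI subsetI)
  fix A assume A: "A:sets (run_history N R n g)"
  hence "A \<subseteq> space N" using sets.sets_into_space[OF A] by(simp add: space_history)
  thus "A:sets N" using measurable_sets[OF \<open>(%w. w):_\<close> A] by(simp add: Int_absorb2)
 qed (simp add: space_history)
qed

lemma measurable_past_to_history: "(%w. w):run_history N R n g ->M run_past N R n"
 unfolding run_history_def[of N R n "%_. 0"]
proof(rule measurable_vimage_algebra2)
 show "(%w. (\<lambda>k\<in>{..<n}. (smpD R k w, smpJ R k w, smp_t1 R k w, smp_s R k w, smp_v R k w, smp_x R k w, smp_U R k w), 0 :: real))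
  :run_history N R n g ->M Pi\<^sub>M {..<n} (%_. borel) >< borel"
  using measurable_history(1)[of _ n g] unfolding samples_def[abs_def] by(intro measurable_Pair measurable_restrict) auto
qed (simp add: space_history)

end

lemma (in prob_space) sampled_given_distr:
 fixes Y :: "'w => 'y::topological_space"
 assumes N: "prob_space N" and sub: "subalgebra N F" and Y: "Y:Borel N" and E: "Measurable.pred F E"
  and g: "(%(w, w'). g w w'):Borel (F >< M)"
  and sg: "sampled_given N F E Y mu" and eq: "AE w in N. E w --> mu w = distr M borel (g w)"
  and f: "f:Borel (F >< borel)"
 shows "(NINT w|N. (if E w then f (w, Y w) else 0)) = (NINT w|N. (if E w then (NINT w'|M. f (w, g w w')) else 0))"
proof -
 have sp: "space F = space N" using sub by(simp add: subalgebra_def)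
 have "M:space (subprob_algebra M)" using subprob_space_axioms by(simp add: space_subprob_algebra)
 hence ka: "(%w. distr M borel (g w)):F ->M subprob_algebra borel"
  using g by(intro measurable_distr2[where M=M]) auto
 have "(NINT w|N. (if E w then f (w, Y w) else 0)) = (NINT w|N. (if E w then (NINT y|(distr M borel (g w)). f (w, y)) else 0))"
  by(rule sampled_given_nn_integral[OF N sub Y E ka sg eq f])
 also have "... = (NINT w|N. (if E w then (NINT w'|M. f (w, g w w')) else 0))"
 proof(rule nn_integral_cong)
  fix w assume "w:space N"
  hence v: "w:space F" by(simp add: sp)
  have "g w:Borel M" using measurable_Pair2[OF g v] by simp
  moreover have "(%y. f (w, y)):Borel borel" using measurable_Pair2[OF f v] by simp
  ultimately show "(if E w then (NINT y|(distr M borel (g w)). f (w, y)) else 0) = (if E w then (NINT w'|M. f (w, g w w')) else 0)"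
   by(simp add: nn_integral_distr)
 qed
 finally show ?thesis .
qed

text \<open>An almost sure property of the law passes to the sample, since the integral of the
  indicator of its failure is 0.\<close>

lemma (in prob_space) sampled_given_distr_AE:
 fixes Y :: "'w => 'y::topological_space"
 assumes N: "prob_space N" and sub: "subalgebra N F" and Y[measurable]: "Y:Borel N" and E: "Measurable.pred F E"
  and g: "(%(w, w'). g w w'):Borel (F >< M)"
  and sg: "sampled_given N F E Y mu" and eq: "AE w in N. E w --> mu w = distr M borel (g w)"
  and P: "Measurable.pred (F >< borel) (%(w, y). P w y)" and AE: "AE w in N. E w --> (AE w' in M. P w (g w w'))"
 shows "AE w in N. E w --> P w (Y w)"
proof -
 have id[measurable]: "(%w. w):N ->M F"
  using measurable_from_subalg[OF sub measurable_ident] by(simp add: id_def)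
 have EN[measurable]: "Measurable.pred N E" using measurable_from_subalg[OF sub E] .
 define f where "f = (%(w, y). if P w y then 0 else 1 :: ennreal)"
 have f[measurable]: "f:Borel (F >< borel)" unfolding f_def using P by(simp add: split_beta')
 have "(NINT w|N. (if E w then f (w, Y w) else 0)) = (NINT w|N. (if E w then (NINT w'|M. f (w, g w w')) else 0))"
  by(rule sampled_given_distr[OF N sub Y E g sg eq f])
 also have "... = (NINT w|N. 0)"
 proof(rule nn_integral_cong_AE, goal_cases)
  case 1 show ?case
   using AE
  proof eventually_elim
   case (elim w)
   show ?case
   proof(cases "E w")
    case True
    hence "AE w' in M. P w (g w w')" using elim by simp
    hence "AE w' in M. f (w, g w w') = 0" by eventually_elim (simp add: f_def)
    hence "(NINT w'|M. f (w, g w w')) = (NINT w'|M. 0)" by(rule nn_integral_cong_AE)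
    thus ?thesis by simp
   qed simp
  qed
 qed
 finally have z: "(NINT w|N. (if E w then f (w, Y w) else 0)) = 0" by simp
 have "(%w. if E w then f (w, Y w) else 0):Borel N" by measurable
 from z[unfolded nn_integral_0_iff_AE[OF this]] show ?thesis
  by eventually_elim (auto simp: f_def split: if_splits)
qed

section \<open>Invariants of a run\<close>

context sampler
begin

abbreviation active :: "nat => 'w => bool" where "active n w \<equiv> run_active q r R n w"
abbreviation (input) stops :: "nat => 'w => bool" where "stops \<equiv> run_stops q r R"
abbreviation (input) dur :: "nat => 'w => real" where "dur n w \<equiv> real_of_ereal (run_t R n w)"
abbreviation (input) target :: "nat => 'w => real => ereal" where "target n w \<equiv> capped_residual (elapsed R n w) (curH R n w)"
abbreviation (input) history :: "nat => ('w => 'g::topological_space) => 'w measure" where "history \<equiv> run_history N R"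

text \<open>Conditioned on activity, since the assignments go on with meaningless values after the
  run has stopped. The condition on \<open>smpJ\<close> for a nonzero \<open>curD\<close>
  anticipates that Step 1 then keeps the old jump.\<close>

definition state_ok :: "nat => 'w => bool" where
 "state_ok n w <-> (active n w --> curT R n w = ereal (elapsed R n w) & admissible (elapsed R n w) (curH R n w) &
   curA R n w = K - ereal (elapsed R n w) & 0 <= curD R n w & (curD R n w ~= 0 --> curD R n w <= curA R n w & 0 <= smpJ R n w))"

definition pending_ok :: "nat => 'w => bool" where
 "pending_ok n w <-> (active n w --> 0 < smpD R n w & smpD R n w <= K - ereal (elapsed R n w) & 0 <= smpJ R n w)"

lemma state_ok_0: "w:space N ==> state_ok 0 w"
 using K by(simp add: state_ok_def updates elapsed_def admissible_def zero_ereal_def[symmetric])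

lemma active_Suc: "active (Suc n) w <-> active n w & ~ stops n w"
 by(auto simp: run_active_def less_Suc_eq)

lemma elapsed_Suc: "elapsed R (Suc n) w = elapsed R n w + dur n w"
 by(simp add: elapsed_def)

lemma elapsed_nonneg: "state_ok n w ==> active n w ==> 0 <= elapsed R n w"
 by(auto simp: state_ok_def admissible_def)

lemma curb_residual:
 assumes "w:space N" "state_ok n w" "active n w"
 shows "curb R n w = residual (elapsed R n w) (curH R n w)" "run_bound r R n w = target n w"
 using elapsed_nonneg[OF assms(2,3)] by(auto simp: run_bound_def curb_eq[OF assms(1)] residual_def fun_eq_iff)

lemma run_t_real:
 assumes "state_ok n w" "pending_ok n w" "0 < smp_t1 R n w" "active n w" "run_t R n w < oo"
 shows "run_t R n w = ereal (dur n w)" "0 < dur n w"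
proof -
 have "0 < run_t R n w" using assms(2-4) by(auto simp: pending_ok_def run_t_def)
 thus "run_t R n w = ereal (dur n w)" "0 < dur n w"
  using assms(5) by(cases "run_t R n w"; simp)+
qed

text \<open>That the run goes on means that \<open>z\<close> is below the boundary and
  \<open>t\<close> is less than \<open>A\<close>; rewritten in absolute terms, this is admissibility
  of the next state.\<close>

lemma state_ok_Suc:
 assumes v: "w:space N" and ok: "state_ok n w" "pending_ok n w" and t1: "active n w --> 0 < smp_t1 R n w"
 shows "state_ok (Suc n) w"
 unfolding state_ok_def
proof(rule impI)
 assume a: "active (Suc n) w"
 hence act: "active n w" and ns: "~ stops n w" by(simp_all add: active_Suc)
 define T H where "T = elapsed R n w" and "H = curH R n w"
 have s: "curT R n w = ereal T" "admissible T H" "curA R n w = K - ereal T"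
  using ok(1) act by(simp_all add: state_ok_def T_def H_def)
 have p: "0 < smpD R n w" "smpD R n w <= K - ereal T" "0 <= smpJ R n w"
  using ok(2) act by(simp_all add: pending_ok_def T_def)
 have T0: "0 <= T" using elapsed_nonneg[OF ok(1) act] by(simp add: T_def)
 have tA: "run_t R n w < K - ereal T" using ns s by(simp add: run_stops_def)
 hence "run_t R n w < oo" by auto
 from run_t_real[OF ok _ act this] t1 act obtain u where u: "run_t R n w = ereal u" "0 < u" by fastforce
 have z: "ereal (run_z q r R n w) < residual T H u" using ns u by(simp add: run_stops_def curb_residual[OF v ok(1) act] T_def H_def)
 have E: "elapsed R (Suc n) w = T + u" by(simp add: elapsed_Suc u T_def)
 have HS: "curH R (Suc n) w = H + run_z q r R n w" by(simp add: updates[OF v] H_def)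
 have "ereal (T + u) < K" using tA u by(cases K) auto
 moreover have "ereal (H + run_z q r R n w) < c (T + u)"
  using z T0 u by(cases "c (u + T)") (auto simp: residual_def add.commute)
 ultimately have "admissible (T + u) (H + run_z q r R n w)" using T0 u by(simp add: admissible_def)
 moreover have "curT R (Suc n) w = ereal (T + u)" using s u by(simp add: updates[OF v])
 moreover have A: "curA R (Suc n) w = K - ereal (T + u)" using s u by(cases K) (auto simp: updates[OF v])
 moreover have "u <= smpD R n w" using u by(metis run_t_def min.cobounded2)
 hence "0 <= curD R (Suc n) w" using u by(cases "smpD R n w") (auto simp: updates[OF v])
 moreover have "curD R (Suc n) w <= curA R (Suc n) w"
  unfolding A using p(2) u by(cases "smpD R n w"; cases K) (auto simp: updates[OF v])
 moreover have "curD R (Suc n) w ~= 0 ==> 0 <= smpJ R (Suc n) w"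
 proof -
  assume "curD R (Suc n) w ~= 0"
  hence "smpJ R (Suc n) w = curJ R (Suc n) w" using steps(1)[of "Suc n"] a v by(simp add: step1_def)
  thus ?thesis using p(3) by(simp add: updates[OF v])
 qed
 ultimately show "curT R (Suc n) w = ereal (elapsed R (Suc n) w) & admissible (elapsed R (Suc n) w) (curH R (Suc n) w) &
   curA R (Suc n) w = K - ereal (elapsed R (Suc n) w) & 0 <= curD R (Suc n) w &
   (curD R (Suc n) w ~= 0 --> curD R (Suc n) w <= curA R (Suc n) w & 0 <= smpJ R (Suc n) w)"
  by(simp add: E HS)
qed

abbreviation past :: "nat => 'w measure" where "past n \<equiv> run_past N R n"

lemma past_state:
 "elapsed R n:Borel (past n)" "curH R n:Borel (past n)"
 "curA R n:Borel (past n)" "curD R n:Borel (past n)" "Measurable.pred (past n) (active n)"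
 using measurable_state[where G="past n" and n=n and k=n, OF space_history measurable_history(1)]
  measurable_active[where G="past n" and n=n and k=n, OF space_history measurable_history(1)] by auto

lemma history_state:
 "elapsed R n:Borel (history n g)" "curH R n:Borel (history n g)"
 "curA R n:Borel (history n g)" "curD R n:Borel (history n g)"
 "Measurable.pred (history n g) (active n)"
 using measurable_compose[OF measurable_past_to_history[where g=g] past_state(1)[of n]] measurable_compose[OF measurable_past_to_history[where g=g] past_state(2)[of n]]
  measurable_compose[OF measurable_past_to_history[where g=g] past_state(3)[of n]] measurable_compose[OF measurable_past_to_history[where g=g] past_state(4)[of n]]
  measurable_compose[OF measurable_past_to_history[where g=g] past_state(5)[of n]] by auto

lemma first_jump_kernel:
 assumes [measurable]: "A:Borel G"
 shows "(%(w, w'). first_jump w' (A w)):Borel (G >< M)"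
proof -
 have [measurable]: "(%z. traj Q (snd z)):G >< M ->M path_space" by(rule measurable_compose[OF measurable_snd path_measurable(4)])
 show ?thesis unfolding split_beta' Let_def by(intro borel_measurable_Pair) measurable
qed

lemma passage_kernel:
 assumes [measurable]: "T:Borel G" "H:Borel G"
 shows "(%(w, w'). passage_time (traj S w') (capped_residual (T w) (H w))):Borel (G >< M)"
 unfolding split_beta'
proof(rule measurable_passage_time)
 show "(%z. traj S (snd z)):G >< M ->M path_space" by(rule measurable_compose[OF measurable_snd path_measurable(5)])
 show "(%z. capped_residual (T (fst z)) (H (fst z)) u):Borel (G >< M)" for u
 proof -
  have "(%z. residual (T (fst z)) (H (fst z)) u):Borel (G >< M)" by(rule residual_measurable) measurable
  thus ?thesis by measurable
 qed
 show "isCont (capped_residual (T (fst z)) (H (fst z))) u" if "0 < u" for z u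
  using residual_continuous[OF that] by(intro continuous_intros)
qed

lemma smpDJ_N: "(%w. (smpD R n w, smpJ R n w)):Borel N"
 using measurable_samples[OF samples_N] by(intro borel_measurable_Pair) auto

lemma step1_nn_integral:
 assumes f: "f:Borel (past n >< borel)"
 shows "(NINT w|N. (if active n w & curD R n w = 0 then f (w, (smpD R n w, smpJ R n w)) else 0)) =
  (NINT w|N. (if active n w & curD R n w = 0 then (NINT w'|M. f (w, first_jump w' (curA R n w))) else 0))"
proof(rule sampled_given_distr[OF prob_space_N _ smpDJ_N _ first_jump_kernel _ _ f])
 note [measurable] = past_state[of n]
 show "subalgebra N (past n)" by(rule subalgebra_history) simp
 show "Measurable.pred (past n) (%w. active n w & curD R n w = 0)" by measurable
 show "curA R n:Borel (past n)" by measurable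
 show "sampled_given N (past n) (%w. active n w & curD R n w = 0) (%w. (smpD R n w, smpJ R n w))
   (%w. distr M borel (%w'. first_jump w' (curA R n w)))"
  using steps(1)[of n] by(simp add: step1_def)
qed simp

lemma pending_ok_AE:
 assumes ok: "AE w in N. state_ok n w"
 shows "AE w in N. pending_ok n w"
proof -
 note [measurable] = past_state[of n]
 have "AE w in N. active n w & curD R n w = 0 --> (0 < curA R n w --> 0 < fst (smpD R n w, smpJ R n w)) & fst (smpD R n w, smpJ R n w) <= curA R n w & 0 <= snd (smpD R n w, smpJ R n w)"
 proof(rule sampled_given_distr_AE[OF prob_space_N _ smpDJ_N _ first_jump_kernel])
  show "subalgebra N (past n)" by(rule subalgebra_history) simp
  show "Measurable.pred (past n) (%w. active n w & curD R n w = 0)" by measurable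
  show "curA R n:Borel (past n)" by measurable
  show "sampled_given N (past n) (%w. active n w & curD R n w = 0) (%w. (smpD R n w, smpJ R n w))
   (%w. distr M borel (%w'. first_jump w' (curA R n w)))"
   using steps(1)[of n] by(simp add: step1_def)
  have "Measurable.pred (past n >< borel >< borel)
   (%(w, y :: ereal \<times> real). (0 < curA R n w --> 0 < fst y) & fst y <= curA R n w & 0 <= snd y)" by measurable
  thus "Measurable.pred (past n >< borel)
   (%(w, y :: ereal \<times> real). (0 < curA R n w --> 0 < fst y) & fst y <= curA R n w & 0 <= snd y)" by(simp add: borel_prod)
  have *: "AE w' in M. (0 < A --> 0 < fst (first_jump w' A)) &
     fst (first_jump w' A) <= A &
     0 <= snd (first_jump w' A)" for A
   using first_jump_time_pos AE_space
  proof eventually_elim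
   case (elim w')
   thus ?case using jump_nonneg[OF path_nice(4)[OF elim(2)]] by(simp add: Let_def)
  qed
  show "AE w in N. active n w & curD R n w = 0 --> (AE w' in M. (0 < curA R n w --> 0 < fst (first_jump w' (curA R n w))) &
     fst (first_jump w' (curA R n w)) <= curA R n w &
     0 <= snd (first_jump w' (curA R n w)))"
   using * by simp
 qed simp
 thus ?thesis using ok AE_space
 proof eventually_elim
  case (elim w)
  show ?case unfolding pending_ok_def
  proof(rule impI)
   assume a: "active n w"
   hence s: "admissible (elapsed R n w) (curH R n w)" "curA R n w = K - ereal (elapsed R n w)" "0 <= curD R n w"
    "curD R n w ~= 0 --> curD R n w <= curA R n w & 0 <= smpJ R n w" using elim(2) by(auto simp: state_ok_def)
   show "0 < smpD R n w & smpD R n w <= K - ereal (elapsed R n w) & 0 <= smpJ R n w"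
   proof(cases "curD R n w = 0")
    case True
    have "ereal (elapsed R n w) < K" using s(1) by(simp add: admissible_def)
    hence "0 < curA R n w" unfolding s(2) by(cases K) auto
    thus ?thesis using True elim(1) a s(2) by simp
   next
    case False
    hence "smpD R n w = curD R n w" using steps(1)[of n] a elim(3) by(simp add: step1_def)
    thus ?thesis using False s by auto
   qed
  qed
 qed
qed

abbreviation history1 :: "nat => 'w measure" where "history1 n \<equiv> history n (%w. (smpD R n w, smpJ R n w))"

lemma history1_smp: "smpD R n:Borel (history1 n)" "smpJ R n:Borel (history1 n)"
proof -
 have [measurable]: "(%w. (smpD R n w, smpJ R n w)):history1 n ->M borel >< borel"
  using measurable_history(2)[where g="%w. (smpD R n w, smpJ R n w)"] by(simp add: borel_prod)
 have "(%w. fst (smpD R n w, smpJ R n w)):Borel (history1 n)" "(%w. snd (smpD R n w, smpJ R n w)):Borel (history1 n)" by measurable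
 thus "smpD R n:Borel (history1 n)" "smpJ R n:Borel (history1 n)" by simp_all
qed

lemma step2_sampled:
 assumes ok: "AE w in N. state_ok n w"
 shows "subalgebra N (history1 n)" "smp_t1 R n:Borel N" "Measurable.pred (history1 n) (active n)"
  "(%(w, w'). passage_time (traj S w') (target n w)):Borel (history1 n >< M)"
  "sampled_given N (history1 n) (active n) (smp_t1 R n) (%w. distr M borel (%w'. passage_time (traj S w') (run_bound r R n w)))"
  "AE w in N. active n w --> distr M borel (%w'. passage_time (traj S w') (run_bound r R n w)) =
   distr M borel (%w'. passage_time (traj S w') (target n w))"
proof -
 show "subalgebra N (history1 n)" by(rule subalgebra_history[OF smpDJ_N])
 show "smp_t1 R n:Borel N" by(rule measurable_samples[OF samples_N])
 show "Measurable.pred (history1 n) (active n)" by(rule history_state)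
 show "(%(w, w'). passage_time (traj S w') (target n w)):Borel (history1 n >< M)"
  by(rule passage_kernel; rule history_state)
 show "sampled_given N (history1 n) (active n) (smp_t1 R n) (%w. distr M borel (%w'. passage_time (traj S w') (run_bound r R n w)))"
  using steps(2)[of n] by(simp add: step2_def)
 show "AE w in N. active n w --> distr M borel (%w'. passage_time (traj S w') (run_bound r R n w)) =
   distr M borel (%w'. passage_time (traj S w') (target n w))"
  using ok AE_space by eventually_elim (simp add: curb_residual)
qed

text \<open>\<open>D\<close> is drawn before \<open>t1\<close>, so a tie means that \<open>S\<close>
  passes at a given time, which \<open>passage_time_iff\<close> excludes. Steps 3 and 4 therefore
  cover all cases.\<close>

lemma t1_AE:
 assumes ok: "AE w in N. state_ok n w"
 shows "AE w in N. active n w --> 0 < smp_t1 R n w & smp_t1 R n w ~= smpD R n w"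
proof -
 note [measurable] = history1_smp[of n]
 have "AE w in N. active n w --> 0 < smp_t1 R n w & smp_t1 R n w ~= smpD R n w"
 proof(rule sampled_given_distr_AE[OF prob_space_N step2_sampled[OF ok]])
  show "Measurable.pred (history1 n >< borel) (%(w, y). 0 < y & y ~= smpD R n w)" by measurable
  show "AE w in N. active n w --> (AE w' in M. 0 < passage_time (traj S w') (target n w) &
     passage_time (traj S w') (target n w) ~= smpD R n w)"
   using ok pending_ok_AE[OF ok]
  proof eventually_elim
   case (elim w)
   show ?case
   proof(rule impI)
    assume a: "active n w"
    define be where "be = target n w"
    have be: "barrier be" using elim(1) a unfolding be_def by(intro capped_barrier) (simp add: state_ok_def)
    have D: "0 < smpD R n w" "smpD R n w <= K - ereal (elapsed R n w)" using elim(2) a by(auto simp: pending_ok_def)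
    have "AE w' in M. passage_time (traj S w') be ~= smpD R n w"
    proof(cases "smpD R n w")
     case (real d)
     hence "0 < d" using D by simp
     hence "AE w' in M. passage_time (traj S w') be ~= ereal d & (ereal d < passage_time (traj S w') be <-> ereal (S d w') < be d)"
      by(rule passage_time_iff[OF be])
     thus ?thesis by eventually_elim (simp add: real)
    next
     case PInf
     hence "K = oo" using D(2) by(cases K) auto
     hence "EX t>0. be t < oo" using capped_finite[of 1] unfolding be_def by(intro exI[of _ 1]) auto
     from passage_time_finite[OF be this] show ?thesis by eventually_elim (auto simp: PInf)
    qed (use D in auto)
    thus "AE w' in M. 0 < passage_time (traj S w') (target n w) &
     passage_time (traj S w') (target n w) ~= smpD R n w"
     using AE_space unfolding be_def[symmetric] by eventually_elim (simp add: passage_time_pos[OF be path_nice(5)])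
   qed
  qed
 qed
 thus ?thesis .
qed

lemma state_ok_AE: "AE w in N. state_ok n w"
proof(induction n)
 case 0
 show ?case using state_ok_0 by(intro AE_I2)
next
 case (Suc n)
 show ?case using Suc.IH pending_ok_AE[OF Suc.IH] t1_AE[OF Suc.IH] AE_space
  by eventually_elim (auto intro: state_ok_Suc)
qed

end

section \<open>Integrating out the sampling steps in reverse order\<close>

lemma nn_integral_uniform_threshold:
 fixes a b :: ennreal and p :: real
 assumes p: "0 <= p" "p <= 1"
 shows "(NINT u|(uniform_measure lborel {0<..<1::real}). (if u <= p then a else b)) = ennreal p * a + ennreal (1 - p) * b"
proof -
 have "(NINT u|(uniform_measure lborel {0<..<1::real}). (if u <= p then a else b)) =
  (NINT u|lborel. (if u <= p then a else b) * indicator {0<..<1} u)"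
  by(subst nn_integral_uniform_measure) (auto simp: divide_ennreal_def)
 also have "... = (NINT u|lborel. a * indicator {0<..p} u + b * indicator {p<..<1} u)"
 proof(rule nn_integral_cong_AE, goal_cases)
  case 1 show ?case
   using AE_lborel_singleton[of 1] by eventually_elim (use p in \<open>auto simp: indicator_def\<close>)
 qed
 also have "... = a * emeasure lborel {0<..p} + b * emeasure lborel {p<..<1}"
  by(subst nn_integral_add) (auto simp: nn_integral_cmult_indicator)
 finally show ?thesis using p by(simp add: mult.commute)
qed

lemma measurable_PairD:
 fixes f :: "'a => 'x::second_countable_topology" and g :: "'a => 'y::second_countable_topology"
 assumes "(%w. (f w, g w)):Borel L"
 shows "f:Borel L" "g:Borel L"
proof -
 have [measurable]: "(%w. (f w, g w)):L ->M borel >< borel" using assms by(simp add: borel_prod)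
 have "(%w. fst (f w, g w)):Borel L" "(%w. snd (f w, g w)):Borel L" by measurable
 thus "f:Borel L" "g:Borel L" by simp_all
qed

context decomposition
begin

text \<open>Only a sub-probability kernel, because the conditioning event may be null for some
  \<open>x\<close>; the conditional law is then the zero measure.\<close>

lemma conditioned_law_kernel:
 assumes d[measurable]: "d:Borel G" and d0: "!!x. x:space G ==> 0 <= d x" and b[measurable]: "b:Borel G"
 shows "(%x. distr (uniform_measure M {w:space M. ereal (S (d x) w) < b x}) borel (S (d x))):G ->M subprob_algebra borel"
 (is "?L:_")
proof(rule measurable_subprob_algebra)
 let ?E = "%x. {w:space M. ereal (S (d x) w) < b x}" and ?EA = "%x A. {w:space M. ereal (S (d x) w) < b x & S (d x) w:A}"
 have [measurable]: "(%z. S (d (fst z)) (snd z)):Borel (G >< M)"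
  by(rule measurable_path_at[OF measurable_compose[OF measurable_snd path_measurable(5)]]) (auto simp: space_pair_measure d0)
 have S: "S (d x):Borel M" if "x:space G" for x
  using driftless_subordinatorD(3)[OF S d0[OF that]] .
 have em: "emeasure (?L x) A =
   emeasure M (?EA x A) / emeasure M (?E x)"
  if "x:space G" "A:sets borel" for x A
 proof -
  note [measurable] = S[OF that(1)] that(2)
  have "emeasure (?L x) A =
   emeasure M (?E x \<inter> (S (d x) -` A \<inter> space M)) / emeasure M (?E x)"
   by(subst emeasure_distr) (auto simp: emeasure_uniform_measure)
  also have "?E x \<inter> (S (d x) -` A \<inter> space M) = ?EA x A" by auto
  finally show ?thesis .
 qed
 show "subprob_space (?L x)" if "x:space G" for x
 proof(rule subprob_spaceI)
  \<comment> \<open>Covers a null conditioning event: the quotient of 0 by 0 is 0.\<close>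
  have "y / y <= (1 :: ennreal)" for y by(cases "y = 0 \<or> y = top") (auto simp: less_top)
  thus "emeasure (?L x)
    (space (?L x)) <= 1"
   using em[OF that, of UNIV] by simp
 qed simp
 fix A :: "real set" assume [measurable]: "A:sets borel"
 let ?G = "{z. ereal (S (d (fst z)) (snd z)) < b (fst z) & S (d (fst z)) (snd z):A}" and ?H = "{z. ereal (S (d (fst z)) (snd z)) < b (fst z)}"
 have "(%x. (NINT w|M. indicator ?G (x, w)) /
   (NINT w|M. indicator ?H (x, w))):Borel G"
 proof(intro borel_measurable_divide_ennreal sigma_finite_measure.borel_measurable_nn_integral[OF sigma_finite_measure_axioms])
  show "(%(x, w). indicator ?G (x, w)):Borel (G >< M)"
   "(%(x, w). indicator ?H (x, w)):Borel (G >< M)"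
   unfolding split_beta' indicator_def by measurable
 qed
 also have "?this <-> (%x. emeasure (?L x) A):Borel G"
 proof(rule measurable_cong)
  fix x assume x: "x:space G"
  note [measurable] = S[OF x]
  have "(NINT w|M. indicator ?G (x, w)) =
    (NINT w|M. indicator (?EA x A) w)"
   "(NINT w|M. indicator ?H (x, w)) = (NINT w|M. indicator (?E x) w)"
   by(intro nn_integral_cong, simp add: indicator_def)+
  thus "(NINT w|M. indicator ?G (x, w)) /
   (NINT w|M. indicator ?H (x, w)) =
   emeasure (?L x) A"
   by(simp add: em[OF x])
 qed
 finally show "(%x. emeasure (?L x) A):Borel G" .
qed simp

end

context sampler
begin

lemma samples_measurable_N:
 "smpD R n:Borel N" "smpJ R n:Borel N" "smp_t1 R n:Borel N"
 "smp_s R n:Borel N" "smp_v R n:Borel N" "smp_x R n:Borel N" "smp_U R n:Borel N"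
 by(rule measurable_samples[OF samples_N])+

lemma state_measurable_N:
 "elapsed R n:Borel N" "curH R n:Borel N" "curT R n:Borel N"
 "curD R n:Borel N" "curA R n:Borel N"
 "Measurable.pred N (active n)" "Measurable.pred N (stops n)"
 "run_t R n:Borel N" "run_v q r R n:Borel N" "run_Delta q r R n:Borel N" "run_z q r R n:Borel N"
 using measurable_state[of N "Suc n" n] measurable_active[of N "Suc n" n] measurable_stops[of N "Suc n" n]
  measurable_derived[of N "Suc n" n] samples_N by auto

lemma history_refine:
 fixes g :: "'w => 'g::topological_space" and g' :: "'w => 'h::topological_space"
 assumes "g':Borel (history n g)"
 shows "(%w. w):history n g ->M history n g'"
 unfolding run_history_def[of N R n g']
proof(rule measurable_vimage_algebra2)
 show "(%w. (\<lambda>k\<in>{..<n}. (smpD R k w, smpJ R k w, smp_t1 R k w, smp_s R k w, smp_v R k w, smp_x R k w, smp_U R k w), g' w))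
  :history n g ->M Pi\<^sub>M {..<n} (%_. borel) >< borel"
  using assms measurable_history(1)[of _ n g] unfolding samples_def[abs_def] by(intro measurable_Pair measurable_restrict) auto
qed (simp add: space_history)

context
 fixes h :: "real \<times> real \<times> ereal \<times> real \<times> real \<times> real \<times> real => ennreal" and n :: nat
 assumes h: "h:Borel borel"
begin

lemma h_compose:
 assumes "T:Borel L" "H:Borel L" "D:Borel L" "J:Borel L"
  "t:Borel L" "x:Borel L" "v:Borel L"
 shows "(%e. h (T e, H e, D e, J e, t e, x e, v e)):Borel L"
 by(rule measurable_compose[OF _ h]) (intro borel_measurable_Pair assms)

text \<open>The test function with everything frozen that is known when Step 2 begins.\<close>

definition tail :: "'w => real \<times> real \<times> real => ennreal" where
 "tail w = (%(t, x, v). h (elapsed R n w, curH R n w, smpD R n w, smpJ R n w, t, x, v))"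

lemma measurable_tail:
 assumes e: "e:L ->M history1 n" and [measurable]: "t:Borel L" "x:Borel L" "v:Borel L"
 shows "(%z. tail (e z) (t z, x z, v z)):Borel L"
 unfolding tail_def split_conv
 by(rule h_compose) (auto intro: measurable_compose[OF e] history_state history1_smp)

lemma measurable_thinned_tail:
 assumes e[measurable]: "e:L ->M history1 n" and [measurable]: "t:Borel L" "x:Borel L" "v:Borel L"
 shows "(%z. thinned thin (tail (e z)) (t z) (x z) (v z)):Borel L"
proof -
 have [measurable]: "(%z. tail (e z) (t z, x z, v z)):Borel L" "(%z. tail (e z) (t z, x z, 0)):Borel L"
  by(rule measurable_tail; measurable)+
 show ?thesis unfolding thinned_def by measurable
qed

lemma tail_borel: assumes e: "w:space N" shows "tail w:Borel borel"
proof -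
 have "(%z. tail w (fst z, fst (snd z), snd (snd z))):Borel (borel >< borel >< borel)"
  by(rule measurable_tail) (use e in \<open>auto simp: space_history\<close>)
 thus ?thesis by(simp add: borel_prod)
qed

text \<open>For positive \<open>v\<close> the uniform variable falls below the acceptance level with
  probability \<open>thin v\<close>, which averages the two results to \<open>thinned\<close>;
  otherwise no draw takes place and both sides agree.\<close>

lemma step6_nn_integral:
 "(NINT w|N. (if active n w then tail w (dur n w, smp_x R n w, run_v q r R n w) else 0)) =
  (NINT w|N. (if active n w then thinned thin (tail w) (dur n w) (smp_x R n w) (smp_v R n w) else 0))"
 (is "(NINT w|N. (if _ then ?a w else 0)) = (NINT w|N. (if _ then ?b w else 0))")
proof -
 let ?p = "%w. active n w & 0 < smp_v R n w" and ?n = "%w. active n w & ~ 0 < smp_v R n w"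
 note [measurable] = samples_measurable_N[of n] state_measurable_N[of n]
 define g where "g w = (smpD R n w, smpJ R n w, smp_t1 R n w, smp_s R n w, smp_v R n w, smp_x R n w)" for w
 let ?F = "history n g"
 have gN: "g:Borel N" unfolding g_def[abs_def] by(intro borel_measurable_Pair samples_measurable_N)
 have sub: "subalgebra N ?F" by(rule subalgebra_history[OF gN])
 have m: "(%w. (smpD R n w, smpJ R n w, smp_t1 R n w, smp_s R n w, smp_v R n w, smp_x R n w)):Borel ?F"
  using measurable_history(2)[of g n] by(simp add: g_def[abs_def])
 note m1 = measurable_PairD[OF m] note m2 = measurable_PairD[OF m1(2)] note m3 = measurable_PairD[OF m2(2)]
 note m4 = measurable_PairD[OF m3(2)] note m5 = measurable_PairD[OF m4(2)]
 note [measurable] = m1(1) m2(1) m3(1) m4(1) m5 history_state[of n g]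
 have ref: "(%w. w):?F ->M history1 n" by(rule history_refine) (intro borel_measurable_Pair; measurable)
 have refN: "(%w. w):N ->M history1 n"
  using measurable_from_subalg[OF sub ref] .
 have [measurable]: "run_t R n:Borel ?F" unfolding run_t_def[abs_def] by measurable
 define f where "f z = tail (fst z) (real_of_ereal (run_t R n (fst z)), smp_x R n (fst z),
   smp_v R n (fst z) * of_bool (ereal (smp_v R n (fst z)) <= r & snd z <= exp (- q * smp_v R n (fst z))))" for z
 have f: "f:Borel (?F >< borel)"
  unfolding f_def of_bool_def by(rule measurable_tail[OF measurable_compose[OF measurable_fst ref]]) measurable
 have unif: "(NINT u|(uniform_measure lborel {0<..<1}). f (w, u)) = ?b w"
  if "0 < smp_v R n w" for w
 proof(cases "ereal (smp_v R n w) <= r")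
  case True
  have p: "0 <= exp (- q * smp_v R n w)" "exp (- q * smp_v R n w) <= 1" using q that by auto
  have "f (w, u) = (if u <= exp (- q * smp_v R n w) then tail w (dur n w, smp_x R n w, smp_v R n w) else tail w (dur n w, smp_x R n w, 0))" for u
   using True by(simp add: f_def)
  thus ?thesis using that True by(simp only: nn_integral_uniform_threshold[OF p] thinned_def thin_def if_True)
 next
  case False
  interpret unif: prob_space "uniform_measure lborel {0<..<1::real}" by(rule prob_space_uniform_measure) auto
  have "f (w, u) = tail w (dur n w, smp_x R n w, 0)" for u
   using False by(simp add: f_def)
  thus ?thesis using that False unif.emeasure_space_1 by(simp add: thinned_def thin_def)
 qed
 have [measurable]: "(%w. ?a w):Borel N"
  "(%w. ?b w):Borel N"
  by(rule measurable_tail[OF refN] measurable_thinned_tail[OF refN]; measurable)+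
 have "(NINT w|N. (if active n w then ?a w else 0)) =
  (NINT w|N. (if ?p w then ?a w else 0)) +
  (NINT w|N. (if ?n w then ?a w else 0))"
  by(rule nn_integral_split) measurable
 also have "(NINT w|N. (if ?p w then ?a w else 0)) =
  (NINT w|N. (if ?p w then f (w, smp_U R n w) else 0))"
  by(intro nn_integral_cong) (auto simp: f_def run_v_def Let_def)
 also have "... = (NINT w|N. (if ?p w then (NINT u|(uniform_measure lborel {0<..<1}). f (w, u)) else 0))"
 proof(rule sampled_given_nn_integral[OF prob_space_N sub samples_measurable_N(7) _ _ _ _ f])
  show "Measurable.pred ?F (%w. ?p w)" by measurable
  have "prob_space (uniform_measure lborel {0<..<1::real})" by(rule prob_space_uniform_measure) auto
  thus "(%w. uniform_measure lborel {0<..<1::real}):?F ->M subprob_algebra borel"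
   by(intro measurable_const) (auto simp: space_subprob_algebra intro: prob_space_imp_subprob_space)
  show "sampled_given N ?F (%w. ?p w) (smp_U R n) (%w. uniform_measure lborel {0<..<1})"
   using steps(6)[of n] by(simp add: step6_def g_def[abs_def])
 qed simp
 also have "... = (NINT w|N. (if ?p w then ?b w else 0))"
  by(intro nn_integral_cong) (simp add: unif)
 also have "(NINT w|N. (if ?n w then ?a w else 0)) =
  (NINT w|N. (if ?n w then ?b w else 0))"
  by(intro nn_integral_cong) (auto simp: thinned_def run_v_def Let_def)
 also have "(NINT w|N. (if ?p w then ?b w else 0)) + ... =
  (NINT w|N. (if active n w then ?b w else 0))"
  by(rule nn_integral_split[symmetric]) measurable
 finally show ?thesis .
qed

end

end

context sampler
begin

context
 fixes h :: "real \<times> real \<times> ereal \<times> real \<times> real \<times> real \<times> real => ennreal" and n :: nat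
  and ka :: "'w => real => real => real measure"
 assumes h: "h:Borel borel"
  and kam: "(%(w, t, s). ka w t s):run_past N R n >< borel >< borel ->M prob_algebra borel"
begin

definition averaged :: "'w => real => real => real => ennreal" where
 "averaged w t s v = (NINT x|(ka w t s). thinned thin (tail h n w) t x v)"

lemma measurable_ka:
 assumes e: "e:L ->M history1 n" and [measurable]: "t:Borel L" "s:Borel L"
 shows "(%z. ka (e z) (t z) (s z)):L ->M subprob_algebra borel"
proof -
 have [measurable]: "e:L ->M past n" using measurable_compose[OF e measurable_past_to_history] .
 have "(%z. (e z, t z, s z)):L ->M past n >< borel >< borel" by measurable
 from measurable_compose[OF this measurable_prob_algebraD[OF kam]] show ?thesis by simp
qed

lemma measurable_averaged:
 assumes e[measurable]: "e:L ->M history1 n" and [measurable]: "t:Borel L" "s:Borel L" "v:Borel L"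
 shows "(%z. averaged (e z) (t z) (s z) (v z)):Borel L"
 unfolding averaged_def
proof(rule nn_integral_measurable_subprob_algebra2)
 show "(%(z, x). thinned thin (tail h n (e z)) (t z) x (v z)):Borel (L >< borel)"
  unfolding split_beta' by(rule measurable_thinned_tail[OF h]) measurable
 show "(%z. ka (e z) (t z) (s z)):L ->M subprob_algebra borel" by(rule measurable_ka) measurable
qed

lemma step5_nn_integral:
 assumes sg: "sampled_given N
     (history n (%w. (smpD R n w, smpJ R n w, smp_t1 R n w, smp_s R n w, smp_v R n w)))
     (run_active q r R n) (smp_x R n)
     (%w. ka w (dur n w) (smp_s R n w))"
 shows "(NINT w|N. (if active n w then thinned thin (tail h n w) (dur n w) (smp_x R n w) (smp_v R n w) else 0)) =
  (NINT w|N. (if active n w then averaged w (dur n w) (smp_s R n w) (smp_v R n w) else 0))"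
proof -
 define g where "g w = (smpD R n w, smpJ R n w, smp_t1 R n w, smp_s R n w, smp_v R n w)" for w
 let ?F = "history n g"
 have gN: "g:Borel N" unfolding g_def[abs_def] by(intro borel_measurable_Pair samples_measurable_N)
 have sub: "subalgebra N ?F" by(rule subalgebra_history[OF gN])
 have m: "(%w. (smpD R n w, smpJ R n w, smp_t1 R n w, smp_s R n w, smp_v R n w)):Borel ?F"
  using measurable_history(2)[of g n] by(simp add: g_def[abs_def])
 note m1 = measurable_PairD[OF m] note m2 = measurable_PairD[OF m1(2)] note m3 = measurable_PairD[OF m2(2)]
 note m4 = measurable_PairD[OF m3(2)]
 note [measurable] = m1(1) m2(1) m3(1) m4 history_state[of n g]
 have ref: "(%w. w):?F ->M history1 n" by(rule history_refine) (intro borel_measurable_Pair; measurable)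
 have [measurable]: "run_t R n:Borel ?F" unfolding run_t_def[abs_def] by measurable
 define f where "f z = thinned thin (tail h n (fst z)) (real_of_ereal (run_t R n (fst z))) (snd z) (smp_v R n (fst z))" for z
 have f: "f:Borel (?F >< borel)"
  unfolding f_def by(rule measurable_thinned_tail[OF h measurable_compose[OF measurable_fst ref]]) measurable
 have "(NINT w|N. (if active n w then f (w, smp_x R n w) else 0)) =
  (NINT w|N. (if active n w then (NINT x|(ka w (dur n w) (smp_s R n w)). f (w, x)) else 0))"
 proof(rule sampled_given_nn_integral[OF prob_space_N sub samples_measurable_N(6) _ _ _ _ f])
  show "Measurable.pred ?F (active n)" by measurable
  show "(%w. ka w (dur n w) (smp_s R n w)):?F ->M subprob_algebra borel"
   by(rule measurable_ka[OF ref]) measurable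
  show "sampled_given N ?F (active n) (smp_x R n) (%w. ka w (dur n w) (smp_s R n w))"
   using sg by(simp add: g_def[abs_def])
 qed simp
 thus ?thesis unfolding f_def averaged_def fst_conv snd_conv .
qed

definition deadline_law :: "'w => real measure" where
 "deadline_law w = (let d = max 0 (real_of_ereal (smpD R n w)) in
   distr (uniform_measure M {w':space M. ereal (S d w') < target n w d}) borel (S d))"

lemma measurable_deadline_law:
 assumes e: "e:L ->M history1 n"
 shows "(%z. deadline_law (e z)):L ->M subprob_algebra borel"
proof -
 have [measurable]: "(%z. smpD R n (e z)):Borel L" "(%z. elapsed R n (e z)):Borel L" "(%z. curH R n (e z)):Borel L"
  by(rule measurable_compose[OF e] history1_smp history_state)+
 have [measurable]: "(%z. residual (elapsed R n (e z)) (curH R n (e z)) (max 0 (real_of_ereal (smpD R n (e z))))):Borel L"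
  by(rule residual_measurable) measurable
 show ?thesis unfolding deadline_law_def Let_def
  by(rule conditioned_law_kernel) (auto, measurable)
qed

context
 fixes mu :: "'w => ereal => (real \<times> real) measure"
 assumes mum: "(%(w, t). mu w t):run_past N R n >< borel ->M prob_algebra borel"
  and sg: "sampled_given N (history n (%w. (smpD R n w, smpJ R n w, smp_t1 R n w)))
     (%w. run_active q r R n w & smp_t1 R n w < smpD R n w)
     (%w. (smp_s R n w, smp_v R n w)) (%w. mu w (smp_t1 R n w))"
begin

text \<open>Expectation of the rest of the iteration as a function of the passage time drawn in Step
  2: Steps 3, 5 and 6 before the deadline, Steps 4 and 5 after it. Ties are null, so 0 is an
  arbitrary value for them.\<close>

definition crossed :: "'w => ereal => ennreal" where
 "crossed w y = (if y < smpD R n w then (NINT z|(mu w y). averaged w (real_of_ereal y) (fst z) (snd z))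
   else if smpD R n w < y then (NINT s|(deadline_law w). averaged w (real_of_ereal (smpD R n w)) s 0) else 0)"

lemma measurable_mu:
 assumes e: "e:L ->M history1 n" and [measurable]: "t:Borel L"
 shows "(%z. mu (e z) (t z)):L ->M subprob_algebra borel"
proof -
 have [measurable]: "e:L ->M past n" using measurable_compose[OF e measurable_past_to_history] .
 have "(%z. (e z, t z)):L ->M past n >< borel" by measurable
 from measurable_compose[OF this measurable_prob_algebraD[OF mum]] show ?thesis by simp
qed

lemma measurable_crossed:
 assumes e[measurable]: "e:L ->M history1 n" and [measurable]: "y:Borel L"
 shows "(%z. crossed (e z) (y z)):Borel L"
proof -
 have [measurable]: "(%z. smpD R n (e z)):Borel L" by(rule measurable_compose[OF e history1_smp(1)])
 have [measurable]: "(%z. (NINT p|(mu (e z) (y z)). averaged (e z) (real_of_ereal (y z)) (fst p) (snd p))):Borel L"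
 proof(rule nn_integral_measurable_subprob_algebra2[OF _ measurable_mu[OF e]])
  have "(%(z, p). averaged (e z) (real_of_ereal (y z)) (fst p) (snd p)):Borel (L >< borel >< borel)"
   unfolding split_beta' by(rule measurable_averaged) measurable
  thus "(%(z, p). averaged (e z) (real_of_ereal (y z)) (fst p) (snd p)):Borel (L >< borel)" by(simp add: borel_prod)
 qed measurable
 have [measurable]: "(%z. (NINT s|(deadline_law (e z)). averaged (e z) (real_of_ereal (smpD R n (e z))) s 0)):Borel L"
 proof(rule nn_integral_measurable_subprob_algebra2[OF _ measurable_deadline_law[OF e]])
  show "(%(z, s). averaged (e z) (real_of_ereal (smpD R n (e z))) s 0):Borel (L >< borel)"
   unfolding split_beta' by(rule measurable_averaged) measurable
 qed
 show ?thesis unfolding crossed_def by measurable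
qed

lemma step34_nn_integral:
 "(NINT w|N. (if active n w then averaged w (dur n w) (smp_s R n w) (smp_v R n w) else 0)) =
  (NINT w|N. (if active n w then crossed w (smp_t1 R n w) else 0))"
 (is "(NINT w|N. (if _ then ?a w else 0)) = (NINT w|N. (if _ then ?c w else 0))")
proof -
 let ?lt = "%w. active n w & smp_t1 R n w < smpD R n w" and ?gt = "%w. active n w & smpD R n w < smp_t1 R n w"
  and ?ge = "%w. active n w & ~ smp_t1 R n w < smpD R n w"
 note [measurable] = samples_measurable_N[of n] state_measurable_N[of n]
 define g where "g w = (smpD R n w, smpJ R n w, smp_t1 R n w)" for w
 let ?F = "history n g"
 have gN: "g:Borel N" unfolding g_def[abs_def] by(intro borel_measurable_Pair samples_measurable_N)
 have sub: "subalgebra N ?F" by(rule subalgebra_history[OF gN])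
 have m: "(%w. (smpD R n w, smpJ R n w, smp_t1 R n w)):Borel ?F"
  using measurable_history(2)[of g n] by(simp add: g_def[abs_def])
 note m1 = measurable_PairD[OF m] note m2 = measurable_PairD[OF m1(2)]
 have F: "smpD R n:Borel ?F" "smpJ R n:Borel ?F" "smp_t1 R n:Borel ?F" "Measurable.pred ?F (active n)"
  by(rule m1 m2 history_state)+
 have ref: "(%w. w):?F ->M history1 n" by(rule history_refine) (intro borel_measurable_Pair F)
 have refN: "(%w. w):N ->M history1 n" using measurable_from_subalg[OF sub ref] .
 have E3: "Measurable.pred ?F (%w. ?lt w)" and E4: "Measurable.pred ?F (%w. ?gt w)"
  using F by measurable
 note [measurable] = F
 define f3 where "f3 z = averaged (fst z) (real_of_ereal (smp_t1 R n (fst z))) (fst (snd z)) (snd (snd z))" for z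
 define f4 where "f4 z = averaged (fst z) (real_of_ereal (smpD R n (fst z))) (snd z) 0" for z
 have f3: "f3:Borel (?F >< borel)"
 proof -
  have "f3:Borel (?F >< borel >< borel)"
   unfolding f3_def by(rule measurable_averaged[OF measurable_compose[OF measurable_fst ref]]) measurable
  thus ?thesis by(simp add: borel_prod)
 qed
 have f4: "f4:Borel (?F >< borel)"
  unfolding f4_def by(rule measurable_averaged[OF measurable_compose[OF measurable_fst ref]]) measurable
 have Y: "(%w. (smp_s R n w, smp_v R n w)):Borel N" by(intro borel_measurable_Pair samples_measurable_N)
 have [measurable]: "(%w. ?a w):Borel N"
  by(rule measurable_averaged[OF refN]) measurable
 have [measurable]: "(%w. ?c w):Borel N"
  by(rule measurable_crossed[OF refN]) measurable
 let ?law = "%w t. distr (uniform_measure M {w':space M. ereal (S t w') < run_bound r R n w t}) borel (S t)"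
 have tie: "AE w in N. active n w --> smp_t1 R n w ~= smpD R n w"
  using t1_AE[OF state_ok_AE, of n] by eventually_elim simp
 have 3: "(NINT w|N. (if ?lt w then ?a w else 0)) =
  (NINT w|N. (if ?lt w then ?c w else 0))"
 proof -
  have "(NINT w|N. (if ?lt w then ?a w else 0)) =
   (NINT w|N. (if ?lt w then f3 (w, (smp_s R n w, smp_v R n w)) else 0))"
   by(intro nn_integral_cong) (auto simp: f3_def run_t_def min.absorb1)
  also have "... = (NINT w|N. (if ?lt w then (NINT z|(mu w (smp_t1 R n w)). f3 (w, z)) else 0))"
  proof(rule sampled_given_nn_integral[OF prob_space_N sub Y E3 _ _ _ f3])
   show "(%w. mu w (smp_t1 R n w)):?F ->M subprob_algebra borel" by(rule measurable_mu[OF ref F(3)])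
   show "sampled_given N ?F (%w. ?lt w) (%w. (smp_s R n w, smp_v R n w)) (%w. mu w (smp_t1 R n w))"
    using sg by(simp add: g_def[abs_def])
  qed simp
  also have "... = (NINT w|N. (if ?lt w then ?c w else 0))"
   by(intro nn_integral_cong) (auto simp: crossed_def f3_def)
  finally show ?thesis .
 qed
 have 4: "(NINT w|N. (if ?ge w then ?a w else 0)) =
  (NINT w|N. (if ?ge w then ?c w else 0))"
 proof -
  have "(NINT w|N. (if ?ge w then ?a w else 0)) =
   (NINT w|N. (if ?gt w then f4 (w, smp_s R n w) else 0))"
  proof(rule nn_integral_cong_AE, goal_cases)
   case 1 show ?case
    using tie AE_space
   proof eventually_elim
    case (elim w)
    have "active n w ==> smpD R n w < smp_t1 R n w ==> smp_v R n w = 0" using steps(4)[of n] elim(2) by(simp add: step4_def)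
    thus ?case using elim(1) by(auto simp: f4_def run_t_def min.absorb2 not_less le_less)
   qed
  qed
  also have "... = (NINT w|N. (if ?gt w then (NINT s|(deadline_law w). f4 (w, s)) else 0))"
  proof(rule sampled_given_nn_integral[OF prob_space_N sub samples_measurable_N(4) E4 _ _ _ f4])
   show "deadline_law:?F ->M subprob_algebra borel" by(rule measurable_deadline_law[OF ref])
   show "sampled_given N ?F (%w. ?gt w) (smp_s R n)
     (%w. let t = real_of_ereal (smpD R n w) in ?law w t)"
    using steps(4)[of n] by(simp add: step4_def g_def[abs_def])
   show "AE w in N. ?gt w -->
     (let t = real_of_ereal (smpD R n w) in ?law w t) = deadline_law w"
    using state_ok_AE[of n] pending_ok_AE[OF state_ok_AE, of n] AE_space
   proof eventually_elim
    case (elim w)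
    show ?case
    proof
     assume a: "?gt w"
     hence "0 <= real_of_ereal (smpD R n w)" using elim(2) by(auto simp: pending_ok_def intro: real_of_ereal_pos)
     hence "max 0 (real_of_ereal (smpD R n w)) = real_of_ereal (smpD R n w)" by simp
     thus "(let t = real_of_ereal (smpD R n w) in ?law w t) = deadline_law w"
      using curb_residual(2)[OF elim(3,1)] a by(simp only: deadline_law_def)
    qed
   qed
  qed
  also have "... = (NINT w|N. (if ?ge w then ?c w else 0))"
  proof(rule nn_integral_cong_AE, goal_cases)
   case 1 show ?case
    using tie by eventually_elim (auto simp: crossed_def f4_def)
  qed
  finally show ?thesis .
 qed
 have "(NINT w|N. (if active n w then ?a w else 0)) =
  (NINT w|N. (if ?lt w then ?a w else 0)) +
  (NINT w|N. (if ?ge w then ?a w else 0))"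
  by(rule nn_integral_split) measurable
 also have "... = (NINT w|N. (if active n w then ?c w else 0))"
  unfolding 3 4 by(rule nn_integral_split[symmetric]) measurable
 finally show ?thesis .
qed

text \<open>Once the passage time is that of a path of \<open>S\<close> on \<open>M\<close>, the
  kernel \<open>mu\<close> reproduces its actual left limit and jump by the definition of a
  conditional distribution. What remains is the left side of
  \<open>iteration_identity\<close>.\<close>

lemma crossed_nn_integral:
 assumes e: "w:space N" and ok: "state_ok n w" "pending_ok n w" and act: "active n w"
  and mu: "reg_cond_dist M (%_. True) (%w'. passage_time (traj S w') (target n w))
    (%w'. (left_limit (traj S w') (passage_time (traj S w') (target n w)), jump (traj S w') (passage_time (traj S w') (target n w)))) (mu w)"
  and ka1: "ALL t>0. reg_cond_dist M (%_. True) (%w'. X1 t w' + X2 t w') (X1 t) (ka w t)"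
  and ka2: "reg_cond_dist M (%w'. passage_time (traj S w') (target n w) < oo & jump (traj S w') (passage_time (traj S w') (target n w)) = 0)
    (%w'. real_of_ereal (passage_time (traj S w') (target n w))) (%w'. X1 (real_of_ereal (passage_time (traj S w') (target n w))) w')
    (%t. ka w t (real_of_ereal (target n w t)))"
 shows "(NINT w'|M. crossed w (passage_time (traj S w') (target n w))) =
  (NINT w'|M. (let t = min (passage_time (traj S w') (target n w)) (smpD R n w) in
    tail h n w (passed w' t)))"
proof -
 define be where "be = target n w"
 define D where "D = smpD R n w"
 let ?tau = "%w'. passage_time (traj S w') be"
 let ?law = "distr (uniform_measure M {w:space M. ereal (S (real_of_ereal D) w) < be (real_of_ereal D)}) borel (S (real_of_ereal D))"
 have be: "barrier be" unfolding be_def using ok(1) act by(intro capped_barrier) (simp add: state_ok_def)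
 have D: "0 < D" "D <= K - ereal (elapsed R n w)" using ok(2) act by(auto simp: pending_ok_def D_def)
 have [measurable]: "(%w'. ?tau w'):Borel M"
  by(rule measurable_passage_time_const[OF path_measurable(5) be])
 define C where "C = (NINT s|(deadline_law w). averaged w (real_of_ereal D) s 0)"
 define f where "f z = (if fst z < D then averaged w (real_of_ereal (fst z)) (fst (snd z)) (snd (snd z)) else if D < fst z then C else 0)" for z
 have f: "f:Borel (borel >< borel)"
 proof -
  have [measurable]: "(%z. averaged w (real_of_ereal (fst z)) (fst (snd z)) (snd (snd z))):Borel (borel >< borel >< borel)"
   using e by(intro measurable_averaged) (auto simp: space_history)
  have "f:Borel (borel >< borel >< borel)" unfolding f_def by measurable
  thus ?thesis by(simp add: borel_prod)
 qed
 have "mu w:borel ->M prob_algebra borel" using mu by(simp add: reg_cond_dist_def)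
 hence pmu: "prob_space (mu w y)" for y using measurable_space[of "mu w" borel "prob_algebra borel" y] by(simp add: space_prob_algebra)
 have "(NINT w'|M. crossed w (?tau w')) = (NINT w'|M. (if True then (NINT y|(mu w (?tau w')). f (?tau w', y)) else 0))"
  using prob_space.emeasure_space_1[OF pmu] by(intro nn_integral_cong) (simp add: f_def crossed_def D_def C_def)
 also have "... = (NINT w'|M. (if True then f (?tau w', (left_limit (traj S w') (?tau w'), jump (traj S w') (?tau w'))) else 0))"
 proof(rule reg_cond_dist_nn_integral[OF prob_space_axioms mu[folded be_def] _ _ _ f, symmetric])
  show "(%w'. (left_limit (traj S w') (?tau w'), jump (traj S w') (?tau w'))):Borel M"
   by(intro borel_measurable_Pair) measurable
 qed measurable
 also have "... = (NINT w'|M. (let tau = ?tau w' in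
   if tau < D then (NINT x|(ka w (real_of_ereal tau) (left_limit (traj S w') tau)). thinned thin (tail h n w) (real_of_ereal tau) x (jump (traj S w') tau))
   else if D < tau then (NINT s|?law. NINT x|(ka w (real_of_ereal D) s). tail h n w (real_of_ereal D, x, 0))
   else 0))"
 proof -
  have "max 0 (real_of_ereal D) = real_of_ereal D" using D(1) by(simp add: real_of_ereal_pos)
  hence "C = (NINT s|?law. NINT x|(ka w (real_of_ereal D) s). tail h n w (real_of_ereal D, x, 0))"
   unfolding C_def deadline_law_def D_def[symmetric] be_def averaged_def by(simp add: Let_def thinned_def)
  thus ?thesis by(intro nn_integral_cong) (simp add: f_def Let_def averaged_def)
 qed
 also have "... = (NINT w'|M. (let t = min (?tau w') D in
    tail h n w (passed w' t)))"
 proof(rule iteration_identity[OF be _ D(1) _ _ _ _ tail_borel[OF h e]])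
  show "be t <= r" for t by(simp add: be_def)
  show "D < oo \<or> (EX t>0. be t < oo)"
  proof(cases "D = oo")
   case True
   hence "K = oo" using D(2) by(cases K) auto
   thus ?thesis using capped_finite[of 1] unfolding be_def by(intro disjI2 exI[of _ 1]) auto
  qed auto
  show "(%(t, s). ka w t s):borel >< borel ->M prob_algebra borel"
  proof -
   have "(%z. (w, z)):borel >< borel ->M past n >< borel >< borel" using e by(simp add: space_history)
   from measurable_compose[OF this kam] show ?thesis by(simp add: split_beta')
  qed
  show "reg_cond_dist M (%_. True) (%w'. X1 t w' + X2 t w') (X1 t) (ka w t)" if "0 < t" for t using ka1 that by simp
  show "reg_cond_dist M (%w'. ?tau w' < oo & jump (traj S w') (?tau w') = 0)
   (%w'. real_of_ereal (?tau w')) (%w'. X1 (real_of_ereal (?tau w')) w') (%t. ka w t (real_of_ereal (be t)))"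
   using ka2 by(simp only: be_def)
 qed
 finally show ?thesis by(simp add: be_def D_def)
qed

end

end

text \<open>After Steps 6, 5, 4 and 3, and 2 have been integrated out, only the passage event of
  paths on \<open>M\<close> is left. \<open>h\<close> is kept general because it is used for
  \<open>step_value\<close> in the law of the output and for \<open>drift_weight\<close> in the
  proof of termination.\<close>

theorem iteration_nn_integral:
 assumes h: "h:Borel borel"
 shows "(NINT w|N. (if active n w then h (elapsed R n w, curH R n w, smpD R n w, smpJ R n w, dur n w, smp_x R n w, run_v q r R n w) else 0)) =
  (NINT w|N. (if active n w then (NINT w'|M. (let t = min (passage_time (traj S w') (target n w)) (smpD R n w) in
    h (elapsed R n w, curH R n w, smpD R n w, smpJ R n w, passed w' t))) else 0))"
  (is "?L = (NINT w|N. (if _ then ?R w else 0))")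
proof -
 obtain ka where kam: "(%(w, t, s). ka w t s):run_past N R n >< borel >< borel ->M prob_algebra borel"
  and ka12: "AE w in N. run_active q r R n w -->
      (ALL t>0. reg_cond_dist M (%_. True) (%w'. X1 t w' + X2 t w') (X1 t) (ka w t)) &
      (let be = run_bound r R n w; tau = (%w'. passage_time (%u. S u w') be) in
      reg_cond_dist M (%w'. tau w' < oo & jump (%u. S u w') (tau w') = 0)
       (%w'. real_of_ereal (tau w')) (%w'. X1 (real_of_ereal (tau w')) w')
       (%t. ka w t (real_of_ereal (be t))))"
  and sg5: "sampled_given N
     (history n (%w. (smpD R n w, smpJ R n w, smp_t1 R n w, smp_s R n w, smp_v R n w)))
     (run_active q r R n) (smp_x R n)
     (%w. ka w (dur n w) (smp_s R n w))"
  using steps(5)[of n] unfolding step5_def by blast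
 obtain mu :: "'w => ereal => (real \<times> real) measure" where mum: "(%(w, t). mu w t):run_past N R n >< borel ->M prob_algebra borel"
  and mu1: "AE w in N. run_active q r R n w -->
      (let tau = (%w'. passage_time (%u. S u w') (run_bound r R n w)) in
      reg_cond_dist M (%_. True) tau
       (%w'. (left_limit (%u. S u w') (tau w'), jump (%u. S u w') (tau w'))) (mu w))"
  and sg3: "sampled_given N (history n (%w. (smpD R n w, smpJ R n w, smp_t1 R n w)))
     (%w. run_active q r R n w & smp_t1 R n w < smpD R n w)
     (%w. (smp_s R n w, smp_v R n w)) (%w. mu w (smp_t1 R n w))"
  using steps(3)[of n] unfolding step3_def by blast
 have "?L = (NINT w|N. (if active n w then tail h n w (dur n w, smp_x R n w, run_v q r R n w) else 0))"
  unfolding tail_def[OF h] split_conv ..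
 also have "... = (NINT w|N. (if active n w then crossed h n ka mu w (smp_t1 R n w) else 0))"
  unfolding step6_nn_integral[OF h] step5_nn_integral[OF h kam sg5] by(rule step34_nn_integral[OF h kam mum sg3])
 also have "... = (NINT w|N. (if active n w then (NINT w'|M. crossed h n ka mu w (passage_time (traj S w') (target n w))) else 0))"
 proof -
  have "(%z. crossed h n ka mu (fst z) (snd z)):Borel (history1 n >< borel)"
   by(rule measurable_crossed[OF h kam mum sg3]) measurable
  from sampled_given_distr[OF prob_space_N step2_sampled[OF state_ok_AE] this] show ?thesis unfolding fst_conv snd_conv .
 qed
 also have "... = (NINT w|N. (if active n w then (NINT w'|M. (let t = min (passage_time (traj S w') (target n w)) (smpD R n w) in
    tail h n w (passed w' t))) else 0))"
 proof(rule nn_integral_cong_AE, goal_cases)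
  case 1 show ?case
   using state_ok_AE[of n] pending_ok_AE[OF state_ok_AE, of n] ka12 mu1 AE_space
  proof eventually_elim
   case (elim w)
   show ?case
   proof(cases "active n w")
    case True
    note b = curb_residual(2)[OF elim(5,1) True]
    show ?thesis unfolding if_P[OF True]
     using elim(3,4)[rule_format, OF True] unfolding b Let_def
     by(intro crossed_nn_integral[OF h kam mum sg3 elim(5,1,2) True, unfolded Let_def]) (elim conjE; assumption)+
   qed simp
  qed
 qed
 finally show ?thesis unfolding tail_def[OF h] split_conv .
qed

end

section \<open>Preservation of the value along the run\<close>

context sampler
begin

lemma run_t_finite_AE: "AE w in N. active n w --> run_t R n w = ereal (dur n w) & 0 < dur n w"
 using state_ok_AE[of n] pending_ok_AE[OF state_ok_AE, of n] t1_AE[OF state_ok_AE, of n]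
proof eventually_elim
 case (elim w)
 show ?case
 proof(rule impI)
  assume a: "active n w"
  hence "smp_t1 R n w ~= oo \<or> smpD R n w ~= oo" using elim(3) by auto
  hence "run_t R n w < oo" by(auto simp: run_t_def min_def)
  with run_t_real[of n w] elim a
  show "run_t R n w = ereal (dur n w) & 0 < dur n w" by simp
 qed
qed

lemma run_continues:
 assumes p: "w:space N" and ok: "state_ok n w" and act: "active n w" and t: "run_t R n w = ereal u"
 shows "continues (elapsed R n w) (curH R n w) (smpD R n w) (smpJ R n w) u (smp_x R n w) (run_v q r R n w) <-> ~ stops n w"
proof -
 have "curA R n w = K - ereal (elapsed R n w)" using ok act by(simp add: state_ok_def)
 thus ?thesis
  by(auto simp: continues_def run_stops_def curb_residual[OF p ok act] t run_z_def run_Delta_def add.assoc)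
qed

lemma smp_Suc:
 assumes "w:space N" "active (Suc n) w" "curD R (Suc n) w ~= 0"
 shows "smpD R (Suc n) w = curD R (Suc n) w" "smpJ R (Suc n) w = smpJ R n w"
 using steps(1)[of "Suc n"] assms by(auto simp: step1_def updates)

context
 fixes F :: "ereal \<times> real \<times> real => ennreal"
 assumes F[measurable]: "F:Borel borel"
begin

text \<open>The value before Step 1. For a pending jump it refers to \<open>smpD\<close> and
  \<open>smpJ\<close>, which Step 1 then copies from the current variables.\<close>

definition state_value :: "nat => 'w => ennreal" where
 "state_value n w = (if curD R n w = 0 then fresh_value F (elapsed R n w) (curH R n w)
   else pending_value F (elapsed R n w) (curH R n w) (smpD R n w) (smpJ R n w))"

text \<open>Step 1 preserves the expected value: if no jump is pending, its sample has the law over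
  which \<open>fresh_value_first_jump\<close> averages.\<close>

lemma state_value_pending:
 "(NINT w|N. (if active n w then state_value n w else 0)) =
  (NINT w|N. (if active n w then pending_value F (elapsed R n w) (curH R n w) (smpD R n w) (smpJ R n w) else 0))"
proof -
 note [measurable] = samples_measurable_N[of n] state_measurable_N[of n]
 have pm[measurable]: "(%w. pending_value F (elapsed R n w) (curH R n w) (smpD R n w) (smpJ R n w)):Borel N"
  by(rule measurable_pending_value[OF F]) measurable
 have fm[measurable]: "(%w. fresh_value F (elapsed R n w) (curH R n w)):Borel N"
  by(rule measurable_fresh_value[OF F]) measurable
 have [measurable]: "state_value n:Borel N" unfolding state_value_def[abs_def] by measurable
 have "(NINT w|N. (if active n w & curD R n w = 0 then state_value n w else 0)) =
  (NINT w|N. (if active n w & curD R n w = 0 then (NINT w'|M. (let d = min (first_jump_time (traj Q w')) (curA R n w) in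
    pending_value F (elapsed R n w) (curH R n w) d (jump (traj Q w') d))) else 0))"
 proof(rule nn_integral_cong_AE, goal_cases)
  case 1 show ?case
   using state_ok_AE[of n]
  proof eventually_elim
   case (elim w)
   show ?case
   proof(cases "active n w & curD R n w = 0")
    case True
    hence "curA R n w = K - ereal (elapsed R n w)" "ereal (elapsed R n w) < K"
     using elim by(auto simp: state_ok_def admissible_def)
    thus ?thesis using True fresh_value_first_jump[OF F, of "elapsed R n w" "curH R n w"] by(simp add: state_value_def)
   qed auto
  qed
 qed
 also have "... = (NINT w|N. (if active n w & curD R n w = 0 then pending_value F (elapsed R n w) (curH R n w) (smpD R n w) (smpJ R n w) else 0))"
 proof -
  define f where "f z = pending_value F (elapsed R n (fst z)) (curH R n (fst z)) (fst (snd z)) (snd (snd z))" for z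
  have f: "f:Borel (past n >< borel)"
  proof -
   note [measurable] = past_state[of n]
   have "f:Borel (past n >< borel >< borel)"
    unfolding f_def by(rule measurable_pending_value[OF F]) measurable
   thus ?thesis by(simp add: borel_prod)
  qed
  show ?thesis using step1_nn_integral[OF f] unfolding f_def fst_conv snd_conv Let_def by(rule sym)
 qed
 finally have 1: "(NINT w|N. (if active n w & curD R n w = 0 then state_value n w else 0)) =
  (NINT w|N. (if active n w & curD R n w = 0 then pending_value F (elapsed R n w) (curH R n w) (smpD R n w) (smpJ R n w) else 0))" .
 have 2: "(NINT w|N. (if active n w & ~ curD R n w = 0 then state_value n w else 0)) =
  (NINT w|N. (if active n w & ~ curD R n w = 0 then pending_value F (elapsed R n w) (curH R n w) (smpD R n w) (smpJ R n w) else 0))"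
  by(intro nn_integral_cong) (auto simp: state_value_def)
 have "(NINT w|N. (if active n w then state_value n w else 0)) =
  (NINT w|N. (if active n w & curD R n w = 0 then state_value n w else 0)) + (NINT w|N. (if active n w & ~ curD R n w = 0 then state_value n w else 0))"
  by(rule nn_integral_split) measurable
 also have "... = (NINT w|N. (if active n w then pending_value F (elapsed R n w) (curH R n w) (smpD R n w) (smpJ R n w) else 0))"
  unfolding 1 2 by(rule nn_integral_split[symmetric]) measurable
 finally show ?thesis .
qed

lemma measurable_run_output: "run_output q r R:Borel N"
proof -
 note [measurable] = state_measurable_N(7)
 have L[measurable]: "(%w. LEAST n. stops n w):N ->M count_space UNIV" by measurable
 define f where "f n w = (curT R (Suc n) w, curH R (Suc n) w - run_Delta q r R n w, run_Delta q r R n w)" for n w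
 have "f n:Borel N" for n
 proof -
  have [measurable]: "curT R (Suc n):Borel N" "curH R (Suc n):Borel N" "run_Delta q r R n:Borel N"
   by(rule state_measurable_N)+
  show ?thesis unfolding f_def[abs_def] by(intro borel_measurable_Pair) measurable
 qed
 hence "(%w. f (LEAST n. stops n w) w):Borel N"
  by(rule measurable_compose_countable[OF _ L])
 thus ?thesis by(simp add: run_output_def[abs_def] Let_def f_def)
qed

lemma run_output_stops: "active n w ==> stops n w ==>
  run_output q r R w = (curT R (Suc n) w, curH R (Suc n) w - run_Delta q r R n w, run_Delta q r R n w)"
proof -
 assume "active n w" "stops n w"
 hence "(LEAST n. stops n w) = n"
  by(intro Least_equality) (auto simp: run_active_def not_less[symmetric])
 thus ?thesis by(simp add: run_output_def Let_def)
qed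

text \<open>\<open>pending_value_iteration\<close> expresses the value through the end of an
  iteration on \<open>M\<close>, and \<open>iteration_nn_integral\<close> replaces the quantities
  there by the sampled ones.\<close>

lemma state_value_step:
 "(NINT w|N. (if active n w then state_value n w else 0)) =
  (NINT w|N. (if active n w then (if stops n w then F (run_output q r R w) else state_value (Suc n) w) else 0))"
proof -
 define h where "h = (%(T, H, D, J, t, x, v). step_value F T H D J t x v)"
 have h: "h:Borel borel"
 proof -
  have "h:Borel (borel >< borel >< borel >< borel >< borel >< borel >< borel)"
   unfolding h_def split_beta' by(rule measurable_step_value[OF F]) measurable
  thus ?thesis by(simp add: borel_prod)
 qed
 have "(NINT w|N. (if active n w then state_value n w else 0)) =
  (NINT w|N. (if active n w then (NINT w'|M. (let t = min (passage_time (traj S w') (target n w)) (smpD R n w) in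
    h (elapsed R n w, curH R n w, smpD R n w, smpJ R n w, passed w' t))) else 0))"
  unfolding state_value_pending
 proof(rule nn_integral_cong_AE, goal_cases)
  case 1 show ?case
   using state_ok_AE[of n] pending_ok_AE[OF state_ok_AE, of n]
  proof eventually_elim
   case (elim w)
   show ?case
   proof(cases "active n w")
    case True
    hence "pending_value F (elapsed R n w) (curH R n w) (smpD R n w) (smpJ R n w) =
     (NINT w'|M. (let t = min (passage_time (traj S w') (target n w)) (smpD R n w) in
      step_value F (elapsed R n w) (curH R n w) (smpD R n w) (smpJ R n w) (real_of_ereal t) (left_limit (traj X1 w') t) (jump (traj X1 w') t)))"
     using elim by(intro pending_value_iteration[OF F]) (auto simp: state_ok_def pending_ok_def)
    thus ?thesis using True by(simp add: h_def)
   qed simp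
  qed
 qed
 also have "... = (NINT w|N. (if active n w then h (elapsed R n w, curH R n w, smpD R n w, smpJ R n w, dur n w, smp_x R n w, run_v q r R n w) else 0))"
  by(rule iteration_nn_integral[OF h, symmetric])
 also have "... = (NINT w|N. (if active n w then (if stops n w then F (run_output q r R w) else state_value (Suc n) w) else 0))"
 proof(rule nn_integral_cong_AE, goal_cases)
  case 1 show ?case
   using state_ok_AE[of n] run_t_finite_AE[of n] AE_space
  proof eventually_elim
   case (elim w)
   show ?case
   proof(cases "active n w")
    case True
    obtain u where u: "run_t R n w = ereal u" using elim(2) True by blast
    note cont = run_continues[OF elim(3,1) True u]
    have T: "curT R n w = ereal (elapsed R n w)" using elim(1) True by(simp add: state_ok_def)
    have E: "elapsed R (Suc n) w = elapsed R n w + u" by(simp add: elapsed_Suc u)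
    have Dl: "run_Delta q r R n w = run_v q r R n w + (if ereal u = smpD R n w then smpJ R n w else 0)"
     by(simp add: run_Delta_def u)
    show ?thesis
    proof(cases "stops n w")
     case stop: True
     thus ?thesis using True cont
      by(simp add: h_def step_value_def u run_output_stops updates[OF elim(3)] T run_z_def Dl)
    next
     case False
     hence a: "active (Suc n) w" using True by(simp add: active_Suc)
     have D: "curD R (Suc n) w = smpD R n w - ereal u" by(simp add: updates[OF elim(3)] u)
     hence D0: "curD R (Suc n) w = 0 <-> ereal u = smpD R n w" by(cases "smpD R n w") auto
     show ?thesis
     proof(cases "ereal u = smpD R n w")
      case at: True
      hence "curD R (Suc n) w = 0" using D0 by simp
      thus ?thesis using True False cont unfolding at[symmetric]
       by(simp add: at[symmetric] h_def step_value_def u state_value_def E updates(7)[OF elim(3)] run_z_def Dl add.assoc)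
     next
      case before: False
      hence nz: "curD R (Suc n) w ~= 0" using D0 by simp
      show ?thesis using True False cont before nz smp_Suc[OF elim(3) a nz]
       by(simp add: h_def step_value_def u state_value_def E updates(7)[OF elim(3)] run_z_def Dl D[symmetric])
     qed
    qed
   qed simp
  qed
 qed
 finally show ?thesis .
qed

text \<open>The martingale property in integrated form: stopped runs contribute the output, the
  others their current value. It does not presuppose that the run stops and can thus serve the proof
  of termination as well.\<close>

theorem value_identity:
 "fresh_value F 0 0 = (NINT w|N. (if active n w then state_value n w else F (run_output q r R w)))"
proof(induction n)
 case 0
 have "(NINT w|N. (if active 0 w then state_value 0 w else F (run_output q r R w))) = (NINT w|N. fresh_value F 0 0)"
  by(intro nn_integral_cong) (simp add: run_active_def state_value_def updates elapsed_def)
 thus ?case by(simp add: N.emeasure_space_1)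
next
 case (Suc n)
 have sv: "state_value m:Borel N" for m
 proof -
  note [measurable] = samples_measurable_N[of m] state_measurable_N[of m]
  have pm[measurable]: "(%w. pending_value F (elapsed R m w) (curH R m w) (smpD R m w) (smpJ R m w)):Borel N"
   by(rule measurable_pending_value[OF F]) measurable
  have fm[measurable]: "(%w. fresh_value F (elapsed R m w) (curH R m w)):Borel N"
   by(rule measurable_fresh_value[OF F]) measurable
  show ?thesis unfolding state_value_def[abs_def] by measurable
 qed
 note [measurable] = sv[of n] sv[of "Suc n"] state_measurable_N[of n] state_measurable_N(6)[of "Suc n"] measurable_run_output
 have split: "(NINT w|N. (if active n w then f w else F (run_output q r R w))) = (NINT w|N. (if active n w then f w else 0)) +
   (NINT w|N. (if active n w then 0 else F (run_output q r R w)))" if [measurable]: "f:Borel N" for f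
  by(subst nn_integral_add[symmetric]) (auto intro!: nn_integral_cong)
 have "fresh_value F 0 0 = (NINT w|N. (if active n w then (if stops n w then F (run_output q r R w) else state_value (Suc n) w) else 0)) +
   (NINT w|N. (if active n w then 0 else F (run_output q r R w)))"
  unfolding Suc split[OF sv] state_value_step ..
 also have "... = (NINT w|N. (if active n w then (if stops n w then F (run_output q r R w) else state_value (Suc n) w) else F (run_output q r R w)))"
  by(rule split[symmetric]) measurable
 also have "... = (NINT w|N. (if active (Suc n) w then state_value (Suc n) w else F (run_output q r R w)))"
  by(intro nn_integral_cong) (simp add: active_Suc)
 finally show ?case .
qed

end

end

section \<open>Termination and output\<close>

context decomposition
begin

lemma finite_X2_X3:
 "emeasure (density Lam (%x. ennreal (1 - exp (- q * x)) * indicator {x. ereal x <= r} x)) {0<..} < oo"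
 "emeasure (density Lam (indicator {x. r < ereal x})) {0<..} < oo"
proof -
 let ?D = "density Lam (%x. ennreal (1 - exp (- q * x)) * indicator {x. ereal x <= r} x)"
 let ?i = "indicator {x. r < ereal x} :: real => ennreal"
 let ?m = "%x. ennreal (min 1 x)"
 note [measurable_cong] = sets_Lam
 have fin: "(NINT x|Lam. ?m x) < oo" using levy_Lam by(simp add: levy_measure_def)
 have fin': "(NINT x|Lam. ennreal C * ?m x) < oo" for C
  using fin by(subst nn_integral_cmult) (auto simp: ennreal_mult_less_top)
 have "emeasure (?D) {0<..} =
  (NINT x|Lam. ennreal (1 - exp (- q * x)) * indicator {x. ereal x <= r} x * indicator {0<..} x)"
  by(rule emeasure_density) auto
 also have "... <= (NINT x|Lam. ennreal (max 1 q) * ?m x)"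
  using one_minus_exp_le_min[OF levy_Lam _ q] q by(intro nn_integral_mono) (auto simp: indicator_def ennreal_mult''[symmetric] intro!: ennreal_leI)
 also have "... < oo" by(rule fin')
 finally show "emeasure (?D) {0<..} < oo" .
 have "emeasure (density Lam (?i)) {0<..} = (NINT x|Lam. ?i x * indicator {0<..} x)"
  by(rule emeasure_density) auto
 also have "... < oo"
 proof(cases r)
  case (real r')
  hence r': "0 < r'" using r by simp
  have "(NINT x|Lam. ?i x * indicator {0<..} x) <= (NINT x|Lam. ennreal (1 / min 1 r') * ?m x)"
  proof(rule nn_integral_mono)
   fix x
   show "?i x * indicator {0<..} x <= ennreal (1 / min 1 r') * ?m x"
   proof(cases "r' < x")
    case True
    hence "min 1 r' <= min 1 x" "0 < min 1 r'" using r' by auto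
    hence "1 <= 1 / min 1 r' * min 1 x" by(simp add: field_simps)
    hence "ennreal 1 <= ennreal (1 / min 1 r' * min 1 x)" by(rule ennreal_leI)
    thus ?thesis using r' by(auto simp: indicator_def ennreal_mult'[symmetric])
   qed (simp add: real)
  qed
  also have "... < oo" by(rule fin')
  finally show ?thesis .
 qed (use r in auto)
 finally show "emeasure (density Lam (?i)) {0<..} < oo" .
qed

lemma prob_nonzero_small:
 assumes X: "driftless_subordinator M nu X" and fin: "emeasure nu {0<..} < oo"
 shows "(%k. prob {w:space M. X (1 / Suc k) w ~= 0}) ----> 0"
proof -
 have "prob {w:space M. X (1 / Suc k) w ~= 0} = 1 - exp (- (1 / Suc k) * measure nu {0<..})" for k
 proof -
  have [measurable]: "X (1 / Suc k):Borel M" by(rule driftless_subordinatorD(3)[OF X]) simp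
  have "prob {w:space M. ~ X (1 / Suc k) w = 0} = 1 - prob {w:space M. X (1 / Suc k) w = 0}"
   by(rule prob_neg) measurable
  thus ?thesis using subordinator_prob_zero_finite[OF X fin, of "1 / Suc k"] by simp
 qed
 moreover have "(%k. 1 - exp (- (1 / Suc k) * measure nu {0<..})) ----> 1 - exp (- 0 * measure nu {0<..})"
  by(intro tendsto_intros LIMSEQ_inverse_real_of_nat[unfolded inverse_eq_divide])
 ultimately show ?thesis by(simp del: of_nat_Suc)
qed

text \<open>If this does not happen, then up to time \<open>eta\<close> the process \<open>S\<close>
  coincides with \<open>X1\<close> and stays below \<open>r\<close>; a passage of the capped
  boundary is then one of the boundary itself by \<open>X1\<close>, and the run stops.\<close>

definition eventful :: "real => 'a => bool" where
 "eventful eta w <-> X2 eta w ~= 0 \<or> X3 eta w ~= 0 \<or> r <= ereal (X1 eta w)"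

lemma measurable_eventful: "0 <= eta ==> Measurable.pred M (eventful eta)"
proof -
 assume "0 <= eta"
 hence [measurable]: "X1 eta:Borel M" "X2 eta:Borel M" "X3 eta:Borel M"
  by(auto intro: driftless_subordinatorD(3) X1 X2 X3)
 show ?thesis unfolding eventful_def[abs_def] by measurable
qed

text \<open>\<open>X2\<close>, \<open>X3\<close> and \<open>Q\<close> have finite Levy measures and
  are probably still 0 at a small time; \<open>X1\<close> starts at 0 and is right-continuous, so it
  is probably still below \<open>r\<close>.\<close>

lemma uneventful_time:
 assumes ep: "0 < ep"
 obtains eta where "0 < eta" "prob {w:space M. eventful eta w} <= ep" "prob {w:space M. Q eta w ~= 0} <= ep"
proof -
 define A where "A k = {w:space M. r <= ereal (X1 (1 / Suc k) w)}" for k :: nat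
 define B where "B k = {w:space M. X2 (1 / Suc k) w ~= 0}" for k :: nat
 define C where "C k = {w:space M. X3 (1 / Suc k) w ~= 0}" for k :: nat
 have m[measurable]: "X1 (1 / real (Suc k)):Borel M" "X2 (1 / real (Suc k)):Borel M" "X3 (1 / real (Suc k)):Borel M" for k
  by(auto intro!: driftless_subordinatorD(3) X1 X2 X3)
 have sets[measurable]: "A k:sets M" "B k:sets M" "C k:sets M" for k unfolding A_def B_def C_def by measurable
 have "(%k. prob (A k)) ----> prob (\<Inter>k. A k)"
 proof(rule finite_Lim_measure_decseq)
  show "decseq A"
  proof(rule decseq_SucI, rule subsetI)
   fix k w assume "w:A (Suc k)"
   hence p: "w:space M" "r <= ereal (X1 (1 / Suc (Suc k)) w)" by(auto simp: A_def)
   have "X1 (1 / Suc (Suc k)) w <= X1 (1 / Suc k) w"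
    by(rule subordinator_pathD(2)[OF path_nice(1)[OF p(1)]]) (auto simp: field_simps)
   thus "w:A k" using p by(auto simp: A_def simp del: of_nat_Suc intro: order_trans)
  qed
 qed auto
 also have "(\<Inter>k. A k) = {}"
 proof(rule ccontr)
  assume "(\<Inter>k. A k) ~= {}"
  then obtain w where p: "w:space M" "!!k. r <= ereal (X1 (1 / Suc k) w)" by(auto simp: A_def simp del: of_nat_Suc)
  note f = path_nice(1)[OF p(1)]
  have "(%k. X1 (1 / real (Suc k)) w) ----> X1 0 w"
   by(rule path_tendsto_above[OF f _ LIMSEQ_inverse_real_of_nat[unfolded inverse_eq_divide]]) auto
  hence "(%k. ereal (X1 (1 / real (Suc k)) w)) ----> ereal 0" using subordinator_pathD(1)[OF f] by simp
  hence "r <= ereal 0" by(rule LIMSEQ_le_const) (use p(2) in auto)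
  thus False using r by(simp add: zero_ereal_def[symmetric])
 qed
 finally have lim: "(%k. prob (A k) + prob (B k) + prob (C k) + prob {w:space M. Q (1 / Suc k) w ~= 0}) ----> 0 + 0 + 0 + 0"
  unfolding B_def C_def
  by(intro tendsto_add prob_nonzero_small[OF X2] prob_nonzero_small[OF X3] prob_nonzero_small[OF Q] finite_X2_X3 chi(2)) simp
 hence "\<forall>\<^sub>F k in sequentially. prob (A k) + prob (B k) + prob (C k) + prob {w:space M. Q (1 / Suc k) w ~= 0} < ep"
  using ep by(intro order_tendstoD(2)) auto
 then obtain k where k: "prob (A k) + prob (B k) + prob (C k) + prob {w:space M. Q (1 / Suc k) w ~= 0} < ep"
  by(auto simp: eventually_sequentially)
 have "prob {w:space M. eventful (1 / Suc k) w} <= prob (A k \<union> B k \<union> C k)"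
  by(intro finite_measure_mono) (auto simp: A_def B_def C_def eventful_def simp del: of_nat_Suc)
 also have "... <= prob (A k \<union> B k) + prob (C k)" by(intro measure_Un_le) auto
 also have "prob (A k \<union> B k) <= prob (A k) + prob (B k)" by(intro measure_Un_le) auto
 finally have "prob {w:space M. eventful (1 / Suc k) w} <= prob (A k) + prob (B k) + prob (C k)" by simp
 moreover have "0 <= prob {w:space M. Q (1 / Suc k) w ~= 0}" "0 <= prob (A k) + prob (B k) + prob (C k)" by(auto intro!: add_nonneg_nonneg)
 ultimately show ?thesis using k by(intro that[of "1 / Suc k"]) (linarith | simp)+
qed

end

context crossing
begin

text \<open>The weight of the next state if the run goes on: discounted at rate \<open>l\<close>,
  and doubled unless the iteration ends at the deadline, when no jump is pending any more.\<close>

definition drift_weight :: "real => real => real => ereal => real => real => real => real => ennreal" where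
 "drift_weight l T H D J t x v =
   (if continues T H D J t x v then ennreal (exp (- l * (T + t)) * (if ereal t = D then 1 else 2)) else 0)"

text \<open>Three cases. If \<open>t >= eta\<close>, the discount is effective. If
  \<open>t = D < eta\<close>, the pending jump is used up and the factor 2 is gone. Otherwise
  \<open>S\<close> has passed early although nothing eventful happened, so \<open>X1\<close> has
  reached the boundary, and the run does not continue.\<close>

lemma drift_weight_bound:
 assumes p: "w:space M" and adm: "admissible T H" and D: "0 < D" and eta: "0 < eta" and l: "0 <= l" and quiet: "~ eventful eta w"
  and t: "min (passage_time (traj S w) (capped_residual T H)) D = ereal t"
 shows "drift_weight l T H D J t (left_limit (traj X1 w) (ereal t)) (jump (traj X1 w) (ereal t)) <=
  ennreal (exp (- l * T) * (2 * exp (- l * eta) + (if D < ereal eta & D < K - ereal T then 1 else 0)))"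
proof(cases "continues T H D J t (left_limit (traj X1 w) (ereal t)) (jump (traj X1 w) (ereal t))")
 case True
 let ?i = "if D < ereal eta & D < K - ereal T then 1 else 0 :: real" and ?c = "if ereal t = D then 1 else 2 :: real"
 note n = path_nice[OF p]
 have be: "barrier (capped_residual T H)" by(rule capped_barrier[OF adm])
 have "0 < min (passage_time (traj S w) (capped_residual T H)) D" using D passage_time_pos[OF be n(5)] by simp
 hence t0: "0 < t" using t by simp
 have mult: "exp (- l * (T + t)) = exp (- l * T) * exp (- l * t)" by(simp add: exp_add[symmetric] algebra_simps)
 consider "eta <= t" | "t < eta" "ereal t = D" | "t < eta" "ereal t ~= D" by fastforce
 hence "exp (- l * (T + t)) * ?c <= exp (- l * T) * (2 * exp (- l * eta) + ?i)"
 proof cases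
  case 1
  define a b where "a = exp (- l * t)" and "b = exp (- l * eta)"
  have "a <= b" "0 <= a" using 1 l by(simp_all add: a_def b_def mult_left_mono)
  hence "exp (- l * t) * ?c <= 2 * exp (- l * eta) + ?i"
   unfolding a_def[symmetric] b_def[symmetric] by auto
  thus ?thesis unfolding mult mult.assoc by(rule mult_left_mono) simp
 next
  case 2
  have "D < ereal eta" using 2 by auto
  moreover have "D < K - ereal T" using True 2 by(simp add: continues_def)
  moreover define a b where "a = exp (- l * t)" and "b = exp (- l * eta)"
  moreover have "a <= 1" "0 <= b" using l t0 by(simp_all add: a_def b_def)
  ultimately have "exp (- l * t) * ?c <= 2 * exp (- l * eta) + ?i"
   unfolding a_def[symmetric] b_def[symmetric] using 2 by simp
  thus ?thesis unfolding mult mult.assoc by(rule mult_left_mono) simp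
 next
  case 3
  have tau: "passage_time (traj S w) (capped_residual T H) = ereal t" using t 3 by(auto simp: min_def split: if_splits)
  have q: "X2 eta w = 0" "X3 eta w = 0" "ereal (X1 eta w) < r" using quiet by(auto simp: eventful_def)
  have z: "X2 t w = 0" "X3 t w = 0"
   using subordinator_pathD(2)[OF n(2), of t eta] subordinator_pathD(3)[OF n(2), of t]
    subordinator_pathD(2)[OF n(3), of t eta] subordinator_pathD(3)[OF n(3), of t] 3 t0 q by auto
  have "X1 t w <= X1 eta w" using subordinator_pathD(2)[OF n(1), of t eta] 3 t0 by simp
  hence "ereal (X1 t w) < r" using q(3) by(metis ereal_less_eq(3) le_less_trans)
  moreover have "capped_residual T H t <= ereal (X1 t w)"
   using barrier_le_passage_time[OF be n(5) tau] z by(simp add: S_eq)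
  ultimately have "residual T H t <= ereal (X1 t w)" by(auto simp: min_le_iff_disj)
  moreover have "left_limit (traj X1 w) (ereal t) + jump (traj X1 w) (ereal t) = X1 t w" using t0 by(simp add: jump_def)
  ultimately have False using True 3 by(auto simp: continues_def)
  thus ?thesis ..
 qed
 thus ?thesis using True by(simp add: drift_weight_def del: mult_minus_left)
qed (simp add: drift_weight_def)

lemma drift_weight_le: "0 <= l ==> 0 <= t ==> drift_weight l T H D J t x v <= ennreal (exp (- l * T) * 2)"
proof -
 assume "0 <= l" "0 <= t"
 hence "- l * (T + t) <= - l * T" by(simp add: distrib_left)
 hence "exp (- l * (T + t)) * (if ereal t = D then 1 else 2) <= exp (- l * T) * 2"
  by(intro mult_mono) auto
 thus ?thesis by(auto simp: drift_weight_def intro!: ennreal_leI)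
qed

text \<open>Eventful paths contribute at most \<open>2 * ep\<close> and long iterations at most
  \<open>2 * ep\<close>, relative to the discount at time \<open>T\<close>; the last term is left
  over for a deadline before \<open>eta\<close>.\<close>

lemma drift_weight_nn_integral:
 assumes adm: "admissible T H" and D: "0 < D" "D <= K - ereal T" and eta: "0 < eta" and l: "0 <= l"
  and ep: "prob {w:space M. eventful eta w} <= ep" "exp (- l * eta) <= ep"
 shows "(NINT w|M. (let t = min (passage_time (traj S w) (capped_residual T H)) D in
   drift_weight l T H D J (real_of_ereal t) (left_limit (traj X1 w) t) (jump (traj X1 w) t))) <=
  ennreal (exp (- l * T) * (4 * ep + (if D < ereal eta & D < K - ereal T then 1 else 0)))"
proof -
 have be: "barrier (capped_residual T H)" by(rule capped_barrier[OF adm])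
 define e where "e = exp (- l * T)"
 define i where "i = (if D < ereal eta & D < K - ereal T then 1 else 0 :: real)"
 have ep0: "0 <= ep" using ep(2) by(meson exp_ge_zero order_trans)
 have [measurable]: "Measurable.pred M (eventful eta)" using eta by(intro measurable_eventful) simp
 let ?t = "%w. min (passage_time (traj S w) (capped_residual T H)) D" and ?p = "prob {w:space M. eventful eta w}"
 have t_fin: "AE w in M. ?t w < oo"
 proof(cases "D = oo")
  case True
  hence "K = oo" using D(2) by(cases K) auto
  hence "EX t>0. capped_residual T H t < oo" using capped_finite[of 1] by(intro exI[of _ 1]) auto
  from passage_time_finite[OF be this] show ?thesis by eventually_elim (auto simp: min_def)
 next
  case False
  thus ?thesis by(cases D) (auto simp: min_def)
 qed
 have "(NINT w|M. (let t = ?t w in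
   drift_weight l T H D J (real_of_ereal t) (left_limit (traj X1 w) t) (jump (traj X1 w) t))) <=
  (NINT w|M. ennreal (e * 2) * indicator {w:space M. eventful eta w} w + ennreal (e * (2 * exp (- l * eta) + i)))"
 proof(rule nn_integral_mono_AE, goal_cases)
  case 1 show ?case
   using t_fin AE_space
  proof eventually_elim
   case (elim w)
   have "0 < ?t w" using D passage_time_pos[OF be path_nice(5)[OF elim(2)]] by simp
   then obtain t where t: "?t w = ereal t" "0 < t"
    using elim(1) by(cases "?t w") auto
   show ?case
   proof(cases "eventful eta w")
    case True
    thus ?thesis using drift_weight_le[OF l, of t T H D J "left_limit (traj X1 w) (ereal t)" "jump (traj X1 w) (ereal t)"] t elim(2)
     by(auto simp: e_def Let_def intro: add_increasing2)
   next
    case False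
    thus ?thesis using drift_weight_bound[OF elim(2) adm D(1) eta l False t(1), of J] t by(simp add: e_def i_def Let_def)
   qed
  qed
 qed
 also have "... = ennreal (e * 2) * emeasure M {w:space M. eventful eta w} + ennreal (e * (2 * exp (- l * eta) + i))"
  by(subst nn_integral_add) (auto simp: nn_integral_cmult_indicator emeasure_space_1)
 also have "... = ennreal (e * 2 * ?p + e * (2 * exp (- l * eta) + i))"
  by(simp add: emeasure_eq_measure ennreal_mult''[symmetric] ennreal_plus[symmetric] e_def i_def del: ennreal_plus)
 also have "... <= ennreal (e * (4 * ep + i))"
 proof(rule ennreal_leI)
  have "e * (2 * ?p + (2 * exp (- l * eta) + i)) <= e * (4 * ep + i)"
   using ep by(intro mult_left_mono) (auto simp: e_def)
  thus "e * 2 * ?p + e * (2 * exp (- l * eta) + i) <= e * (4 * ep + i)"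
   by(simp add: algebra_simps)
 qed
 finally show ?thesis by(simp add: e_def i_def)
qed

abbreviation result :: "real => real => 'a => ereal \<times> real \<times> real" where
 "result T H w \<equiv> outcome T H (%u. X1 u w + Q u w)"

lemma outcome_finite: "AE w in M. fst (result 0 0 w) < oo"
proof -
 have adm: "admissible 0 0" using K by(simp add: admissible_def zero_ereal_def[symmetric])
 have "AE w in M. ALL B. EX t>0. B < X1 t w"
  using infinite_measures(1) by(intro subordinator_unbounded[OF X1]) simp
 thus ?thesis using AE_space
 proof eventually_elim
  case (elim w)
  note n = path_nice[OF elim(2)]
  have "min (passage_time (%u. X1 u w + Q u w) (residual 0 0)) K < oo"
  proof(cases "K = oo")
   case True
   have "passage_time (%u. X1 u w + Q u w) (residual 0 0) < oo"
   proof(rule passage_time_unbounded[OF residual_barrier[OF adm], of 1])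
    show "residual 0 0 1 < oo" using True by(intro residual_finite) auto
    show "subordinator_path (%u. X1 u w + Q u w)" by(rule subordinator_path_add[OF n(1,4)])
    fix B
    obtain t where "0 < t" "B < X1 t w" using elim(1) by blast
    thus "EX t>0. B < X1 t w + Q t w" using subordinator_pathD(3)[OF n(4), of t] by(intro exI[of _ t]) simp
   qed simp
   thus ?thesis by(auto simp: min_def)
  qed (auto simp: min_def)
  thus ?case by(simp add: outcome_def Let_def zero_ereal_def[symmetric])
 qed
qed

end

context sampler
begin

definition weight :: "real => nat => 'w => ennreal" where
 "weight l n w = ennreal (exp (- l * elapsed R n w) * (if curD R n w = 0 then 1 else 2))"

lemma measurable_weight: "weight l n:Borel N"
proof -
 note [measurable] = state_measurable_N[of n]
 show ?thesis unfolding weight_def[abs_def] by measurable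
qed

text \<open>With a pending jump the bound \<open>4/10 + 1\<close> is 7/10 of the weight 2. Without
  one, the last term requires a jump of \<open>Q\<close> before \<open>eta\<close>, which has
  probability at most 1/10, and 5/10 is less than 7/10.\<close>

lemma weight_contraction:
 assumes eta: "0 < eta" and l: "0 <= l" and ep: "prob {w:space M. eventful eta w} <= 1/10" "exp (- l * eta) <= 1/10"
  and Qeta: "prob {w:space M. Q eta w ~= 0} <= 1/10"
 shows "(NINT w|N. (if active (Suc n) w then weight l (Suc n) w else 0)) <=
  ennreal (7/10) * (NINT w|N. (if active n w then weight l n w else 0))"
proof -
 note [measurable] = samples_measurable_N[of n] state_measurable_N[of n] measurable_weight[of l n]
 define h where "h = (%(T, H, D, J, t, x, v). drift_weight l T H D J t x v)"
 have h: "h:Borel borel"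
 proof -
  have 1: "Measurable.pred (borel >< borel >< borel >< borel >< borel >< borel >< borel)
   (%z. continues (fst z) (fst (snd z)) (fst (snd (snd z))) (fst (snd (snd (snd z)))) (fst (snd (snd (snd (snd z)))))
    (fst (snd (snd (snd (snd (snd z)))))) (snd (snd (snd (snd (snd (snd z)))))))"
   by(rule measurable_continues) measurable
  have "h:Borel (borel >< borel >< borel >< borel >< borel >< borel >< borel)"
   unfolding h_def drift_weight_def split_beta' using 1 by measurable
  thus ?thesis by(simp add: borel_prod)
 qed
 define f where "f z = ennreal (exp (- l * elapsed R n (fst z)) * (4/10 + (if fst (snd z) < ereal eta & fst (snd z) < curA R n (fst z) then 1 else 0)))"
  for z :: "'w \<times> ereal \<times> real"
 have f: "f:Borel (past n >< borel)"
 proof -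
  note [measurable] = past_state[of n]
  have "f:Borel (past n >< borel >< borel)" unfolding f_def by measurable
  thus ?thesis by(simp add: borel_prod)
 qed
 have fN: "(%w. f (w, (smpD R n w, smpJ R n w))):Borel N" unfolding f_def by measurable
 have "(NINT w|N. (if active (Suc n) w then weight l (Suc n) w else 0)) =
  (NINT w|N. (if active n w then h (elapsed R n w, curH R n w, smpD R n w, smpJ R n w, dur n w, smp_x R n w, run_v q r R n w) else 0))"
 proof(rule nn_integral_cong_AE, goal_cases)
  case 1 show ?case
   using state_ok_AE[of n] run_t_finite_AE[of n] AE_space
  proof eventually_elim
   case (elim w)
   show ?case
   proof(cases "active n w")
    case True
    obtain u where u: "run_t R n w = ereal u" using elim(2) True by blast
    have "curD R (Suc n) w = smpD R n w - ereal u" by(simp add: updates[OF elim(3)] u)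
    hence "curD R (Suc n) w = 0 <-> ereal u = smpD R n w" by(cases "smpD R n w") auto
    thus ?thesis using True run_continues[OF elim(3,1) True u]
     by(simp add: active_Suc h_def drift_weight_def u weight_def elapsed_Suc)
   qed (simp add: active_Suc)
  qed
 qed
 also have "... = (NINT w|N. (if active n w then (NINT w'|M. (let t = min (passage_time (traj S w') (target n w)) (smpD R n w) in
    h (elapsed R n w, curH R n w, smpD R n w, smpJ R n w, passed w' t))) else 0))"
  by(rule iteration_nn_integral[OF h])
 also have "... <= (NINT w|N. (if active n w then f (w, (smpD R n w, smpJ R n w)) else 0))"
 proof(rule nn_integral_mono_AE, goal_cases)
  case 1 show ?case
   using state_ok_AE[of n] pending_ok_AE[OF state_ok_AE, of n]
  proof eventually_elim
   case (elim w)
   show ?case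
   proof(cases "active n w")
    case True
    have s: "admissible (elapsed R n w) (curH R n w)" "curA R n w = K - ereal (elapsed R n w)"
     "0 < smpD R n w" "smpD R n w <= K - ereal (elapsed R n w)"
     using elim True by(auto simp: state_ok_def pending_ok_def)
    show ?thesis using drift_weight_nn_integral[OF s(1,3,4) eta l ep, of "smpJ R n w"] True
     by(simp add: h_def f_def s(2))
   qed simp
  qed
 qed
 also have "... = (NINT w|N. (if active n w & curD R n w = 0 then f (w, (smpD R n w, smpJ R n w)) else 0)) +
   (NINT w|N. (if active n w & ~ curD R n w = 0 then f (w, (smpD R n w, smpJ R n w)) else 0))"
  by(rule nn_integral_split) (use fN in measurable)
 also have "... <= (NINT w|N. (if active n w & curD R n w = 0 then ennreal (7/10) * weight l n w else 0)) +
   (NINT w|N. (if active n w & ~ curD R n w = 0 then ennreal (7/10) * weight l n w else 0))"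
 proof(rule add_mono)
  have inner: "(NINT w'|M. f (w, first_jump w' (curA R n w))) <= ennreal (7/10) * weight l n w"
   if "curD R n w = 0" for w
  proof -
   define e where "e = exp (- l * elapsed R n w)"
   have "0 < e" by(simp add: e_def)
   have [measurable]: "Q eta:Borel M" using eta by(intro driftless_subordinatorD(3)[OF Q]) simp
   have "(NINT w'|M. f (w, first_jump w' (curA R n w))) <=
    (NINT w'|M. ennreal (e * (4/10)) + ennreal e * indicator {w:space M. Q eta w ~= 0} w')"
   proof(rule nn_integral_mono)
    fix w' assume p: "w':space M"
    \<comment> \<open>The second condition excludes a deadline that is merely the horizon
      \<open>A\<close>; so it is the first jump of \<open>Q\<close> that comes before
      \<open>eta\<close>.\<close>
    have "Q eta w' ~= 0" if "min (first_jump_time (traj Q w')) (curA R n w) < ereal eta" "min (first_jump_time (traj Q w')) (curA R n w) < curA R n w"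
    proof
     assume "Q eta w' = 0"
     hence "ereal eta <= first_jump_time (traj Q w')" using eta by(intro first_jump_time_ge[OF p]) auto
     thus False using that by(auto simp: min_def split: if_splits)
    qed
    thus "f (w, first_jump w' (curA R n w)) <=
     ennreal (e * (4/10)) + ennreal e * indicator {w:space M. Q eta w ~= 0} w'"
     using p by(auto simp: f_def Let_def e_def[symmetric] indicator_def distrib_left ennreal_plus[symmetric] e_def simp del: ennreal_plus intro!: ennreal_leI)
   qed
   also have "... = ennreal (e * (4/10)) + ennreal e * emeasure M {w:space M. Q eta w ~= 0}"
    by(subst nn_integral_add) (auto simp: nn_integral_cmult_indicator emeasure_space_1)
   also have "... = ennreal (e * (4/10) + e * prob {w:space M. Q eta w ~= 0})"
    by(simp add: emeasure_eq_measure ennreal_mult''[symmetric] ennreal_plus[symmetric] e_def del: ennreal_plus)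
   also have "... <= ennreal (7/10 * e)"
   proof(rule ennreal_leI)
    have "e * prob {w:space M. Q eta w ~= 0} <= e * (1/10)" using Qeta by(intro mult_left_mono) (auto simp: e_def)
    thus "e * (4/10) + e * prob {w:space M. Q eta w ~= 0} <= 7/10 * e" using \<open>0 < e\<close> by simp
   qed
   also have "... = ennreal (7/10) * weight l n w"
    unfolding weight_def e_def[symmetric] using that \<open>0 < e\<close> by(subst ennreal_mult[symmetric]) auto
   finally show ?thesis .
  qed
  have "(NINT w|N. (if active n w & curD R n w = 0 then f (w, (smpD R n w, smpJ R n w)) else 0)) =
   (NINT w|N. (if active n w & curD R n w = 0 then (NINT w'|M. f (w, first_jump w' (curA R n w))) else 0))"
   by(rule step1_nn_integral[OF f])
  also have "... <= (NINT w|N. (if active n w & curD R n w = 0 then ennreal (7/10) * weight l n w else 0))"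
   using inner by(intro nn_integral_mono) auto
  finally show "(NINT w|N. (if active n w & curD R n w = 0 then f (w, (smpD R n w, smpJ R n w)) else 0)) <=
   (NINT w|N. (if active n w & curD R n w = 0 then ennreal (7/10) * weight l n w else 0))" .
  show "(NINT w|N. (if active n w & ~ curD R n w = 0 then f (w, (smpD R n w, smpJ R n w)) else 0)) <=
   (NINT w|N. (if active n w & ~ curD R n w = 0 then ennreal (7/10) * weight l n w else 0))"
  proof(rule nn_integral_mono)
   fix w
   have "f (w, (smpD R n w, smpJ R n w)) <= ennreal (7/10) * weight l n w" if "curD R n w ~= 0"
   proof -
    have "f (w, (smpD R n w, smpJ R n w)) <= ennreal (7/10 * (exp (- l * elapsed R n w) * 2))"
     by(auto simp: f_def intro!: ennreal_leI)
    also have "... = ennreal (7/10) * weight l n w"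
     unfolding weight_def using that by(subst ennreal_mult[symmetric]) auto
    finally show ?thesis .
   qed
   thus "(if active n w & ~ curD R n w = 0 then f (w, (smpD R n w, smpJ R n w)) else 0) <=
    (if active n w & ~ curD R n w = 0 then ennreal (7/10) * weight l n w else 0)" by auto
  qed
 qed
 also have "... = (NINT w|N. (if active n w then ennreal (7/10) * weight l n w else 0))"
  by(rule nn_integral_split[symmetric]) measurable
 also have "... = (NINT w|N. ennreal (7/10) * (if active n w then weight l n w else 0))"
  by(intro nn_integral_cong) auto
 also have "... = ennreal (7/10) * (NINT w|N. (if active n w then weight l n w else 0))"
  by(rule nn_integral_cmult) measurable
 finally show ?thesis .
qed

abbreviation late :: "real => ereal \<times> real \<times> real => ennreal" where
 "late m \<equiv> indicator {z. ereal m <= fst z}"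

lemma late_value:
 assumes adm: "admissible T H" and m: "m <= T"
 shows "fresh_value (late m) T H = 1"
  and "pending_value (late m) T H D J = 1"
proof -
 have TK: "ereal T < K" using adm by(simp add: admissible_def)
 have "ereal m <= fst (outcome T H f)" for f
 proof -
  have "0 <= min (passage_time f (residual T H)) (K - ereal T)"
   using passage_time_nonneg TK by(cases K) auto
  hence "ereal m + 0 <= ereal T + min (passage_time f (residual T H)) (K - ereal T)"
   using m by(intro add_mono) auto
  thus ?thesis by(simp add: outcome_def Let_def)
 qed
 thus "fresh_value (late m) T H = 1" "pending_value (late m) T H D J = 1"
  by(simp_all add: fresh_value_def pending_value_def emeasure_space_1)
qed

lemma late_indicator: "late m:Borel borel"
proof -
 have "late m:Borel (borel >< borel)" unfolding indicator_def by measurable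
 thus ?thesis by(simp add: borel_prod)
qed

text \<open>In a state with elapsed time at least \<open>m\<close>, the value of the test function
  \<open>late m\<close> is 1, because the target time is not earlier than the elapsed time.
  \<open>value_identity\<close> turns this into a bound by the target law.\<close>

lemma active_late:
 "emeasure N {w:space N. active n w & m <= elapsed R n w} <= fresh_value (late m) 0 0"
proof -
 note [measurable] = state_measurable_N[of n]
 have "emeasure N {w:space N. active n w & m <= elapsed R n w} = (NINT w|N. indicator {w:space N. active n w & m <= elapsed R n w} w)"
  by(rule nn_integral_indicator[symmetric]) measurable
 also have "... <= (NINT w|N. (if active n w then state_value (late m) n w else late m (run_output q r R w)))"
 proof(rule nn_integral_mono_AE, goal_cases)
  case 1 show ?case
   using state_ok_AE[of n]
  proof eventually_elim
   case (elim w)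
   show ?case
   proof(cases "active n w & m <= elapsed R n w")
    case True
    hence "admissible (elapsed R n w) (curH R n w)" using elim by(simp add: state_ok_def)
    from late_value[OF this] True show ?thesis
     by(simp add: state_value_def[OF late_indicator] indicator_def)
   qed (auto simp: indicator_def)
  qed
 qed
 also have "... = fresh_value (late m) 0 0"
  by(rule value_identity[OF late_indicator, symmetric])
 finally show ?thesis .
qed

lemma late_value_tendsto: "(%m. fresh_value (late (real m)) 0 0) ----> 0"
proof -
 define A where "A m = {w:space M. ereal (real m) <= fst (result 0 0 w)}" for m :: nat
 have "(result 0 0):Borel M"
  by(intro measurable_outcome measurable_path_add) auto
 hence [measurable]: "(result 0 0):M ->M borel >< borel" by(simp add: borel_prod)
 have [measurable]: "A m:sets M" for m unfolding A_def by measurable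
 have eq: "fresh_value (late (real m)) 0 0 = emeasure M (A m)" for m
 proof -
  have "fresh_value (late (real m)) 0 0 = (NINT w|M. indicator (A m) w)"
   unfolding fresh_value_def by(intro nn_integral_cong) (auto simp: A_def indicator_def)
  thus ?thesis by simp
 qed
 have "(%m. emeasure M (A m)) ----> emeasure M (\<Inter>m. A m)"
 proof(rule Lim_emeasure_decseq)
  show "decseq A"
  proof(rule decseq_SucI, rule subsetI)
   fix m w assume "w:A (Suc m)"
   thus "w:A m" unfolding A_def
    using order_trans[of "ereal (real m)" "ereal (real (Suc m))" "fst (result 0 0 w)"] by auto
  qed
 qed auto
 also have "emeasure M (\<Inter>m. A m) = 0"
 proof -
  have "AE w in M. w \<notin> (\<Inter>m. A m)"
   using outcome_finite
  proof eventually_elim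
   case (elim w)
   then obtain m :: nat where "fst (result 0 0 w) < ereal (real m)"
    using less_PInf_Ex_of_nat[of "fst (result 0 0 w)"] by auto
   thus ?case by(auto simp: A_def intro!: exI[of _ m])
  qed
  hence "(\<Inter>m. A m):null_sets M" by(subst AE_iff_null_sets) auto
  thus ?thesis by auto
 qed
 finally show ?thesis unfolding eq .
qed

text \<open>A run still active at iteration \<open>n\<close> has elapsed time either below
  \<open>m\<close>, which the decay of the weight makes unlikely, or at least \<open>m\<close>,
  which is as unlikely as a late target time. First \<open>n\<close> and then \<open>m\<close> tends
  to infinity.\<close>

theorem stops_AE: "AE w in N. EX n. stops n w"
proof -
 obtain eta where eta: "0 < eta" "prob {w:space M. eventful eta w} <= 1/10" "prob {w:space M. Q eta w ~= 0} <= 1/10"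
  using uneventful_time[of "1/10"] by auto
 \<comment> \<open>Chosen so that \<open>exp (- l * eta)\<close> equals 1/10.\<close>
 define l where "l = ln 10 / eta"
 have l: "0 <= l" "exp (- l * eta) <= 1/10" using eta(1) by(simp_all add: l_def exp_minus divide_simps)
 let ?W = "%n w. if active n w then weight l n w else 0"
 have decay: "(NINT w|N. ?W n w) <= ennreal ((7/10) ^ n)" for n
 proof(induction n)
  case 0
  have "(NINT w|N. ?W 0 w) = (NINT w|N. 1)"
   by(intro nn_integral_cong) (simp add: run_active_def weight_def elapsed_def updates)
  thus ?case by(simp add: N.emeasure_space_1)
 next
  case (Suc n)
  have "(NINT w|N. ?W (Suc n) w) <= ennreal (7/10) * (NINT w|N. ?W n w)"
   by(rule weight_contraction[OF eta(1) l(1) eta(2) l(2) eta(3)])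
  also have "... <= ennreal (7/10) * ennreal ((7/10) ^ n)" by(intro mult_left_mono Suc) simp
  also have "... = ennreal ((7/10) ^ Suc n)" by(simp add: ennreal_mult'[symmetric])
  finally show ?case .
 qed
 note [measurable] = state_measurable_N measurable_weight
 define A where "A = {w:space N. ALL n. active n w}"
 have [measurable]: "A:sets N" unfolding A_def by measurable
 let ?e = "%m n. exp (l * real m) * (7/10) ^ n"
 have bound: "emeasure N A <= ennreal (?e m n) + fresh_value (late (real m)) 0 0" for m n :: nat
 proof -
  let ?E = "{w:space N. active n w & elapsed R n w < real m}" and ?L = "{w:space N. active n w & real m <= elapsed R n w}"
  have early: "emeasure N ?E <= ennreal (?e m n)"
  proof -
   have "emeasure N ?E = (NINT w|N. indicator ?E w)"
    by(rule nn_integral_indicator[symmetric]) measurable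
   also have "... <= (NINT w|N. ennreal (exp (l * real m)) * ?W n w)"
   proof(rule nn_integral_mono)
    fix w
    have "1 <= ennreal (exp (l * real m)) * weight l n w" if "elapsed R n w < real m"
    proof -
     have "0 <= l * real m + - l * elapsed R n w" using that l(1) by(simp add: mult_left_mono)
     hence "1 <= exp (l * real m) * exp (- l * elapsed R n w)" by(simp add: exp_add[symmetric])
     also have "... * 1 <= ... * (if curD R n w = 0 then 1 else 2)" by(intro mult_left_mono) auto
     finally have "ennreal 1 <= ennreal (exp (l * real m) * exp (- l * elapsed R n w) * (if curD R n w = 0 then 1 else 2))"
      by(intro ennreal_leI) simp
     thus ?thesis unfolding weight_def by(simp only: mult.assoc ennreal_mult'[OF exp_ge_zero] ennreal_1)
    qed
    thus "indicator ?E w <= ennreal (exp (l * real m)) * ?W n w"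
     by(auto simp: indicator_def)
   qed
   also have "... = ennreal (exp (l * real m)) * (NINT w|N. ?W n w)"
    by(rule nn_integral_cmult) measurable
   also have "... <= ennreal (exp (l * real m)) * ennreal ((7/10) ^ n)" by(intro mult_left_mono decay) simp
   finally show ?thesis by(simp add: ennreal_mult'[symmetric])
  qed
  have "emeasure N A <= emeasure N (?E \<union> ?L)"
   by(intro emeasure_mono) (auto simp: A_def)
  also have "... <= emeasure N ?E + emeasure N ?L"
   by(rule emeasure_subadditive) measurable
  also have "... <= ennreal (?e m n) + fresh_value (late (real m)) 0 0"
   by(intro add_mono early active_late)
  finally show ?thesis .
 qed
 have "emeasure N A <= fresh_value (late (real m)) 0 0" for m :: nat
 proof -
  have "(%n. ?e m n) ----> exp (l * real m) * 0"
   by(intro tendsto_intros LIMSEQ_power_zero) simp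
  hence "(%n. ennreal (?e m n)) ----> ennreal 0" by(intro tendsto_ennrealI) simp
  hence "(%n. ennreal (?e m n) + fresh_value (late (real m)) 0 0) ---->
    ennreal 0 + fresh_value (late (real m)) 0 0"
   by(intro tendsto_add tendsto_const)
  hence "emeasure N A <= ennreal 0 + fresh_value (late (real m)) 0 0"
   by(rule LIMSEQ_le_const) (use bound in auto)
  thus ?thesis by simp
 qed
 hence "emeasure N A <= 0" by(intro LIMSEQ_le_const[OF late_value_tendsto]) auto
 hence "A:null_sets N" by(auto simp: null_sets_def)
 hence "AE w in N. w \<notin> A" by(rule AE_not_in)
 thus ?thesis using AE_space by eventually_elim (auto simp: A_def run_active_def)
qed

text \<open>For an indicator \<open>F\<close>, \<open>value_identity\<close> differs from the
  expectation of \<open>F\<close> of the output by at most the probability that iteration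
  \<open>n\<close> is active, which tends to 0.\<close>

theorem output_distribution:
 "distr N borel (run_output q r R) = distr M borel (result 0 0)"
proof(rule measure_eqI)
 let ?D = "distr M borel (result 0 0)"
 fix B assume "B:sets (distr N borel (run_output q r R))"
 hence B[measurable]: "B:sets borel" by simp
 have ro[measurable]: "run_output q r R:Borel N" by(rule measurable_run_output[of "indicator B"]) simp
 have oc[measurable]: "(result 0 0):Borel M"
  by(intro measurable_outcome measurable_path_add) auto
 note [measurable] = state_measurable_N
 define F where "F = (indicator B :: _ => ennreal)"
 have F: "F:Borel borel" unfolding F_def by simp
 have F1: "F z <= 1" for z by(simp add: F_def indicator_def)
 have sv1: "state_value F n w <= 1" for n w
 proof -
  have "fresh_value F T H <= (NINT w|M. 1)" "pending_value F T H D J <= (NINT w|M. 1)" for T H D J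
   unfolding fresh_value_def pending_value_def by(intro nn_integral_mono F1)+
  thus ?thesis by(simp add: state_value_def[OF F] emeasure_space_1)
 qed
 let ?f = "%w. F (run_output q r R w)" and ?A = "%n. {w:space N. active n w}"
 define a where "a n = emeasure N (?A n)" for n
 have a: "a ----> 0"
 proof -
  have "a ----> emeasure N (\<Inter>n. ?A n)"
   unfolding a_def by(rule Lim_emeasure_decseq) (auto simp: decseq_Suc_iff active_Suc)
  also have "emeasure N (\<Inter>n. ?A n) = 0"
  proof -
   have "AE w in N. w \<notin> (\<Inter>n. ?A n)"
    using stops_AE
   proof eventually_elim
    case (elim w)
    then obtain n where "stops n w" by blast
    hence "~ active (Suc n) w" by(simp add: active_Suc)
    thus ?case by blast
   qed
   hence "(\<Inter>n. ?A n):null_sets N" by(subst AE_iff_null_sets) auto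
   thus ?thesis by auto
  qed
  finally show ?thesis .
 qed
 have V: "fresh_value F 0 0 = emeasure (?D) B"
 proof -
  have "fresh_value F 0 0 = (NINT z|?D. F z)"
   unfolding fresh_value_def by(rule nn_integral_distr[symmetric]) (use F in auto)
  thus ?thesis by(simp add: F_def)
 qed
 let ?I = "(NINT w|N. ?f w)"
 have I: "?I = emeasure (distr N borel (run_output q r R)) B"
 proof -
  have "?I = (NINT z|(distr N borel (run_output q r R)). F z)"
   by(rule nn_integral_distr[symmetric]) (use F in auto)
  thus ?thesis by(simp add: F_def)
 qed
 have ind: "(NINT w|N. f w + indicator (?A n) w) = (NINT w|N. f w) + a n"
  if "f:Borel N" for f n
  using that by(subst nn_integral_add) (auto simp: a_def)
 have Fro: "?f:Borel N" using measurable_compose[OF ro F] .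
 have le1: "fresh_value F 0 0 <= ?I + a n" for n
  unfolding value_identity[OF F, of n] ind[OF Fro, symmetric]
  using sv1 by(intro nn_integral_mono) (auto simp: indicator_def intro: add_increasing)
 have le2: "?I <= fresh_value F 0 0 + a n" for n
 proof -
  have "?I <= (NINT w|N. (if active n w then 0 else ?f w) + indicator (?A n) w)"
   using F1 by(intro nn_integral_mono) (auto simp: indicator_def)
  also have "... = (NINT w|N. (if active n w then 0 else ?f w)) + a n"
   by(rule ind) (use Fro in measurable)
  also have "... <= fresh_value F 0 0 + a n"
   unfolding value_identity[OF F, of n] by(intro add_right_mono nn_integral_mono) auto
  finally show ?thesis .
 qed
 have "fresh_value F 0 0 <= ?I + 0"
  by(rule LIMSEQ_le_const[OF tendsto_add[OF tendsto_const a]]) (use le1 in auto)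
 moreover have "?I <= fresh_value F 0 0 + 0"
  by(rule LIMSEQ_le_const[OF tendsto_add[OF tendsto_const a]]) (use le2 in auto)
 ultimately show "emeasure (distr N borel (run_output q r R)) B = emeasure (?D) B"
  unfolding V[symmetric] I[symmetric] by simp
qed simp

end

lemma (in sampler) outcome_initial:
 "outcome 0 0 f = (let tau = min (passage_time f c) K in (tau, left_limit f tau, jump f tau))"
proof -
 have "passage_time f (residual 0 0) = passage_time f c"
  by(rule passage_time_cong) (simp add: residual_def zero_ereal_def[symmetric])
 thus ?thesis by(simp add: outcome_def Let_def zero_ereal_def[symmetric])
qed

theorem theorem4p1:
  fixes M :: "'a measure" and N :: "'w measure"
    and X1 X2 X3 Q Z S :: "real \<Rightarrow> 'a \<Rightarrow> real"
    and \<nu> \<Lambda> chi :: "real measure" and q :: real and r K :: ereal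
    and c :: "real \<Rightarrow> ereal" and R :: "'w run"
  assumes q: "0 \<le> q" and r: "0 < r" and K: "0 < K"
    and chi: "sets chi = sets borel" "emeasure chi {..0} = 0" "emeasure chi {0<..} < \<infinity>"
    and \<nu>: "sets \<nu> = sets borel" "emeasure \<nu> {0<..} = \<infinity>"
      "\<And>B. B \<in> sets borel \<Longrightarrow> emeasure \<nu> B =
         emeasure (density \<Lambda> (\<lambda>x. ennreal (exp (- q * x)) * indicator {x. ereal x \<le> r} x)) B
         + emeasure chi B"
    and Z: "driftless_subordinator M \<nu> Z"
    and S: "driftless_subordinator M \<Lambda> S"
    and X1: "driftless_subordinator M
      (density \<Lambda> (\<lambda>x. ennreal (exp (- q * x)) * indicator {x. ereal x \<le> r} x)) X1"
    and X2: "driftless_subordinator M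
      (density \<Lambda> (\<lambda>x. ennreal (1 - exp (- q * x)) * indicator {x. ereal x \<le> r} x)) X2"
    and X3: "driftless_subordinator M (density \<Lambda> (indicator {x. r < ereal x})) X3"
    and Q: "driftless_subordinator M chi Q"
    and indep: "prob_space.indep_vars M (\<lambda>_. Pi\<^sub>M {0..} (\<lambda>_. borel))
      (\<lambda>i \<omega>. \<lambda>t\<in>{0..}. ([X1, X2, X3, Q] ! i) t \<omega>) {..<4::nat}"
    and Z_eq: "Z = (\<lambda>t \<omega>. X1 t \<omega> + Q t \<omega>)"
    and S_eq: "S = (\<lambda>t \<omega>. X1 t \<omega> + X2 t \<omega> + X3 t \<omega>)"
    and c: "(\<exists>f. regular_boundary f \<and> c = (\<lambda>t. ereal (f t))) \<or> (c = (\<lambda>_. \<infinity>) \<and> K < \<infinity>)"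
    and run: "sampling_run M X1 X2 S Q q r c K N R"
  shows "(AE \<omega> in N. \<exists>n. run_stops q r R n \<omega>) \<and>
    distr N borel (run_output q r R) =
    distr M borel (\<lambda>\<omega>. let \<tau> = min (passage_time (\<lambda>t. Z t \<omega>) c) K in
      (\<tau>, left_limit (\<lambda>t. Z t \<omega>) \<tau>, jump (\<lambda>t. Z t \<omega>) \<tau>))"
proof -
 interpret sampler M X1 X2 X3 Q S \<Lambda> chi q r c K N R
 proof(intro sampler.intro crossing.intro decomposition.intro)
  show "prob_space M" using S by(rule driftless_subordinatorD(1))
  show "decomposition_axioms M X1 X2 X3 Q S \<Lambda> chi q r"
  proof
   \<comment> \<open>As \<open>chi\<close> is finite, the infinite mass of \<nu> comes from the part
     that drives \<open>X1\<close>.\<close>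
   show "emeasure (density \<Lambda> (%x. ennreal (exp (- q * x)) * indicator {x. ereal x <= r} x)) {0<..} = oo"
    using \<nu>(2) \<nu>(3)[of "{0<..}"] chi(3) by(auto simp: ennreal_add_eq_top)
  qed (fact assms)+
  show "crossing_axioms c K"
  proof
   show "barrier c" using c regular_boundary_barrier barrier_infinity by auto
   show "K < oo \<or> (ALL t>0. c t < oo)" using c by auto
  qed (fact K)
  show "sampler_axioms M X1 X2 Q S q r c K N R" using run by unfold_locales
 qed
 show ?thesis using stops_AE output_distribution by(simp add: outcome_initial Z_eq)
qed

end
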